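(* Let $k$ be a field, let $\mathcal{A}$ be a dualizing $k$-variety and let $\mathcal{B}$ be a functorially finite subcategory of $\mathcal{A}$. Let $i:\mathcal{B}\hookrightarrow\mathcal{A}$ be the inclusion and $p:\mathcal{A}\to\mathcal{A}/[\mathcal{B}]$ the canonical projection. Then there is a recollement of abelian categories, of $\mathrm{mod}\,\mathcal{A}$ relative to $\mathrm{mod}(\mathcal{A}/[\mathcal{B}])$ and $\mathrm{mod}\,\mathcal{B}$, given by six functors $$e:\mathrm{mod}(\mathcal{A}/[\mathcal{B}])\to\mathrm{mod}\,\mathcal{A},\quad e_\lambda,e_\rho:\mathrm{mod}\,\mathcal{A}\to\mathrm{mod}(\mathcal{A}/[\mathcal{B}]),\quad q:\mathrm{mod}\,\mathcal{A}\to\mathrm{mod}\,\mathcal{B},\quad q_\lambda,q_\rho:\mathrm{mod}\,\mathcal{B}\to\mathrm{mod}\,\mathcal{A},$$ with $e_\lambda\dashv e\dashv e_\rho$ and $q_\lambda\dashv q\dashv q_\rho$, where these six functors are the restrictions to the categories of finitely presented modules of, respectively, the functors $$p^*,\ p^*_\lambda,\ p^*_\rho\quad\text{(between } \mathrm{Mod}(\mathcal{A}/[\mathcal{B}])\text{ and }\mathrm{Mod}\,\mathcal{A}),\qquad i^*,\ i^*_\lambda,\ i^*_\rho\quad\text{(between }\mathrm{Mod}\,\mathcal{A}\text{ and }\mathrm{Mod}\,\mathcal{B}),$$ where $p^*$ and $i^*$ are precomposition with $p$ and $i$, and the subscripts $\lambda,\rho$ denote their left and right adjoints. In particular, there is an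 equivalence $$\frac{\mathrm{mod}\,\mathcal{A}}{\mathrm{mod}(\mathcal{A}/[\mathcal{B}])}\simeq\mathrm{mod}\,\mathcal{B},$$ where the left-hand side is the Serre quotient.
   Context: Throughout, $k$ is a field, and all categories and functors are additive and $k$-linear; categories over which modules are taken are essentially small. Modules. For a $k$-linear category $\mathcal{C}$, $\mathrm{Mod}\,\mathcal{C}$ is the abelian category of $k$-linear contravariant functors $\mathcal{C}\to\mathrm{Mod}\,k$. A $\mathcal{C}$-module $X$ is finitely generated if there is an epimorphism $\mathcal{C}(-,c)\to X$ for some $c\in\mathcal C$, and finitely presented if there is an exact sequence $\mathcal{C}(-,c_1)\to\mathcal{C}(-,c_0)\to X\to 0$; $\mathrm{mod}\,\mathcal{C}$ is the full subcategory of finitely presented modules. Dualizing $k$-variety: a Krull-Schmidt Hom-finite $k$-linear category $\mathcal{A}$ such that $X\mapsto D\circ X$, where $D=\mathrm{Hom}_k(-,k)$, induces a duality $\mathrm{mod}\,\mathcal{A}\to\mathrm{mod}(\mathcal{A}^{\mathrm{op}})$. Krull-Schmidt means every object is a finite direct sum of objects with local endomorphism algebras; Hom-finite means all $\mathcal{A}(x,y)$ are finite dimensional over $k$. Functorially finite: a full subcategory $\mathcal{B}$ of $\mathcal{A}$ is functorially finite if for every $x\in\mathcal{A}$ the $\mathcal{B}$-module $\mathcal{A}(-,x)|_{\mathcal{B}}$ and the $\mathcal{B}^{\mathrm{op}}$-module $\mathcal{A}(x,-)|_{\mathcal{B}}$ are finitely generated. $\mathcal{B}$ is assumed additive and itself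 Krull-Schmidt. $\mathcal{A}/[\mathcal{B}]$ is the ideal quotient of $\mathcal{A}$ by the ideal of morphisms factoring through an object of $\mathcal{B}$. Explicitly, $i^*_\lambda=-\otimes_{\mathcal{B}}\mathcal{A}$, i.e. $(i^*_\lambda Y)(a)=Y\otimes_{\mathcal{B}}\mathcal{A}(a,-)|_{\mathcal{B}}$; $(i^*_\rho Y)(a)=\mathrm{Hom}_{\mathcal{B}}(\mathcal{A}(-,a)|_{\mathcal{B}},Y)$; $(p^*_\lambda X)(a)=X\otimes_{\mathcal{A}}(\mathcal{A}/[\mathcal{B}])(a,-)$; $(p^*_\rho X)(a)=\mathrm{Hom}_{\mathcal{A}}((\mathcal{A}/[\mathcal{B}])(-,a),X)$. Recollement: for abelian categories $\mathcal{X},\mathcal{Y},\mathcal{Z}$, a recollement of $\mathcal{Y}$ relative to $\mathcal{X}$ and $\mathcal{Z}$ consists of functors $e:\mathcal{X}\to\mathcal{Y}$, $e_\lambda,e_\rho:\mathcal{Y}\to\mathcal{X}$, $q:\mathcal{Y}\to\mathcal{Z}$, $q_\lambda,q_\rho:\mathcal{Z}\to\mathcal{Y}$ such that (R1) $(e_\lambda\dashv e)$, $(e\dashv e_\rho)$, $(q_\lambda\dashv q)$, $(q\dashv q_\rho)$ are adjoint pairs; (R2) $q_\lambda,q_\rho,e$ are fully faithful; (R3) the essential image of $e$ equals $\mathrm{Ker}\,q=\{y\mid q(y)=0\}$. In the Serre quotient, $\mathrm{mod}(\mathcal{A}/[\mathcal{B}])$ is identified with the essential image of $e$. *)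

theory Defs
  imports "Jordan_Normal_Form.Missing_VectorSpace" "HOL-Algebra.AbelCoset" "HOL-Library.FuncSet"
begin

section \<open>Linear categories\<close>

text \<open>
  A linear category has a set of objects and, for any two objects, a vector space of arrows
  (a record of \<^theory>\<open>HOL-Algebra.Module\<close>; its fields \<open>mult\<close> and \<open>one\<close> carry no meaning).
  Hom spaces need not be disjoint, so composition and the action of functors on arrows are
  indexed by objects: \<open>Cmp C x y z g f\<close> is the composite of \<open>f : x \<rightarrow> y\<close> and \<open>g : y \<rightarrow> z\<close>.
\<close>

record ('k, 'o, 'm) lincat =
  Obj :: "'o set"
  Hom :: "'o \<Rightarrow> 'o \<Rightarrow> ('k, 'm) module"
  Idt :: "'o \<Rightarrow> 'm"
  Cmp :: "'o \<Rightarrow> 'o \<Rightarrow> 'o \<Rightarrow> 'm \<Rightarrow> 'm \<Rightarrow> 'm"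

abbreviation Arr :: "('k, 'o, 'm) lincat \<Rightarrow> 'o \<Rightarrow> 'o \<Rightarrow> 'm set" where
  "Arr C x y \<equiv> carrier (Hom C x y)"

locale linear_category = field K for K :: "'k ring" (structure) +
  fixes C :: "('k, 'o, 'm) lincat"
  assumes hom_vectorspace: "\<lbrakk>x \<in> Obj C; y \<in> Obj C\<rbrakk> \<Longrightarrow> vectorspace K (Hom C x y)"
    and idt_closed: "x \<in> Obj C \<Longrightarrow> Idt C x \<in> Arr C x x"
    and cmp_linear_left:
      "\<lbrakk>x \<in> Obj C; y \<in> Obj C; z \<in> Obj C; f \<in> Arr C x y\<rbrakk>
        \<Longrightarrow> (\<lambda>g. Cmp C x y z g f) \<in> module_hom K (Hom C y z) (Hom C x z)"
    and cmp_linear_right: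
      "\<lbrakk>x \<in> Obj C; y \<in> Obj C; z \<in> Obj C; g \<in> Arr C y z\<rbrakk>
        \<Longrightarrow> (\<lambda>f. Cmp C x y z g f) \<in> module_hom K (Hom C x y) (Hom C x z)"
    and cmp_idt_left:
      "\<lbrakk>x \<in> Obj C; y \<in> Obj C; f \<in> Arr C x y\<rbrakk> \<Longrightarrow> Cmp C x y y (Idt C y) f = f"
    and cmp_idt_right:
      "\<lbrakk>x \<in> Obj C; y \<in> Obj C; f \<in> Arr C x y\<rbrakk> \<Longrightarrow> Cmp C x x y f (Idt C x) = f"
    and cmp_assoc:
      "\<lbrakk>w \<in> Obj C; x \<in> Obj C; y \<in> Obj C; z \<in> Obj C;
        f \<in> Arr C w x; g \<in> Arr C x y; h \<in> Arr C y z\<rbrakk>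
        \<Longrightarrow> Cmp C w y z h (Cmp C w x y g f) = Cmp C w x z (Cmp C x y z h g) f"

definition op_cat :: "('k, 'o, 'm) lincat \<Rightarrow> ('k, 'o, 'm) lincat" where
  "op_cat C = \<lparr>Obj = Obj C, Hom = (\<lambda>x y. Hom C y x), Idt = Idt C,
               Cmp = (\<lambda>x y z g f. Cmp C z y x f g)\<rparr>"

definition full_sub :: "('k, 'o, 'm) lincat \<Rightarrow> 'o set \<Rightarrow> ('k, 'o, 'm) lincat" where
  "full_sub C S = C\<lparr>Obj := S\<rparr>"

definition is_iso :: "('k, 'o, 'm) lincat \<Rightarrow> 'o \<Rightarrow> 'o \<Rightarrow> 'm \<Rightarrow> bool" where
  "is_iso C x y f \<longleftrightarrow> f \<in> Arr C x y \<and>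
     (\<exists>g\<in>Arr C y x. Cmp C x y x g f = Idt C x \<and> Cmp C y x y f g = Idt C y)"

definition isomorphic :: "('k, 'o, 'm) lincat \<Rightarrow> 'o \<Rightarrow> 'o \<Rightarrow> bool" where
  "isomorphic C x y \<longleftrightarrow> (\<exists>f. is_iso C x y f)"

definition is_zero_object :: "('k, 'o, 'm) lincat \<Rightarrow> 'o \<Rightarrow> bool" where
  "is_zero_object C z \<longleftrightarrow> z \<in> Obj C \<and>
     (\<forall>x\<in>Obj C. Arr C x z = {\<zero>\<^bsub>Hom C x z\<^esub>} \<and> Arr C z x = {\<zero>\<^bsub>Hom C z x\<^esub>})"

definition is_direct_sum ::
    "('k, 'o, 'm) lincat \<Rightarrow> nat \<Rightarrow> (nat \<Rightarrow> 'o) \<Rightarrow> 'o \<Rightarrow> bool" where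
  "is_direct_sum C n xs s \<longleftrightarrow> s \<in> Obj C \<and> (\<forall>i<n. xs i \<in> Obj C) \<and>
     (\<exists>\<iota> \<pi>. (\<forall>i<n. \<iota> i \<in> Arr C (xs i) s \<and> \<pi> i \<in> Arr C s (xs i)) \<and>
        (\<forall>i<n. \<forall>j<n. Cmp C (xs i) s (xs j) (\<pi> j) (\<iota> i) =
            (if i = j then Idt C (xs i) else \<zero>\<^bsub>Hom C (xs i) (xs j)\<^esub>)) \<and>
        (\<Oplus>\<^bsub>Hom C s s\<^esub>i\<in>{..<n}. Cmp C s (xs i) s (\<iota> i) (\<pi> i)) = Idt C s)"

text \<open>The case \<open>n = 0\<close> below provides a zero object.\<close>

definition additive_category :: "'k ring \<Rightarrow> ('k, 'o, 'm) lincat \<Rightarrow> bool" where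
  "additive_category K C \<longleftrightarrow> linear_category K C \<and>
     (\<forall>n xs. (\<forall>i<n. xs i \<in> Obj C) \<longrightarrow> (\<exists>s. is_direct_sum C n xs s))"


subsection \<open>Abelian categories\<close>

definition is_mono :: "('k, 'o, 'm) lincat \<Rightarrow> 'o \<Rightarrow> 'o \<Rightarrow> 'm \<Rightarrow> bool" where
  "is_mono C x y f \<longleftrightarrow> f \<in> Arr C x y \<and>
     (\<forall>w\<in>Obj C. \<forall>g\<in>Arr C w x. \<forall>h\<in>Arr C w x. Cmp C w x y f g = Cmp C w x y f h \<longrightarrow> g = h)"

definition is_epi :: "('k, 'o, 'm) lincat \<Rightarrow> 'o \<Rightarrow> 'o \<Rightarrow> 'm \<Rightarrow> bool" where
  "is_epi C x y f \<longleftrightarrow> f \<in> Arr C x y \<and>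
     (\<forall>z\<in>Obj C. \<forall>g\<in>Arr C y z. \<forall>h\<in>Arr C y z. Cmp C x y z g f = Cmp C x y z h f \<longrightarrow> g = h)"

text \<open>\<open>i : k \<rightarrow> x\<close> is a kernel, resp. \<open>p : y \<rightarrow> c\<close> is a cokernel, of \<open>f : x \<rightarrow> y\<close>.\<close>

definition is_kernel ::
    "('k, 'o, 'm) lincat \<Rightarrow> 'o \<Rightarrow> 'o \<Rightarrow> 'm \<Rightarrow> 'o \<Rightarrow> 'm \<Rightarrow> bool" where
  "is_kernel C x y f k i \<longleftrightarrow> f \<in> Arr C x y \<and> k \<in> Obj C \<and> i \<in> Arr C k x \<and>
     Cmp C k x y f i = \<zero>\<^bsub>Hom C k y\<^esub> \<and>
     (\<forall>w\<in>Obj C. \<forall>g\<in>Arr C w x. Cmp C w x y f g = \<zero>\<^bsub>Hom C w y\<^esub> \<longrightarrow>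
        (\<exists>!u. u \<in> Arr C w k \<and> Cmp C w k x i u = g))"

definition is_cokernel ::
    "('k, 'o, 'm) lincat \<Rightarrow> 'o \<Rightarrow> 'o \<Rightarrow> 'm \<Rightarrow> 'o \<Rightarrow> 'm \<Rightarrow> bool" where
  "is_cokernel C x y f c p \<longleftrightarrow> f \<in> Arr C x y \<and> c \<in> Obj C \<and> p \<in> Arr C y c \<and>
     Cmp C x y c p f = \<zero>\<^bsub>Hom C x c\<^esub> \<and>
     (\<forall>z\<in>Obj C. \<forall>g\<in>Arr C y z. Cmp C x y z g f = \<zero>\<^bsub>Hom C x z\<^esub> \<longrightarrow>
        (\<exists>!u. u \<in> Arr C c z \<and> Cmp C y c z u p = g))"

definition abelian_category :: "'k ring \<Rightarrow> ('k, 'o, 'm) lincat \<Rightarrow> bool" where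
  "abelian_category K C \<longleftrightarrow> additive_category K C \<and>
     (\<forall>x\<in>Obj C. \<forall>y\<in>Obj C. \<forall>f\<in>Arr C x y.
        (\<exists>k i. is_kernel C x y f k i) \<and> (\<exists>c p. is_cokernel C x y f c p) \<and>
        (is_mono C x y f \<longrightarrow> (\<exists>z\<in>Obj C. \<exists>g\<in>Arr C y z. is_kernel C y z g x f)) \<and>
        (is_epi C x y f \<longrightarrow> (\<exists>w\<in>Obj C. \<exists>g\<in>Arr C w x. is_cokernel C w x g y f)))"


subsection \<open>Functors\<close>

record ('o, 'm, 'p, 'n) funct =
  Fob :: "'o \<Rightarrow> 'p"
  Far :: "'o \<Rightarrow> 'o \<Rightarrow> 'm \<Rightarrow> 'n"

definition linear_functor ::
    "'k ring \<Rightarrow> ('k, 'o, 'm) lincat \<Rightarrow> ('k, 'p, 'n) lincat \<Rightarrow> ('o, 'm, 'p, 'n) funct \<Rightarrow> bool"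
  where
  "linear_functor K C D F \<longleftrightarrow>
     (\<forall>x\<in>Obj C. Fob F x \<in> Obj D \<and> Far F x x (Idt C x) = Idt D (Fob F x)) \<and>
     (\<forall>x\<in>Obj C. \<forall>y\<in>Obj C. Far F x y \<in> module_hom K (Hom C x y) (Hom D (Fob F x) (Fob F y))) \<and>
     (\<forall>x\<in>Obj C. \<forall>y\<in>Obj C. \<forall>z\<in>Obj C. \<forall>f\<in>Arr C x y. \<forall>g\<in>Arr C y z.
        Far F x z (Cmp C x y z g f) =
          Cmp D (Fob F x) (Fob F y) (Fob F z) (Far F y z g) (Far F x y f))"

definition id_funct :: "('o, 'm, 'o, 'm) funct" where
  "id_funct = \<lparr>Fob = (\<lambda>x. x), Far = (\<lambda>x y f. f)\<rparr>"

definition comp_funct ::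
    "('p, 'n, 'q, 'l) funct \<Rightarrow> ('o, 'm, 'p, 'n) funct \<Rightarrow> ('o, 'm, 'q, 'l) funct" where
  "comp_funct G F = \<lparr>Fob = (\<lambda>x. Fob G (Fob F x)),
                     Far = (\<lambda>x y f. Far G (Fob F x) (Fob F y) (Far F x y f))\<rparr>"

definition op_funct :: "('o, 'm, 'p, 'n) funct \<Rightarrow> ('o, 'm, 'p, 'n) funct" where
  "op_funct F = \<lparr>Fob = Fob F, Far = (\<lambda>x y f. Far F y x f)\<rparr>"

definition fully_faithful ::
    "('k, 'o, 'm) lincat \<Rightarrow> ('k, 'p, 'n) lincat \<Rightarrow> ('o, 'm, 'p, 'n) funct \<Rightarrow> bool" where
  "fully_faithful C D F \<longleftrightarrow>
     (\<forall>x\<in>Obj C. \<forall>y\<in>Obj C. bij_betw (Far F x y) (Arr C x y) (Arr D (Fob F x) (Fob F y)))"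

definition essential_image ::
    "('k, 'o, 'm) lincat \<Rightarrow> ('k, 'p, 'n) lincat \<Rightarrow> ('o, 'm, 'p, 'n) funct \<Rightarrow> 'p set" where
  "essential_image C D F = {y \<in> Obj D. \<exists>x\<in>Obj C. isomorphic D (Fob F x) y}"

definition naturally_isomorphic ::
    "('k, 'o, 'm) lincat \<Rightarrow> ('k, 'p, 'n) lincat \<Rightarrow>
     ('o, 'm, 'p, 'n) funct \<Rightarrow> ('o, 'm, 'p, 'n) funct \<Rightarrow> bool" where
  "naturally_isomorphic C D F G \<longleftrightarrow>
     (\<exists>\<theta>. (\<forall>x\<in>Obj C. is_iso D (Fob F x) (Fob G x) (\<theta> x)) \<and>
        (\<forall>x\<in>Obj C. \<forall>y\<in>Obj C. \<forall>f\<in>Arr C x y.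
           Cmp D (Fob F x) (Fob F y) (Fob G y) (\<theta> y) (Far F x y f) =
           Cmp D (Fob F x) (Fob G x) (Fob G y) (Far G x y f) (\<theta> x)))"

definition category_equivalence ::
    "'k ring \<Rightarrow> ('k, 'o, 'm) lincat \<Rightarrow> ('k, 'p, 'n) lincat \<Rightarrow> ('o, 'm, 'p, 'n) funct \<Rightarrow> bool"
  where
  "category_equivalence K C D F \<longleftrightarrow> linear_functor K C D F \<and>
     (\<exists>G. linear_functor K D C G \<and>
        naturally_isomorphic C C (comp_funct G F) id_funct \<and>
        naturally_isomorphic D D (comp_funct F G) id_funct)"

text \<open>\<open>F : C \<rightarrow> D\<close> is left adjoint to \<open>G : D \<rightarrow> C\<close>.\<close>

definition adjoint_pair ::
    "'k ring \<Rightarrow> ('k, 'o, 'm) lincat \<Rightarrow> ('k, 'p, 'n) lincat \<Rightarrow>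
     ('o, 'm, 'p, 'n) funct \<Rightarrow> ('p, 'n, 'o, 'm) funct \<Rightarrow> bool" where
  "adjoint_pair K C D F G \<longleftrightarrow> linear_functor K C D F \<and> linear_functor K D C G \<and>
     (\<exists>\<phi>. (\<forall>x\<in>Obj C. \<forall>y\<in>Obj D. bij_betw (\<phi> x y) (Arr D (Fob F x) y) (Arr C x (Fob G y))) \<and>
        (\<forall>x\<in>Obj C. \<forall>x'\<in>Obj C. \<forall>y\<in>Obj D. \<forall>y'\<in>Obj D.
           \<forall>f\<in>Arr C x' x. \<forall>g\<in>Arr D y y'. \<forall>h\<in>Arr D (Fob F x) y.
             \<phi> x' y' (Cmp D (Fob F x') y y' g (Cmp D (Fob F x') (Fob F x) y h (Far F x' x f))) =
             Cmp C x' (Fob G y) (Fob G y') (Far G y y' g)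
               (Cmp C x' x (Fob G y) (\<phi> x y h) f)))"


section \<open>Recollements and Serre quotients\<close>

text \<open>Recollement of \<open>Y\<close> relative to \<open>X\<close> and \<open>Z\<close>.\<close>

definition recollement ::
    "'k ring \<Rightarrow> ('k, 'o, 'm) lincat \<Rightarrow> ('k, 'p, 'n) lincat \<Rightarrow> ('k, 'q, 'l) lincat \<Rightarrow>
     ('o, 'm, 'p, 'n) funct \<Rightarrow> ('p, 'n, 'o, 'm) funct \<Rightarrow> ('p, 'n, 'o, 'm) funct \<Rightarrow>
     ('p, 'n, 'q, 'l) funct \<Rightarrow> ('q, 'l, 'p, 'n) funct \<Rightarrow> ('q, 'l, 'p, 'n) funct \<Rightarrow> bool" where
  "recollement K X Y Z e e\<^sub>l e\<^sub>r q q\<^sub>l q\<^sub>r \<longleftrightarrow>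
     abelian_category K X \<and> abelian_category K Y \<and> abelian_category K Z \<and>
     adjoint_pair K Y X e\<^sub>l e \<and> adjoint_pair K X Y e e\<^sub>r \<and>
     adjoint_pair K Z Y q\<^sub>l q \<and> adjoint_pair K Y Z q q\<^sub>r \<and>
     fully_faithful Z Y q\<^sub>l \<and> fully_faithful Z Y q\<^sub>r \<and> fully_faithful X Y e \<and>
     essential_image X Y e = {y \<in> Obj Y. is_zero_object Z (Fob q y)}"

text \<open>A Serre subcategory, given by its objects: for every short exact sequence
  \<open>0 \<rightarrow> x \<rightarrow> y \<rightarrow> z \<rightarrow> 0\<close> the object \<open>y\<close> belongs to it if and only if \<open>x\<close> and \<open>z\<close> do.\<close>

definition serre_subcategory :: "('k, 'o, 'm) lincat \<Rightarrow> 'o set \<Rightarrow> bool" where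
  "serre_subcategory C S \<longleftrightarrow> S \<noteq> {} \<and> S \<subseteq> Obj C \<and>
     (\<forall>x\<in>Obj C. \<forall>y\<in>Obj C. \<forall>z\<in>Obj C. \<forall>f g.
        is_kernel C y z g x f \<and> is_cokernel C x y f z g \<longrightarrow> (y \<in> S \<longleftrightarrow> x \<in> S \<and> z \<in> S))"

text \<open>
  The Serre quotient is the localization at the arrows with kernel and cokernel in \<open>S\<close>, by right
  fractions: an arrow from \<open>x\<close> to \<open>y\<close> is a class of roofs \<open>s : w \<rightarrow> x\<close>, \<open>f : w \<rightarrow> y\<close> with \<open>s\<close> inverted.
  Operations on classes are unions of the classes obtained from all representatives and all
  choices of common denominators; for a Serre subcategory these classes coincide.
\<close>

definition inverted :: "('k, 'o, 'm) lincat \<Rightarrow> 'o set \<Rightarrow> 'o \<Rightarrow> 'o \<Rightarrow> 'm \<Rightarrow> bool" where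
  "inverted C S x y s \<longleftrightarrow> s \<in> Arr C x y \<and>
     (\<exists>k\<in>S. \<exists>i. is_kernel C x y s k i) \<and> (\<exists>c\<in>S. \<exists>p. is_cokernel C x y s c p)"

definition roofs :: "('k, 'o, 'm) lincat \<Rightarrow> 'o set \<Rightarrow> 'o \<Rightarrow> 'o \<Rightarrow> ('o \<times> 'm \<times> 'm) set" where
  "roofs C S x y = {(w, s, f). w \<in> Obj C \<and> inverted C S w x s \<and> f \<in> Arr C w y}"

definition roof_class ::
    "('k, 'o, 'm) lincat \<Rightarrow> 'o set \<Rightarrow> 'o \<Rightarrow> 'o \<Rightarrow> 'o \<times> 'm \<times> 'm \<Rightarrow> ('o \<times> 'm \<times> 'm) set" where
  "roof_class C S x y = (\<lambda>(w, s, f). {(w', s', f') \<in> roofs C S x y.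
     \<exists>v\<in>Obj C. \<exists>u\<in>Arr C v w. \<exists>u'\<in>Arr C v w'.
       Cmp C v w x s u = Cmp C v w' x s' u' \<and> inverted C S v x (Cmp C v w x s u) \<and>
       Cmp C v w y f u = Cmp C v w' y f' u'})"

definition serre_quotient ::
    "'k ring \<Rightarrow> ('k, 'o, 'm) lincat \<Rightarrow> 'o set \<Rightarrow> ('k, 'o, ('o \<times> 'm \<times> 'm) set) lincat" where
  "serre_quotient K C S =
     \<lparr>Obj = Obj C,
      Hom = (\<lambda>x y.
        \<lparr>carrier = roof_class C S x y ` roofs C S x y, mult = undefined, one = undefined,
         zero = roof_class C S x y (x, Idt C x, \<zero>\<^bsub>Hom C x y\<^esub>),
         add = (\<lambda>P P'. \<Union>{roof_class C S x y
                   (v, Cmp C v w x s u, Cmp C v w y f u \<oplus>\<^bsub>Hom C v y\<^esub> Cmp C v w' y f' u')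
                 | v w w' s s' f f' u u'.
                   (w, s, f) \<in> P \<and> (w', s', f') \<in> P' \<and>
                   v \<in> Obj C \<and> u \<in> Arr C v w \<and> u' \<in> Arr C v w' \<and>
                   Cmp C v w x s u = Cmp C v w' x s' u' \<and> inverted C S v x (Cmp C v w x s u)}),
         smult = (\<lambda>r P. \<Union>(w, s, f)\<in>P. roof_class C S x y (w, s, r \<odot>\<^bsub>Hom C w y\<^esub> f))\<rparr>),
      Idt = (\<lambda>x. roof_class C S x x (x, Idt C x, Idt C x)),
      Cmp = (\<lambda>x y z Q P. \<Union>{roof_class C S x z (v, Cmp C v w x s u, Cmp C v w' z g h)
                 | v w w' s t f g u h.
                   (w, s, f) \<in> P \<and> (w', t, g) \<in> Q \<and>
                   v \<in> Obj C \<and> inverted C S v w u \<and> h \<in> Arr C v w' \<and>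
                   Cmp C v w y f u = Cmp C v w' y t h})\<rparr>"


section \<open>Vector space constructions\<close>

definition quot_space :: "('k, 'v) module \<Rightarrow> 'v set \<Rightarrow> ('k, 'v set) module" where
  "quot_space V N =
     \<lparr>carrier = a_rcosets\<^bsub>V\<^esub> N, mult = undefined, one = undefined, zero = N, add = set_add V,
      smult = (\<lambda>r T. \<Union>t\<in>T. N +>\<^bsub>V\<^esub> (r \<odot>\<^bsub>V\<^esub> t))\<rparr>"

definition dual_space :: "'k ring \<Rightarrow> ('k, 'v) module \<Rightarrow> ('k, 'v \<Rightarrow> 'k) module" where
  "dual_space K V =
     \<lparr>carrier = {\<phi> \<in> extensional (carrier V).
        \<phi> \<in> module_hom K V
               \<lparr>carrier = carrier K, mult = mult K, one = one K, zero = zero K, add = add K,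
                smult = mult K\<rparr>},
      mult = undefined, one = undefined,
      zero = (\<lambda>v\<in>carrier V. \<zero>\<^bsub>K\<^esub>),
      add = (\<lambda>\<phi> \<psi>. \<lambda>v\<in>carrier V. \<phi> v \<oplus>\<^bsub>K\<^esub> \<psi> v),
      smult = (\<lambda>r \<phi>. \<lambda>v\<in>carrier V. r \<otimes>\<^bsub>K\<^esub> \<phi> v)\<rparr>"

text \<open>The space with basis \<open>S\<close>, its basis vectors, and the map induced by a map of bases.\<close>

definition free_space :: "'k ring \<Rightarrow> 's set \<Rightarrow> ('k, 's \<Rightarrow> 'k) module" where
  "free_space K S =
     \<lparr>carrier = {u. range u \<subseteq> carrier K \<and> finite {s. u s \<noteq> \<zero>\<^bsub>K\<^esub>} \<and> {s. u s \<noteq> \<zero>\<^bsub>K\<^esub>} \<subseteq> S},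
      mult = undefined, one = undefined,
      zero = (\<lambda>s. \<zero>\<^bsub>K\<^esub>),
      add = (\<lambda>u u' s. u s \<oplus>\<^bsub>K\<^esub> u' s),
      smult = (\<lambda>r u s. r \<otimes>\<^bsub>K\<^esub> u s)\<rparr>"

definition basis_vec :: "'k ring \<Rightarrow> 's \<Rightarrow> 's \<Rightarrow> 'k" where
  "basis_vec K s = (\<lambda>t. if t = s then \<one>\<^bsub>K\<^esub> else \<zero>\<^bsub>K\<^esub>)"

definition free_map :: "'k ring \<Rightarrow> ('s \<Rightarrow> 't) \<Rightarrow> ('s \<Rightarrow> 'k) \<Rightarrow> 't \<Rightarrow> 'k" where
  "free_map K g u = (\<lambda>t. \<Oplus>\<^bsub>K\<^esub>s\<in>{s. u s \<noteq> \<zero>\<^bsub>K\<^esub> \<and> g s = t}. u s)"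


section \<open>Modules over a linear category\<close>

text \<open>For an arrow \<open>f : x \<rightarrow> y\<close>, \<open>Act X x y f\<close> is the contravariant action \<open>X y \<rightarrow> X x\<close>.
  Covariant functors are modules over the opposite category.\<close>

record ('k, 'o, 'm, 'v) cmod =
  Val :: "'o \<Rightarrow> ('k, 'v) module"
  Act :: "'o \<Rightarrow> 'o \<Rightarrow> 'm \<Rightarrow> 'v \<Rightarrow> 'v"

definition cmodule :: "'k ring \<Rightarrow> ('k, 'o, 'm) lincat \<Rightarrow> ('k, 'o, 'm, 'v) cmod \<Rightarrow> bool" where
  "cmodule K C X \<longleftrightarrow>
     (\<forall>c\<in>Obj C. vectorspace K (Val X c) \<and> (\<forall>v\<in>carrier (Val X c). Act X c c (Idt C c) v = v)) \<and>
     (\<forall>x\<in>Obj C. \<forall>y\<in>Obj C. \<forall>f\<in>Arr C x y. Act X x y f \<in> module_hom K (Val X y) (Val X x)) \<and>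
     (\<forall>x\<in>Obj C. \<forall>y\<in>Obj C. \<forall>v\<in>carrier (Val X y).
        (\<lambda>f. Act X x y f v) \<in> module_hom K (Hom C x y) (Val X x)) \<and>
     (\<forall>x\<in>Obj C. \<forall>y\<in>Obj C. \<forall>z\<in>Obj C. \<forall>f\<in>Arr C x y. \<forall>g\<in>Arr C y z. \<forall>v\<in>carrier (Val X z).
        Act X x z (Cmp C x y z g f) v = Act X x y f (Act X y z g v))"

text \<open>The vector space of natural transformations. The two modules may take values in different
  types. Transformations are extensional, so that equality is equality of natural
  transformations.\<close>

definition nat_hom ::
    "'k ring \<Rightarrow> ('k, 'o, 'm) lincat \<Rightarrow> ('k, 'o, 'm, 'v) cmod \<Rightarrow> ('k, 'o, 'm, 'w) cmod \<Rightarrow>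
     ('k, 'o \<Rightarrow> 'v \<Rightarrow> 'w) module" where
  "nat_hom K C X Y =
     \<lparr>carrier = {\<eta> \<in> extensional (Obj C).
        (\<forall>c\<in>Obj C. \<eta> c \<in> extensional (carrier (Val X c)) \<and>
                   \<eta> c \<in> module_hom K (Val X c) (Val Y c)) \<and>
        (\<forall>x\<in>Obj C. \<forall>y\<in>Obj C. \<forall>f\<in>Arr C x y. \<forall>v\<in>carrier (Val X y).
           \<eta> x (Act X x y f v) = Act Y x y f (\<eta> y v))},
      mult = undefined, one = undefined,
      zero = (\<lambda>c\<in>Obj C. \<lambda>v\<in>carrier (Val X c). \<zero>\<^bsub>Val Y c\<^esub>),
      add = (\<lambda>\<eta> \<theta>. \<lambda>c\<in>Obj C. \<lambda>v\<in>carrier (Val X c). \<eta> c v \<oplus>\<^bsub>Val Y c\<^esub> \<theta> c v),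
      smult = (\<lambda>r \<eta>. \<lambda>c\<in>Obj C. \<lambda>v\<in>carrier (Val X c). r \<odot>\<^bsub>Val Y c\<^esub> \<eta> c v)\<rparr>"

definition Mod_cat ::
    "'k ring \<Rightarrow> ('k, 'o, 'm) lincat \<Rightarrow> ('k, ('k, 'o, 'm, 'v) cmod, 'o \<Rightarrow> 'v \<Rightarrow> 'v) lincat" where
  "Mod_cat K C =
     \<lparr>Obj = {X. cmodule K C X}, Hom = nat_hom K C,
      Idt = (\<lambda>X. \<lambda>c\<in>Obj C. \<lambda>v\<in>carrier (Val X c). v),
      Cmp = (\<lambda>X Y Z \<theta> \<eta>. \<lambda>c\<in>Obj C. \<lambda>v\<in>carrier (Val X c). \<theta> c (\<eta> c v))\<rparr>"

definition rep :: "('k, 'o, 'm) lincat \<Rightarrow> 'o \<Rightarrow> ('k, 'o, 'm, 'm) cmod" where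
  "rep C c = \<lparr>Val = (\<lambda>x. Hom C x c), Act = (\<lambda>x y f g. Cmp C x y c g f)\<rparr>"

definition finitely_generated ::
    "'k ring \<Rightarrow> ('k, 'o, 'm) lincat \<Rightarrow> ('k, 'o, 'm, 'v) cmod \<Rightarrow> bool" where
  "finitely_generated K C X \<longleftrightarrow> cmodule K C X \<and>
     (\<exists>c\<in>Obj C. \<exists>\<beta>\<in>carrier (nat_hom K C (rep C c) X).
        \<forall>a\<in>Obj C. \<beta> a ` Arr C a c = carrier (Val X a))"

definition finitely_presented ::
    "'k ring \<Rightarrow> ('k, 'o, 'm) lincat \<Rightarrow> ('k, 'o, 'm, 'v) cmod \<Rightarrow> bool" where
  "finitely_presented K C X \<longleftrightarrow> cmodule K C X \<and>
     (\<exists>c1\<in>Obj C. \<exists>c0\<in>Obj C. \<exists>\<alpha>\<in>carrier (nat_hom K C (rep C c1) (rep C c0)).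
      \<exists>\<beta>\<in>carrier (nat_hom K C (rep C c0) X). \<forall>a\<in>Obj C.
        \<alpha> a ` Arr C a c1 = {g \<in> Arr C a c0. \<beta> a g = \<zero>\<^bsub>Val X a\<^esub>} \<and>
        \<beta> a ` Arr C a c0 = carrier (Val X a))"

definition mod_cat ::
    "'k ring \<Rightarrow> ('k, 'o, 'm) lincat \<Rightarrow> ('k, ('k, 'o, 'm, 'v) cmod, 'o \<Rightarrow> 'v \<Rightarrow> 'v) lincat" where
  "mod_cat K C = full_sub (Mod_cat K C) {X. finitely_presented K C X}"


section \<open>Dualizing varieties, functorially finite subcategories, ideal quotients\<close>

definition hom_finite :: "'k ring \<Rightarrow> ('k, 'o, 'm) lincat \<Rightarrow> bool" where
  "hom_finite K C \<longleftrightarrow> (\<forall>x\<in>Obj C. \<forall>y\<in>Obj C. vectorspace.fin_dim K (Hom C x y))"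

definition end_ring :: "('k, 'o, 'm) lincat \<Rightarrow> 'o \<Rightarrow> 'm ring" where
  "end_ring C x = \<lparr>carrier = Arr C x x, mult = Cmp C x x x, one = Idt C x,
                   zero = \<zero>\<^bsub>Hom C x x\<^esub>, add = add (Hom C x x)\<rparr>"

definition local_ring :: "'r ring \<Rightarrow> bool" where
  "local_ring R \<longleftrightarrow> ring R \<and> \<one>\<^bsub>R\<^esub> \<noteq> \<zero>\<^bsub>R\<^esub> \<and>
     (\<forall>a\<in>carrier R - Units R. \<forall>b\<in>carrier R - Units R. a \<oplus>\<^bsub>R\<^esub> b \<notin> Units R)"

definition krull_schmidt :: "('k, 'o, 'm) lincat \<Rightarrow> bool" where
  "krull_schmidt C \<longleftrightarrow> (\<forall>s\<in>Obj C. \<exists>n xs.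
     is_direct_sum C n xs s \<and> (\<forall>i<n. local_ring (end_ring C (xs i))))"

text \<open>\<open>X \<mapsto> D \<circ> X\<close> as a functor from the opposite of a category of \<open>C\<close>-modules to modules over
  the opposite of \<open>C\<close>. The values of \<open>D \<circ> X\<close> lie in the type \<open>'v \<Rightarrow> 'k\<close>.\<close>

definition dual_funct ::
    "'k ring \<Rightarrow> ('k, 'o, 'm) lincat \<Rightarrow>
     (('k, 'o, 'm, 'v) cmod, 'o \<Rightarrow> 'v \<Rightarrow> 'v,
      ('k, 'o, 'm, 'v \<Rightarrow> 'k) cmod, 'o \<Rightarrow> ('v \<Rightarrow> 'k) \<Rightarrow> ('v \<Rightarrow> 'k)) funct" where
  "dual_funct K C =
     \<lparr>Fob = (\<lambda>X. \<lparr>Val = (\<lambda>c. dual_space K (Val X c)),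
                  Act = (\<lambda>x y f \<phi>. \<lambda>v\<in>carrier (Val X x). \<phi> (Act X y x f v))\<rparr>),
      Far = (\<lambda>X Y \<eta>. \<lambda>c\<in>Obj C. \<lambda>\<phi>\<in>carrier (dual_space K (Val X c)).
                      \<lambda>v\<in>carrier (Val Y c). \<phi> (\<eta> c v))\<rparr>"

text \<open>The type argument is the universe in which modules take their values.\<close>

definition dualizing_variety :: "'v itself \<Rightarrow> 'k ring \<Rightarrow> ('k, 'o, 'm) lincat \<Rightarrow> bool" where
  "dualizing_variety (_ :: 'v itself) K C \<longleftrightarrow>
     additive_category K C \<and> krull_schmidt C \<and> hom_finite K C \<and>
     category_equivalence K
       (op_cat (mod_cat K C :: ('k, ('k, 'o, 'm, 'v) cmod, 'o \<Rightarrow> 'v \<Rightarrow> 'v) lincat))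
       (mod_cat K (op_cat C))
       (dual_funct K C)"

text \<open>Precomposition with a functor \<open>F : C \<rightarrow> D\<close>, on modules and as a functor.\<close>

definition precomp ::
    "('o, 'm, 'p, 'n) funct \<Rightarrow> ('k, 'p, 'n, 'v) cmod \<Rightarrow> ('k, 'o, 'm, 'v) cmod" where
  "precomp F X = \<lparr>Val = (\<lambda>c. Val X (Fob F c)),
                  Act = (\<lambda>x y f. Act X (Fob F x) (Fob F y) (Far F x y f))\<rparr>"

definition pullback ::
    "('k, 'o, 'm) lincat \<Rightarrow> ('o, 'm, 'p, 'n) funct \<Rightarrow>
     (('k, 'p, 'n, 'v) cmod, 'p \<Rightarrow> 'v \<Rightarrow> 'v, ('k, 'o, 'm, 'v) cmod, 'o \<Rightarrow> 'v \<Rightarrow> 'v) funct" where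
  "pullback C F = \<lparr>Fob = precomp F, Far = (\<lambda>X Y \<eta>. \<lambda>c\<in>Obj C. \<eta> (Fob F c))\<rparr>"

definition incl :: "('o, 'm, 'o, 'm) funct" where
  "incl = \<lparr>Fob = (\<lambda>x. x), Far = (\<lambda>x y f. f)\<rparr>"

definition functorially_finite :: "'k ring \<Rightarrow> ('k, 'o, 'm) lincat \<Rightarrow> 'o set \<Rightarrow> bool" where
  "functorially_finite K A B \<longleftrightarrow> B \<subseteq> Obj A \<and>
     additive_category K (full_sub A B) \<and> krull_schmidt (full_sub A B) \<and>
     (\<forall>x\<in>Obj A. finitely_generated K (full_sub A B) (precomp incl (rep A x)) \<and>
                finitely_generated K (op_cat (full_sub A B)) (precomp incl (rep (op_cat A) x)))"

definition factor_ideal :: "('k, 'o, 'm) lincat \<Rightarrow> 'o set \<Rightarrow> 'o \<Rightarrow> 'o \<Rightarrow> 'm set" where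
  "factor_ideal A B x y = {Cmp A x b y g f | b f g. b \<in> B \<and> f \<in> Arr A x b \<and> g \<in> Arr A b y}"

definition ideal_quotient :: "('k, 'o, 'm) lincat \<Rightarrow> 'o set \<Rightarrow> ('k, 'o, 'm set) lincat" where
  "ideal_quotient A B =
     \<lparr>Obj = Obj A,
      Hom = (\<lambda>x y. quot_space (Hom A x y) (factor_ideal A B x y)),
      Idt = (\<lambda>x. factor_ideal A B x x +>\<^bsub>Hom A x x\<^esub> Idt A x),
      Cmp = (\<lambda>x y z G F. \<Union>g\<in>G. \<Union>f\<in>F. factor_ideal A B x z +>\<^bsub>Hom A x z\<^esub> Cmp A x y z g f)\<rparr>"

definition proj :: "('k, 'o, 'm) lincat \<Rightarrow> 'o set \<Rightarrow> ('o, 'm, 'o, 'm set) funct" where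
  "proj A B = \<lparr>Fob = (\<lambda>x. x), Far = (\<lambda>x y f. factor_ideal A B x y +>\<^bsub>Hom A x y\<^esub> f)\<rparr>"


section \<open>Tensor products and the adjoints of restriction\<close>

text \<open>
  The tensor product of a \<open>C\<close>-module \<open>Y\<close> and a module \<open>Z\<close> over the opposite of \<open>C\<close>: the space
  with basis the symbols \<open>y \<otimes> z\<close>, with \<open>y\<close> in \<open>Y c\<close> and \<open>z\<close> in \<open>Z c\<close> for some object \<open>c\<close>, modulo
  bilinearity and \<open>Y(f) y \<otimes> z = y \<otimes> Z(f) z\<close>. As \<open>Z\<close> is a module over the opposite category,
  \<open>f : c \<rightarrow> d\<close> acts on it by \<open>Act Z d c f : Z c \<rightarrow> Z d\<close>.
\<close>

definition tensor_free ::
    "'k ring \<Rightarrow> ('k, 'o, 'm) lincat \<Rightarrow> ('k, 'o, 'm, 'v) cmod \<Rightarrow> ('k, 'o, 'm, 'w) cmod \<Rightarrow>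
     ('k, 'o \<times> 'v \<times> 'w \<Rightarrow> 'k) module" where
  "tensor_free K C Y Z =
     free_space K {(c, y, z). c \<in> Obj C \<and> y \<in> carrier (Val Y c) \<and> z \<in> carrier (Val Z c)}"

definition tensor_rel ::
    "'k ring \<Rightarrow> ('k, 'o, 'm) lincat \<Rightarrow> ('k, 'o, 'm, 'v) cmod \<Rightarrow> ('k, 'o, 'm, 'w) cmod \<Rightarrow>
     ('o \<times> 'v \<times> 'w \<Rightarrow> 'k) set" where
  "tensor_rel K C Y Z =
     (let T = tensor_free K C Y Z; \<tau> = (\<lambda>c y z. basis_vec K (c, y, z)) in
      module.span K T
       ({\<tau> c (y \<oplus>\<^bsub>Val Y c\<^esub> y') z \<ominus>\<^bsub>T\<^esub> (\<tau> c y z \<oplus>\<^bsub>T\<^esub> \<tau> c y' z) | c y y' z.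
           c \<in> Obj C \<and> y \<in> carrier (Val Y c) \<and> y' \<in> carrier (Val Y c) \<and> z \<in> carrier (Val Z c)} \<union>
        {\<tau> c y (z \<oplus>\<^bsub>Val Z c\<^esub> z') \<ominus>\<^bsub>T\<^esub> (\<tau> c y z \<oplus>\<^bsub>T\<^esub> \<tau> c y z') | c y z z'.
           c \<in> Obj C \<and> y \<in> carrier (Val Y c) \<and> z \<in> carrier (Val Z c) \<and> z' \<in> carrier (Val Z c)} \<union>
        {\<tau> c (r \<odot>\<^bsub>Val Y c\<^esub> y) z \<ominus>\<^bsub>T\<^esub> (r \<odot>\<^bsub>T\<^esub> \<tau> c y z) | c r y z.
           c \<in> Obj C \<and> r \<in> carrier K \<and> y \<in> carrier (Val Y c) \<and> z \<in> carrier (Val Z c)} \<union>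
        {\<tau> c y (r \<odot>\<^bsub>Val Z c\<^esub> z) \<ominus>\<^bsub>T\<^esub> (r \<odot>\<^bsub>T\<^esub> \<tau> c y z) | c r y z.
           c \<in> Obj C \<and> r \<in> carrier K \<and> y \<in> carrier (Val Y c) \<and> z \<in> carrier (Val Z c)} \<union>
        {\<tau> c (Act Y c d f y) z \<ominus>\<^bsub>T\<^esub> \<tau> d y (Act Z d c f z) | c d f y z.
           c \<in> Obj C \<and> d \<in> Obj C \<and> f \<in> Arr C c d \<and>
           y \<in> carrier (Val Y d) \<and> z \<in> carrier (Val Z c)}))"

definition tensor ::
    "'k ring \<Rightarrow> ('k, 'o, 'm) lincat \<Rightarrow> ('k, 'o, 'm, 'v) cmod \<Rightarrow> ('k, 'o, 'm, 'w) cmod \<Rightarrow>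
     ('k, ('o \<times> 'v \<times> 'w \<Rightarrow> 'k) set) module" where
  "tensor K C Y Z = quot_space (tensor_free K C Y Z) (tensor_rel K C Y Z)"

text \<open>The map into the tensor product of \<open>Y'\<close> and \<open>Z'\<close> with \<open>y \<otimes> z \<mapsto> \<phi> y \<otimes> \<psi> z\<close>.\<close>

definition tensor_map ::
    "'k ring \<Rightarrow> ('k, 'o, 'm) lincat \<Rightarrow> ('k, 'o, 'm, 'v2) cmod \<Rightarrow> ('k, 'o, 'm, 'w2) cmod \<Rightarrow>
     ('o \<Rightarrow> 'v \<Rightarrow> 'v2) \<Rightarrow> ('o \<Rightarrow> 'w \<Rightarrow> 'w2) \<Rightarrow>
     ('o \<times> 'v \<times> 'w \<Rightarrow> 'k) set \<Rightarrow> ('o \<times> 'v2 \<times> 'w2 \<Rightarrow> 'k) set" where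
  "tensor_map K C Y' Z' \<phi> \<psi> T =
     (\<Union>u\<in>T. tensor_rel K C Y' Z' +>\<^bsub>tensor_free K C Y' Z'\<^esub>
               free_map K (\<lambda>(c, y, z). (c, \<phi> c y, \<psi> c z)) u)"

text \<open>
  Tensor products and spaces of natural transformations have elements of larger types than the
  modules they are formed from. To obtain functors between categories of modules with values in a
  single type \<open>'v\<close>, a module is replaced by an isomorphic copy along chosen injections of the
  carriers of its values into \<open>'v\<close>; these exist when \<open>'v\<close> is large enough.
\<close>

definition code :: "('k, 'w) module \<Rightarrow> 'w \<Rightarrow> 'v" where
  "code V = (SOME e. inj_on e (carrier V))"

definition decode :: "('k, 'w) module \<Rightarrow> 'v \<Rightarrow> 'w" where
  "decode V = inv_into (carrier V) (code V)"

definition copy_space :: "('k, 'w) module \<Rightarrow> ('k, 'v) module" where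
  "copy_space V =
     \<lparr>carrier = code V ` carrier V, mult = undefined, one = undefined,
      zero = code V \<zero>\<^bsub>V\<^esub>,
      add = (\<lambda>v w. code V (decode V v \<oplus>\<^bsub>V\<^esub> decode V w)),
      smult = (\<lambda>r v. code V (r \<odot>\<^bsub>V\<^esub> decode V v))\<rparr>"

definition copy_mod :: "('k, 'o, 'm, 'w) cmod \<Rightarrow> ('k, 'o, 'm, 'v) cmod" where
  "copy_mod X = \<lparr>Val = (\<lambda>c. copy_space (Val X c)),
                 Act = (\<lambda>x y f v. code (Val X x) (Act X x y f (decode (Val X y) v)))\<rparr>"

definition copy_trans ::
    "('k, 'o, 'm) lincat \<Rightarrow> ('k, 'o, 'm, 'w) cmod \<Rightarrow> ('k, 'o, 'm, 'w2) cmod \<Rightarrow>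
     ('o \<Rightarrow> 'w \<Rightarrow> 'w2) \<Rightarrow> 'o \<Rightarrow> 'v \<Rightarrow> 'v" where
  "copy_trans C X Y \<eta> =
     (\<lambda>c\<in>Obj C. \<lambda>v\<in>carrier (copy_space (Val X c)).
        code (Val Y c) (\<eta> c (decode (Val X c) v)))"

text \<open>\<open>left_ext K C D F\<close>: the functor sending a \<open>C\<close>-module \<open>Y\<close> to the \<open>D\<close>-module whose value at \<open>d\<close> is
  the tensor product over \<open>C\<close> of \<open>Y\<close> and \<open>D(d, F-)\<close>.\<close>

definition corep_along ::
    "('k, 'p, 'n) lincat \<Rightarrow> ('o, 'm, 'p, 'n) funct \<Rightarrow> 'p \<Rightarrow> ('k, 'o, 'm, 'n) cmod" where
  "corep_along D F d = precomp (op_funct F) (rep (op_cat D) d)"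

definition left_ext_mod ::
    "'k ring \<Rightarrow> ('k, 'o, 'm) lincat \<Rightarrow> ('k, 'p, 'n) lincat \<Rightarrow> ('o, 'm, 'p, 'n) funct \<Rightarrow>
     ('k, 'o, 'm, 'v) cmod \<Rightarrow> ('k, 'p, 'n, ('o \<times> 'v \<times> 'n \<Rightarrow> 'k) set) cmod" where
  "left_ext_mod K C D F Y =
     \<lparr>Val = (\<lambda>d. tensor K C Y (corep_along D F d)),
      Act = (\<lambda>d d' g. tensor_map K C Y (corep_along D F d)
               (\<lambda>c y. y) (\<lambda>c h. Cmp D d d' (Fob F c) h g))\<rparr>"

definition left_ext ::
    "'k ring \<Rightarrow> ('k, 'o, 'm) lincat \<Rightarrow> ('k, 'p, 'n) lincat \<Rightarrow> ('o, 'm, 'p, 'n) funct \<Rightarrow>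
     (('k, 'o, 'm, 'v) cmod, 'o \<Rightarrow> 'v \<Rightarrow> 'v, ('k, 'p, 'n, 'v) cmod, 'p \<Rightarrow> 'v \<Rightarrow> 'v) funct" where
  "left_ext K C D F =
     \<lparr>Fob = (\<lambda>Y. copy_mod (left_ext_mod K C D F Y)),
      Far = (\<lambda>Y Y' \<eta>. copy_trans D (left_ext_mod K C D F Y) (left_ext_mod K C D F Y')
               (\<lambda>d. tensor_map K C Y' (corep_along D F d) \<eta> (\<lambda>c h. h)))\<rparr>"

text \<open>\<open>right_ext K C D F\<close>: the functor sending a \<open>C\<close>-module \<open>Y\<close> to the \<open>D\<close>-module whose value at \<open>d\<close> is
  the space of natural transformations from \<open>D(F-, d)\<close> to \<open>Y\<close>.\<close>

definition right_ext_mod ::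
    "'k ring \<Rightarrow> ('k, 'o, 'm) lincat \<Rightarrow> ('k, 'p, 'n) lincat \<Rightarrow> ('o, 'm, 'p, 'n) funct \<Rightarrow>
     ('k, 'o, 'm, 'v) cmod \<Rightarrow> ('k, 'p, 'n, 'o \<Rightarrow> 'n \<Rightarrow> 'v) cmod" where
  "right_ext_mod K C D F Y =
     \<lparr>Val = (\<lambda>d. nat_hom K C (precomp F (rep D d)) Y),
      Act = (\<lambda>d d' g \<phi>. \<lambda>c\<in>Obj C. \<lambda>h\<in>Arr D (Fob F c) d. \<phi> c (Cmp D (Fob F c) d d' g h))\<rparr>"

definition right_ext ::
    "'k ring \<Rightarrow> ('k, 'o, 'm) lincat \<Rightarrow> ('k, 'p, 'n) lincat \<Rightarrow> ('o, 'm, 'p, 'n) funct \<Rightarrow>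
     (('k, 'o, 'm, 'v) cmod, 'o \<Rightarrow> 'v \<Rightarrow> 'v, ('k, 'p, 'n, 'v) cmod, 'p \<Rightarrow> 'v \<Rightarrow> 'v) funct" where
  "right_ext K C D F =
     \<lparr>Fob = (\<lambda>Y. copy_mod (right_ext_mod K C D F Y)),
      Far = (\<lambda>Y Y' \<eta>. copy_trans D (right_ext_mod K C D F Y) (right_ext_mod K C D F Y')
               (\<lambda>d \<phi>. \<lambda>c\<in>Obj C. \<lambda>h\<in>Arr D (Fob F c) d. \<eta> c (\<phi> c h)))\<rparr>"

text \<open>
  The type \<open>'v\<close> is a universe for modules over categories with objects in \<open>'o\<close> and arrows in \<open>'m\<close>:
  it is closed, up to bijection, under forming families indexed by objects and arrows, and it
  has room for the field. This makes all the constructions above available inside \<open>'v\<close>.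
\<close>

definition module_universe :: "'v itself \<Rightarrow> 'k ring \<Rightarrow> ('k, 'o, 'm) lincat \<Rightarrow> bool" where
  "module_universe (_ :: 'v itself) K C \<longleftrightarrow>
     (\<exists>j :: ('o \<times> 'm \<times> nat \<Rightarrow> 'v) \<Rightarrow> 'v. inj j) \<and> (\<exists>j :: 'k \<Rightarrow> 'v. inj_on j (carrier K))"

text \<open>Such universes exist over any field, for any category.\<close>

lemma module_universe_exists:
  "module_universe TYPE('o \<times> 'm \<times> nat \<Rightarrow> 'k) K (C :: ('k, 'o, 'm) lincat)"
proof -
  let ?I = "UNIV :: ('o \<times> 'm \<times> nat) set"
  have "infinite ?I"
    by (simp add: finite_prod)
  then have "(card_of (?I \<times> ?I), card_of ?I) \<in> ordLeq"
    by (rule ordIso_imp_ordLeq[OF card_of_Times_same_infinite])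
  then obtain p :: "('o \<times> 'm \<times> nat) \<times> ('o \<times> 'm \<times> nat) \<Rightarrow> 'o \<times> 'm \<times> nat" where p: "inj p"
    unfolding card_of_ordLeq[symmetric] by auto
  have "inj (\<lambda>(F :: 'o \<times> 'm \<times> nat \<Rightarrow> 'o \<times> 'm \<times> nat \<Rightarrow> 'k) i. case inv_into UNIV p i of (a, b) \<Rightarrow> F a b)"
  proof (rule injI, rule ext, rule ext)
    fix F G :: "'o \<times> 'm \<times> nat \<Rightarrow> 'o \<times> 'm \<times> nat \<Rightarrow> 'k" and a b
    assume "(\<lambda>i. case inv_into UNIV p i of (a, b) \<Rightarrow> F a b) = (\<lambda>i. case inv_into UNIV p i of (a, b) \<Rightarrow> G a b)"
    from fun_cong[OF this, of "p (a, b)"] show "F a b = G a b"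
      by (simp add: inv_f_f[OF p])
  qed
  moreover have "inj_on (\<lambda>r (i :: 'o \<times> 'm \<times> nat). r) (carrier K)"
    by (rule inj_onI) (erule fun_cong)
  ultimately show ?thesis
    unfolding module_universe_def by blast
qed

end

theory Submission
  imports Defs
begin

text \<open>
  All adjunctions come from explicit universal arrows: \<open>y \<mapsto> y \<otimes> 1\<close> into the left extension and
  evaluation at an identity out of the right extension. Restricting them to finitely presented modules
  requires that each of the six functors preserves finite presentation. Left extensions do so because they
  send a presentation by representables to one. Over a dualizing variety, kernels are duals of cokernels, so
  they stay finitely presented; with approximations by \<open>\<B>\<close> this makes restriction preserve finite
  presentation, and \<open>i\<^sup>*\<^sub>\<rho> M\<close> is the dual of the left extension of the dual of \<open>M\<close>. An \<open>\<A>/[\<B>]\<close>-module is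
  finitely presented exactly if it is so over \<open>\<A>\<close>, because \<open>\<A>/[\<B>](-,x)\<close> is a cokernel of representables, and
  \<open>p\<^sup>*p\<^sup>*\<^sub>\<rho> X\<close> is the kernel of \<open>X \<rightarrow> i\<^sup>*\<^sub>\<rho> i\<^sup>*X\<close>. The six functors then restrict, kernels are pointwise, and an
  arrow is inverted in the Serre quotient iff its restriction to \<open>\<B>\<close> is bijective. As \<open>i\<^sup>*\<close> has a fully
  faithful left adjoint, it is the localization at these arrows.
\<close>

section \<open>Vector spaces and linear maps\<close>

text \<open>Two obstacles shape the development. The first is size: a module takes its values in one
  type, while tensor products, spaces of transformations, quotients, products and duals live in
  larger types. Hence natural maps, isomorphisms, presentations and universal properties are treated
  between modules with different value types, and the copy into \<open>'v\<close> is made only after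
  the mathematics is done. The values of a finitely presented module are images of Hom spaces, so it
  fits into every type that receives the arrows; this turns the duality, given for the universe
  \<open>'v\<close>, into the type-independent property \<open>dualizing\<close>. The second
  obstacle is that B and A/[B] are not given as dualizing varieties, so closure under kernels must
  be transferred from A. Kernels over B are restrictions of kernels between left extensions, and
  kernels over A/[B] become kernels over A under pullback. Of the equivalence given for A only two
  consequences are extracted: D preserves finite presentation over A and over its opposite. The
  latter follows from essential surjectivity together with the identification of X with its double
  dual.\<close>

type_synonym ('k, 'o, 'm, 'v) modcat = "('k, ('k, 'o, 'm, 'v) cmod, 'o \<Rightarrow> 'v \<Rightarrow> 'v) lincat"

abbreviation (input) El :: "('k, 'o, 'm, 'v) cmod => 'o => 'v set" where "El X c \<equiv> carrier (Val X c)"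
abbreviation (input) zr :: "('k, 'o, 'm, 'v) cmod => 'o => 'v" where "zr X c \<equiv> \<zero>\<^bsub>Val X c\<^esub>"

locale base_field = field K for K :: "'k ring" (structure)
begin

abbreviation vsp :: "('k, 'v) module => bool" where "vsp V \<equiv> vectorspace K V"
abbreviation lin :: "('k, 'v) module => ('k, 'w) module => ('v => 'w) => bool" where
 "lin V W f \<equiv> f \<in> module_hom K V W"
abbreviation (input) Nats :: "('k, 'o, 'm) lincat \<Rightarrow> ('k, 'o, 'm, 'v) cmod \<Rightarrow> ('k, 'o, 'm, 'w) cmod \<Rightarrow> ('o \<Rightarrow> 'v \<Rightarrow> 'w) set" where
 "Nats C X Y \<equiv> carrier (nat_hom K C X Y)"
abbreviation (input) fp :: "('k, 'o, 'm) lincat \<Rightarrow> ('k, 'o, 'm, 'v) cmod \<Rightarrow> bool" where "fp C X \<equiv> finitely_presented K C X"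

text \<open>Additive inverses come for free: (-1)v is one, by distributivity over 1 + (-1) and 0v =
  0.\<close>

lemma vspI:
 assumes "\<zero>\<^bsub>V\<^esub> \<in> carrier V"
  and "\<And>v w. v \<in> carrier V ==> w \<in> carrier V ==> v \<oplus>\<^bsub>V\<^esub> w \<in> carrier V"
  and "\<And>r v. r \<in> carrier K ==> v \<in> carrier V ==> r \<odot>\<^bsub>V\<^esub> v \<in> carrier V"
  and "\<And>v w. v \<in> carrier V ==> w \<in> carrier V ==> v \<oplus>\<^bsub>V\<^esub> w = w \<oplus>\<^bsub>V\<^esub> v"
  and "\<And>u v w. u \<in> carrier V ==> v \<in> carrier V ==> w \<in> carrier V ==>
   (u \<oplus>\<^bsub>V\<^esub> v) \<oplus>\<^bsub>V\<^esub> w = u \<oplus>\<^bsub>V\<^esub> (v \<oplus>\<^bsub>V\<^esub> w)"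
  and "\<And>v. v \<in> carrier V ==> v \<oplus>\<^bsub>V\<^esub> \<zero>\<^bsub>V\<^esub> = v"
  and "\<And>v. v \<in> carrier V ==> \<zero> \<odot>\<^bsub>V\<^esub> v = \<zero>\<^bsub>V\<^esub>"
  and "\<And>v. v \<in> carrier V ==> \<one> \<odot>\<^bsub>V\<^esub> v = v"
  and "\<And>r s v. r \<in> carrier K ==> s \<in> carrier K ==> v \<in> carrier V ==>
   (r \<otimes> s) \<odot>\<^bsub>V\<^esub> v = r \<odot>\<^bsub>V\<^esub> (s \<odot>\<^bsub>V\<^esub> v)"
  and "\<And>r s v. r \<in> carrier K ==> s \<in> carrier K ==> v \<in> carrier V ==>
   (r \<oplus> s) \<odot>\<^bsub>V\<^esub> v = r \<odot>\<^bsub>V\<^esub> v \<oplus>\<^bsub>V\<^esub> s \<odot>\<^bsub>V\<^esub> v"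
  and "\<And>r v w. r \<in> carrier K ==> v \<in> carrier V ==> w \<in> carrier V ==>
   r \<odot>\<^bsub>V\<^esub> (v \<oplus>\<^bsub>V\<^esub> w) = r \<odot>\<^bsub>V\<^esub> v \<oplus>\<^bsub>V\<^esub> r \<odot>\<^bsub>V\<^esub> w"
 shows "vsp V"
proof -
 have neg: "v \<oplus>\<^bsub>V\<^esub> (\<ominus> \<one>) \<odot>\<^bsub>V\<^esub> v = \<zero>\<^bsub>V\<^esub>" if "v \<in> carrier V" for v
  using assms(10)[of \<one> "\<ominus> \<one>" v] assms(7,8)[OF that] that by (simp add: r_neg)
 have negc: "(\<ominus> \<one>) \<odot>\<^bsub>V\<^esub> v \<in> carrier V" if "v \<in> carrier V" for v
  using assms(3) that by simp
 have "module K V"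
 proof (rule module_criteria)
  show "\<forall>v\<in>carrier V. \<exists>w\<in>carrier V. v \<oplus>\<^bsub>V\<^esub> w = \<zero>\<^bsub>V\<^esub>"
   using neg negc by metis
  show "\<forall>v w. v \<in> carrier V \<and> w \<in> carrier V --> v \<oplus>\<^bsub>V\<^esub> w = w \<oplus>\<^bsub>V\<^esub> v"
   using assms(4) by metis
 qed (simp_all add: is_cring assms(1-3,5-))
 then show ?thesis
  by (simp add: vectorspace_def field_axioms)
qed

section \<open>Arithmetic in a single vector space\<close>

context
 fixes V :: "('k, 'v) module"
 assumes V: "vsp V"
begin

interpretation V: vectorspace K V by (rule V)

lemma vs_closed:
 "\<zero>\<^bsub>V\<^esub> \<in> carrier V"
 "v \<in> carrier V ==> w \<in> carrier V ==> v \<oplus>\<^bsub>V\<^esub> w \<in> carrier V"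
 "v \<in> carrier V ==> w \<in> carrier V ==> v \<ominus>\<^bsub>V\<^esub> w \<in> carrier V"
 "v \<in> carrier V ==> \<ominus>\<^bsub>V\<^esub> v \<in> carrier V"
 "r \<in> carrier K ==> v \<in> carrier V ==> r \<odot>\<^bsub>V\<^esub> v \<in> carrier V"
 by auto

lemma vs_simps:
 "v \<in> carrier V ==> v \<oplus>\<^bsub>V\<^esub> \<zero>\<^bsub>V\<^esub> = v"
 "v \<in> carrier V ==> \<zero>\<^bsub>V\<^esub> \<oplus>\<^bsub>V\<^esub> v = v"
 "v \<in> carrier V ==> \<zero> \<odot>\<^bsub>V\<^esub> v = \<zero>\<^bsub>V\<^esub>"
 "v \<in> carrier V ==> \<one> \<odot>\<^bsub>V\<^esub> v = v"
 "r \<in> carrier K ==> r \<odot>\<^bsub>V\<^esub> \<zero>\<^bsub>V\<^esub> = \<zero>\<^bsub>V\<^esub>"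
 by auto

lemma vs_ac:
 "v \<in> carrier V ==> w \<in> carrier V ==> v \<oplus>\<^bsub>V\<^esub> w = w \<oplus>\<^bsub>V\<^esub> v"
 "u \<in> carrier V ==> v \<in> carrier V ==> w \<in> carrier V ==>
  (u \<oplus>\<^bsub>V\<^esub> v) \<oplus>\<^bsub>V\<^esub> w = u \<oplus>\<^bsub>V\<^esub> (v \<oplus>\<^bsub>V\<^esub> w)"
 "u \<in> carrier V ==> v \<in> carrier V ==> w \<in> carrier V ==>
  u \<oplus>\<^bsub>V\<^esub> (v \<oplus>\<^bsub>V\<^esub> w) = v \<oplus>\<^bsub>V\<^esub> (u \<oplus>\<^bsub>V\<^esub> w)"
 by (auto simp: V.a_ac)

lemma vs_distr:
 "r \<in> carrier K ==> s \<in> carrier K ==> v \<in> carrier V ==>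
  (r \<otimes> s) \<odot>\<^bsub>V\<^esub> v = r \<odot>\<^bsub>V\<^esub> (s \<odot>\<^bsub>V\<^esub> v)"
 "r \<in> carrier K ==> s \<in> carrier K ==> v \<in> carrier V ==>
  (r \<oplus> s) \<odot>\<^bsub>V\<^esub> v = r \<odot>\<^bsub>V\<^esub> v \<oplus>\<^bsub>V\<^esub> s \<odot>\<^bsub>V\<^esub> v"
 "r \<in> carrier K ==> v \<in> carrier V ==> w \<in> carrier V ==>
  r \<odot>\<^bsub>V\<^esub> (v \<oplus>\<^bsub>V\<^esub> w) = r \<odot>\<^bsub>V\<^esub> v \<oplus>\<^bsub>V\<^esub> r \<odot>\<^bsub>V\<^esub> w"
 by (auto simp: V.smult_assoc1 V.smult_l_distr V.smult_r_distr)

lemma vs_minus_eq: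
 "v \<in> carrier V ==> w \<in> carrier V ==> v \<ominus>\<^bsub>V\<^esub> w = v \<oplus>\<^bsub>V\<^esub> (\<ominus> \<one>) \<odot>\<^bsub>V\<^esub> w"
 by (simp add: a_minus_def V.smult_l_minus)

lemma vs_diff_zero:
 "v \<in> carrier V ==> v \<ominus>\<^bsub>V\<^esub> \<zero>\<^bsub>V\<^esub> = v" "v \<in> carrier V ==> v \<ominus>\<^bsub>V\<^esub> v = \<zero>\<^bsub>V\<^esub>"
 by (simp_all add: a_minus_def V.r_neg)

lemma vs_diff:
 assumes v: "v \<in> carrier V" and w: "w \<in> carrier V"
 shows "v \<ominus>\<^bsub>V\<^esub> w = \<zero>\<^bsub>V\<^esub> \<longleftrightarrow> v = w"
  and "w \<oplus>\<^bsub>V\<^esub> (v \<ominus>\<^bsub>V\<^esub> w) = v"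
  and "(v \<ominus>\<^bsub>V\<^esub> w) \<oplus>\<^bsub>V\<^esub> w = v"
  and "(v \<oplus>\<^bsub>V\<^esub> w) \<ominus>\<^bsub>V\<^esub> w = v"
proof -
 show "v \<ominus>\<^bsub>V\<^esub> w = \<zero>\<^bsub>V\<^esub> \<longleftrightarrow> v = w" using v w by simp
 show 1: "w \<oplus>\<^bsub>V\<^esub> (v \<ominus>\<^bsub>V\<^esub> w) = v"
  using v w by (simp add: a_minus_def V.a_lcomm V.r_neg)
 show "(v \<ominus>\<^bsub>V\<^esub> w) \<oplus>\<^bsub>V\<^esub> w = v"
  using v w by (simp add: a_minus_def V.a_assoc V.l_neg)
 show "(v \<oplus>\<^bsub>V\<^esub> w) \<ominus>\<^bsub>V\<^esub> w = v"
  using v w by (simp add: a_minus_def V.a_assoc V.r_neg)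
qed

end

section \<open>Linear maps\<close>

lemma linI:
 assumes "\<And>v. v \<in> carrier V ==> f v \<in> carrier W"
  and "\<And>v w. v \<in> carrier V ==> w \<in> carrier V ==> f (v \<oplus>\<^bsub>V\<^esub> w) = f v \<oplus>\<^bsub>W\<^esub> f w"
  and "\<And>r v. r \<in> carrier K ==> v \<in> carrier V ==> f (r \<odot>\<^bsub>V\<^esub> v) = r \<odot>\<^bsub>W\<^esub> f v"
 shows "lin V W f"
 using assms by (auto simp: module_hom_def)

lemma linD:
 assumes "lin V W f"
 shows "v \<in> carrier V ==> f v \<in> carrier W"
  and "v \<in> carrier V ==> w \<in> carrier V ==> f (v \<oplus>\<^bsub>V\<^esub> w) = f v \<oplus>\<^bsub>W\<^esub> f w"
  and "r \<in> carrier K ==> v \<in> carrier V ==> f (r \<odot>\<^bsub>V\<^esub> v) = r \<odot>\<^bsub>W\<^esub> f v"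
 using assms by (auto simp: module_hom_def)

lemma lin_cong:
 assumes "lin V W f" "\<And>v. v \<in> carrier V ==> f v = g v" "vsp V"
 shows "lin V W g"
 using linD[OF assms(1)] assms(2) vs_closed[OF assms(3)] by (intro linI) (metis, metis, metis)

lemma lin_zero:
 assumes f: "lin V W f" and V: "vsp V" and W: "vsp W"
 shows "f \<zero>\<^bsub>V\<^esub> = \<zero>\<^bsub>W\<^esub>"
 using linD(3)[OF f zero_closed vs_closed(1)[OF V]] linD(1)[OF f vs_closed(1)[OF V]]
  vs_simps(3)[OF V vs_closed(1)[OF V]] vs_simps(3)[OF W] by simp

lemma lin_diff:
 assumes f: "lin V W f" and V: "vsp V" and W: "vsp W" and "v \<in> carrier V" "w \<in> carrier V"
 shows "f (v \<ominus>\<^bsub>V\<^esub> w) = f v \<ominus>\<^bsub>W\<^esub> f w"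
 using assms(4,5) by (simp add: vs_minus_eq[OF V] vs_minus_eq[OF W] linD[OF f] vs_closed[OF V])

lemma lin_comp: "lin U V g ==> lin V W f ==> lin U W (\<lambda>u. f (g u))"
 by (rule linI) (auto simp: linD)

lemma lin_id: "lin V V (\<lambda>v. v)"
 by (rule linI) auto

lemma lin_add:
 assumes "lin V W f" "lin V W g" "vsp W"
 shows "lin V W (\<lambda>v. f v \<oplus>\<^bsub>W\<^esub> g v)"
 by (rule linI)
  (simp_all add: linD[OF assms(1)] linD[OF assms(2)] vs_closed[OF assms(3)] vs_ac[OF assms(3)]
   vs_distr[OF assms(3)])

lemma lin_smult:
 assumes "lin V W f" "vsp W" "r \<in> carrier K"
 shows "lin V W (\<lambda>v. r \<odot>\<^bsub>W\<^esub> f v)"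
proof (rule linI)
 fix s v assume "s \<in> carrier K" "v \<in> carrier V"
 then show "r \<odot>\<^bsub>W\<^esub> f (s \<odot>\<^bsub>V\<^esub> v) = s \<odot>\<^bsub>W\<^esub> (r \<odot>\<^bsub>W\<^esub> f v)"
  using assms(3) m_comm[of r s] by (simp add: linD[OF assms(1)] vs_distr(1)[OF assms(2), symmetric])
qed (use assms(3) in \<open>simp_all add: linD[OF assms(1)] vs_closed[OF assms(2)] vs_distr[OF assms(2)]\<close>)

lemma lin_zero_map:
 assumes "vsp W" shows "lin V W (\<lambda>v. \<zero>\<^bsub>W\<^esub>)"
 by (rule linI) (simp_all add: vs_closed[OF assms] vs_simps[OF assms])

lemma lin_inverse:
 assumes f: "lin V W f" and b: "bij_betw f (carrier V) (carrier W)" and V: "vsp V"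
  and g: "\<And>v. v \<in> carrier V ==> g (f v) = v"
 shows "lin W V g"
proof -
 have *: "\<exists>v\<in>carrier V. w = f v" if "w \<in> carrier W" for w
  using b that by (auto simp: bij_betw_def)
 show ?thesis
 proof (rule linI)
  fix v assume "v \<in> carrier W" then show "g v \<in> carrier V" using * g by metis
 next
  fix v w assume "v \<in> carrier W" "w \<in> carrier W"
  then obtain v' w' where "v' \<in> carrier V" "w' \<in> carrier V" "v = f v'" "w = f w'" using * by metis
  then show "g (v \<oplus>\<^bsub>W\<^esub> w) = g v \<oplus>\<^bsub>V\<^esub> g w"
   using g vs_closed[OF V] by (simp add: linD(2)[OF f, symmetric])
 next
  fix r v assume "r \<in> carrier K" "v \<in> carrier W"
  moreover then obtain v' where "v' \<in> carrier V" "v = f v'" using * by metis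
  ultimately show "g (r \<odot>\<^bsub>W\<^esub> v) = r \<odot>\<^bsub>V\<^esub> g v"
   using g vs_closed[OF V] by (simp add: linD(3)[OF f, symmetric])
 qed
qed

lemma lin_inj_iff:
 assumes f: "lin V W f" and V: "vsp V" and W: "vsp W"
 shows "inj_on f (carrier V) \<longleftrightarrow> (\<forall>v\<in>carrier V. f v = \<zero>\<^bsub>W\<^esub> --> v = \<zero>\<^bsub>V\<^esub>)"
proof safe
 fix v assume "inj_on f (carrier V)" "v \<in> carrier V" "f v = \<zero>\<^bsub>W\<^esub>"
 then show "v = \<zero>\<^bsub>V\<^esub>"
  using lin_zero[OF f V W] vs_closed(1)[OF V] by (metis inj_onD)
next
 assume *: "\<forall>v\<in>carrier V. f v = \<zero>\<^bsub>W\<^esub> --> v = \<zero>\<^bsub>V\<^esub>"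
 show "inj_on f (carrier V)"
 proof (rule inj_onI)
  fix v w assume vw: "v \<in> carrier V" "w \<in> carrier V" "f v = f w"
  then have "f (v \<ominus>\<^bsub>V\<^esub> w) = \<zero>\<^bsub>W\<^esub>"
   using linD(1)[OF f] by (simp add: lin_diff[OF f V W] vs_diff(1)[OF W])
  then show "v = w" using * vw vs_closed(3)[OF V] vs_diff(1)[OF V] by metis
 qed
qed

text \<open>The axioms are equations and closure conditions, so they pass to the image under a map
  that respects the operations. Since \<open>p\<close> only has to be onto, the lemma serves
  quotients as well as copies along injections.\<close>

lemma vs_transport:
 assumes V: "vsp V" and c: "carrier W = p ` carrier V" and z: "p \<zero>\<^bsub>V\<^esub> = \<zero>\<^bsub>W\<^esub>"
  and a: "\<And>v w. v \<in> carrier V ==> w \<in> carrier V ==> p (v \<oplus>\<^bsub>V\<^esub> w) = p v \<oplus>\<^bsub>W\<^esub> p w"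
  and s: "\<And>r v. r \<in> carrier K ==> v \<in> carrier V ==> p (r \<odot>\<^bsub>V\<^esub> v) = r \<odot>\<^bsub>W\<^esub> p v"
 shows "vsp W" "lin V W p"
proof -
 note S = vs_closed[OF V] vs_simps[OF V] vs_ac[OF V] vs_distr[OF V]
 show "lin V W p" by (rule linI) (simp_all add: c a s)
 show "vsp W"
  by (rule vspI) (auto simp: c z[symmetric] a[symmetric] s[symmetric] S)
qed

text \<open>The notion of \<open>submodule\<close> in bare closure form; the translation is made in
  \<open>rel_subsp\<close> and \<open>rel_vanish\<close>, where spans enter.\<close>

definition subsp :: "('k, 'v) module => 'v set => bool" where
 "subsp V N \<longleftrightarrow> N \<subseteq> carrier V \<and> \<zero>\<^bsub>V\<^esub> \<in> N \<and> (\<forall>v\<in>N. \<forall>w\<in>N. v \<oplus>\<^bsub>V\<^esub> w \<in> N) \<and>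
   (\<forall>r\<in>carrier K. \<forall>v\<in>N. r \<odot>\<^bsub>V\<^esub> v \<in> N)"

lemma subspD:
 assumes "subsp V N"
 shows "v \<in> N ==> v \<in> carrier V" "\<zero>\<^bsub>V\<^esub> \<in> N" "v \<in> N ==> w \<in> N ==> v \<oplus>\<^bsub>V\<^esub> w \<in> N"
  "r \<in> carrier K ==> v \<in> N ==> r \<odot>\<^bsub>V\<^esub> v \<in> N"
 using assms by (auto simp: subsp_def)

lemma subsp_diff: "vsp V ==> subsp V N ==> v \<in> N ==> w \<in> N ==> v \<ominus>\<^bsub>V\<^esub> w \<in> N"
 using subspD[of V N] by (auto simp: vs_minus_eq)

lemma subsp_ker:
 assumes f: "lin V W f" and V: "vsp V" and W: "vsp W"
 shows "subsp V {v \<in> carrier V. f v = \<zero>\<^bsub>W\<^esub>}"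
 by (auto simp: subsp_def linD[OF f] vs_closed[OF V] vs_simps[OF W] vs_closed[OF W] lin_zero[OF f V W])

lemma subsp_image:
 assumes f: "lin V W f" and V: "vsp V" and W: "vsp W"
 shows "subsp W (f ` carrier V)"
 unfolding subsp_def
proof (intro conjI ballI)
 show "\<zero>\<^bsub>W\<^esub> \<in> f ` carrier V" using lin_zero[OF f V W] vs_closed(1)[OF V] by (metis imageI)
qed (auto simp: linD(2,3)[OF f, symmetric] linD(1)[OF f] intro!: imageI vs_closed[OF V])

lemma vsp_sub:
 assumes V: "vsp V" and N: "subsp V N"
 shows "vsp (V\<lparr>carrier := N\<rparr>)"
 using subspD[OF N] by (intro vspI) (auto simp: vs_closed[OF V] vs_simps[OF V] vs_ac[OF V] vs_distr[OF V])

subsection \<open>Quotients\<close>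

context
 fixes V :: "('k, 'v) module" and N
 assumes V: "vsp V" and N: "subsp V N"
begin

interpretation V: vectorspace K V by (rule V)

lemma coset_mem: "v \<in> carrier V ==> w \<in> N +>\<^bsub>V\<^esub> v \<longleftrightarrow> w \<in> carrier V \<and> w \<ominus>\<^bsub>V\<^esub> v \<in> N"
proof safe
 assume v: "v \<in> carrier V" and "w \<in> N +>\<^bsub>V\<^esub> v"
 then obtain n where n: "n \<in> N" "w = n \<oplus>\<^bsub>V\<^esub> v" by (auto simp: a_r_coset_def')
 then show "w \<in> carrier V" "w \<ominus>\<^bsub>V\<^esub> v \<in> N"
  using subspD[OF N] v by (auto simp: vs_closed[OF V] vs_diff[OF V])
next
 assume v: "v \<in> carrier V" and w: "w \<in> carrier V" "w \<ominus>\<^bsub>V\<^esub> v \<in> N"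
 then have "w = (w \<ominus>\<^bsub>V\<^esub> v) \<oplus>\<^bsub>V\<^esub> v" by (simp add: vs_diff[OF V])
 then show "w \<in> N +>\<^bsub>V\<^esub> v" using w(2) by (auto simp: a_r_coset_def')
qed

lemma coset_self: "v \<in> carrier V ==> v \<in> N +>\<^bsub>V\<^esub> v"
 using subspD(2)[OF N] by (simp add: coset_mem vs_diff_zero[OF V])

lemma coset_eq:
 assumes v: "v \<in> carrier V" and w: "w \<in> carrier V"
 shows "N +>\<^bsub>V\<^esub> v = N +>\<^bsub>V\<^esub> w \<longleftrightarrow> v \<ominus>\<^bsub>V\<^esub> w \<in> N"
proof
 assume "N +>\<^bsub>V\<^esub> v = N +>\<^bsub>V\<^esub> w"
 then show "v \<ominus>\<^bsub>V\<^esub> w \<in> N" using coset_self[OF v] coset_mem[OF w] by auto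
next
 have *: "N +>\<^bsub>V\<^esub> x \<subseteq> N +>\<^bsub>V\<^esub> y" if x: "x \<in> carrier V" and y: "y \<in> carrier V" and d: "x \<ominus>\<^bsub>V\<^esub> y \<in> N" for x y
 proof
  fix u assume u: "u \<in> N +>\<^bsub>V\<^esub> x"
  then have u': "u \<in> carrier V" "u \<ominus>\<^bsub>V\<^esub> x \<in> N" using coset_mem[OF x] by auto
  have "(u \<ominus>\<^bsub>V\<^esub> x) \<oplus>\<^bsub>V\<^esub> (x \<ominus>\<^bsub>V\<^esub> y) = u \<ominus>\<^bsub>V\<^esub> y"
   using u' x y by (simp add: a_minus_def V.a_assoc) (simp add: V.a_assoc[symmetric] V.l_neg)
  then show "u \<in> N +>\<^bsub>V\<^esub> y" using subspD(3)[OF N u'(2) d] u'(1) by (simp add: coset_mem[OF y])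
 qed
 assume d: "v \<ominus>\<^bsub>V\<^esub> w \<in> N"
 have "w \<ominus>\<^bsub>V\<^esub> v = \<zero>\<^bsub>V\<^esub> \<ominus>\<^bsub>V\<^esub> (v \<ominus>\<^bsub>V\<^esub> w)"
  using v w by (simp add: a_minus_def V.minus_add V.a_ac)
 then have d': "w \<ominus>\<^bsub>V\<^esub> v \<in> N" using subsp_diff[OF V N subspD(2)[OF N] d] by simp
 show "N +>\<^bsub>V\<^esub> v = N +>\<^bsub>V\<^esub> w" using *[OF v w d] *[OF w v d'] by simp
qed

lemma coset_zero: "N +>\<^bsub>V\<^esub> \<zero>\<^bsub>V\<^esub> = N"
 using coset_mem[of "\<zero>\<^bsub>V\<^esub>"] subspD[OF N] by (auto simp: vs_diff_zero[OF V])

lemma coset_eq_zero: "v \<in> carrier V ==> N +>\<^bsub>V\<^esub> v = N \<longleftrightarrow> v \<in> N"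
 using coset_eq[of v "\<zero>\<^bsub>V\<^esub>"] coset_zero by (simp add: vs_diff_zero[OF V])

text \<open>Scalar multiplication in a quotient, the action on a quotient module and
  \<open>tensor_map\<close> are all unions over representatives. A linear map that carries
  \<open>N\<close> into \<open>N'\<close> sends all representatives of a coset into one coset, so
  each of these unions collapses to a single coset.\<close>

lemma Union_coset:
 assumes V': "vsp V'" and N': "subsp V' N'" and f: "lin V V' f"
  and fN: "\<And>n. n \<in> N ==> f n \<in> N'" and v: "v \<in> carrier V"
 shows "(\<Union>u\<in>N +>\<^bsub>V\<^esub> v. N' +>\<^bsub>V'\<^esub> f u) = N' +>\<^bsub>V'\<^esub> f v"
proof -
 interpret W: vectorspace K V' by (rule V')
 have "N' +>\<^bsub>V'\<^esub> f u = N' +>\<^bsub>V'\<^esub> f v" if "u \<in> N +>\<^bsub>V\<^esub> v" for u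
 proof -
  have u: "u \<in> carrier V" "u \<ominus>\<^bsub>V\<^esub> v \<in> N" using that coset_mem[OF v] by auto
  have "f u \<ominus>\<^bsub>V'\<^esub> f v \<in> N'" using fN[OF u(2)] lin_diff[OF f V V' u(1) v] by simp
  moreover have fc: "f u \<in> carrier V'" "f v \<in> carrier V'" using linD(1)[OF f] u v by auto
  have *: "N' +>\<^bsub>V'\<^esub> x \<subseteq> N' +>\<^bsub>V'\<^esub> y" if x: "x \<in> carrier V'" and y: "y \<in> carrier V'" and d: "x \<ominus>\<^bsub>V'\<^esub> y \<in> N'" for x y
  proof
   fix z assume "z \<in> N' +>\<^bsub>V'\<^esub> x"
   then obtain n where n: "n \<in> N'" "z = n \<oplus>\<^bsub>V'\<^esub> x" by (auto simp: a_r_coset_def')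
   have "z = (n \<oplus>\<^bsub>V'\<^esub> (x \<ominus>\<^bsub>V'\<^esub> y)) \<oplus>\<^bsub>V'\<^esub> y"
    using n x y subspD(1)[OF N'] by (simp add: W.a_assoc vs_diff[OF V'])
   then show "z \<in> N' +>\<^bsub>V'\<^esub> y" using subspD(3)[OF N' n(1) d] by (auto simp: a_r_coset_def')
  qed
  have "f v \<ominus>\<^bsub>V'\<^esub> f u = \<zero>\<^bsub>V'\<^esub> \<ominus>\<^bsub>V'\<^esub> (f u \<ominus>\<^bsub>V'\<^esub> f v)"
   using fc by (simp add: a_minus_def W.minus_add W.a_ac)
  then have "f v \<ominus>\<^bsub>V'\<^esub> f u \<in> N'"
   using subsp_diff[OF V' N' subspD(2)[OF N'] \<open>f u \<ominus>\<^bsub>V'\<^esub> f v \<in> N'\<close>] by simp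
  with \<open>f u \<ominus>\<^bsub>V'\<^esub> f v \<in> N'\<close> show ?thesis using * fc by blast
 qed
 moreover have "v \<in> N +>\<^bsub>V\<^esub> v" by (rule coset_self[OF v])
 ultimately show ?thesis by blast
qed

lemma quot_sel:
 "carrier (quot_space V N) = (\<lambda>v. N +>\<^bsub>V\<^esub> v) ` carrier V" "\<zero>\<^bsub>quot_space V N\<^esub> = N"
 by (auto simp: quot_space_def A_RCOSETS_def')

lemma quot_vsp: "vsp (quot_space V N)" and quot_lin: "lin V (quot_space V N) (\<lambda>v. N +>\<^bsub>V\<^esub> v)"
proof -
 have ag: "abelian_subgroup N V"
  using subspD[OF N] subsp_diff[OF V N subspD(2)[OF N]]
  by (intro abelian_subgroupI3 additive_subgroupI subgroup.intro)
   (auto simp: V.abelian_group_axioms a_inv_def[symmetric] a_minus_def)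
 have a: "N +>\<^bsub>V\<^esub> (v \<oplus>\<^bsub>V\<^esub> w) = (N +>\<^bsub>V\<^esub> v) \<oplus>\<^bsub>quot_space V N\<^esub> (N +>\<^bsub>V\<^esub> w)"
  if "v \<in> carrier V" "w \<in> carrier V" for v w
  using abelian_subgroup.a_rcos_sum[OF ag that] by (simp add: quot_space_def)
 have s: "N +>\<^bsub>V\<^esub> (r \<odot>\<^bsub>V\<^esub> v) = r \<odot>\<^bsub>quot_space V N\<^esub> (N +>\<^bsub>V\<^esub> v)"
  if r: "r \<in> carrier K" and v: "v \<in> carrier V" for r v
  using Union_coset[OF V N lin_smult[OF lin_id V r], of v] v r subspD[OF N] by (simp add: quot_space_def)
 show "vsp (quot_space V N)" "lin V (quot_space V N) (\<lambda>v. N +>\<^bsub>V\<^esub> v)"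
  using vs_transport[OF V, of "quot_space V N" "\<lambda>v. N +>\<^bsub>V\<^esub> v"] a s by (auto simp: quot_sel coset_zero)
qed

lemma quot_lift:
 assumes W: "vsp W" and f: "lin V W f" and fN: "\<And>n. n \<in> N ==> f n = \<zero>\<^bsub>W\<^esub>"
 shows "\<exists>g. lin (quot_space V N) W g \<and> (\<forall>v\<in>carrier V. g (N +>\<^bsub>V\<^esub> v) = f v)"
proof -
 \<comment> \<open>An arbitrary representative is evaluated; the vanishing of \<open>f\<close> on
   \<open>N\<close> makes the choice irrelevant.\<close>
 define g where "g = (\<lambda>T. f (SOME v. v \<in> T))"
 have g: "g (N +>\<^bsub>V\<^esub> v) = f v" if v: "v \<in> carrier V" for v
 proof -
  have "(SOME u. u \<in> N +>\<^bsub>V\<^esub> v) \<in> N +>\<^bsub>V\<^esub> v" using coset_self[OF v] by (rule someI)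
  then have *: "(SOME u. u \<in> N +>\<^bsub>V\<^esub> v) \<in> carrier V" "(SOME u. u \<in> N +>\<^bsub>V\<^esub> v) \<ominus>\<^bsub>V\<^esub> v \<in> N"
   using coset_mem[OF v] by auto
  show ?thesis
   using fN[OF *(2)] lin_diff[OF f V W *(1) v] vs_diff(1)[OF W linD(1)[OF f *(1)] linD(1)[OF f v]]
   by (simp add: g_def)
 qed
 have "lin (quot_space V N) W g"
 proof (rule linI)
  fix r T assume r: "r \<in> carrier K" and "T \<in> carrier (quot_space V N)"
  then obtain v where "v \<in> carrier V" "T = N +>\<^bsub>V\<^esub> v" by (auto simp: quot_sel)
  then show "g (r \<odot>\<^bsub>quot_space V N\<^esub> T) = r \<odot>\<^bsub>W\<^esub> g T"
   using r vs_closed[OF V] by (simp add: g linD(3)[OF quot_lin, symmetric] linD(3)[OF f])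
 next
  fix T T' assume "T \<in> carrier (quot_space V N)" "T' \<in> carrier (quot_space V N)"
  then obtain v v' where "v \<in> carrier V" "T = N +>\<^bsub>V\<^esub> v" "v' \<in> carrier V" "T' = N +>\<^bsub>V\<^esub> v'"
   by (auto simp: quot_sel)
  then show "g (T \<oplus>\<^bsub>quot_space V N\<^esub> T') = g T \<oplus>\<^bsub>W\<^esub> g T'"
   using vs_closed[OF V] by (simp add: g linD(2)[OF quot_lin, symmetric] linD(2)[OF f])
 qed (auto simp: quot_sel g linD(1)[OF f])
 with g show ?thesis by blast
qed

end

end

section \<open>Modules and natural transformations\<close>

text \<open>Normal form of a transformation: the arrows of \<open>Mod_cat\<close> are the natural
  families fixed by \<open>ex C X\<close>, and two normal forms agree iff the families agree on
  elements. Calculations use arbitrary families and normalize at the end.\<close>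

definition ex :: "('k, 'o, 'm) lincat => ('k, 'o, 'm, 'v) cmod => ('o => 'v => 'w) => 'o => 'v => 'w" where
 "ex C X \<eta> = (\<lambda>c\<in>Obj C. \<lambda>v\<in>El X c. \<eta> c v)"

lemma ex_apply [simp]: "c \<in> Obj C ==> v \<in> El X c ==> ex C X \<eta> c v = \<eta> c v"
 by (simp add: ex_def)

lemma ex_eq_iff: "ex C X \<eta> = ex C X \<theta> \<longleftrightarrow> (\<forall>c\<in>Obj C. \<forall>v\<in>El X c. \<eta> c v = \<theta> c v)"
 by (auto simp: ex_def restrict_def fun_eq_iff)

lemma ex_ex [simp]: "ex C X (ex C X \<eta>) = ex C X \<eta>"
 by (simp add: ex_eq_iff)

context base_field
begin

abbreviation lcat :: "('k, 'o, 'm) lincat => bool" where "lcat C \<equiv> linear_category K C"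
abbreviation cmd :: "('k, 'o, 'm) lincat => ('k, 'o, 'm, 'v) cmod => bool" where "cmd C X \<equiv> cmodule K C X"

lemma lin_finsum:
 assumes f: "lin V W f" and V: "vsp V" and W: "vsp W" and "finite I" and "\<And>i. i \<in> I ==> g i \<in> carrier V"
 shows "f (\<Oplus>\<^bsub>V\<^esub>i\<in>I. g i) = (\<Oplus>\<^bsub>W\<^esub>i\<in>I. f (g i))"
 using assms(4,5)
proof (induction I)
 case empty
 interpret V: vectorspace K V by (rule V)
 interpret W: vectorspace K W by (rule W)
 show ?case by (simp add: lin_zero[OF f V W])
next
 case (insert i I)
 interpret V: vectorspace K V by (rule V)
 interpret W: vectorspace K W by (rule W)
 from insert show ?case
  by (simp add: V.finsum_insert W.finsum_insert linD[OF f] Pi_def V.finsum_closed)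
qed

context
 fixes C :: "('k, 'o, 'm) lincat"
 assumes C: "lcat C"
begin

interpretation C: linear_category K C by (rule C)

lemma catD:
 "x \<in> Obj C ==> y \<in> Obj C ==> vsp (Hom C x y)"
 "x \<in> Obj C ==> Idt C x \<in> Arr C x x"
 "x \<in> Obj C ==> y \<in> Obj C ==> z \<in> Obj C ==> f \<in> Arr C x y ==> g \<in> Arr C y z ==> Cmp C x y z g f \<in> Arr C x z"
 "x \<in> Obj C ==> y \<in> Obj C ==> f \<in> Arr C x y ==> Cmp C x y y (Idt C y) f = f"
 "x \<in> Obj C ==> y \<in> Obj C ==> f \<in> Arr C x y ==> Cmp C x x y f (Idt C x) = f"
 by (simp_all add: C.hom_vectorspace C.idt_closed C.cmp_idt_left C.cmp_idt_right
   linD(1)[OF C.cmp_linear_left])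

lemma cmp_lin:
 "x \<in> Obj C ==> y \<in> Obj C ==> z \<in> Obj C ==> f \<in> Arr C x y ==>
  lin (Hom C y z) (Hom C x z) (\<lambda>g. Cmp C x y z g f)"
 "x \<in> Obj C ==> y \<in> Obj C ==> z \<in> Obj C ==> g \<in> Arr C y z ==>
  lin (Hom C x y) (Hom C x z) (\<lambda>f. Cmp C x y z g f)"
 by (simp_all add: C.cmp_linear_left C.cmp_linear_right)

lemma cmp_zero:
 "x \<in> Obj C ==> y \<in> Obj C ==> z \<in> Obj C ==> f \<in> Arr C x y ==>
  Cmp C x y z \<zero>\<^bsub>Hom C y z\<^esub> f = \<zero>\<^bsub>Hom C x z\<^esub>"
 "x \<in> Obj C ==> y \<in> Obj C ==> z \<in> Obj C ==> g \<in> Arr C y z ==>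
  Cmp C x y z g \<zero>\<^bsub>Hom C x y\<^esub> = \<zero>\<^bsub>Hom C x z\<^esub>"
 by (auto intro: lin_zero[OF cmp_lin(1)] lin_zero[OF cmp_lin(2)] catD)

lemma cmp_add:
 "x \<in> Obj C ==> y \<in> Obj C ==> z \<in> Obj C ==> f \<in> Arr C x y ==> g \<in> Arr C y z ==> g' \<in> Arr C y z ==>
  Cmp C x y z (g \<oplus>\<^bsub>Hom C y z\<^esub> g') f = Cmp C x y z g f \<oplus>\<^bsub>Hom C x z\<^esub> Cmp C x y z g' f"
 "x \<in> Obj C ==> y \<in> Obj C ==> z \<in> Obj C ==> f \<in> Arr C x y ==> f' \<in> Arr C x y ==> g \<in> Arr C y z ==>
  Cmp C x y z g (f \<oplus>\<^bsub>Hom C x y\<^esub> f') = Cmp C x y z g f \<oplus>\<^bsub>Hom C x z\<^esub> Cmp C x y z g f'"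
 "r \<in> carrier K ==> x \<in> Obj C ==> y \<in> Obj C ==> z \<in> Obj C ==> f \<in> Arr C x y ==> g \<in> Arr C y z ==>
  Cmp C x y z (r \<odot>\<^bsub>Hom C y z\<^esub> g) f = r \<odot>\<^bsub>Hom C x z\<^esub> Cmp C x y z g f"
 "r \<in> carrier K ==> x \<in> Obj C ==> y \<in> Obj C ==> z \<in> Obj C ==> f \<in> Arr C x y ==> g \<in> Arr C y z ==>
  Cmp C x y z g (r \<odot>\<^bsub>Hom C x y\<^esub> f) = r \<odot>\<^bsub>Hom C x z\<^esub> Cmp C x y z g f"
 using linD[OF cmp_lin(1)] linD[OF cmp_lin(2)] by auto

lemma cmp_assoc':
 "w \<in> Obj C ==> x \<in> Obj C ==> y \<in> Obj C ==> z \<in> Obj C ==>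
  f \<in> Arr C w x ==> g \<in> Arr C x y ==> h \<in> Arr C y z ==>
  Cmp C w x z (Cmp C x y z h g) f = Cmp C w y z h (Cmp C w x y g f)"
 by (simp add: C.cmp_assoc)

lemma full_sub_lcat:
 assumes "S \<subseteq> Obj C" shows "lcat (full_sub C S)"
proof -
 have s: "x \<in> S ==> x \<in> Obj C" for x using assms by blast
 show ?thesis
  by (intro linear_category.intro linear_category_axioms.intro field_axioms)
   (simp_all add: full_sub_def s C.hom_vectorspace C.idt_closed C.cmp_linear_left C.cmp_linear_right
    C.cmp_idt_left C.cmp_idt_right C.cmp_assoc)
qed

lemma op_lcat: "lcat (op_cat C)"
 by (intro linear_category.intro linear_category_axioms.intro field_axioms)
  (auto simp: op_cat_def C.hom_vectorspace C.idt_closed C.cmp_linear_left C.cmp_linear_right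
   C.cmp_idt_left C.cmp_idt_right intro!: C.cmp_assoc[symmetric])

end

lemma cmdI:
 assumes "\<And>c. c \<in> Obj C ==> vsp (Val X c)"
  and "\<And>c v. c \<in> Obj C ==> v \<in> El X c ==> Act X c c (Idt C c) v = v"
  and "\<And>x y f. x \<in> Obj C ==> y \<in> Obj C ==> f \<in> Arr C x y ==> lin (Val X y) (Val X x) (Act X x y f)"
  and "\<And>x y v. x \<in> Obj C ==> y \<in> Obj C ==> v \<in> El X y ==>
   lin (Hom C x y) (Val X x) (\<lambda>f. Act X x y f v)"
  and "\<And>x y z f g v. x \<in> Obj C ==> y \<in> Obj C ==> z \<in> Obj C ==> f \<in> Arr C x y ==> g \<in> Arr C y z ==>
   v \<in> El X z ==> Act X x z (Cmp C x y z g f) v = Act X x y f (Act X y z g v)"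
 shows "cmd C X"
 using assms by (simp add: cmodule_def)

lemma cmdD:
 assumes "cmd C X"
 shows "c \<in> Obj C ==> vsp (Val X c)"
  and "c \<in> Obj C ==> v \<in> El X c ==> Act X c c (Idt C c) v = v"
  and "x \<in> Obj C ==> y \<in> Obj C ==> z \<in> Obj C ==> f \<in> Arr C x y ==> g \<in> Arr C y z ==>
   v \<in> El X z ==> Act X x z (Cmp C x y z g f) v = Act X x y f (Act X y z g v)"
  and "x \<in> Obj C ==> y \<in> Obj C ==> f \<in> Arr C x y ==> v \<in> El X y ==> Act X x y f v \<in> El X x"
 using assms by (simp_all add: cmodule_def linD(1)[where f = "Act X x y f" and V = "Val X y"])

lemma act_lin:
 assumes "cmd C X"
 shows "x \<in> Obj C ==> y \<in> Obj C ==> f \<in> Arr C x y ==> lin (Val X y) (Val X x) (Act X x y f)"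
  and "x \<in> Obj C ==> y \<in> Obj C ==> v \<in> El X y ==> lin (Hom C x y) (Val X x) (\<lambda>f. Act X x y f v)"
 using assms by (auto simp: cmodule_def)

lemma act_add:
 assumes "cmd C X"
 shows "x \<in> Obj C ==> y \<in> Obj C ==> f \<in> Arr C x y ==> v \<in> El X y ==> w \<in> El X y ==>
   Act X x y f (v \<oplus>\<^bsub>Val X y\<^esub> w) = Act X x y f v \<oplus>\<^bsub>Val X x\<^esub> Act X x y f w"
  and "x \<in> Obj C ==> y \<in> Obj C ==> f \<in> Arr C x y ==> r \<in> carrier K ==> v \<in> El X y ==>
   Act X x y f (r \<odot>\<^bsub>Val X y\<^esub> v) = r \<odot>\<^bsub>Val X x\<^esub> Act X x y f v"
  and "x \<in> Obj C ==> y \<in> Obj C ==> f \<in> Arr C x y ==> g \<in> Arr C x y ==> v \<in> El X y ==>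
   Act X x y (f \<oplus>\<^bsub>Hom C x y\<^esub> g) v = Act X x y f v \<oplus>\<^bsub>Val X x\<^esub> Act X x y g v"
  and "x \<in> Obj C ==> y \<in> Obj C ==> f \<in> Arr C x y ==> r \<in> carrier K ==> v \<in> El X y ==>
   Act X x y (r \<odot>\<^bsub>Hom C x y\<^esub> f) v = r \<odot>\<^bsub>Val X x\<^esub> Act X x y f v"
  and "x \<in> Obj C ==> y \<in> Obj C ==> f \<in> Arr C x y ==> Act X x y f (zr X y) = zr X x"
 using linD[OF act_lin(1)[OF assms]] linD[OF act_lin(2)[OF assms]]
 by (auto intro: lin_zero[OF act_lin(1)[OF assms]] cmdD(1)[OF assms])

text \<open>Membership in \<open>nat_hom\<close> without extensionality, so that composites written
  as plain functions qualify. Source and target may have different value types.\<close>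

definition nt :: "('k, 'o, 'm) lincat => ('k, 'o, 'm, 'v) cmod => ('k, 'o, 'm, 'w) cmod =>
  ('o => 'v => 'w) => bool" where
 "nt C X Y \<eta> \<longleftrightarrow> (\<forall>c\<in>Obj C. lin (Val X c) (Val Y c) (\<eta> c)) \<and>
   (\<forall>x\<in>Obj C. \<forall>y\<in>Obj C. \<forall>f\<in>Arr C x y. \<forall>v\<in>El X y.
    \<eta> x (Act X x y f v) = Act Y x y f (\<eta> y v))"

lemma ntI:
 assumes "\<And>c. c \<in> Obj C ==> lin (Val X c) (Val Y c) (\<eta> c)"
  and "\<And>x y f v. x \<in> Obj C ==> y \<in> Obj C ==> f \<in> Arr C x y ==> v \<in> El X y ==>
    \<eta> x (Act X x y f v) = Act Y x y f (\<eta> y v)"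
 shows "nt C X Y \<eta>"
 using assms by (simp add: nt_def)

lemma ntD:
 assumes "nt C X Y \<eta>"
 shows "c \<in> Obj C ==> lin (Val X c) (Val Y c) (\<eta> c)"
  and "x \<in> Obj C ==> y \<in> Obj C ==> f \<in> Arr C x y ==> v \<in> El X y ==>
    \<eta> x (Act X x y f v) = Act Y x y f (\<eta> y v)"
  and "c \<in> Obj C ==> v \<in> El X c ==> \<eta> c v \<in> El Y c"
  and "c \<in> Obj C ==> v \<in> El X c ==> w \<in> El X c ==>
   \<eta> c (v \<oplus>\<^bsub>Val X c\<^esub> w) = \<eta> c v \<oplus>\<^bsub>Val Y c\<^esub> \<eta> c w"
  and "c \<in> Obj C ==> r \<in> carrier K ==> v \<in> El X c ==>
   \<eta> c (r \<odot>\<^bsub>Val X c\<^esub> v) = r \<odot>\<^bsub>Val Y c\<^esub> \<eta> c v"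
 using assms by (auto simp: nt_def linD)

lemma nt_zero_app: "nt C X Y \<eta> ==> cmd C X ==> cmd C Y ==> c \<in> Obj C ==> \<eta> c (zr X c) = zr Y c"
 by (rule lin_zero[OF ntD(1) cmdD(1) cmdD(1)])

lemma nt_diff_app:
 "nt C X Y \<eta> ==> cmd C X ==> cmd C Y ==> c \<in> Obj C ==> v \<in> El X c ==> w \<in> El X c ==>
  \<eta> c (v \<ominus>\<^bsub>Val X c\<^esub> w) = \<eta> c v \<ominus>\<^bsub>Val Y c\<^esub> \<eta> c w"
 by (rule lin_diff[OF ntD(1) cmdD(1) cmdD(1)])

lemma nt_cong:
 assumes "nt C X Y \<eta>" "cmd C X" "\<And>c v. c \<in> Obj C ==> v \<in> El X c ==> \<eta> c v = \<theta> c v"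
 shows "nt C X Y \<theta>"
 by (rule ntI)
  (auto intro: lin_cong[OF ntD(1)[OF assms(1)]] simp: assms(3)[symmetric] cmdD[OF assms(2)] ntD[OF assms(1)])

lemma nt_ex: "nt C X Y \<eta> ==> cmd C X ==> nt C X Y (ex C X \<eta>)"
 by (erule nt_cong) auto

lemma nt_id: "nt C X X (\<lambda>c v. v)"
 by (rule ntI) (auto intro: lin_id)

lemma nt_comp:
 assumes "nt C X Y \<eta>" "nt C Y Z \<theta>" shows "nt C X Z (\<lambda>c v. \<theta> c (\<eta> c v))"
 by (rule ntI) (auto intro: lin_comp[OF ntD(1)[OF assms(1)] ntD(1)[OF assms(2)]]
   simp: ntD[OF assms(1)] ntD[OF assms(2)])

lemma nt_zero: "cmd C Y ==> nt C X Y (\<lambda>c v. (zr Y c))"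
 by (rule ntI) (auto intro: lin_zero_map dest: cmdD(1) simp: act_add)

lemma nt_add:
 assumes "nt C X Y \<eta>" "nt C X Y \<theta>" "cmd C Y" shows "nt C X Y (\<lambda>c v. \<eta> c v \<oplus>\<^bsub>Val Y c\<^esub> \<theta> c v)"
 by (rule ntI) (auto intro!: lin_add ntD(1)[OF assms(1)] ntD(1)[OF assms(2)] cmdD(1)[OF assms(3)]
   simp: ntD[OF assms(1)] ntD[OF assms(2)] act_add[OF assms(3)])

lemma nt_smult:
 assumes "nt C X Y \<eta>" "r \<in> carrier K" "cmd C Y" shows "nt C X Y (\<lambda>c v. r \<odot>\<^bsub>Val Y c\<^esub> \<eta> c v)"
 by (rule ntI) (auto intro!: lin_smult ntD(1)[OF assms(1)] assms(2) cmdD(1)[OF assms(3)]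
   simp: ntD[OF assms(1)] assms(2) act_add[OF assms(3)])

lemma nat_hom_sel:
 "\<zero>\<^bsub>nat_hom K C X Y\<^esub> = ex C X (\<lambda>c v. (zr Y c))"
 "\<eta> \<oplus>\<^bsub>nat_hom K C X Y\<^esub> \<theta> = ex C X (\<lambda>c v. \<eta> c v \<oplus>\<^bsub>Val Y c\<^esub> \<theta> c v)"
 "r \<odot>\<^bsub>nat_hom K C X Y\<^esub> \<eta> = ex C X (\<lambda>c v. r \<odot>\<^bsub>Val Y c\<^esub> \<eta> c v)"
 by (simp_all add: nat_hom_def ex_def)

lemma nat_hom_iff: "\<eta> \<in> Nats C X Y \<longleftrightarrow> nt C X Y \<eta> \<and> ex C X \<eta> = \<eta>"
 by (auto simp: nat_hom_def nt_def ex_def extensional_def restrict_def fun_eq_iff)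

lemma nat_homD:
 assumes "\<eta> \<in> Nats C X Y"
 shows "nt C X Y \<eta>" "ex C X \<eta> = \<eta>"
 using assms by (simp_all add: nat_hom_iff)

lemma nat_homI: "nt C X Y \<eta> ==> cmd C X ==> ex C X \<eta> \<in> Nats C X Y"
 by (simp add: nat_hom_iff nt_ex)

lemma nat_hom_eqI:
 assumes "\<eta> \<in> Nats C X Y" "\<theta> \<in> Nats C X Z"
  and "\<And>c v. c \<in> Obj C ==> v \<in> El X c ==> \<eta> c v = \<theta> c v"
 shows "\<eta> = \<theta>"
 using assms by (metis nat_homD(2) ex_eq_iff)

lemma nat_hom_vsp:
 assumes X: "cmd C X" and Y: "cmd C Y"
 shows "vsp (nat_hom K C X Y)"
proof -
 note S = vs_closed[OF cmdD(1)[OF Y]] vs_simps[OF cmdD(1)[OF Y]] vs_ac[OF cmdD(1)[OF Y]]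
  vs_distr[OF cmdD(1)[OF Y]]
 note M = nat_homI[OF _ X]
 note A = ntD(3)[OF nat_homD(1)[where C = C and X = X and Y = Y]]
 have eq: "ex C X \<eta> = \<theta>" if "\<theta> \<in> Nats C X Y"
  "\<And>c v. c \<in> Obj C ==> v \<in> El X c ==> \<eta> c v = \<theta> c v" for \<eta> \<theta>
  using that by (metis nat_homD(2) ex_eq_iff)
 show ?thesis
  by (rule vspI; (unfold nat_hom_sel)?)
   (auto simp: ex_eq_iff S A
    intro!: M nt_zero nt_add nt_smult eq Y dest: nat_homD(1))
qed

lemma Mod_cat_sel [simp]:
 "Obj (Mod_cat K C) = {X. cmd C X}" "Hom (Mod_cat K C) = nat_hom K C"
 "Idt (Mod_cat K C) = (\<lambda>X. ex C X (\<lambda>c v. v))"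
 "Cmp (Mod_cat K C) = (\<lambda>X Y Z \<theta> \<eta>. ex C X (\<lambda>c v. \<theta> c (\<eta> c v)))"
 by (simp_all add: Mod_cat_def ex_def)

lemma full_sub_sel [simp]:
 "Obj (full_sub C S) = S" "Hom (full_sub C S) = Hom C" "Idt (full_sub C S) = Idt C" "Cmp (full_sub C S) = Cmp C"
 by (simp_all add: full_sub_def)

lemma op_cat_sel [simp]:
 "Obj (op_cat C) = Obj C" "Hom (op_cat C) = (\<lambda>x y. Hom C y x)" "Idt (op_cat C) = Idt C"
 "Cmp (op_cat C) = (\<lambda>x y z g f. Cmp C z y x f g)"
 by (simp_all add: op_cat_def)

lemma op_op_cat [simp]: "op_cat (op_cat C) = C"
 by (cases C) (simp add: op_cat_def)

lemma op_full_sub: "full_sub (op_cat C) S = op_cat (full_sub C S)"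
 by (cases C) (simp add: op_cat_def full_sub_def)

lemma mod_cat_sel [simp]:
 "Obj (mod_cat K C) = {X. fp C X}" "Hom (mod_cat K C) = nat_hom K C"
 "Idt (mod_cat K C) = (\<lambda>X. ex C X (\<lambda>c v. v))"
 "Cmp (mod_cat K C) = (\<lambda>X Y Z \<theta> \<eta>. ex C X (\<lambda>c v. \<theta> c (\<eta> c v)))"
 by (simp_all add: mod_cat_def)

lemma Mod_cat_lcat: "lcat (Mod_cat K C)"
proof (intro linear_category.intro linear_category_axioms.intro field_axioms, goal_cases)
 case (1 X Y) then show ?case by (simp add: nat_hom_vsp)
next
 case (2 X) then show ?case by (simp add: nat_homI nt_id)
next
 case (3 X Y Z f)
 then have f: "nt C X Y f" and X: "cmd C X" and Z: "cmd C Z" by (auto dest: nat_homD)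
 show ?case
  by (rule linI)
   (auto simp: nat_hom_sel ex_eq_iff ntD(3)[OF f] intro!: nat_homI[OF _ X] nt_comp[OF f] dest: nat_homD(1))
next
 case (4 X Y Z g)
 then have g: "nt C Y Z g" and X: "cmd C X" by (auto dest: nat_homD)
 note A = ntD(3)[OF nat_homD(1)[where C = C and X = X and Y = Y]]
 show ?case
  by (rule linI)
   (auto simp: nat_hom_sel ex_eq_iff ntD[OF g] A intro!: nat_homI[OF _ X] nt_comp[OF _ g] dest: nat_homD(1))
next
 case (5 X Y f)
 then have f: "nt C X Y f" "ex C X f = f" by (auto dest: nat_homD)
 have "ex C X (\<lambda>c v. ex C Y (\<lambda>c v. v) c (f c v)) = ex C X f"
  by (simp add: ex_eq_iff ntD(3)[OF f(1)])
 with f show ?case by simp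
next
 case (6 X Y f)
 then have f: "nt C X Y f" "ex C X f = f" by (auto dest: nat_homD)
 have "ex C X (\<lambda>c v. f c (ex C X (\<lambda>c v. v) c v)) = ex C X f"
  by (simp add: ex_eq_iff)
 with f show ?case by simp
next
 case (7 W X Y Z f g h)
 then have f: "nt C W X f" by (auto dest: nat_homD)
 show ?case by (simp add: ex_eq_iff ntD(3)[OF f])
qed

subsection \<open>Representable modules and finite presentations\<close>

lemma rep_sel [simp]: "Val (rep C c) = (\<lambda>x. Hom C x c)" "Act (rep C c) = (\<lambda>x y f g. Cmp C x y c g f)"
 by (simp_all add: rep_def)

lemma rep_cmd:
 assumes C: "lcat C" and c: "c \<in> Obj C" shows "cmd C (rep C c)"
 by (rule cmdI)
  (auto simp: c catD[OF C] linear_category.cmp_assoc[OF C] intro: cmp_lin[OF C])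

lemma yoneda_nt:
 assumes C: "lcat C" and X: "cmd C X" and c: "c \<in> Obj C" and x: "x \<in> El X c"
 shows "nt C (rep C c) X (\<lambda>a f. Act X a c f x)"
 by (rule ntI) (auto simp: c x cmdD[OF X] act_lin[OF X])

text \<open>Naturality along \<open>f\<close> itself, evaluated at the identity of
  \<open>c\<close>.\<close>

lemma yoneda_eq:
 assumes C: "lcat C" and c: "c \<in> Obj C" and \<beta>: "nt C (rep C c) X \<beta>" and a: "a \<in> Obj C" "f \<in> Arr C a c"
 shows "\<beta> a f = Act X a c f (\<beta> c (Idt C c))"
 using ntD(2)[OF \<beta> a(1) c a(2), of "Idt C c"] by (simp add: catD[OF C] c a)

text \<open>By the Yoneda lemma, an epimorphism onto \<open>X\<close> from the module represented by
  \<open>c\<close>.\<close>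

definition gen :: "('k, 'o, 'm) lincat => ('k, 'o, 'm, 'v) cmod => 'o => 'v => bool" where
 "gen C X c x \<longleftrightarrow> c \<in> Obj C \<and> x \<in> El X c \<and>
   (\<forall>a\<in>Obj C. \<forall>v\<in>El X a. \<exists>f\<in>Arr C a c. v = Act X a c f x)"

text \<open>By the Yoneda lemma a presentation is an arrow \<open>g : c1 \<rightarrow> c0\<close> and an element of \<open>X c0\<close>.\<close>

definition pres :: "('k, 'o, 'm) lincat => ('k, 'o, 'm, 'v) cmod => 'o => 'o => 'm => 'v => bool" where
 "pres C X c1 c0 g x \<longleftrightarrow> c1 \<in> Obj C \<and> g \<in> Arr C c1 c0 \<and> gen C X c0 x \<and>
   (\<forall>a\<in>Obj C. \<forall>f\<in>Arr C a c0.
    Act X a c0 f x = zr X a \<longleftrightarrow> (\<exists>h\<in>Arr C a c1. f = Cmp C a c1 c0 g h))"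

lemma fg_iff:
 assumes C: "lcat C"
 shows "finitely_generated K C X \<longleftrightarrow> cmd C X \<and> (\<exists>c x. gen C X c x)"
proof
 assume "finitely_generated K C X"
 then obtain c \<beta> where X: "cmd C X" and c: "c \<in> Obj C" and \<beta>: "\<beta> \<in> Nats C (rep C c) X"
  and s: "\<forall>a\<in>Obj C. \<beta> a ` Arr C a c = El X a"
  by (auto simp: finitely_generated_def)
 have "gen C X c (\<beta> c (Idt C c))"
  unfolding gen_def
 proof (intro conjI ballI c)
  show "\<beta> c (Idt C c) \<in> El X c" using s c catD(2)[OF C c] by auto
  fix a v assume a: "a \<in> Obj C" "v \<in> El X a"
  then obtain f where "f \<in> Arr C a c" "v = \<beta> a f" using s by blast
  then show "\<exists>f\<in>Arr C a c. v = Act X a c f (\<beta> c (Idt C c))"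
   using yoneda_eq[OF C c nat_homD(1)[OF \<beta>] a(1)] by auto
 qed
 with X show "cmd C X \<and> (\<exists>c x. gen C X c x)" by blast
next
 assume "cmd C X \<and> (\<exists>c x. gen C X c x)"
 then obtain c x where X: "cmd C X" and g: "gen C X c x" by blast
 then have c: "c \<in> Obj C" "x \<in> El X c" by (auto simp: gen_def)
 show "finitely_generated K C X"
  unfolding finitely_generated_def
 proof (intro conjI X bexI[OF _ c(1)] bexI[OF _ nat_homI[OF yoneda_nt[OF C X c] rep_cmd[OF C c(1)]]] ballI)
  fix a assume a: "a \<in> Obj C"
  then show "ex C (rep C c) (\<lambda>a f. Act X a c f x) a ` Arr C a c = El X a"
   using g c by (auto simp: gen_def image_iff cmdD[OF X])
 qed
qed

lemma fp_iff:
 assumes C: "lcat C"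
 shows "fp C X \<longleftrightarrow> cmd C X \<and> (\<exists>c1 c0 g x. pres C X c1 c0 g x)"
proof
 assume "fp C X"
 then obtain c1 c0 \<alpha> \<beta> where X: "cmd C X" and c: "c1 \<in> Obj C" "c0 \<in> Obj C"
  and \<alpha>: "\<alpha> \<in> Nats C (rep C c1) (rep C c0)" and \<beta>: "\<beta> \<in> Nats C (rep C c0) X"
  and s: "\<And>a. a \<in> Obj C ==> \<alpha> a ` Arr C a c1 = {g \<in> Arr C a c0. \<beta> a g = zr X a}"
   "\<And>a. a \<in> Obj C ==> \<beta> a ` Arr C a c0 = El X a"
  by (auto simp: finitely_presented_def)
 have y: "\<beta> a f = Act X a c0 f (\<beta> c0 (Idt C c0))" if "a \<in> Obj C" "f \<in> Arr C a c0" for a f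
  by (rule yoneda_eq[OF C c(2) nat_homD(1)[OF \<beta>] that])
 have y': "\<alpha> a f = Cmp C a c1 c0 (\<alpha> c1 (Idt C c1)) f" if "a \<in> Obj C" "f \<in> Arr C a c1" for a f
  using yoneda_eq[OF C c(1) nat_homD(1)[OF \<alpha>] that] by simp
 have "pres C X c1 c0 (\<alpha> c1 (Idt C c1)) (\<beta> c0 (Idt C c0))"
  unfolding pres_def gen_def
 proof (intro conjI ballI c)
  show "\<beta> c0 (Idt C c0) \<in> El X c0" using ntD(3)[OF nat_homD(1)[OF \<beta>] c(2)] catD(2)[OF C c(2)] by simp
  show "\<alpha> c1 (Idt C c1) \<in> Arr C c1 c0" using ntD(3)[OF nat_homD(1)[OF \<alpha>] c(1)] catD(2)[OF C c(1)] by simp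
  show "\<exists>f\<in>Arr C a c0. v = Act X a c0 f (\<beta> c0 (Idt C c0))" if a: "a \<in> Obj C" "v \<in> El X a" for a v
   using s(2)[OF a(1)] a(2) y[OF a(1)] by (metis imageE)
  show "Act X a c0 f (\<beta> c0 (Idt C c0)) = zr X a \<longleftrightarrow>
    (\<exists>h\<in>Arr C a c1. f = Cmp C a c1 c0 (\<alpha> c1 (Idt C c1)) h)" if a: "a \<in> Obj C" "f \<in> Arr C a c0" for a f
  proof -
   have "Act X a c0 f (\<beta> c0 (Idt C c0)) = zr X a \<longleftrightarrow> f \<in> \<alpha> a ` Arr C a c1"
    using s(1)[OF a(1)] a(2) y[OF a] by auto
   also have "\<dots> \<longleftrightarrow> (\<exists>h\<in>Arr C a c1. f = Cmp C a c1 c0 (\<alpha> c1 (Idt C c1)) h)"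
    using y'[OF a(1)] by (auto simp: image_iff)
   finally show ?thesis .
  qed
 qed
 with X show "cmd C X \<and> (\<exists>c1 c0 g x. pres C X c1 c0 g x)" by blast
next
 assume "cmd C X \<and> (\<exists>c1 c0 g x. pres C X c1 c0 g x)"
 then obtain c1 c0 g x where X: "cmd C X" and p: "pres C X c1 c0 g x" by blast
 then have c: "c1 \<in> Obj C" "c0 \<in> Obj C" "g \<in> Arr C c1 c0" "x \<in> El X c0"
  by (auto simp: gen_def pres_def)
 have g: "nt C (rep C c1) (rep C c0) (\<lambda>a f. Cmp C a c1 c0 g f)"
  using yoneda_nt[OF C rep_cmd[OF C c(2)] c(1), of g] c(3) by simp
 show "fp C X"
  unfolding finitely_presented_def
 proof (rule conjI[OF X], rule bexI[OF _ c(1)], rule bexI[OF _ c(2)], rule bexI[OF _ nat_homI[OF g rep_cmd[OF C c(1)]]],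
   rule bexI[OF _ nat_homI[OF yoneda_nt[OF C X c(2,4)] rep_cmd[OF C c(2)]]], intro ballI conjI)
  fix a assume a: "a \<in> Obj C"
  then show "ex C (rep C c0) (\<lambda>a f. Act X a c0 f x) a ` Arr C a c0 = El X a"
   using p c by (auto simp: gen_def pres_def image_iff cmdD[OF X])
  show "ex C (rep C c1) (\<lambda>a f. Cmp C a c1 c0 g f) a ` Arr C a c1 =
   {h \<in> Arr C a c0. ex C (rep C c0) (\<lambda>a f. Act X a c0 f x) a h = zr X a}"
  proof (intro equalityI subsetI)
   fix h assume "h \<in> ex C (rep C c1) (\<lambda>a f. Cmp C a c1 c0 g f) a ` Arr C a c1"
   then obtain k where k: "k \<in> Arr C a c1" "h = Cmp C a c1 c0 g k" using a by auto
   then have h: "h \<in> Arr C a c0" using catD(3)[OF C a c(1,2) k(1) c(3)] by simp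
   show "h \<in> {h \<in> Arr C a c0. ex C (rep C c0) (\<lambda>a f. Act X a c0 f x) a h = zr X a}"
    using p k a h by (auto simp: pres_def)
  next
   fix h assume "h \<in> {h \<in> Arr C a c0. ex C (rep C c0) (\<lambda>a f. Act X a c0 f x) a h = zr X a}"
   then have "h \<in> Arr C a c0" "Act X a c0 h x = zr X a" using a by auto
   then obtain k where "k \<in> Arr C a c1" "h = Cmp C a c1 c0 g k" using p a by (auto simp: pres_def)
   then show "h \<in> ex C (rep C c1) (\<lambda>a f. Cmp C a c1 c0 g f) a ` Arr C a c1" using a by auto
  qed
 qed
qed

lemma fp_cmd: "fp C X ==> cmd C X"
 by (simp add: finitely_presented_def)

lemma genD:
 assumes "gen C X c x"
 shows "c \<in> Obj C" "x \<in> El X c"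
  "a \<in> Obj C ==> v \<in> El X a ==> \<exists>f\<in>Arr C a c. v = Act X a c f x"
 using assms by (auto simp: gen_def)

lemma presD:
 assumes "pres C X c1 c0 g x"
 shows "c1 \<in> Obj C" "g \<in> Arr C c1 c0" "gen C X c0 x" "c0 \<in> Obj C" "x \<in> El X c0"
  "a \<in> Obj C ==> v \<in> El X a ==> \<exists>f\<in>Arr C a c0. v = Act X a c0 f x"
  "a \<in> Obj C ==> f \<in> Arr C a c0 ==>
    Act X a c0 f x = zr X a \<longleftrightarrow> (\<exists>h\<in>Arr C a c1. f = Cmp C a c1 c0 g h)"
 using assms by (auto simp: pres_def gen_def)

subsection \<open>Isomorphisms and copies\<close>

text \<open>Pointwise bijectivity in place of an inverse arrow, which makes sense for modules whose
  values lie in different types and hence in no common category.\<close>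

definition niso :: "('k, 'o, 'm) lincat => ('k, 'o, 'm, 'v) cmod => ('k, 'o, 'm, 'w) cmod =>
  ('o => 'v => 'w) => bool" where
 "niso C X Y \<eta> \<longleftrightarrow> nt C X Y \<eta> \<and> (\<forall>c\<in>Obj C. bij_betw (\<eta> c) (El X c) (El Y c))"

lemma nisoI:
 assumes "nt C X Y \<eta>" and X: "cmd C X" and Y: "cmd C Y"
  and inj: "\<And>c v. c \<in> Obj C ==> v \<in> El X c ==> \<eta> c v = zr Y c ==> v = zr X c"
  and surj: "\<And>c w. c \<in> Obj C ==> w \<in> El Y c ==> \<exists>v\<in>El X c. \<eta> c v = w"
 shows "niso C X Y \<eta>"
 unfolding niso_def bij_betw_def
proof (intro conjI ballI assms(1))
 fix c assume c: "c \<in> Obj C"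
 show "inj_on (\<eta> c) (El X c)"
  using inj[OF c] by (simp add: lin_inj_iff[OF ntD(1)[OF assms(1) c] cmdD(1)[OF X c] cmdD(1)[OF Y c]])
 show "\<eta> c ` El X c = El Y c"
  using surj[OF c] ntD(3)[OF assms(1) c] by blast
qed

lemma niso_inv:
 assumes \<eta>: "niso C X Y \<eta>" and X: "cmd C X" and Y: "cmd C Y"
 shows "niso C Y X (\<lambda>c. inv_into (El X c) (\<eta> c))"
 unfolding niso_def
proof (intro conjI ntI ballI)
 have n: "nt C X Y \<eta>" and b: "\<And>c. c \<in> Obj C ==> bij_betw (\<eta> c) (El X c) (El Y c)"
  using \<eta> by (auto simp: niso_def)
 note i = bij_betw_inv_into_left[OF b] bij_betw_inv_into_right[OF b]
 show "bij_betw (inv_into (El X c) (\<eta> c)) (El Y c) (El X c)" if "c \<in> Obj C" for c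
  by (rule bij_betw_inv_into[OF b[OF that]])
 show "lin (Val Y c) (Val X c) (inv_into (El X c) (\<eta> c))" if "c \<in> Obj C" for c
  by (rule lin_inverse[OF ntD(1)[OF n that] b[OF that] cmdD(1)[OF X that]]) (rule i(1)[OF that])
 fix x y f v assume h: "x \<in> Obj C" "y \<in> Obj C" "f \<in> Arr C x y" "v \<in> El Y y"
 then obtain w where w: "w \<in> El X y" "v = \<eta> y w" using b[OF h(2)] by (auto simp: bij_betw_def)
 show "inv_into (El X x) (\<eta> x) (Act Y x y f v) = Act X x y f (inv_into (El X y) (\<eta> y) v)"
  using h w i(1) cmdD(4)[OF X h(1,2,3) w(1)] by (simp add: ntD(2)[OF n, symmetric])
qed

lemma niso_comp:
 assumes \<eta>: "niso C X Y \<eta>" and \<theta>: "niso C Y Z \<theta>"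
 shows "niso C X Z (\<lambda>c v. \<theta> c (\<eta> c v))"
 unfolding niso_def
proof (intro conjI ballI)
 show "nt C X Z (\<lambda>c v. \<theta> c (\<eta> c v))" using \<eta> \<theta> by (auto simp: niso_def intro: nt_comp)
 fix c assume c: "c \<in> Obj C"
 have "bij_betw (\<theta> c \<circ> \<eta> c) (El X c) (El Z c)"
  using \<eta> \<theta> c by (intro bij_betw_trans) (auto simp: niso_def)
 then show "bij_betw (\<lambda>v. \<theta> c (\<eta> c v)) (El X c) (El Z c)"
  by (simp add: comp_def)
qed

text \<open>The presenting arrow stays, only the generator is moved. As the value types may differ,
  this is the vehicle that carries finite presentation to and from copies.\<close>

lemma niso_fp:
 assumes C: "lcat C" and \<eta>: "niso C X Y \<eta>" and X: "fp C X" and Y: "cmd C Y"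
 shows "fp C Y"
proof -
 have Xc: "cmd C X" using fp_cmd[OF X] .
 obtain c1 c0 g x where p: "pres C X c1 c0 g x" using X fp_iff[OF C, of X] by blast
 note p = presD[OF p]
 have n: "nt C X Y \<eta>" and b: "\<And>c. c \<in> Obj C ==> bij_betw (\<eta> c) (El X c) (El Y c)"
  using \<eta> by (auto simp: niso_def)
 have "pres C Y c1 c0 g (\<eta> c0 x)"
  unfolding pres_def gen_def
 proof (intro conjI ballI p)
  show "\<eta> c0 x \<in> El Y c0" using ntD(3)[OF n] p by blast
  fix a assume a: "a \<in> Obj C"
  show "\<exists>f\<in>Arr C a c0. v = Act Y a c0 f (\<eta> c0 x)" if v: "v \<in> El Y a" for v
  proof -
   obtain w where "w \<in> El X a" "v = \<eta> a w" using b[OF a] v by (auto simp: bij_betw_def)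
   with p(6)[OF a] ntD(2)[OF n a p(4) _ p(5)] show ?thesis by metis
  qed
  fix f assume f: "f \<in> Arr C a c0"
  have "Act Y a c0 f (\<eta> c0 x) = zr Y a \<longleftrightarrow> \<eta> a (Act X a c0 f x) = \<eta> a (zr X a)"
   using ntD(2)[OF n a p(4) f p(5)] nt_zero_app[OF n Xc Y a] by simp
  also have "\<dots> \<longleftrightarrow> Act X a c0 f x = zr X a"
   using b[OF a] cmdD(4)[OF Xc a p(4) f p(5)] vs_closed(1)[OF cmdD(1)[OF Xc a]]
   by (metis bij_betw_imp_inj_on inj_on_eq_iff)
  finally show "Act Y a c0 f (\<eta> c0 x) = zr Y a \<longleftrightarrow> (\<exists>h\<in>Arr C a c1. f = Cmp C a c1 c0 g h)"
   using p(7)[OF a f] by simp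
 qed
 with Y show ?thesis using fp_iff[OF C, of Y] by blast
qed

context
 fixes V :: "('k, 'w) module" and t :: "'v itself"
 assumes V: "vsp V" and e: "\<exists>e :: 'w => 'v. inj_on e (carrier V)"
begin

lemma code_inj: "inj_on (code V :: 'w => 'v) (carrier V)"
 unfolding code_def using e by (rule someI_ex)

lemma decode_code: "v \<in> carrier V ==> decode V (code V v :: 'v) = v"
 unfolding decode_def by (rule inv_into_f_f[OF code_inj])

lemma copy_vsp: "vsp (copy_space V :: ('k, 'v) module)"
 and code_lin: "lin V (copy_space V :: ('k, 'v) module) (code V)"
 by (rule vs_transport[OF V, where p = "code V :: 'w => 'v"]; simp add: copy_space_def decode_code)+

end

lemma copy_mod_sel: "Val (copy_mod X) = (\<lambda>c. copy_space (Val X c))"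
 "Act (copy_mod X) = (\<lambda>x y f v. code (Val X x) (Act X x y f (decode (Val X y) v)))"
 by (simp_all add: copy_mod_def)

lemma copy_space_carrier: "carrier (copy_space V) = code V ` carrier V"
 by (simp add: copy_space_def)

text \<open>The injections are chosen separately at every object. They are nevertheless natural,
  because the action on the copy is conjugated by them.\<close>

lemma copy_mod:
 fixes X :: "('k, 'o, 'm, 'w) cmod" and t :: "'v itself"
 assumes X: "cmd C X" and e: "\<And>c. c \<in> Obj C ==> \<exists>e :: 'w => 'v. inj_on e (El X c)"
 shows "cmd C (copy_mod X :: ('k, 'o, 'm, 'v) cmod)"
  and "niso C X (copy_mod X :: ('k, 'o, 'm, 'v) cmod) (\<lambda>c. code (Val X c))"
  and "niso C (copy_mod X :: ('k, 'o, 'm, 'v) cmod) X (\<lambda>c. decode (Val X c))"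
proof -
 let ?Y = "copy_mod X :: ('k, 'o, 'm, 'v) cmod"
 note D = decode_code[OF cmdD(1)[OF X] e]
 note L = linD[OF code_lin[OF cmdD(1)[OF X] e]]
 have co: "El ?Y c = code (Val X c) ` El X c" for c
  by (simp add: copy_mod_sel copy_space_carrier)
 show Y: "cmd C ?Y"
 proof (rule cmdI)
  show "vsp (Val ?Y c)" if "c \<in> Obj C" for c
   using copy_vsp[OF cmdD(1)[OF X that] e[OF that]] by (simp add: copy_mod_sel)
  show "lin (Val ?Y y) (Val ?Y x) (Act ?Y x y f)" if h: "x \<in> Obj C" "y \<in> Obj C" "f \<in> Arr C x y" for x y f
  proof -
   have "lin (Val ?Y y) (Val X y) (decode (Val X y))"
    using lin_inverse[OF code_lin[OF cmdD(1)[OF X h(2)] e[OF h(2)]] _ cmdD(1)[OF X h(2)]]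
     code_inj[OF cmdD(1)[OF X h(2)] e[OF h(2)]]
    by (auto simp: bij_betw_def copy_space_carrier D h copy_mod_sel)
   from lin_comp[OF lin_comp[OF this act_lin(1)[OF X h]] code_lin[OF cmdD(1)[OF X h(1)] e[OF h(1)]]]
   show ?thesis by (simp add: copy_mod_sel)
  qed
  show "lin (Hom C x y) (Val ?Y x) (\<lambda>f. Act ?Y x y f v)"
   if h: "x \<in> Obj C" "y \<in> Obj C" "v \<in> El ?Y y" for x y v
  proof -
   obtain w where w: "w \<in> El X y" "v = code (Val X y) w" using h(3) by (auto simp: co)
   from lin_comp[OF act_lin(2)[OF X h(1,2) w(1)] code_lin[OF cmdD(1)[OF X h(1)] e[OF h(1)]]]
   show ?thesis using w h by (simp add: copy_mod_sel D)
  qed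
 qed (auto simp: copy_space_carrier copy_mod_sel D cmdD[OF X])
 have n: "nt C X ?Y (\<lambda>c. code (Val X c))"
  by (rule ntI) (auto simp: copy_mod_sel D intro: code_lin[OF cmdD(1)[OF X] e])
 show i: "niso C X ?Y (\<lambda>c. code (Val X c))"
  using n code_inj[OF cmdD(1)[OF X] e] by (auto simp: niso_def bij_betw_def co)
 show "niso C ?Y X (\<lambda>c. decode (Val X c))"
  using niso_inv[OF i X Y] by (simp add: decode_def)
qed

end

subsection \<open>Factorizations, submodules, quotients, products\<close>

definition sub_mod :: "('k, 'o, 'm, 'v) cmod => ('o => 'v set) => ('k, 'o, 'm, 'v) cmod" where
 "sub_mod X N = \<lparr>Val = (\<lambda>c. (Val X c)\<lparr>carrier := N c\<rparr>), Act = Act X\<rparr>"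

definition ker_mod :: "('k, 'o, 'm, 'v) cmod => ('k, 'o, 'm, 'w) cmod => ('o => 'v => 'w) =>
  ('k, 'o, 'm, 'v) cmod" where
 "ker_mod X Y \<phi> = sub_mod X (\<lambda>c. {v \<in> El X c. \<phi> c v = zr Y c})"

text \<open>The action is a union over representatives, in the style of \<open>quot_space\<close>;
  it collapses to one coset by \<open>Union_coset\<close>.\<close>

definition quot_mod :: "('k, 'o, 'm, 'v) cmod => ('o => 'v set) => ('k, 'o, 'm, 'v set) cmod" where
 "quot_mod X N = \<lparr>Val = (\<lambda>c. quot_space (Val X c) (N c)),
   Act = (\<lambda>x y f T. \<Union>t\<in>T. N x +>\<^bsub>Val X x\<^esub> Act X x y f t)\<rparr>"

text \<open>Tuples are extensional functions, so equality is componentwise and \<open>n = 0\<close>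
  gives a zero module.\<close>

definition prod_mod :: "nat => (nat => ('k, 'o, 'm, 'v) cmod) => ('k, 'o, 'm, nat => 'v) cmod" where
 "prod_mod n X = \<lparr>Val = (\<lambda>c. \<lparr>carrier = (\<Pi>\<^sub>E i\<in>{..<n}. El (X i) c), mult = undefined, one = undefined,
    zero = (\<lambda>i\<in>{..<n}. (zr (X i) c)), add = (\<lambda>u v. \<lambda>i\<in>{..<n}. u i \<oplus>\<^bsub>Val (X i) c\<^esub> v i),
    smult = (\<lambda>r u. \<lambda>i\<in>{..<n}. r \<odot>\<^bsub>Val (X i) c\<^esub> u i)\<rparr>),
   Act = (\<lambda>x y f u. \<lambda>i\<in>{..<n}. Act (X i) x y f (u i))\<rparr>"

lemma restrict_eq_iff: "restrict f A = restrict g A \<longleftrightarrow> (\<forall>i\<in>A. f i = g i)"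
 by (auto simp: restrict_def fun_eq_iff)

lemma restrict_eq_extensional: "u \<in> extensional A ==> restrict f A = u \<longleftrightarrow> (\<forall>i\<in>A. f i = u i)"
 by (auto simp: restrict_def fun_eq_iff extensional_def)

context base_field
begin

text \<open>Linearity and naturality of the factor can be tested after applying \<open>i\<close>,
  where they become those of \<open>g\<close>. The three modules may have different value
  types.\<close>

lemma nt_factor_inj:
 assumes K: "cmd C M" and X: "cmd C X" and W: "cmd C W"
  and i: "nt C M X i" and inj: "\<And>c. c \<in> Obj C ==> inj_on (i c) (El M c)"
  and g: "nt C W X g"
  and im: "\<And>c w. c \<in> Obj C ==> w \<in> El W c ==> \<exists>k\<in>El M c. g c w = i c k"
 shows "\<exists>u. nt C W M u \<and> (\<forall>c\<in>Obj C. \<forall>w\<in>El W c. i c (u c w) = g c w)"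
proof -
 define u where "u = (\<lambda>c w. inv_into (El M c) (i c) (g c w))"
 have u: "u c w \<in> El M c" "i c (u c w) = g c w" if "c \<in> Obj C" "w \<in> El W c" for c w
  using im[OF that] by (auto simp: u_def image_iff intro!: inv_into_into f_inv_into_f)
 have e: "a = b" if "c \<in> Obj C" "a \<in> El M c" "b \<in> El M c" "i c a = i c b" for a b c
  using inj[OF that(1)] that by (auto dest: inj_onD)
 have "nt C W M u"
 proof (intro ntI linI)
  fix c v w assume h: "c \<in> Obj C" "v \<in> El W c" "w \<in> El W c"
  show "u c (v \<oplus>\<^bsub>Val W c\<^esub> w) = u c v \<oplus>\<^bsub>Val M c\<^esub> u c w"
   by (rule e[OF h(1)])
    (simp_all add: u h vs_closed[OF cmdD(1)[OF W h(1)]] vs_closed[OF cmdD(1)[OF K h(1)]] ntD[OF i] ntD[OF g])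
 next
  fix c r v assume h: "c \<in> Obj C" "r \<in> carrier K" "v \<in> El W c"
  show "u c (r \<odot>\<^bsub>Val W c\<^esub> v) = r \<odot>\<^bsub>Val M c\<^esub> u c v"
   by (rule e[OF h(1)])
    (simp_all add: u h vs_closed[OF cmdD(1)[OF W h(1)]] vs_closed[OF cmdD(1)[OF K h(1)]] ntD[OF i] ntD[OF g])
 next
  fix x y f v assume h: "x \<in> Obj C" "y \<in> Obj C" "f \<in> Arr C x y" "v \<in> El W y"
  show "u x (Act W x y f v) = Act M x y f (u y v)"
   by (rule e[OF h(1)])
    (simp_all add: u h cmdD[OF W] cmdD[OF K] ntD[OF i] ntD[OF g])
 qed (simp add: u)
 with u show ?thesis by blast
qed

text \<open>Preimages under \<open>p\<close> are chosen arbitrarily. Two of them differ by an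
  element of the kernel of \<open>p\<close>, which \<open>g\<close> kills, so the choice does not
  affect the value.\<close>

lemma nt_factor_surj:
 assumes Y: "cmd C Y" and Z: "cmd C Z" and W: "cmd C W"
  and p: "nt C Y Z p" and surj: "\<And>c z. c \<in> Obj C ==> z \<in> El Z c ==> \<exists>y\<in>El Y c. z = p c y"
  and g: "nt C Y W g"
  and ker: "\<And>c y. c \<in> Obj C ==> y \<in> El Y c ==> p c y = zr Z c ==> g c y = zr W c"
 shows "\<exists>u. nt C Z W u \<and> (\<forall>c\<in>Obj C. \<forall>y\<in>El Y c. u c (p c y) = g c y)"
proof -
 define s where "s = (\<lambda>c z. SOME y. y \<in> El Y c \<and> z = p c y)"
 have s: "s c z \<in> El Y c" "p c (s c z) = z" if "c \<in> Obj C" "z \<in> El Z c" for c z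
  using someI_ex[OF surj[OF that, unfolded Bex_def]] by (auto simp: s_def)
 define u where "u = (\<lambda>c z. g c (s c z))"
 have u: "u c (p c y) = g c y" if h: "c \<in> Obj C" "y \<in> El Y c" for c y
 proof -
  have z: "p c y \<in> El Z c" by (rule ntD(3)[OF p h])
  have "g c (s c (p c y) \<ominus>\<^bsub>Val Y c\<^esub> y) = zr W c"
   by (rule ker[OF h(1)])
    (simp_all add: vs_closed[OF cmdD(1)[OF Y h(1)]] h s[OF h(1) z] nt_diff_app[OF p Y Z h(1)]
     vs_diff_zero[OF cmdD(1)[OF Z h(1)] z])
  then show ?thesis
   by (simp add: u_def nt_diff_app[OF g Y W h(1)] h s[OF h(1) z] vs_diff[OF cmdD(1)[OF W h(1)]] ntD(3)[OF g])
 qed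
 have "nt C Z W u"
 proof (intro ntI linI)
  fix c v assume "c \<in> Obj C" "v \<in> El Z c"
  then show "u c v \<in> El W c" using s ntD(3)[OF g] by (simp add: u_def)
 next
  fix c v w assume h: "c \<in> Obj C" "v \<in> El Z c" "w \<in> El Z c"
  then obtain v' w' where v': "v' \<in> El Y c" "w' \<in> El Y c" "v = p c v'" "w = p c w'"
   using surj by metis
  then show "u c (v \<oplus>\<^bsub>Val Z c\<^esub> w) = u c v \<oplus>\<^bsub>Val W c\<^esub> u c w"
   using h(1) by (simp add: ntD(4)[OF p, symmetric] u vs_closed[OF cmdD(1)[OF Y]] ntD(4)[OF g])
 next
  fix c r v assume h: "c \<in> Obj C" "r \<in> carrier K" "v \<in> El Z c"
  then obtain v' where v': "v' \<in> El Y c" "v = p c v'"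
   using surj by metis
  then show "u c (r \<odot>\<^bsub>Val Z c\<^esub> v) = r \<odot>\<^bsub>Val W c\<^esub> u c v"
   using h(1,2) by (simp add: ntD(5)[OF p, symmetric] u vs_closed[OF cmdD(1)[OF Y]] ntD(5)[OF g])
 next
  fix x y f v assume h: "x \<in> Obj C" "y \<in> Obj C" "f \<in> Arr C x y" "v \<in> El Z y"
  then obtain v' where v': "v' \<in> El Y y" "v = p y v'"
   using surj by metis
  then show "u x (Act Z x y f v) = Act W x y f (u y v)"
   using h(1-3) by (simp add: ntD(2)[OF p, symmetric] u cmdD[OF Y] ntD(2)[OF g])
 qed
 with u show ?thesis by blast
qed

definition submod :: "('k, 'o, 'm) lincat => ('k, 'o, 'm, 'v) cmod => ('o => 'v set) => bool" where
 "submod C X N \<longleftrightarrow> (\<forall>c\<in>Obj C. subsp (Val X c) (N c)) \<and>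
   (\<forall>x\<in>Obj C. \<forall>y\<in>Obj C. \<forall>f\<in>Arr C x y. \<forall>v\<in>N y. Act X x y f v \<in> N x)"

lemma submodD:
 assumes "submod C X N"
 shows "c \<in> Obj C ==> subsp (Val X c) (N c)"
  "x \<in> Obj C ==> y \<in> Obj C ==> f \<in> Arr C x y ==> v \<in> N y ==> Act X x y f v \<in> N x"
  "c \<in> Obj C ==> v \<in> N c ==> v \<in> El X c"
 using assms by (auto simp: submod_def subsp_def)

lemma sub_mod_sel [simp]: "Val (sub_mod X N) c = (Val X c)\<lparr>carrier := N c\<rparr>" "Act (sub_mod X N) = Act X"
 by (simp_all add: sub_mod_def)

lemma sub_mod_cmd:
 assumes X: "cmd C X" and N: "submod C X N"
 shows "cmd C (sub_mod X N)"
proof (rule cmdI)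
 show "vsp (Val (sub_mod X N) c)" if "c \<in> Obj C" for c
  using vsp_sub[OF cmdD(1)[OF X that] submodD(1)[OF N that]] by simp
 show "lin (Val (sub_mod X N) y) (Val (sub_mod X N) x) (Act (sub_mod X N) x y f)"
  if h: "x \<in> Obj C" "y \<in> Obj C" "f \<in> Arr C x y" for x y f
  by (rule linI) (simp_all add: submodD(2,3)[OF N] h act_add[OF X])
 show "lin (Hom C x y) (Val (sub_mod X N) x) (\<lambda>f. Act (sub_mod X N) x y f v)"
  if h: "x \<in> Obj C" "y \<in> Obj C" "v \<in> El (sub_mod X N) y" for x y v
  using h by (intro linI) (simp_all add: submodD(2,3)[OF N] act_add[OF X])
qed (auto simp: cmdD[OF X] submodD(3)[OF N])

lemma sub_mod_incl: "submod C X N ==> nt C (sub_mod X N) X (\<lambda>c v. v)"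
 by (intro ntI linI) (auto simp: submodD(3))

lemma submod_ker:
 assumes \<phi>: "nt C X Y \<phi>" and X: "cmd C X" and Y: "cmd C Y"
 shows "submod C X (\<lambda>c. {v \<in> El X c. \<phi> c v = zr Y c})"
 unfolding submod_def
proof (intro conjI ballI)
 fix c assume "c \<in> Obj C"
 then show "subsp (Val X c) {v \<in> El X c. \<phi> c v = zr Y c}"
  using subsp_ker[OF ntD(1)[OF \<phi>] cmdD(1)[OF X] cmdD(1)[OF Y]] by blast
qed (auto simp: cmdD[OF X] ntD(2)[OF \<phi>] act_add(5)[OF Y])

lemma submod_image:
 assumes \<phi>: "nt C X Y \<phi>" and X: "cmd C X" and Y: "cmd C Y"
 shows "submod C Y (\<lambda>c. \<phi> c ` El X c)"
 unfolding submod_def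
proof (intro conjI ballI)
 fix c assume "c \<in> Obj C"
 then show "subsp (Val Y c) (\<phi> c ` El X c)"
  using subsp_image[OF ntD(1)[OF \<phi>] cmdD(1)[OF X] cmdD(1)[OF Y]] by blast
qed (auto simp: cmdD[OF X] ntD(2)[OF \<phi>, symmetric])

lemma quot_mod_sel: "Val (quot_mod X N) c = quot_space (Val X c) (N c)"
 "Act (quot_mod X N) x y f T = (\<Union>t\<in>T. N x +>\<^bsub>Val X x\<^esub> Act X x y f t)"
 by (simp_all add: quot_mod_def)

context
 fixes C :: "('k, 'o, 'm) lincat" and X :: "('k, 'o, 'm, 'v) cmod" and N
 assumes C: "lcat C" and X: "cmd C X" and N: "submod C X N"
begin

lemma quot_mod_carrier:
 "c \<in> Obj C ==> El (quot_mod X N) c = (\<lambda>v. N c +>\<^bsub>Val X c\<^esub> v) ` El X c"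
 "c \<in> Obj C ==> (zr (quot_mod X N) c) = N c"
 by (simp_all add: quot_mod_sel quot_sel[OF cmdD(1)[OF X] submodD(1)[OF N]])

lemma quot_mod_act:
 assumes "x \<in> Obj C" "y \<in> Obj C" "f \<in> Arr C x y" "v \<in> El X y"
 shows "Act (quot_mod X N) x y f (N y +>\<^bsub>Val X y\<^esub> v) = N x +>\<^bsub>Val X x\<^esub> Act X x y f v"
 unfolding quot_mod_sel using assms
 by (intro Union_coset[OF cmdD(1)[OF X] submodD(1)[OF N] cmdD(1)[OF X] submodD(1)[OF N] act_lin(1)[OF X]])
  (auto simp: submodD[OF N])

lemma quot_mod_lin: "c \<in> Obj C ==> lin (Val X c) (Val (quot_mod X N) c) (\<lambda>v. N c +>\<^bsub>Val X c\<^esub> v)"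
 unfolding quot_mod_sel by (rule quot_lin[OF cmdD(1)[OF X] submodD(1)[OF N]])

lemma quot_mod_eq_zero:
 "c \<in> Obj C ==> v \<in> El X c ==> N c +>\<^bsub>Val X c\<^esub> v = zr (quot_mod X N) c \<longleftrightarrow> v \<in> N c"
 by (simp add: quot_mod_carrier coset_eq_zero[OF cmdD(1)[OF X] submodD(1)[OF N]])

lemma quot_mod_cmd: "cmd C (quot_mod X N)"
proof (rule cmdI)
 show "vsp (Val (quot_mod X N) c)" if "c \<in> Obj C" for c
  unfolding quot_mod_sel by (rule quot_vsp[OF cmdD(1)[OF X that] submodD(1)[OF N that]])
 note L = linD(2,3)[OF quot_mod_lin, symmetric]
 note S = vs_closed[OF cmdD(1)[OF X]]
 show "lin (Val (quot_mod X N) y) (Val (quot_mod X N) x) (Act (quot_mod X N) x y f)"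
  if h: "x \<in> Obj C" "y \<in> Obj C" "f \<in> Arr C x y" for x y f
  by (rule linI)
   (auto simp: quot_mod_carrier h L quot_mod_act S cmdD(4)[OF X] act_add[OF X])
 show "lin (Hom C x y) (Val (quot_mod X N) x) (\<lambda>f. Act (quot_mod X N) x y f v)"
  if h: "x \<in> Obj C" "y \<in> Obj C" "v \<in> El (quot_mod X N) y" for x y v
 proof -
  obtain w where w: "w \<in> El X y" "v = N y +>\<^bsub>Val X y\<^esub> w" using h(3) by (auto simp: quot_mod_carrier h)
  show ?thesis
   by (rule lin_cong[OF lin_comp[OF act_lin(2)[OF X h(1,2) w(1)] quot_mod_lin[OF h(1)]]])
    (simp_all add: w h quot_mod_act catD[OF C])
 qed
qed (auto simp: quot_mod_carrier quot_mod_act cmdD[OF X] catD[OF C])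

lemma quot_mod_proj: "nt C X (quot_mod X N) (\<lambda>c v. N c +>\<^bsub>Val X c\<^esub> v)"
 by (rule ntI) (auto simp: quot_mod_lin quot_mod_act)

end

lemma prod_mod_sel [simp]:
 "El (prod_mod n X) c = (\<Pi>\<^sub>E i\<in>{..<n}. El (X i) c)"
 "zr (prod_mod n X) c = (\<lambda>i\<in>{..<n}. (zr (X i) c))"
 "u \<oplus>\<^bsub>Val (prod_mod n X) c\<^esub> v = (\<lambda>i\<in>{..<n}. u i \<oplus>\<^bsub>Val (X i) c\<^esub> v i)"
 "r \<odot>\<^bsub>Val (prod_mod n X) c\<^esub> u = (\<lambda>i\<in>{..<n}. r \<odot>\<^bsub>Val (X i) c\<^esub> u i)"
 "Act (prod_mod n X) x y f u = (\<lambda>i\<in>{..<n}. Act (X i) x y f (u i))"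
 by (simp_all add: prod_mod_def)

lemma prod_mod_cmd:
 assumes X: "\<And>i. i < n ==> cmd C (X i)"
 shows "cmd C (prod_mod n X)"
proof -
 note E = restrict_eq_iff restrict_eq_extensional
 show ?thesis
 proof (rule cmdI)
  fix c assume c: "c \<in> Obj C"
  note S = vs_closed[OF cmdD(1)[OF X c]] vs_simps[OF cmdD(1)[OF X c]] vs_ac[OF cmdD(1)[OF X c]]
   vs_distr[OF cmdD(1)[OF X c]]
  show "vsp (Val (prod_mod n X) c)"
   by (rule vspI) (simp_all add: PiE_iff E S)
 next
  fix x y f assume h: "x \<in> Obj C" "y \<in> Obj C" "f \<in> Arr C x y"
  show "lin (Val (prod_mod n X) y) (Val (prod_mod n X) x) (Act (prod_mod n X) x y f)"
   by (rule linI) (simp_all add: PiE_iff E h cmdD[OF X] act_add[OF X])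
 next
  fix x y v assume h: "x \<in> Obj C" "y \<in> Obj C" "v \<in> El (prod_mod n X) y"
  show "lin (Hom C x y) (Val (prod_mod n X) x) (\<lambda>f. Act (prod_mod n X) x y f v)"
   using h by (intro linI) (simp_all add: PiE_iff E cmdD[OF X] act_add[OF X])
 qed (simp_all add: PiE_iff E cmdD[OF X])
qed

lemma prod_mod_proj: "i < n ==> nt C (prod_mod n X) (X i) (\<lambda>c u. u i)"
 by (intro ntI linI) auto

lemma prod_mod_tuple:
 assumes f: "\<And>i. i < n ==> nt C W (X i) (f i)"
 shows "nt C W (prod_mod n X) (\<lambda>c w. \<lambda>i\<in>{..<n}. f i c w)"
 by (intro ntI linI) (auto simp: ntD[OF f] fun_eq_iff)

subsection \<open>Closure properties of finitely presented modules\<close>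

text \<open>The part of a direct sum that is seen by arrows into it. The projections are a parameter
  here, whereas \<open>is_direct_sum\<close> hides them under a quantifier.\<close>

definition is_product :: "('k, 'o, 'm) lincat => nat => (nat => 'o) => 'o => (nat => 'm) => bool" where
 "is_product C n xs s \<pi> \<longleftrightarrow> s \<in> Obj C \<and> (\<forall>i<n. \<pi> i \<in> Arr C s (xs i)) \<and>
  (\<forall>a\<in>Obj C. \<forall>f. (\<forall>i<n. f i \<in> Arr C a (xs i)) -->
    (\<exists>h\<in>Arr C a s. \<forall>i<n. Cmp C a s (xs i) (\<pi> i) h = f i)) \<and>
  (\<forall>a\<in>Obj C. \<forall>h\<in>Arr C a s. \<forall>h'\<in>Arr C a s.
    (\<forall>i<n. Cmp C a s (xs i) (\<pi> i) h = Cmp C a s (xs i) (\<pi> i) h') --> h = h')"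

text \<open>A tuple \<open>f\<close> lifts to the sum of the composites of \<iota> i with
  \<open>f i\<close>. The lift is unique because the sum of all \<iota> i \<pi> i is the
  identity.\<close>

lemma direct_sum_product:
 assumes C: "lcat C" and s: "is_direct_sum C n xs s"
 shows "\<exists>\<pi>. is_product C n xs s \<pi>"
proof -
 obtain \<iota> \<pi> where so: "s \<in> Obj C" and o: "\<forall>i<n. xs i \<in> Obj C"
  "\<forall>i<n. \<iota> i \<in> Arr C (xs i) s \<and> \<pi> i \<in> Arr C s (xs i)"
  "\<forall>i<n. \<forall>j<n. Cmp C (xs i) s (xs j) (\<pi> j) (\<iota> i) =
      (if i = j then Idt C (xs i) else \<zero>\<^bsub>Hom C (xs i) (xs j)\<^esub>)"
  and id: "(\<Oplus>\<^bsub>Hom C s s\<^esub>i\<in>{..<n}. Cmp C s (xs i) s (\<iota> i) (\<pi> i)) = Idt C s"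
  using s unfolding is_direct_sum_def by (elim conjE exE) (rule that)
 from o have xo: "\<And>i. i < n ==> xs i \<in> Obj C"
  and \<iota>: "\<And>i. i < n ==> \<iota> i \<in> Arr C (xs i) s" and \<pi>: "\<And>i. i < n ==> \<pi> i \<in> Arr C s (xs i)"
  and \<pi>\<iota>: "\<And>i j. i < n ==> j < n ==> Cmp C (xs i) s (xs j) (\<pi> j) (\<iota> i) =
      (if i = j then Idt C (xs i) else \<zero>\<^bsub>Hom C (xs i) (xs j)\<^esub>)"
  by blast+
 show ?thesis
  unfolding is_product_def
 proof (intro exI[of _ \<pi>] conjI ballI allI impI so)
  fix a f assume a: "a \<in> Obj C" and f: "\<forall>i<n. f i \<in> Arr C a (xs i)"
  interpret V: vectorspace K "Hom C a s" by (rule catD(1)[OF C a so])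
  define h where "h = (\<Oplus>\<^bsub>Hom C a s\<^esub>i\<in>{..<n}. Cmp C a (xs i) s (\<iota> i) (f i))"
  have t: "Cmp C a (xs i) s (\<iota> i) (f i) \<in> Arr C a s" if "i < n" for i
   using that f \<iota> xo a so by (intro catD(3)[OF C]) auto
  have h: "h \<in> Arr C a s" unfolding h_def using t by (intro V.finsum_closed) auto
  have "Cmp C a s (xs j) (\<pi> j) h = f j" if j: "j < n" for j
  proof -
   interpret W: vectorspace K "Hom C a (xs j)" by (rule catD(1)[OF C a xo[OF j]])
   have "Cmp C a s (xs j) (\<pi> j) h =
    (\<Oplus>\<^bsub>Hom C a (xs j)\<^esub>i\<in>{..<n}. Cmp C a s (xs j) (\<pi> j) (Cmp C a (xs i) s (\<iota> i) (f i)))"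
    unfolding h_def using t
    by (intro lin_finsum[OF cmp_lin(2)[OF C a so xo[OF j] \<pi>[OF j]]] V.vectorspace_axioms W.vectorspace_axioms) auto
   also have "\<dots> = (\<Oplus>\<^bsub>Hom C a (xs j)\<^esub>i\<in>{..<n}. if j = i then f j else \<zero>\<^bsub>Hom C a (xs j)\<^esub>)"
   proof (rule W.finsum_cong')
    fix i assume "i \<in> {..<n}"
    then have i: "i < n" by simp
    then have fi: "f i \<in> Arr C a (xs i)" using f by blast
    show "Cmp C a s (xs j) (\<pi> j) (Cmp C a (xs i) s (\<iota> i) (f i)) = (if j = i then f j else \<zero>\<^bsub>Hom C a (xs j)\<^esub>)"
     using cmp_assoc'[OF C a xo[OF i] so xo[OF j] fi \<iota>[OF i] \<pi>[OF j]] \<pi>\<iota>[OF i j]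
      catD(4)[OF C a xo[OF i] fi] cmp_zero(1)[OF C a xo[OF i] xo[OF j] fi] by auto
   qed (use f in auto)
   also have "\<dots> = f j" using j f by (intro W.finsum_singleton[of j _ "\<lambda>_. f j"]) auto
   finally show ?thesis .
  qed
  with h show "\<exists>h\<in>Arr C a s. \<forall>i<n. Cmp C a s (xs i) (\<pi> i) h = f i" by blast
 next
  fix a h h' assume a: "a \<in> Obj C" and h: "h \<in> Arr C a s" and h': "h' \<in> Arr C a s"
   and e: "\<forall>i<n. Cmp C a s (xs i) (\<pi> i) h = Cmp C a s (xs i) (\<pi> i) h'"
  interpret V: vectorspace K "Hom C a s" by (rule catD(1)[OF C a so])
  \<comment> \<open>The identity of \<open>s\<close>, written as a sum over the summands, is
    inserted in front of \<open>k\<close>.\<close>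
  have *: "k = (\<Oplus>\<^bsub>Hom C a s\<^esub>i\<in>{..<n}. Cmp C a (xs i) s (\<iota> i) (Cmp C a s (xs i) (\<pi> i) k))"
   if k: "k \<in> Arr C a s" for k
  proof -
   have "k = Cmp C a s s (\<Oplus>\<^bsub>Hom C s s\<^esub>i\<in>{..<n}. Cmp C s (xs i) s (\<iota> i) (\<pi> i)) k"
    using catD(4)[OF C a so k] by (simp add: id)
   also have "\<dots> = (\<Oplus>\<^bsub>Hom C a s\<^esub>i\<in>{..<n}. Cmp C a s s (Cmp C s (xs i) s (\<iota> i) (\<pi> i)) k)"
    using \<iota> \<pi> xo so
    by (intro lin_finsum[OF cmp_lin(1)[OF C a so so k]] catD[OF C] V.vectorspace_axioms) auto
   also have "\<dots> = (\<Oplus>\<^bsub>Hom C a s\<^esub>i\<in>{..<n}. Cmp C a (xs i) s (\<iota> i) (Cmp C a s (xs i) (\<pi> i) k))"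
    using \<iota> \<pi> xo so a k by (intro V.finsum_cong') (auto intro!: cmp_assoc'[OF C] catD(3)[OF C])
   finally show ?thesis .
  qed
  have "(\<Oplus>\<^bsub>Hom C a s\<^esub>i\<in>{..<n}. Cmp C a (xs i) s (\<iota> i) (Cmp C a s (xs i) (\<pi> i) h)) =
   (\<Oplus>\<^bsub>Hom C a s\<^esub>i\<in>{..<n}. Cmp C a (xs i) s (\<iota> i) (Cmp C a s (xs i) (\<pi> i) h'))"
   using \<iota> \<pi> xo so a h' e by (intro V.finsum_cong') (auto intro!: catD(3)[OF C])
  then show "h = h'" using *[OF h] *[OF h'] by simp
 qed (use \<pi> in blast)
qed

lemma additive_product:
 assumes "additive_category K C" and "\<And>i. i < n ==> xs i \<in> Obj C"
 shows "\<exists>s \<pi>. is_product C n xs s \<pi>"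
 using assms direct_sum_product[of C n xs] unfolding additive_category_def by blast

lemma is_productD:
 assumes "is_product C n xs s \<pi>"
 shows "s \<in> Obj C" "\<And>i. i < n ==> \<pi> i \<in> Arr C s (xs i)"
  "\<And>a f. a \<in> Obj C ==> (\<And>i. i < n ==> f i \<in> Arr C a (xs i)) ==>
   \<exists>h\<in>Arr C a s. \<forall>i<n. Cmp C a s (xs i) (\<pi> i) h = f i"
  "\<And>a h h'. a \<in> Obj C ==> h \<in> Arr C a s ==> h' \<in> Arr C a s ==>
   (\<And>i. i < n ==> Cmp C a s (xs i) (\<pi> i) h = Cmp C a s (xs i) (\<pi> i) h') ==> h = h'"
 using assms unfolding is_product_def by blast+

text \<open>For an exact sequence M \<rightarrow> N \<rightarrow> X \<rightarrow> 0 with N finitely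
  presented and M finitely generated: the generator of N generates X, and the relations of X are
  those of N together with one further arrow that records the image of the generator of M.\<close>

lemma fp_exact:
 assumes A: "additive_category K C" and N: "fp C N" and M: "gen C M d m" "cmd C M"
  and X: "cmd C X" and \<phi>: "nt C M N \<phi>" and \<psi>: "nt C N X \<psi>"
  and surj: "\<And>c x. c \<in> Obj C ==> x \<in> El X c ==> \<exists>v\<in>El N c. x = \<psi> c v"
  and ex: "\<And>c v. c \<in> Obj C ==> v \<in> El N c ==>
   \<psi> c v = zr X c \<longleftrightarrow> (\<exists>u\<in>El M c. v = \<phi> c u)"
 shows "fp C X"
proof -
 have C: "lcat C" using A by (simp add: additive_category_def)
 have Nc: "cmd C N" by (rule fp_cmd[OF N])
 obtain c1 c0 g n where p: "pres C N c1 c0 g n" using N fp_iff[OF C, of N] by blast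
 note p = presD[OF p] and m = genD[OF M(1)]
 \<comment> \<open>\<gamma> lifts the image of the generator \<open>m\<close> along the cover of N
   represented by \<open>c0\<close>.\<close>
 obtain \<gamma> where \<gamma>: "\<gamma> \<in> Arr C d c0" "\<phi> d m = Act N d c0 \<gamma> n"
  using p(6)[OF m(1) ntD(3)[OF \<phi> m(1,2)]] by blast
 define xs where "xs = (\<lambda>i::nat. if i = 0 then c1 else d)"
 have "xs i \<in> Obj C" for i using p(1) m(1) by (simp add: xs_def)
 then obtain s \<pi> where prod: "is_product C 2 xs s \<pi>" using additive_product[OF A] by meson
 note s = is_productD(1)[OF prod]
 have \<pi>: "\<pi> 0 \<in> Arr C s c1" "\<pi> 1 \<in> Arr C s d"
  using is_productD(2)[OF prod, of 0] is_productD(2)[OF prod, of 1] by (auto simp: xs_def)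
 have pair: "\<exists>h\<in>Arr C a s. Cmp C a s c1 (\<pi> 0) h = f \<and> Cmp C a s d (\<pi> 1) h = k"
  if "a \<in> Obj C" "f \<in> Arr C a c1" "k \<in> Arr C a d" for a f k
 proof -
  have "\<exists>h\<in>Arr C a s. \<forall>i<2. Cmp C a s (xs i) (\<pi> i) h = (if i = 0 then f else k)"
   by (rule is_productD(3)[OF prod that(1)]) (simp add: xs_def that)
  then obtain h where h: "h \<in> Arr C a s" "\<forall>i<2. Cmp C a s (xs i) (\<pi> i) h = (if i = 0 then f else k)" by blast
  then show ?thesis using h(2)[rule_format, of 0] h(2)[rule_format, of 1] by (auto simp: xs_def)
 qed
 note V = catD(1)[OF C]
 note cl = catD(3)[OF C]
 \<comment> \<open>The row (g, \<gamma>) on the direct sum of \<open>c1\<close> and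
   \<open>d\<close>, expressed through the projections because \<open>is_product\<close> provides no
   inclusions.\<close>
 define G where "G = Cmp C s c1 c0 g (\<pi> 0) \<oplus>\<^bsub>Hom C s c0\<^esub> Cmp C s d c0 \<gamma> (\<pi> 1)"
 have G: "G \<in> Arr C s c0" unfolding G_def using \<pi> \<gamma> s p m by (intro vs_closed[OF V] cl)
 have Gl: "Cmp C a s c0 G l = Cmp C a c1 c0 g (Cmp C a s c1 (\<pi> 0) l) \<oplus>\<^bsub>Hom C a c0\<^esub> Cmp C a d c0 \<gamma> (Cmp C a s d (\<pi> 1) l)"
  if l: "a \<in> Obj C" "l \<in> Arr C a s" for a l
  unfolding G_def using \<pi> \<gamma> s p m l by (simp add: cmp_add[OF C] cmp_assoc'[OF C] cl)
 have "pres C X s c0 G (\<psi> c0 n)"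
  unfolding pres_def gen_def
 proof (intro conjI ballI s G p(4) ntD(3)[OF \<psi> p(4,5)])
  fix a assume a: "a \<in> Obj C"
  show "\<exists>f\<in>Arr C a c0. v = Act X a c0 f (\<psi> c0 n)" if v: "v \<in> El X a" for v
  proof -
   obtain w where w: "w \<in> El N a" "v = \<psi> a w" using surj[OF a v] by blast
   then obtain f where "f \<in> Arr C a c0" "w = Act N a c0 f n" using p(6)[OF a] by blast
   with w show ?thesis using ntD(2)[OF \<psi> a p(4) _ p(5)] by blast
  qed
  fix f assume f: "f \<in> Arr C a c0"
  have fn: "Act N a c0 f n \<in> El N a" by (rule cmdD(4)[OF Nc a p(4) f p(5)])
  have kg: "\<phi> a (Act M a d k m) = Act N a c0 (Cmp C a d c0 \<gamma> k) n" if "k \<in> Arr C a d" for k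
   using ntD(2)[OF \<phi> a m(1) that m(2)] cmdD(3)[OF Nc a m(1) p(4) that \<gamma>(1) p(5)] \<gamma>(2) by simp
  have "Act X a c0 f (\<psi> c0 n) = zr X a \<longleftrightarrow> (\<exists>u\<in>El M a. Act N a c0 f n = \<phi> a u)"
   using ex[OF a fn] ntD(2)[OF \<psi> a p(4) f p(5)] by simp
  also have "\<dots> \<longleftrightarrow> (\<exists>k\<in>Arr C a d. Act N a c0 f n = Act N a c0 (Cmp C a d c0 \<gamma> k) n)"
   using m(3)[OF a] cmdD(4)[OF M(2) a m(1) _ m(2)] kg by metis
  \<comment> \<open>The element given by \<open>f\<close> lies in the image of \<phi> exactly if
    \<open>f\<close> differs from some \<gamma> k by a relation of N.\<close>
  also have "\<dots> \<longleftrightarrow> (\<exists>k\<in>Arr C a d. \<exists>h\<in>Arr C a c1. f \<ominus>\<^bsub>Hom C a c0\<^esub> Cmp C a d c0 \<gamma> k = Cmp C a c1 c0 g h)"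
  proof (rule bex_cong[OF refl])
   fix k assume k: "k \<in> Arr C a d"
   have gk: "Cmp C a d c0 \<gamma> k \<in> Arr C a c0" by (rule cl[OF a m(1) p(4) k \<gamma>(1)])
   have "Act N a c0 (f \<ominus>\<^bsub>Hom C a c0\<^esub> Cmp C a d c0 \<gamma> k) n =
     Act N a c0 f n \<ominus>\<^bsub>Val N a\<^esub> Act N a c0 (Cmp C a d c0 \<gamma> k) n"
    by (rule lin_diff[OF act_lin(2)[OF Nc a p(4,5)] V[OF a p(4)] cmdD(1)[OF Nc a] f gk])
   then show "Act N a c0 f n = Act N a c0 (Cmp C a d c0 \<gamma> k) n \<longleftrightarrow>
     (\<exists>h\<in>Arr C a c1. f \<ominus>\<^bsub>Hom C a c0\<^esub> Cmp C a d c0 \<gamma> k = Cmp C a c1 c0 g h)"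
    using p(7)[OF a vs_closed(3)[OF V[OF a p(4)] f gk]]
     vs_diff(1)[OF cmdD(1)[OF Nc a] fn cmdD(4)[OF Nc a p(4) gk p(5)]] by simp
  qed
  also have "\<dots> \<longleftrightarrow> (\<exists>l\<in>Arr C a s. f = Cmp C a s c0 G l)"
  proof
   assume "\<exists>k\<in>Arr C a d. \<exists>h\<in>Arr C a c1. f \<ominus>\<^bsub>Hom C a c0\<^esub> Cmp C a d c0 \<gamma> k = Cmp C a c1 c0 g h"
   then obtain k h where k: "k \<in> Arr C a d" "h \<in> Arr C a c1" "f \<ominus>\<^bsub>Hom C a c0\<^esub> Cmp C a d c0 \<gamma> k = Cmp C a c1 c0 g h"
    by blast
   obtain l where l: "l \<in> Arr C a s" "Cmp C a s c1 (\<pi> 0) l = h" "Cmp C a s d (\<pi> 1) l = k" using pair[OF a k(2,1)] by blast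
   have "f = Cmp C a s c0 G l"
    using vs_diff(3)[OF V[OF a p(4)] f cl[OF a m(1) p(4) k(1) \<gamma>(1)]] k(3) l by (simp add: Gl[OF a])
   with l show "\<exists>l\<in>Arr C a s. f = Cmp C a s c0 G l" by blast
  next
   assume "\<exists>l\<in>Arr C a s. f = Cmp C a s c0 G l"
   then obtain l where l: "l \<in> Arr C a s" "f = Cmp C a s c0 G l" by blast
   have 1: "Cmp C a s c1 (\<pi> 0) l \<in> Arr C a c1" by (rule cl[OF a s p(1) l(1) \<pi>(1)])
   have 2: "Cmp C a s d (\<pi> 1) l \<in> Arr C a d" by (rule cl[OF a s m(1) l(1) \<pi>(2)])
   have "f \<ominus>\<^bsub>Hom C a c0\<^esub> Cmp C a d c0 \<gamma> (Cmp C a s d (\<pi> 1) l) = Cmp C a c1 c0 g (Cmp C a s c1 (\<pi> 0) l)"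
    using vs_diff(4)[OF V[OF a p(4)] cl[OF a p(1,4) 1 p(2)] cl[OF a m(1) p(4) 2 \<gamma>(1)]] l(2) Gl[OF a l(1)] by simp
   with 1 2 show "\<exists>k\<in>Arr C a d. \<exists>h\<in>Arr C a c1. f \<ominus>\<^bsub>Hom C a c0\<^esub> Cmp C a d c0 \<gamma> k = Cmp C a c1 c0 g h"
    by blast
  qed
  finally show "Act X a c0 f (\<psi> c0 n) = zr X a \<longleftrightarrow> (\<exists>l\<in>Arr C a s. f = Cmp C a s c0 G l)" .
 qed
 with X show ?thesis using fp_iff[OF C, of X] by blast
qed

text \<open>Arrows into a product are tuples, so the products of the presenting objects, with the
  induced arrow \<open>G\<close>, present the product of the modules; generation and relations are
  checked in each component.\<close>

lemma fp_prod:
 assumes A: "additive_category K C" and X: "\<And>i. i < n ==> fp C (X i)"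
 shows "fp C (prod_mod n X)"
proof -
 have C: "lcat C" using A by (simp add: additive_category_def)
 have Xc: "cmd C (X i)" if "i < n" for i using fp_cmd[OF X[OF that]] .
 have "\<exists>q. pres C (X i) (fst q) (fst (snd q)) (fst (snd (snd q))) (snd (snd (snd q)))" if "i < n" for i
  using X[OF that] fp_iff[OF C, of "X i"] by force
 then obtain q where "\<And>i. i < n ==> pres C (X i) (fst (q i)) (fst (snd (q i))) (fst (snd (snd (q i)))) (snd (snd (snd (q i))))"
  by metis
 then obtain c1 c0 g x where p: "\<And>i. i < n ==> pres C (X i) (c1 i) (c0 i) (g i) (x i)" by meson
 note p = presD[OF p]
 obtain s1 \<pi>1 where "is_product C n c1 s1 \<pi>1" using additive_product[OF A, of n c1] p(1) by meson
 note s1 = is_productD[OF this]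
 obtain s0 \<pi> where "is_product C n c0 s0 \<pi>" using additive_product[OF A, of n c0] p(4) by meson
 note s0 = is_productD[OF this]
 note cl = catD(3)[OF C]
 have "\<exists>G\<in>Arr C s1 s0. \<forall>i<n. Cmp C s1 s0 (c0 i) (\<pi> i) G = Cmp C s1 (c1 i) (c0 i) (g i) (\<pi>1 i)"
  by (rule s0(3)[OF s1(1)]) (rule cl[OF s1(1) p(1) p(4) s1(2) p(2)])
 then obtain G where G: "G \<in> Arr C s1 s0"
  "\<And>i. i < n ==> Cmp C s1 s0 (c0 i) (\<pi> i) G = Cmp C s1 (c1 i) (c0 i) (g i) (\<pi>1 i)" by blast
 define \<xi> where "\<xi> = (\<lambda>i\<in>{..<n}. Act (X i) s0 (c0 i) (\<pi> i) (x i))"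
 have act: "Act (prod_mod n X) a s0 f \<xi> = (\<lambda>i\<in>{..<n}. Act (X i) a (c0 i) (Cmp C a s0 (c0 i) (\<pi> i) f) (x i))"
  if "a \<in> Obj C" "f \<in> Arr C a s0" for a f
  using that s0 p by (auto simp: \<xi>_def fun_eq_iff cmdD(3)[OF Xc])
 have "pres C (prod_mod n X) s1 s0 G \<xi>"
  unfolding pres_def gen_def
 proof (intro conjI ballI s1(1) s0(1) G(1))
  show "\<xi> \<in> El (prod_mod n X) s0"
   using s0 p by (auto simp: \<xi>_def cmdD[OF Xc])
  fix a assume a: "a \<in> Obj C"
  show "\<exists>f\<in>Arr C a s0. v = Act (prod_mod n X) a s0 f \<xi>" if v: "v \<in> El (prod_mod n X) a" for v
  proof -
   have "\<exists>f\<in>Arr C a (c0 i). v i = Act (X i) a (c0 i) f (x i)" if "i < n" for i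
    using p(6)[OF that a, of "v i"] v that by auto
   then obtain f where f: "\<And>i. i < n ==> f i \<in> Arr C a (c0 i)" "\<And>i. i < n ==> v i = Act (X i) a (c0 i) (f i) (x i)"
    by metis
   obtain h where h: "h \<in> Arr C a s0" "\<forall>i<n. Cmp C a s0 (c0 i) (\<pi> i) h = f i" using s0(3)[OF a f(1)] by blast
   have "v = Act (prod_mod n X) a s0 h \<xi>"
    unfolding act[OF a h(1)] using v h(2) f(2) by (auto simp: fun_eq_iff PiE_def extensional_def)
   with h show ?thesis by blast
  qed
  fix f assume f: "f \<in> Arr C a s0"
  have fi: "Cmp C a s0 (c0 i) (\<pi> i) f \<in> Arr C a (c0 i)" if "i < n" for i
   using cl[OF a s0(1) p(4)[OF that] f s0(2)[OF that]] .
  have "Act (prod_mod n X) a s0 f \<xi> = zr (prod_mod n X) a \<longleftrightarrow>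
   (\<forall>i<n. Act (X i) a (c0 i) (Cmp C a s0 (c0 i) (\<pi> i) f) (x i) = zr (X i) a)"
   unfolding act[OF a f] by (auto simp: fun_eq_iff)
  also have "\<dots> \<longleftrightarrow> (\<forall>i<n. \<exists>h\<in>Arr C a (c1 i). Cmp C a s0 (c0 i) (\<pi> i) f = Cmp C a (c1 i) (c0 i) (g i) h)"
   using p(7)[OF _ a fi] by simp
  also have "\<dots> \<longleftrightarrow> (\<exists>h\<in>Arr C a s1. f = Cmp C a s1 s0 G h)"
  proof
   assume "\<forall>i<n. \<exists>h\<in>Arr C a (c1 i). Cmp C a s0 (c0 i) (\<pi> i) f = Cmp C a (c1 i) (c0 i) (g i) h"
   then obtain h where h: "\<And>i. i < n ==> h i \<in> Arr C a (c1 i)"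
    "\<And>i. i < n ==> Cmp C a s0 (c0 i) (\<pi> i) f = Cmp C a (c1 i) (c0 i) (g i) (h i)" by metis
   obtain l where l: "l \<in> Arr C a s1" "\<forall>i<n. Cmp C a s1 (c1 i) (\<pi>1 i) l = h i" using s1(3)[OF a h(1)] by blast
   have Gl: "Cmp C a s1 s0 G l \<in> Arr C a s0" by (rule cl[OF a s1(1) s0(1) l(1) G(1)])
   have "f = Cmp C a s1 s0 G l"
   proof (rule s0(4)[OF a f Gl])
    fix i assume i: "i < n"
    show "Cmp C a s0 (c0 i) (\<pi> i) f = Cmp C a s0 (c0 i) (\<pi> i) (Cmp C a s1 s0 G l)"
     using cmp_assoc'[OF C a s1(1) s0(1) p(4)[OF i] l(1) G(1) s0(2)[OF i]] G(2)[OF i]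
      cmp_assoc'[OF C a s1(1) p(1)[OF i] p(4)[OF i] l(1) s1(2)[OF i] p(2)[OF i]] l(2) h(2)[OF i] i by simp
   qed
   with l show "\<exists>h\<in>Arr C a s1. f = Cmp C a s1 s0 G h" by blast
  next
   assume "\<exists>h\<in>Arr C a s1. f = Cmp C a s1 s0 G h"
   then obtain l where l: "l \<in> Arr C a s1" "f = Cmp C a s1 s0 G l" by blast
   show "\<forall>i<n. \<exists>h\<in>Arr C a (c1 i). Cmp C a s0 (c0 i) (\<pi> i) f = Cmp C a (c1 i) (c0 i) (g i) h"
   proof (intro allI impI)
    fix i assume i: "i < n"
    show "\<exists>h\<in>Arr C a (c1 i). Cmp C a s0 (c0 i) (\<pi> i) f = Cmp C a (c1 i) (c0 i) (g i) h"
     using cmp_assoc'[OF C a s1(1) s0(1) p(4)[OF i] l(1) G(1) s0(2)[OF i]] G(2)[OF i]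
      cmp_assoc'[OF C a s1(1) p(1)[OF i] p(4)[OF i] l(1) s1(2)[OF i] p(2)[OF i]] l(2)
      cl[OF a s1(1) p(1)[OF i] l(1) s1(2)[OF i]] by (intro bexI) auto
   qed
  qed
  finally show "Act (prod_mod n X) a s0 f \<xi> = zr (prod_mod n X) a \<longleftrightarrow> (\<exists>h\<in>Arr C a s1. f = Cmp C a s1 s0 G h)" .
 qed
 moreover have "cmd C (prod_mod n X)" by (rule prod_mod_cmd) (rule Xc)
 ultimately show ?thesis using fp_iff[OF C, of "prod_mod n X"] by blast
qed

text \<open>Generated by the identity of \<open>c\<close>, with the zero endomorphism of
  \<open>c\<close> as arrow of relations.\<close>

lemma rep_fp:
 assumes C: "lcat C" and c: "c \<in> Obj C"
 shows "fp C (rep C c)"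
proof -
 have "pres C (rep C c) c c \<zero>\<^bsub>Hom C c c\<^esub> (Idt C c)"
  unfolding pres_def gen_def using c vs_closed(1)[OF catD(1)[OF C]]
  by (auto simp: catD[OF C] cmp_zero[OF C])
 with rep_cmd[OF C c] show ?thesis using fp_iff[OF C, of "rep C c"] by blast
qed

section \<open>The abelian category of finitely presented modules\<close>


lemma ex_eqD: "ex C X \<eta> = \<theta> ==> c \<in> Obj C ==> v \<in> El X c ==> \<eta> c v = \<theta> c v"
 by (auto simp: ex_def)

text \<open>Kernels and, below, cokernels computed at every object. Unlike \<open>is_kernel\<close>
  and \<open>is_cokernel\<close> they make sense across value types; for finitely presented modules
  in one universe both notions agree, see \<open>is_kernel_iff\<close> and
  \<open>is_cokernel_iff\<close>.\<close>

definition ker_pt :: "('k, 'o, 'm) lincat => ('k, 'o, 'm, 'v) cmod => ('k, 'o, 'm, 'w) cmod => ('o => 'v => 'w) =>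
  ('k, 'o, 'm, 'u) cmod => ('o => 'u => 'v) => bool" where
 "ker_pt C X Y f M i \<longleftrightarrow> (\<forall>c\<in>Obj C. inj_on (i c) (El M c) \<and>
   (\<forall>v\<in>El X c. f c v = zr Y c \<longleftrightarrow> (\<exists>k\<in>El M c. v = i c k)))"

definition coker_pt :: "('k, 'o, 'm) lincat => ('k, 'o, 'm, 'v) cmod => ('k, 'o, 'm, 'w) cmod => ('o => 'v => 'w) =>
  ('k, 'o, 'm, 'u) cmod => ('o => 'w => 'u) => bool" where
 "coker_pt C X Y f Z p \<longleftrightarrow> (\<forall>c\<in>Obj C. (\<forall>z\<in>El Z c. \<exists>y\<in>El Y c. z = p c y) \<and>
   (\<forall>y\<in>El Y c. p c y = zr Z c \<longleftrightarrow> (\<exists>x\<in>El X c. y = f c x)))"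

lemma ker_ptD:
 assumes "ker_pt C X Y f M i"
 shows "c \<in> Obj C ==> inj_on (i c) (El M c)"
  "c \<in> Obj C ==> v \<in> El X c ==> f c v = zr Y c \<longleftrightarrow> (\<exists>k\<in>El M c. v = i c k)"
 using assms by (auto simp: ker_pt_def)

lemma coker_ptD:
 assumes "coker_pt C X Y f Z p"
 shows "c \<in> Obj C ==> z \<in> El Z c ==> \<exists>y\<in>El Y c. z = p c y"
  "c \<in> Obj C ==> y \<in> El Y c ==> p c y = zr Z c \<longleftrightarrow> (\<exists>x\<in>El X c. y = f c x)"
 using assms by (auto simp: coker_pt_def)

text \<open>The property on which abelianness of mod C hinges: over an additive C cokernels of
  finitely presented modules are again finitely presented, while kernels in general are not. It is
  established for A, B and A/[B] in turn.\<close>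

definition ker_closed :: "'v itself => ('k, 'o, 'm) lincat => bool" where
 "ker_closed (_ :: 'v itself) C \<longleftrightarrow> (\<forall>(X :: ('k, 'o, 'm, 'v) cmod) (Y :: ('k, 'o, 'm, 'v) cmod) \<phi>.
   fp C X --> fp C Y --> nt C X Y \<phi> --> fp C (ker_mod X Y \<phi>))"

lemma ker_mod_pt:
 assumes X: "cmd C X" and Y: "cmd C Y" and f: "nt C X Y f"
 shows "cmd C (ker_mod X Y f)" "nt C (ker_mod X Y f) X (\<lambda>c v. v)" "ker_pt C X Y f (ker_mod X Y f) (\<lambda>c v. v)"
 unfolding ker_mod_def
 using sub_mod_cmd[OF X submod_ker[OF f X Y]] sub_mod_incl[OF submod_ker[OF f X Y]]
 by (auto simp: ker_pt_def)

text \<open>A coset is recovered from any of its elements, so a quotient is no larger than the space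
  and can be copied back into the same universe.\<close>

lemma quot_space_inj:
 assumes V: "vsp V" and N: "subsp V N"
 shows "inj_on (\<lambda>T. SOME t. t \<in> T) (carrier (quot_space V N))"
proof (rule inj_onI)
 have *: "T = N +>\<^bsub>V\<^esub> (SOME t. t \<in> T) \<and> (SOME t. t \<in> T) \<in> carrier V" if T: "T \<in> carrier (quot_space V N)" for T
 proof -
  obtain v where v: "v \<in> carrier V" "T = N +>\<^bsub>V\<^esub> v" using T by (auto simp: quot_sel[OF V N])
  have "(SOME t. t \<in> T) \<in> T" using coset_self[OF V N v(1)] v(2) by (metis someI)
  then show ?thesis using v coset_mem[OF V N v(1)] coset_eq[OF V N _ v(1)] by metis
 qed
 fix T T' assume "T \<in> carrier (quot_space V N)" "T' \<in> carrier (quot_space V N)" "(SOME t. t \<in> T) = (SOME t. t \<in> T')"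
 then show "T = T'" using * by metis
qed

text \<open>An instance of \<open>fp_exact\<close>: of a presentation of X only the generator is
  used.\<close>

lemma coker_fp:
 assumes A: "additive_category K C" and X: "fp C X" and Y: "fp C Y" and f: "nt C X Y f"
 shows "fp C (quot_mod Y (\<lambda>c. f c ` El X c))"
  "coker_pt C X Y f (quot_mod Y (\<lambda>c. f c ` El X c)) (\<lambda>c v. (f c ` El X c) +>\<^bsub>Val Y c\<^esub> v)"
proof -
 have C: "lcat C" using A by (simp add: additive_category_def)
 note Xc = fp_cmd[OF X] and Yc = fp_cmd[OF Y]
 obtain c0 x where g: "gen C X c0 x" using X fp_iff[OF C, of X] by (auto simp: pres_def)
 note N = submod_image[OF f Xc Yc]
 show pt: "coker_pt C X Y f (quot_mod Y (\<lambda>c. f c ` El X c)) (\<lambda>c v. (f c ` El X c) +>\<^bsub>Val Y c\<^esub> v)"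
  using quot_mod_eq_zero[OF C Yc N] quot_mod_carrier(1)[OF C Yc N] by (auto simp: coker_pt_def)
 show "fp C (quot_mod Y (\<lambda>c. f c ` El X c))"
  by (rule fp_exact[OF A Y g Xc quot_mod_cmd[OF C Yc N] f quot_mod_proj[OF C Yc N]])
   (use coker_ptD[OF pt] in auto)
qed

lemma eval_lin:
 assumes "c \<in> Obj C" "v \<in> El X c"
 shows "lin (nat_hom K C X Y) (Val Y c) (\<lambda>\<eta>. \<eta> c v)"
 by (rule linI) (auto simp: assms nat_hom_sel nat_hom_iff dest: ntD(3)[OF _ assms])

text \<open>A tuple is the sum of its one-entry tuples. This is the pointwise form of the equation
  that makes a product a direct sum.\<close>

lemma prod_mod_finsum:
 assumes X: "\<And>i. i < n ==> cmd C (X i)" and c: "c \<in> Obj C" and u: "u \<in> El (prod_mod n X) c"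
 shows "(\<Oplus>\<^bsub>Val (prod_mod n X) c\<^esub>i\<in>{..<n}. (\<lambda>j\<in>{..<n}. if j = i then u j else (zr (X j) c))) = u"
  (is "?S = u")
proof -
 have P: "cmd C (prod_mod n X)" by (rule prod_mod_cmd) (rule X)
 interpret V: vectorspace K "Val (prod_mod n X) c" by (rule cmdD(1)[OF P c])
 have ui: "u i \<in> El (X i) c" if "i < n" for i
  using u that by (simp add: PiE_iff)
 have t: "(\<lambda>j\<in>{..<n}. if j = i then u j else (zr (X j) c)) \<in> El (prod_mod n X) c" for i
  using ui vs_closed(1)[OF cmdD(1)[OF X c]] by (simp add: PiE_iff)
 have S: "?S \<in> El (prod_mod n X) c" using t by (intro V.finsum_closed) auto
 have "?S k = u k" if k: "k < n" for k
 proof -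
  interpret W: vectorspace K "Val (X k) c" by (rule cmdD(1)[OF X[OF k] c])
  have "?S k = (\<Oplus>\<^bsub>Val (X k) c\<^esub>i\<in>{..<n}. (\<lambda>j\<in>{..<n}. if j = i then u j else (zr (X j) c)) k)"
   by (rule lin_finsum[OF ntD(1)[OF prod_mod_proj[OF k] c] V.vectorspace_axioms W.vectorspace_axioms]) (simp, rule t)
  also have "\<dots> = (\<Oplus>\<^bsub>Val (X k) c\<^esub>i\<in>{..<n}. if k = i then u k else (zr (X k) c))"
   using ui[OF k] k W.zero_closed by (intro W.finsum_cong') (simp_all add: Pi_def)
  also have "\<dots> = u k" using u k by (intro W.finsum_singleton[of k _ "\<lambda>_. u k"]) auto
  finally show ?thesis .
 qed
 then show ?thesis using S u by (auto intro!: extensionalityI[of _ "{..<n}"] simp: PiE_def)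
qed

section \<open>Direct sums of finitely presented modules\<close>

lemma mod_cat_lcat: "lcat (mod_cat K C)"
 unfolding mod_cat_def by (rule full_sub_lcat[OF Mod_cat_lcat]) (auto simp: fp_cmd)

text \<open>The product module takes values in \<open>nat => 'v\<close>; the injection
  \<open>j\<close> allows it to be copied into \<open>'v\<close>, and the inclusions and projections
  are conjugated accordingly.\<close>

lemma mod_cat_additive:
 fixes t :: "'v itself" and C :: "('k, 'o, 'm) lincat"
 assumes A: "additive_category K C" and j: "\<exists>j :: (nat => 'v) => 'v. inj j"
 shows "additive_category K (mod_cat K C :: ('k, 'o, 'm, 'v) modcat)"
 unfolding additive_category_def
proof (intro conjI allI impI mod_cat_lcat)
 fix n :: nat and X :: "nat => ('k, 'o, 'm, 'v) cmod"
 assume "\<forall>i<n. X i \<in> Obj (mod_cat K C)"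
 then have X: "\<And>i. i < n ==> fp C (X i)" by simp
 note Xc = fp_cmd[OF X]
 let ?P = "prod_mod n X" let ?S = "copy_mod ?P :: ('k, 'o, 'm, 'v) cmod"
 have C: "lcat C" using A by (simp add: additive_category_def)
 have P: "fp C ?P" by (rule fp_prod[OF A]) (rule X)
 note Pc = fp_cmd[OF P]
 have e: "\<exists>e :: (nat => 'v) => 'v. inj_on e (El ?P c)" for c using j by (blast intro: inj_on_subset)
 note cp = copy_mod[OF Pc e]
 have S: "fp C ?S" by (rule niso_fp[OF C cp(2) P cp(1)])
 have d: "nt C ?S ?P (\<lambda>c. decode (Val ?P c))" and k: "nt C ?P ?S (\<lambda>c. code (Val ?P c))"
  using cp by (auto simp: niso_def)
 have dk: "decode (Val ?P c) (code (Val ?P c) u :: 'v) = u" if "c \<in> Obj C" "u \<in> El ?P c" for c u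
  using decode_code[OF cmdD(1)[OF Pc that(1)] e that(2)] by simp
 have kd: "code (Val ?P c) (decode (Val ?P c) v) = v" if "c \<in> Obj C" "v \<in> El ?S c" for c and v :: 'v
  using that dk by (auto simp: copy_mod_sel copy_space_carrier simp del: prod_mod_sel)
 \<comment> \<open>The inclusion of the i-th factor into the uncopied product.\<close>
 define s where "s = (\<lambda>i c v. \<lambda>j\<in>{..<n}. if j = i then v else (zr (X j) c))"
 have s: "nt C (X i) ?P (s i)" if "i < n" for i
  unfolding s_def
  by (rule prod_mod_tuple, rename_tac j, case_tac "j = i") (use nt_zero[OF Xc] nt_id in auto)
 define \<iota> where "\<iota> = (\<lambda>i. ex C (X i) (\<lambda>c v. code (Val ?P c) (s i c v) :: 'v))"
 define \<pi> where "\<pi> = (\<lambda>i. ex C ?S (\<lambda>c v. decode (Val ?P c) v i))"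
 have \<iota>: "\<iota> i \<in> Nats C (X i) ?S" if "i < n" for i
  unfolding \<iota>_def by (rule nat_homI[OF nt_comp[OF s[OF that] k] Xc[OF that]])
 have \<pi>: "\<pi> i \<in> Nats C ?S (X i)" if "i < n" for i
  unfolding \<pi>_def by (rule nat_homI[OF nt_comp[OF d prod_mod_proj[OF that]] cp(1)])
 note ksc = ntD(3)[OF k _ ntD(3)[OF s]] and sc = ntD(3)[OF s] and dc = ntD(3)[OF d] 
 have dci: "decode (Val ?P c) v i \<in> El (X i) c" if "i < n" "c \<in> Obj C" "v \<in> El ?S c" for c v i
  using dc[OF that(2,3)] that(1) by auto
 have "is_direct_sum (mod_cat K C) n X ?S"
  unfolding is_direct_sum_def
 proof (rule conjI, use S in simp, rule conjI, use X in simp, rule exI[of _ \<iota>], rule exI[of _ \<pi>], intro conjI allI impI)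
  fix i j assume ij: "i < n" "j < n"
  have "ex C (X i) (\<lambda>c v. \<pi> j c (\<iota> i c v)) =
   (if i = j then ex C (X i) (\<lambda>c v. v) else ex C (X i) (\<lambda>c v. (zr (X j) c)))"
   using ij by (auto simp: ex_eq_iff \<pi>_def \<iota>_def ksc dk sc simp del: prod_mod_sel) (auto simp: s_def)
  then show "Cmp (mod_cat K C) (X i) ?S (X j) (\<pi> j) (\<iota> i) =
   (if i = j then Idt (mod_cat K C) (X i) else \<zero>\<^bsub>Hom (mod_cat K C) (X i) (X j)\<^esub>)"
   by (simp add: nat_hom_sel)
 next
  let ?H = "nat_hom K C ?S ?S"
  interpret H: vectorspace K ?H by (rule nat_hom_vsp[OF cp(1,1)])
  let ?c = "\<lambda>i. ex C ?S (\<lambda>c v. \<iota> i c (\<pi> i c v))"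
  have t: "?c i \<in> carrier ?H" if "i < n" for i
   by (rule nat_homI[OF nt_comp[OF nat_homD(1)[OF \<pi>[OF that]] nat_homD(1)[OF \<iota>[OF that]]] cp(1)])
  have sum: "(\<Oplus>\<^bsub>?H\<^esub>i\<in>{..<n}. ?c i) \<in> carrier ?H" using t by (intro H.finsum_closed) auto
  have "(\<Oplus>\<^bsub>?H\<^esub>i\<in>{..<n}. ?c i) = ex C ?S (\<lambda>c v. v)"
  proof (rule nat_hom_eqI[OF sum nat_homI[OF nt_id cp(1)]])
   fix c v assume c: "c \<in> Obj C" and v: "v \<in> El ?S c"
   interpret V: vectorspace K "Val ?S c" by (rule cmdD(1)[OF cp(1) c])
   have sc': "s i c (decode (Val ?P c) v i) \<in> El ?P c" if "i < n" for i
    by (rule sc[OF that c dci[OF that c v]])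
   have "(\<Oplus>\<^bsub>?H\<^esub>i\<in>{..<n}. ?c i) c v = (\<Oplus>\<^bsub>Val ?S c\<^esub>i\<in>{..<n}. ?c i c v)"
    by (rule lin_finsum[OF eval_lin[OF c v] H.vectorspace_axioms V.vectorspace_axioms]) (auto intro: t)
   also have "\<dots> = (\<Oplus>\<^bsub>Val ?S c\<^esub>i\<in>{..<n}. code (Val ?P c) (s i c (decode (Val ?P c) v i)))"
    using c v dci ksc by (intro V.finsum_cong') (auto simp: \<iota>_def \<pi>_def)
   also have "\<dots> = code (Val ?P c) (\<Oplus>\<^bsub>Val ?P c\<^esub>i\<in>{..<n}. s i c (decode (Val ?P c) v i))"
    using sc' by (intro lin_finsum[OF ntD(1)[OF k c] cmdD(1)[OF Pc c] V.vectorspace_axioms, symmetric]) auto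
   also have "(\<Oplus>\<^bsub>Val ?P c\<^esub>i\<in>{..<n}. s i c (decode (Val ?P c) v i)) =
    (\<Oplus>\<^bsub>Val ?P c\<^esub>i\<in>{..<n}. (\<lambda>j\<in>{..<n}. if j = i then decode (Val ?P c) v j else (zr (X j) c)))"
   proof -
    have "s i c (decode (Val ?P c) v i) = (\<lambda>j\<in>{..<n}. if j = i then decode (Val ?P c) v j else (zr (X j) c))" for i
     by (auto simp: s_def restrict_def fun_eq_iff)
    then show ?thesis by simp
   qed
   also have "\<dots> = decode (Val ?P c) v" by (rule prod_mod_finsum[OF Xc c dc[OF c v]])
   also have "code (Val ?P c) \<dots> = v" by (rule kd[OF c v])
   finally show "(\<Oplus>\<^bsub>?H\<^esub>i\<in>{..<n}. ?c i) c v = ex C ?S (\<lambda>c v. v) c v" using c v by simp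
  qed
  then show "(\<Oplus>\<^bsub>Hom (mod_cat K C) ?S ?S\<^esub>i\<in>{..<n}. Cmp (mod_cat K C) ?S (X i) ?S (\<iota> i) (\<pi> i)) =
   Idt (mod_cat K C) ?S"
   by simp
 qed (use \<iota> \<pi> in auto)
 then show "\<exists>S. is_direct_sum (mod_cat K C) n X S" by blast
qed

context
 fixes C :: "('k, 'o, 'm) lincat" and t :: "'v itself"
 assumes A: "additive_category K C" and KC: "ker_closed TYPE('v) C" and j: "\<exists>j :: (nat => 'v) => 'v. inj j"
begin

abbreviation (input) fpmod :: "('k, 'o, 'm, 'v) modcat" where "fpmod \<equiv> mod_cat K C"

lemma lcatC: "lcat C" using A by (simp add: additive_category_def)

lemma ker_ex:
 fixes X Y :: "('k, 'o, 'm, 'v) cmod"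
 assumes X: "fp C X" and Y: "fp C Y" and f: "nt C X Y f"
 shows "\<exists>(N :: ('k, 'o, 'm, 'v) cmod) i. fp C N \<and> i \<in> Nats C N X \<and> ker_pt C X Y f N i"
proof (intro exI conjI)
 note p = ker_mod_pt[OF fp_cmd[OF X] fp_cmd[OF Y] f]
 show "fp C (ker_mod X Y f)" using KC X Y f by (auto simp: ker_closed_def)
 show "ex C (ker_mod X Y f) (\<lambda>c v. v) \<in> Nats C (ker_mod X Y f) X"
  by (rule nat_homI[OF p(2,1)])
 show "ker_pt C X Y f (ker_mod X Y f) (ex C (ker_mod X Y f) (\<lambda>c v. v))"
  using p(3) by (auto simp: ker_pt_def inj_on_def)
qed

text \<open>The quotient module has cosets as values; it is brought back into \<open>'v\<close> by
  choosing representatives.\<close>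

lemma coker_ex:
 fixes X Y :: "('k, 'o, 'm, 'v) cmod"
 assumes X: "fp C X" and Y: "fp C Y" and f: "nt C X Y f"
 shows "\<exists>(Z :: ('k, 'o, 'm, 'v) cmod) p. fp C Z \<and> p \<in> Nats C Y Z \<and> coker_pt C X Y f Z p"
proof -
 let ?N = "\<lambda>c. f c ` El X c" let ?Q = "quot_mod Y ?N" let ?Z = "copy_mod ?Q :: ('k, 'o, 'm, 'v) cmod"
 note Xc = fp_cmd[OF X] and Yc = fp_cmd[OF Y]
 note N = submod_image[OF f Xc Yc]
 note Q = coker_fp[OF A X Y f]
 have e: "\<exists>e :: 'v set => 'v. inj_on e (El ?Q c)" if "c \<in> Obj C" for c
  using quot_space_inj[OF cmdD(1)[OF Yc that] submodD(1)[OF N that]] by (auto simp: quot_mod_sel)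
 note cp = copy_mod[OF fp_cmd[OF Q(1)] e]
 have n: "nt C ?Q ?Z (\<lambda>c. code (Val ?Q c))" and b: "\<And>c. c \<in> Obj C ==> bij_betw (code (Val ?Q c) :: 'v set => 'v) (El ?Q c) (El ?Z c)"
  using cp(2) by (auto simp: niso_def)
 let ?q = "\<lambda>c v. ?N c +>\<^bsub>Val Y c\<^esub> v"
 note q = quot_mod_proj[OF lcatC Yc N]
 let ?p = "ex C Y (\<lambda>c v. code (Val ?Q c) (?q c v)) :: 'o => 'v => 'v"
 have "fp C ?Z" by (rule niso_fp[OF lcatC cp(2) Q(1) cp(1)])
 moreover have "?p \<in> Nats C Y ?Z" by (rule nat_homI[OF nt_comp[OF q n] Yc])
 moreover have "coker_pt C X Y f ?Z ?p"
  unfolding coker_pt_def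
 proof (intro ballI conjI)
  fix c assume c: "c \<in> Obj C"
  show "\<exists>y\<in>El Y c. z = ?p c y" if "z \<in> El ?Z c" for z
  proof -
   have "z \<in> code (Val ?Q c) ` El ?Q c" using bij_betw_imp_surj_on[OF b[OF c]] that by simp
   then obtain T where T: "T \<in> El ?Q c" "z = code (Val ?Q c) T" by blast
   obtain y where "y \<in> El Y c" "T = ?q c y" using coker_ptD(1)[OF Q(2) c T(1)] by blast
   with T c show ?thesis by auto
  qed
  fix y assume y: "y \<in> El Y c"
  have qy: "?q c y \<in> El ?Q c" by (rule ntD(3)[OF q c y])
  have "?p c y = zr ?Z c \<longleftrightarrow> code (Val ?Q c) (?q c y) = (code (Val ?Q c) (zr ?Q c) :: 'v)"
   using c y nt_zero_app[OF n fp_cmd[OF Q(1)] cp(1) c] by simp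
  also have "\<dots> \<longleftrightarrow> ?q c y = zr ?Q c"
   by (rule inj_on_eq_iff[OF bij_betw_imp_inj_on[OF b[OF c]] qy vs_closed(1)[OF cmdD(1)[OF fp_cmd[OF Q(1)] c]]])
  also have "\<dots> \<longleftrightarrow> (\<exists>x\<in>El X c. y = f c x)" by (rule coker_ptD(2)[OF Q(2) c y])
  finally show "?p c y = zr ?Z c \<longleftrightarrow> (\<exists>x\<in>El X c. y = f c x)" .
 qed
 ultimately show ?thesis by blast
qed

section \<open>Agreement of pointwise and categorical kernels and cokernels\<close>

lemma ker_pt_is_kernel:
 fixes X Y N :: "('k, 'o, 'm, 'v) cmod"
 assumes X: "fp C X" and Y: "fp C Y" and N: "fp C N"
  and f: "f \<in> Nats C X Y" and i: "i \<in> Nats C N X" and p: "ker_pt C X Y f N i"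
 shows "is_kernel fpmod X Y f N i"
proof -
 note ni = nat_homD[OF i] and nf = nat_homD[OF f]
 have "\<exists>!u. u \<in> Nats C W N \<and> ex C W (\<lambda>c v. i c (u c v)) = g"
  if W: "fp C W" and g: "g \<in> Nats C W X"
   and z: "ex C W (\<lambda>c v. f c (g c v)) = ex C W (\<lambda>c v. (zr Y c))" for W :: "('k, 'o, 'm, 'v) cmod" and g
 proof -
  note ng = nat_homD[OF g]
  have z': "f c (g c w) = zr Y c" if h: "c \<in> Obj C" "w \<in> El W c" for c w
   using z h unfolding ex_eq_iff by blast
  have im: "\<exists>k\<in>El N c. g c w = i c k" if h: "c \<in> Obj C" "w \<in> El W c" for c w
   using ker_ptD(2)[OF p h(1) ntD(3)[OF ng(1) h]] z'[OF h] by simp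
  obtain u where u: "nt C W N u" "\<forall>c\<in>Obj C. \<forall>w\<in>El W c. i c (u c w) = g c w"
   using nt_factor_inj[OF fp_cmd[OF N] fp_cmd[OF X] fp_cmd[OF W] ni(1) ker_ptD(1)[OF p] ng(1) im] by blast
  show ?thesis
  proof (rule ex1I[of _ "ex C W u"], rule conjI)
   show "ex C W u \<in> Nats C W N" by (rule nat_homI[OF u(1) fp_cmd[OF W]])
   have "ex C W (\<lambda>c v. i c (ex C W u c v)) = ex C W g" using u(2) by (simp add: ex_eq_iff)
   then show "ex C W (\<lambda>c v. i c (ex C W u c v)) = g" using ng(2) by simp
   fix u' assume u': "u' \<in> Nats C W N \<and> ex C W (\<lambda>c v. i c (u' c v)) = g"
   show "u' = ex C W u"
   proof (rule nat_hom_eqI[OF conjunct1[OF u'] nat_homI[OF u(1) fp_cmd[OF W]]])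
    fix c w assume h: "c \<in> Obj C" "w \<in> El W c"
    have "i c (u' c w) = i c (u c w)" using ex_eqD[OF conjunct2[OF u'] h] u(2) h by simp
    then show "u' c w = ex C W u c w"
     using ker_ptD(1)[OF p h(1)] ntD(3)[OF nat_homD(1)[OF conjunct1[OF u']] h] ntD(3)[OF u(1) h] h
     by (simp add: inj_on_eq_iff)
   qed
  qed
 qed
 moreover have "ex C N (\<lambda>c v. f c (i c v)) = ex C N (\<lambda>c v. (zr Y c))"
  unfolding ex_eq_iff using ker_ptD(2)[OF p] ntD(3)[OF ni(1)] by blast
 ultimately show ?thesis using f i N by (simp add: is_kernel_def nat_hom_sel)
qed

lemma coker_pt_is_cokernel:
 fixes X Y Z :: "('k, 'o, 'm, 'v) cmod"
 assumes X: "fp C X" and Y: "fp C Y" and Z: "fp C Z"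
  and f: "f \<in> Nats C X Y" and i: "i \<in> Nats C Y Z" and p: "coker_pt C X Y f Z i"
 shows "is_cokernel fpmod X Y f Z i"
proof -
 note ni = nat_homD[OF i] and nf = nat_homD[OF f]
 have "\<exists>!u. u \<in> Nats C Z W \<and> ex C Y (\<lambda>c v. u c (i c v)) = g"
  if W: "fp C W" and g: "g \<in> Nats C Y W"
   and z: "ex C X (\<lambda>c v. g c (f c v)) = ex C X (\<lambda>c v. (zr W c))" for W :: "('k, 'o, 'm, 'v) cmod" and g
 proof -
  note ng = nat_homD[OF g]
  have z': "g c (f c x) = zr W c" if h: "c \<in> Obj C" "x \<in> El X c" for c x
   using z h unfolding ex_eq_iff by blast
  have k0: "g c y = zr W c" if h: "c \<in> Obj C" "y \<in> El Y c" "i c y = zr Z c" for c y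
   using coker_ptD(2)[OF p h(1,2)] h(3) z'[OF h(1)] by blast
  obtain u where u: "nt C Z W u" "\<forall>c\<in>Obj C. \<forall>y\<in>El Y c. u c (i c y) = g c y"
   using nt_factor_surj[OF fp_cmd[OF Y] fp_cmd[OF Z] fp_cmd[OF W] ni(1) coker_ptD(1)[OF p] ng(1) k0] by blast
  show ?thesis
  proof (rule ex1I[of _ "ex C Z u"], rule conjI)
   show "ex C Z u \<in> Nats C Z W" by (rule nat_homI[OF u(1) fp_cmd[OF Z]])
   have "ex C Y (\<lambda>c v. ex C Z u c (i c v)) = ex C Y g" using u(2) by (simp add: ex_eq_iff ntD(3)[OF ni(1)])
   then show "ex C Y (\<lambda>c v. ex C Z u c (i c v)) = g" using ng(2) by simp
   fix u' assume u': "u' \<in> Nats C Z W \<and> ex C Y (\<lambda>c v. u' c (i c v)) = g"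
   show "u' = ex C Z u"
   proof (rule nat_hom_eqI[OF conjunct1[OF u'] nat_homI[OF u(1) fp_cmd[OF Z]]])
    fix c z assume h: "c \<in> Obj C" "z \<in> El Z c"
    obtain y where y: "y \<in> El Y c" "z = i c y" using coker_ptD(1)[OF p h] by blast
    have "u' c (i c y) = u c (i c y)" using ex_eqD[OF conjunct2[OF u'] h(1) y(1)] u(2) h(1) y(1) by simp
    then show "u' c z = ex C Z u c z" using h y by simp
   qed
  qed
 qed
 moreover have "ex C X (\<lambda>c v. i c (f c v)) = ex C X (\<lambda>c v. zr Z c)"
  unfolding ex_eq_iff using coker_ptD(2)[OF p] ntD(3)[OF nf(1)] by blast
 ultimately show ?thesis using f i Z by (simp add: is_cokernel_def nat_hom_sel)
qed

text \<open>A categorical kernel N is compared with a pointwise kernel N0, which exists by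
  \<open>ker_closed\<close>. The inclusion of N factors through N0 by \<open>a\<close>, that of N0
  through N by \<open>u\<close>, and uniqueness of factorizations makes \<open>a\<close> a section
  of \<open>u\<close>; so the pointwise properties of N0 descend to N.\<close>

lemma is_kernel_iff:
 fixes X Y N :: "('k, 'o, 'm, 'v) cmod"
 assumes X: "fp C X" and Y: "fp C Y" and N: "fp C N"
  and f: "f \<in> Nats C X Y" and i: "i \<in> Nats C N X"
 shows "is_kernel fpmod X Y f N i \<longleftrightarrow> ker_pt C X Y f N i"
proof
 assume k: "is_kernel fpmod X Y f N i"
 note ni = nat_homD[OF i] and nf = nat_homD[OF f]
 have zero: "ex C N (\<lambda>c v. f c (i c v)) = ex C N (\<lambda>c v. (zr Y c))"
  using k by (simp add: is_kernel_def nat_hom_sel)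
 have U: "\<exists>!u. u \<in> Nats C W N \<and> ex C W (\<lambda>c v. i c (u c v)) = g"
  if "fp C W" "g \<in> Nats C W X" "ex C W (\<lambda>c v. f c (g c v)) = ex C W (\<lambda>c v. (zr Y c))"
  for W :: "('k, 'o, 'm, 'v) cmod" and g
  using k that by (simp add: is_kernel_def nat_hom_sel)
 obtain N0 :: "('k, 'o, 'm, 'v) cmod" and i0 where N0: "fp C N0"
  and i0: "i0 \<in> Nats C N0 X" and p0: "ker_pt C X Y f N0 i0"
  using ker_ex[OF X Y nf(1)] by blast
 note ni0 = nat_homD[OF i0]
 have z': "f c (i c n) = zr Y c" if h: "c \<in> Obj C" "n \<in> El N c" for c n
  using zero h unfolding ex_eq_iff by blast
 have im: "\<exists>k\<in>El N0 c. i c n = i0 c k" if h: "c \<in> Obj C" "n \<in> El N c" for c n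
  using ker_ptD(2)[OF p0 h(1) ntD(3)[OF ni(1) h]] z'[OF h] by simp
 obtain a where a: "nt C N N0 a" "\<forall>c\<in>Obj C. \<forall>n\<in>El N c. i0 c (a c n) = i c n"
  using nt_factor_inj[OF fp_cmd[OF N0] fp_cmd[OF X] fp_cmd[OF N] ni0(1) ker_ptD(1)[OF p0] ni(1) im] by blast
 have "ex C N0 (\<lambda>c v. f c (i0 c v)) = ex C N0 (\<lambda>c v. (zr Y c))"
  unfolding ex_eq_iff using ker_ptD(2)[OF p0] ntD(3)[OF ni0(1)] by blast
 then obtain u where u: "u \<in> Nats C N0 N" "ex C N0 (\<lambda>c v. i c (u c v)) = i0"
  using U[OF N0 i0] by blast
 note nu = nat_homD[OF u(1)]
 have iu: "i c (u c v) = i0 c v" if "c \<in> Obj C" "v \<in> El N0 c" for c v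
  by (rule ex_eqD[OF u(2) that])
 \<comment> \<open>Both sides factor \<open>i\<close> through itself, and such a factorization is
   unique.\<close>
 have "ex C N (\<lambda>c v. u c (a c v)) = ex C N (\<lambda>c v. v)"
 proof (rule ex1E[OF U[OF N i zero]])
  fix w assume w: "\<forall>u'. u' \<in> Nats C N N \<and> ex C N (\<lambda>c v. i c (u' c v)) = i --> u' = w"
  have "ex C N (\<lambda>c v. i c (ex C N (\<lambda>c v. u c (a c v)) c v)) = ex C N i"
   using a(2) iu ntD(3)[OF a(1)] by (simp add: ex_eq_iff)
  then have 1: "ex C N (\<lambda>c v. u c (a c v)) = w"
   using w nat_homI[OF nt_comp[OF a(1) nu(1)] fp_cmd[OF N]] ni(2) by simp
  have "ex C N (\<lambda>c v. i c (ex C N (\<lambda>c v. v) c v)) = ex C N i" by (simp add: ex_eq_iff)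
  then have 2: "ex C N (\<lambda>c v. v) = w" using w nat_homI[OF nt_id fp_cmd[OF N]] ni(2) by simp
  show ?thesis using 1 2 by simp
 qed
 then have ua: "u c (a c n) = n" if "c \<in> Obj C" "n \<in> El N c" for c n
  using that by (auto simp: ex_eq_iff)
 show "ker_pt C X Y f N i"
  unfolding ker_pt_def
 proof (intro ballI conjI inj_onI iffI)
  fix c m n assume h: "c \<in> Obj C" "m \<in> El N c" "n \<in> El N c" "i c m = i c n"
  then have "i0 c (a c m) = i0 c (a c n)" using a(2) by simp
  then have "a c m = a c n" using ker_ptD(1)[OF p0 h(1)] ntD(3)[OF a(1)] h by (simp add: inj_on_eq_iff)
  then show "m = n" using ua h by metis
 next
  fix c v assume h: "c \<in> Obj C" "v \<in> El X c" "f c v = zr Y c"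
  then obtain k where "k \<in> El N0 c" "v = i0 c k" using ker_ptD(2)[OF p0 h(1,2)] by blast
  then show "\<exists>k\<in>El N c. v = i c k" using iu[OF h(1)] ntD(3)[OF nu(1) h(1)] by metis
 next
  fix c v assume "c \<in> Obj C" "\<exists>k\<in>El N c. v = i c k"
  then show "f c v = zr Y c" using z' by blast
 qed
qed (rule ker_pt_is_kernel[OF X Y N f i])

text \<open>Dual to \<open>is_kernel_iff\<close>: comparison with the copied pointwise cokernel Z0
  gives maps in both directions, and uniqueness shows that \<open>a\<close> after \<open>u\<close>
  is the identity of Z.\<close>

lemma is_cokernel_iff:
 fixes X Y Z :: "('k, 'o, 'm, 'v) cmod"
 assumes X: "fp C X" and Y: "fp C Y" and Z: "fp C Z"
  and f: "f \<in> Nats C X Y" and p: "p \<in> Nats C Y Z"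
 shows "is_cokernel fpmod X Y f Z p \<longleftrightarrow> coker_pt C X Y f Z p"
proof
 assume k: "is_cokernel fpmod X Y f Z p"
 note np = nat_homD[OF p] and nf = nat_homD[OF f]
 have zero: "ex C X (\<lambda>c v. p c (f c v)) = ex C X (\<lambda>c v. zr Z c)"
  using k by (simp add: is_cokernel_def nat_hom_sel)
 have U: "\<exists>!u. u \<in> Nats C Z W \<and> ex C Y (\<lambda>c v. u c (p c v)) = g"
  if "fp C W" "g \<in> Nats C Y W" "ex C X (\<lambda>c v. g c (f c v)) = ex C X (\<lambda>c v. (zr W c))"
  for W :: "('k, 'o, 'm, 'v) cmod" and g
  using k that by (simp add: is_cokernel_def nat_hom_sel)
 obtain Z0 :: "('k, 'o, 'm, 'v) cmod" and p0 where Z0: "fp C Z0"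
  and p0: "p0 \<in> Nats C Y Z0" and c0: "coker_pt C X Y f Z0 p0"
  using coker_ex[OF X Y nf(1)] by blast
 note np0 = nat_homD[OF p0]
 have z': "p c (f c x) = zr Z c" if h: "c \<in> Obj C" "x \<in> El X c" for c x
  using zero h unfolding ex_eq_iff by blast
 have k0: "p c y = zr Z c" if h: "c \<in> Obj C" "y \<in> El Y c" "p0 c y = zr Z0 c" for c y
  using coker_ptD(2)[OF c0 h(1,2)] h(3) z'[OF h(1)] by blast
 obtain a where a: "nt C Z0 Z a" "\<forall>c\<in>Obj C. \<forall>y\<in>El Y c. a c (p0 c y) = p c y"
  using nt_factor_surj[OF fp_cmd[OF Y] fp_cmd[OF Z0] fp_cmd[OF Z] np0(1) coker_ptD(1)[OF c0] np(1) k0] by blast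
 have "ex C X (\<lambda>c v. p0 c (f c v)) = ex C X (\<lambda>c v. (zr Z0 c))"
  unfolding ex_eq_iff using coker_ptD(2)[OF c0] ntD(3)[OF nf(1)] by blast
 then obtain u where u: "u \<in> Nats C Z Z0" "ex C Y (\<lambda>c v. u c (p c v)) = p0"
  using U[OF Z0 p0] by blast
 note nu = nat_homD[OF u(1)]
 have up: "u c (p c v) = p0 c v" if "c \<in> Obj C" "v \<in> El Y c" for c v
  by (rule ex_eqD[OF u(2) that])
 have "ex C Z (\<lambda>c v. a c (u c v)) = ex C Z (\<lambda>c v. v)"
 proof (rule ex1E[OF U[OF Z p zero]])
  fix w assume w: "\<forall>u'. u' \<in> Nats C Z Z \<and> ex C Y (\<lambda>c v. u' c (p c v)) = p --> u' = w"
  have "ex C Y (\<lambda>c v. ex C Z (\<lambda>c v. a c (u c v)) c (p c v)) = ex C Y p"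
   using a(2) up ntD(3)[OF np(1)] by (simp add: ex_eq_iff)
  then have 1: "ex C Z (\<lambda>c v. a c (u c v)) = w"
   using w nat_homI[OF nt_comp[OF nu(1) a(1)] fp_cmd[OF Z]] np(2) by simp
  have "ex C Y (\<lambda>c v. ex C Z (\<lambda>c v. v) c (p c v)) = ex C Y p" using ntD(3)[OF np(1)] by (simp add: ex_eq_iff)
  then have 2: "ex C Z (\<lambda>c v. v) = w" using w nat_homI[OF nt_id fp_cmd[OF Z]] np(2) by simp
  show ?thesis using 1 2 by simp
 qed
 then have au: "a c (u c n) = n" if "c \<in> Obj C" "n \<in> El Z c" for c n
  using that by (auto simp: ex_eq_iff)
 show "coker_pt C X Y f Z p"
  unfolding coker_pt_def
 proof (intro ballI conjI iffI)
  fix c z assume h: "c \<in> Obj C" "z \<in> El Z c"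
  then obtain y where "y \<in> El Y c" "u c z = p0 c y"
   using coker_ptD(1)[OF c0 h(1) ntD(3)[OF nu(1) h]] by blast
  then show "\<exists>y\<in>El Y c. z = p c y" using a(2) au[OF h] h(1) by metis
 next
  fix c y assume h: "c \<in> Obj C" "y \<in> El Y c" "p c y = zr Z c"
  then have "p0 c y = zr Z0 c" using up[OF h(1,2)] nt_zero_app[OF nu(1) fp_cmd[OF Z] fp_cmd[OF Z0] h(1)] by simp
  then show "\<exists>x\<in>El X c. y = f c x" using coker_ptD(2)[OF c0 h(1,2)] by blast
 next
  fix c y assume "c \<in> Obj C" "\<exists>x\<in>El X c. y = f c x"
  then show "p c y = zr Z c" using z' by blast
 qed
qed (rule coker_pt_is_cokernel[OF X Y Z f p])

theorem abelian_mod_cat: "abelian_category K fpmod"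
 unfolding abelian_category_def
proof (intro conjI ballI mod_cat_additive[OF A j])
 fix X Y :: "('k, 'o, 'm, 'v) cmod" and f
 assume "X \<in> Obj fpmod" "Y \<in> Obj fpmod" and "f \<in> Arr fpmod X Y"
 then have X: "fp C X" and Y: "fp C Y" and f: "f \<in> Nats C X Y"
  by simp_all
 note Xc = fp_cmd[OF X] and Yc = fp_cmd[OF Y] and nf = nat_homD[OF f]
 obtain N :: "('k, 'o, 'm, 'v) cmod" and i where N: "fp C N"
  and i: "i \<in> Nats C N X" and kp: "ker_pt C X Y f N i"
  using ker_ex[OF X Y nf(1)] by blast
 obtain Z :: "('k, 'o, 'm, 'v) cmod" and p where Z: "fp C Z"
  and p: "p \<in> Nats C Y Z" and cp: "coker_pt C X Y f Z p"
  using coker_ex[OF X Y nf(1)] by blast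
 note ni = nat_homD[OF i] and np = nat_homD[OF p] and Nc = fp_cmd[OF N] and Zc = fp_cmd[OF Z]
 show "\<exists>k i. is_kernel fpmod X Y f k i" using ker_pt_is_kernel[OF X Y N f i kp] by blast
 show "\<exists>c p. is_cokernel fpmod X Y f c p" using coker_pt_is_cokernel[OF X Y Z f p cp] by blast
 show "is_mono fpmod X Y f --> (\<exists>z\<in>Obj fpmod. \<exists>g\<in>Arr fpmod Y z. is_kernel fpmod Y z g X f)"
 proof
  assume m: "is_mono fpmod X Y f"
  let ?z = "ex C N (\<lambda>c v. (zr X c))"
  \<comment> \<open>The inclusion of the kernel and the zero map become equal after
    \<open>f\<close>, so a monomorphism has zero kernel. It is therefore injective at every object
    and is the pointwise kernel of its cokernel.\<close>
  have "ex C N (\<lambda>c v. f c (i c v)) = ex C N (\<lambda>c v. f c (?z c v))"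
  proof -
   have "f c (i c v) = f c (?z c v)" if h: "c \<in> Obj C" "v \<in> El N c" for c v
    using ker_ptD(2)[OF kp h(1) ntD(3)[OF ni(1) h]] nt_zero_app[OF nf(1) Xc Yc h(1)] h by auto
   then show ?thesis unfolding ex_eq_iff by blast
  qed
  then have "i = ?z" using m N i nat_homI[OF nt_zero[OF Xc] Nc] by (simp add: is_mono_def)
  then have i0: "i c v = zr X c" if "c \<in> Obj C" "v \<in> El N c" for c v using that by simp
  have "ker_pt C Y Z p X f"
   unfolding ker_pt_def
  proof (intro ballI conjI)
   fix c assume c: "c \<in> Obj C"
   show "inj_on (f c) (El X c)"
    using ker_ptD(2)[OF kp c] i0[OF c] by (subst lin_inj_iff[OF ntD(1)[OF nf(1) c] cmdD(1)[OF Xc c] cmdD(1)[OF Yc c]]) auto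
  qed (rule coker_ptD(2)[OF cp])
  then have "is_kernel fpmod Y Z p X f" by (rule ker_pt_is_kernel[OF Y Z X p f])
  then show "\<exists>z\<in>Obj fpmod. \<exists>g\<in>Arr fpmod Y z. is_kernel fpmod Y z g X f" using Z p by auto
 qed
 show "is_epi fpmod X Y f --> (\<exists>w\<in>Obj fpmod. \<exists>g\<in>Arr fpmod w X. is_cokernel fpmod w X g Y f)"
 proof
  assume m: "is_epi fpmod X Y f"
  let ?z = "ex C Y (\<lambda>c v. zr Z c)"
  \<comment> \<open>Dually, the projection to the cokernel of an epimorphism is zero, so
    \<open>f\<close> is onto at every object and is the cokernel of its kernel.\<close>
  have "ex C X (\<lambda>c v. p c (f c v)) = ex C X (\<lambda>c v. ?z c (f c v))"
  proof -
   have "p c (f c v) = ?z c (f c v)" if h: "c \<in> Obj C" "v \<in> El X c" for c v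
    using coker_ptD(2)[OF cp h(1) ntD(3)[OF nf(1) h]] ntD(3)[OF nf(1) h] h by auto
   then show ?thesis unfolding ex_eq_iff by blast
  qed
  then have "p = ?z" using m Z p nat_homI[OF nt_zero[OF Zc] Yc] by (simp add: is_epi_def)
  then have p0: "p c v = zr Z c" if "c \<in> Obj C" "v \<in> El Y c" for c v using that by simp
  have "coker_pt C N X i Y f"
   unfolding coker_pt_def
  proof (intro ballI conjI)
   fix c y assume "c \<in> Obj C" "y \<in> El Y c"
   then show "\<exists>x\<in>El X c. y = f c x" using coker_ptD(2)[OF cp] p0 by blast
  qed (rule ker_ptD(2)[OF kp])
  then have "is_cokernel fpmod N X i Y f" by (rule coker_pt_is_cokernel[OF N X Y i f])
  then show "\<exists>w\<in>Obj fpmod. \<exists>g\<in>Arr fpmod w X. is_cokernel fpmod w X g Y f" using N i by auto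
 qed
qed

end

section \<open>Functors and adjunctions\<close>


lemma lfI:
 assumes "\<And>x. x \<in> Obj C ==> Fob F x \<in> Obj D"
  and "\<And>x. x \<in> Obj C ==> Far F x x (Idt C x) = Idt D (Fob F x)"
  and "\<And>x y. x \<in> Obj C ==> y \<in> Obj C ==> lin (Hom C x y) (Hom D (Fob F x) (Fob F y)) (Far F x y)"
  and "\<And>x y z f g. x \<in> Obj C ==> y \<in> Obj C ==> z \<in> Obj C ==> f \<in> Arr C x y ==> g \<in> Arr C y z ==>
   Far F x z (Cmp C x y z g f) = Cmp D (Fob F x) (Fob F y) (Fob F z) (Far F y z g) (Far F x y f)"
 shows "linear_functor K C D F"
 using assms by (simp add: linear_functor_def)

lemma lfD:
 assumes "linear_functor K C D F"
 shows "x \<in> Obj C ==> Fob F x \<in> Obj D"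
  "x \<in> Obj C ==> Far F x x (Idt C x) = Idt D (Fob F x)"
  "x \<in> Obj C ==> y \<in> Obj C ==> f \<in> Arr C x y ==> Far F x y f \<in> Arr D (Fob F x) (Fob F y)"
  "x \<in> Obj C ==> y \<in> Obj C ==> z \<in> Obj C ==> f \<in> Arr C x y ==> g \<in> Arr C y z ==>
   Far F x z (Cmp C x y z g f) = Cmp D (Fob F x) (Fob F y) (Fob F z) (Far F y z g) (Far F x y f)"
  "x \<in> Obj C ==> y \<in> Obj C ==> lin (Hom C x y) (Hom D (Fob F x) (Fob F y)) (Far F x y)"
 using assms by (simp_all add: linear_functor_def linD(1)[where f = "Far F x y" and V = "Hom C x y"])

lemma lf_full_sub:
 assumes "linear_functor K C D F" "S \<subseteq> Obj C" "\<And>x. x \<in> S ==> Fob F x \<in> T"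
 shows "linear_functor K (full_sub C S) (full_sub D T) F"
 using assms(2,3) by (intro lfI) (auto simp: lfD[OF assms(1)] subset_iff)

text \<open>An adjunction given by a natural unit with its universal property. Compared with
  \<open>adjoint_pair\<close>, whose bijection is hidden under a quantifier, this form keeps the
  unit available: it restricts to full subcategories unchanged, and its invertibility decides full
  faithfulness.\<close>

definition univ_unit :: "('k, 'o, 'm) lincat => ('k, 'p, 'n) lincat => ('o, 'm, 'p, 'n) funct =>
  ('p, 'n, 'o, 'm) funct => ('o => 'm) => bool" where
 "univ_unit C D F G \<eta> \<longleftrightarrow> linear_functor K C D F \<and> linear_functor K D C G \<and>
   (\<forall>x\<in>Obj C. \<eta> x \<in> Arr C x (Fob G (Fob F x))) \<and>
   (\<forall>x\<in>Obj C. \<forall>x'\<in>Obj C. \<forall>f\<in>Arr C x x'.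
    Cmp C x x' (Fob G (Fob F x')) (\<eta> x') f =
    Cmp C x (Fob G (Fob F x)) (Fob G (Fob F x')) (Far G (Fob F x) (Fob F x') (Far F x x' f)) (\<eta> x)) \<and>
   (\<forall>x\<in>Obj C. \<forall>y\<in>Obj D. \<forall>h\<in>Arr C x (Fob G y).
    \<exists>!k. k \<in> Arr D (Fob F x) y \<and> Cmp C x (Fob G (Fob F x)) (Fob G y) (Far G (Fob F x) y k) (\<eta> x) = h)"

definition univ_counit :: "('k, 'o, 'm) lincat => ('k, 'p, 'n) lincat => ('o, 'm, 'p, 'n) funct =>
  ('p, 'n, 'o, 'm) funct => ('p => 'n) => bool" where
 "univ_counit C D F G \<epsilon> \<longleftrightarrow> linear_functor K C D F \<and> linear_functor K D C G \<and>
   (\<forall>y\<in>Obj D. \<epsilon> y \<in> Arr D (Fob F (Fob G y)) y) \<and>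
   (\<forall>y\<in>Obj D. \<forall>y'\<in>Obj D. \<forall>f\<in>Arr D y y'.
    Cmp D (Fob F (Fob G y)) y y' f (\<epsilon> y) =
    Cmp D (Fob F (Fob G y)) (Fob F (Fob G y')) y' (\<epsilon> y') (Far F (Fob G y) (Fob G y') (Far G y y' f))) \<and>
   (\<forall>x\<in>Obj C. \<forall>y\<in>Obj D. \<forall>h\<in>Arr D (Fob F x) y.
    \<exists>!k. k \<in> Arr C x (Fob G y) \<and> Cmp D (Fob F x) (Fob F (Fob G y)) y (\<epsilon> y) (Far F x (Fob G y) k) = h)"

text \<open>The universal property quantifies over objects only and all arrows of a full subcategory
  are kept, so closure of the two object classes under the functors suffices. This is how
  adjunctions on all modules pass to finitely presented ones.\<close>

lemma univ_unit_full_sub: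
 assumes "univ_unit C D F G \<eta>" "S \<subseteq> Obj C" "T \<subseteq> Obj D" "\<And>x. x \<in> S ==> Fob F x \<in> T" "\<And>y. y \<in> T ==> Fob G y \<in> S"
 shows "univ_unit (full_sub C S) (full_sub D T) F G \<eta>"
 using assms(1) lf_full_sub[OF _ assms(2,4)] lf_full_sub[OF _ assms(3,5)] assms(2,3)
 unfolding univ_unit_def by (simp add: subset_iff)

lemma univ_counit_full_sub:
 assumes "univ_counit C D F G \<epsilon>" "S \<subseteq> Obj C" "T \<subseteq> Obj D" "\<And>x. x \<in> S ==> Fob F x \<in> T" "\<And>y. y \<in> T ==> Fob G y \<in> S"
 shows "univ_counit (full_sub C S) (full_sub D T) F G \<epsilon>"
 using assms(1) lf_full_sub[OF _ assms(2,4)] lf_full_sub[OF _ assms(3,5)] assms(2,3)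
 unfolding univ_counit_def by (simp add: subset_iff)

context
 fixes C :: "('k, 'o, 'm) lincat" and D :: "('k, 'p, 'n) lincat" and F G \<eta>
 assumes C: "lcat C" and D: "lcat D" and u: "univ_unit C D F G \<eta>"
begin

lemma univ_unitD:
 "linear_functor K C D F" "linear_functor K D C G"
 "x \<in> Obj C ==> \<eta> x \<in> Arr C x (Fob G (Fob F x))"
 "x \<in> Obj C ==> x' \<in> Obj C ==> f \<in> Arr C x x' ==>
    Cmp C x x' (Fob G (Fob F x')) (\<eta> x') f =
    Cmp C x (Fob G (Fob F x)) (Fob G (Fob F x')) (Far G (Fob F x) (Fob F x') (Far F x x' f)) (\<eta> x)"
 "x \<in> Obj C ==> y \<in> Obj D ==> h \<in> Arr C x (Fob G y) ==>
    \<exists>k\<in>Arr D (Fob F x) y. Cmp C x (Fob G (Fob F x)) (Fob G y) (Far G (Fob F x) y k) (\<eta> x) = h"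
 using u unfolding univ_unit_def by blast+

lemma univ_unit_closed:
 assumes "x \<in> Obj C" "y \<in> Obj D" "k \<in> Arr D (Fob F x) y"
 shows "Cmp C x (Fob G (Fob F x)) (Fob G y) (Far G (Fob F x) y k) (\<eta> x) \<in> Arr C x (Fob G y)"
 using assms(1,2) univ_unitD(3)[OF assms(1)] lfD(1)[OF univ_unitD(1) assms(1)] lfD(1)[OF univ_unitD(2)]
  lfD(3)[OF univ_unitD(2) _ assms(2,3)] by (intro catD(3)[OF C]) simp_all

lemma univ_unit_inj:
 assumes x: "x \<in> Obj C" and y: "y \<in> Obj D" and k: "k \<in> Arr D (Fob F x) y" "k' \<in> Arr D (Fob F x) y"
  and e: "Cmp C x (Fob G (Fob F x)) (Fob G y) (Far G (Fob F x) y k) (\<eta> x) =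
    Cmp C x (Fob G (Fob F x)) (Fob G y) (Far G (Fob F x) y k') (\<eta> x)"
 shows "k = k'"
proof -
 have "\<exists>!l. l \<in> Arr D (Fob F x) y \<and> Cmp C x (Fob G (Fob F x)) (Fob G y) (Far G (Fob F x) y l) (\<eta> x) =
   Cmp C x (Fob G (Fob F x)) (Fob G y) (Far G (Fob F x) y k) (\<eta> x)"
  using u x y univ_unit_closed[OF x y k(1)] unfolding univ_unit_def by blast
 then show ?thesis using k e by metis
qed

lemma univ_unit_adjoint: "adjoint_pair K C D F G"
 unfolding adjoint_pair_def
proof (intro conjI univ_unitD(1,2) exI[of _ "\<lambda>x y k. Cmp C x (Fob G (Fob F x)) (Fob G y) (Far G (Fob F x) y k) (\<eta> x)"] ballI)
 fix x y assume xy: "x \<in> Obj C" "y \<in> Obj D"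
 show "bij_betw (\<lambda>k. Cmp C x (Fob G (Fob F x)) (Fob G y) (Far G (Fob F x) y k) (\<eta> x)) (Arr D (Fob F x) y) (Arr C x (Fob G y))"
  unfolding bij_betw_def
 proof (intro conjI inj_onI equalityI subsetI)
  fix k k' assume "k \<in> Arr D (Fob F x) y" "k' \<in> Arr D (Fob F x) y"
   "Cmp C x (Fob G (Fob F x)) (Fob G y) (Far G (Fob F x) y k) (\<eta> x) =
    Cmp C x (Fob G (Fob F x)) (Fob G y) (Far G (Fob F x) y k') (\<eta> x)"
  then show "k = k'" by (rule univ_unit_inj[OF xy])
 next
  fix h assume "h \<in> Arr C x (Fob G y)"
  then show "h \<in> (\<lambda>k. Cmp C x (Fob G (Fob F x)) (Fob G y) (Far G (Fob F x) y k) (\<eta> x)) ` Arr D (Fob F x) y"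
   using univ_unitD(5)[OF xy] by blast
 qed (use univ_unit_closed[OF xy] in blast)
next
 fix x x' y y' f g h
 assume x: "x \<in> Obj C" and x': "x' \<in> Obj C" and y: "y \<in> Obj D" and y': "y' \<in> Obj D"
  and f: "f \<in> Arr C x' x" and g: "g \<in> Arr D y y'" and h: "h \<in> Arr D (Fob F x) y"
 note FD = lfD[OF univ_unitD(1)] and GD = lfD[OF univ_unitD(2)]
 note Fx = FD(1)[OF x] FD(1)[OF x'] and Ff = FD(3)[OF x' x f]
 note hf = catD(3)[OF D Fx(2,1) y Ff h]
 have "Far G (Fob F x') y' (Cmp D (Fob F x') y y' g (Cmp D (Fob F x') (Fob F x) y h (Far F x' x f))) =
  Cmp C (Fob G (Fob F x')) (Fob G y) (Fob G y') (Far G y y' g)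
   (Cmp C (Fob G (Fob F x')) (Fob G (Fob F x)) (Fob G y) (Far G (Fob F x) y h) (Far G (Fob F x') (Fob F x) (Far F x' x f)))"
  using GD(4)[OF Fx(2) y y' hf g] GD(4)[OF Fx(2,1) y Ff h] by simp
 moreover note GD(1)[OF Fx(1)] GD(1)[OF Fx(2)] GD(1)[OF y] GD(1)[OF y'] GD(3)[OF y y' g] GD(3)[OF Fx(1) y h]
  GD(3)[OF Fx(2,1) Ff] univ_unitD(3)[OF x] univ_unitD(3)[OF x'] univ_unitD(4)[OF x' x f] x x' f
 ultimately show "Cmp C x' (Fob G (Fob F x')) (Fob G y') (Far G (Fob F x') y'
    (Cmp D (Fob F x') y y' g (Cmp D (Fob F x') (Fob F x) y h (Far F x' x f)))) (\<eta> x') =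
   Cmp C x' (Fob G y) (Fob G y') (Far G y y' g)
    (Cmp C x' x (Fob G y) (Cmp C x (Fob G (Fob F x)) (Fob G y) (Far G (Fob F x) y h) (\<eta> x)) f)"
  by (simp add: cmp_assoc'[OF C] catD(3)[OF C])
qed

text \<open>By naturality of \<eta> and its universal property, \<open>F f = k\<close> amounts to
  \<eta> y after \<open>f\<close> being equal to \<open>G k\<close> after \<eta> x. When \<eta> y is
  invertible this equation has exactly one solution \<open>f\<close>.\<close>

lemma univ_unit_ff:
 assumes i: "\<And>x. x \<in> Obj C ==> is_iso C x (Fob G (Fob F x)) (\<eta> x)"
 shows "fully_faithful C D F"
 unfolding fully_faithful_def
proof (intro ballI)
 fix x y assume x: "x \<in> Obj C" and y: "y \<in> Obj C"
 note FD = lfD[OF univ_unitD(1)] and GD = lfD[OF univ_unitD(2)]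
 let ?z = "Fob G (Fob F y)"
 have z: "?z \<in> Obj C" using FD(1) GD(1) y by blast
 obtain i' where i': "i' \<in> Arr C ?z y" "Cmp C y ?z y i' (\<eta> y) = Idt C y" "Cmp C ?z y ?z (\<eta> y) i' = Idt C ?z"
  using i[OF y] by (auto simp: is_iso_def)
 note \<eta>y = univ_unitD(3)[OF y]
 show "bij_betw (Far F x y) (Arr C x y) (Arr D (Fob F x) (Fob F y))"
  unfolding bij_betw_def
 proof (intro conjI inj_onI equalityI subsetI)
  fix f f' assume f: "f \<in> Arr C x y" "f' \<in> Arr C x y" "Far F x y f = Far F x y f'"
  then have "Cmp C x y ?z (\<eta> y) f = Cmp C x y ?z (\<eta> y) f'" using univ_unitD(4)[OF x y] by simp
  then have "Cmp C x ?z y i' (Cmp C x y ?z (\<eta> y) f) = Cmp C x ?z y i' (Cmp C x y ?z (\<eta> y) f')" by simp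
  then show "f = f'"
   using cmp_assoc'[OF C x y z y _ \<eta>y i'(1), symmetric] f(1,2) i'(2) catD(4)[OF C x y] by simp
 next
  fix k assume k: "k \<in> Arr D (Fob F x) (Fob F y)"
  let ?h = "Cmp C x (Fob G (Fob F x)) ?z (Far G (Fob F x) (Fob F y) k) (\<eta> x)"
  have h: "?h \<in> Arr C x ?z" by (rule univ_unit_closed[OF x FD(1)[OF y] k])
  \<comment> \<open>The preimage of \<open>k\<close> is the inverse of \<eta> y after
    \<open>G k\<close> after \<eta> x.\<close>
  let ?f = "Cmp C x ?z y i' ?h"
  have f: "?f \<in> Arr C x y" by (rule catD(3)[OF C x z y h i'(1)])
  have "Cmp C x y ?z (\<eta> y) ?f = ?h"
   using cmp_assoc'[OF C x z y z h i'(1) \<eta>y] i'(3) catD(4)[OF C x z h] by simp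
  then have "Far F x y ?f = k"
   using univ_unitD(4)[OF x y f] FD(3)[OF x y f] by (intro univ_unit_inj[OF x FD(1)[OF y] _ k]) simp_all
  with f show "k \<in> Far F x y ` Arr C x y" by (intro image_eqI[of _ _ ?f]) simp_all
 qed (use FD(3)[OF x y] in blast)
qed

end

context
 fixes C :: "('k, 'o, 'm) lincat" and D :: "('k, 'p, 'n) lincat" and F G \<epsilon>
 assumes C: "lcat C" and D: "lcat D" and u: "univ_counit C D F G \<epsilon>"
begin

lemma univ_counitD:
 "linear_functor K C D F" "linear_functor K D C G"
 "y \<in> Obj D ==> \<epsilon> y \<in> Arr D (Fob F (Fob G y)) y"
 "y \<in> Obj D ==> y' \<in> Obj D ==> f \<in> Arr D y y' ==>
    Cmp D (Fob F (Fob G y)) y y' f (\<epsilon> y) =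
    Cmp D (Fob F (Fob G y)) (Fob F (Fob G y')) y' (\<epsilon> y') (Far F (Fob G y) (Fob G y') (Far G y y' f))"
 "x \<in> Obj C ==> y \<in> Obj D ==> h \<in> Arr D (Fob F x) y ==>
    \<exists>k\<in>Arr C x (Fob G y). Cmp D (Fob F x) (Fob F (Fob G y)) y (\<epsilon> y) (Far F x (Fob G y) k) = h"
 using u unfolding univ_counit_def by blast+

lemma univ_counit_closed:
 assumes "x \<in> Obj C" "y \<in> Obj D" "k \<in> Arr C x (Fob G y)"
 shows "Cmp D (Fob F x) (Fob F (Fob G y)) y (\<epsilon> y) (Far F x (Fob G y) k) \<in> Arr D (Fob F x) y"
 using assms(1,2) univ_counitD(3)[OF assms(2)] lfD(1)[OF univ_counitD(2) assms(2)] lfD(1)[OF univ_counitD(1)]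
  lfD(3)[OF univ_counitD(1) assms(1) _ assms(3)] by (intro catD(3)[OF D]) simp_all

lemma univ_counit_inj:
 assumes x: "x \<in> Obj C" and y: "y \<in> Obj D" and k: "k \<in> Arr C x (Fob G y)" "k' \<in> Arr C x (Fob G y)"
  and e: "Cmp D (Fob F x) (Fob F (Fob G y)) y (\<epsilon> y) (Far F x (Fob G y) k) =
   Cmp D (Fob F x) (Fob F (Fob G y)) y (\<epsilon> y) (Far F x (Fob G y) k')"
 shows "k = k'"
proof -
 have "\<exists>!l. l \<in> Arr C x (Fob G y) \<and> Cmp D (Fob F x) (Fob F (Fob G y)) y (\<epsilon> y) (Far F x (Fob G y) l) =
   Cmp D (Fob F x) (Fob F (Fob G y)) y (\<epsilon> y) (Far F x (Fob G y) k)"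
  using u x y univ_counit_closed[OF x y k(1)] unfolding univ_counit_def by blast
 then show ?thesis using k e by metis
qed

text \<open>The counit produces the bijection \<psi> in the direction opposite to the one asked for
  in \<open>adjoint_pair\<close>; naturality is verified for \<psi> and transferred to its inverse
  \<phi>.\<close>

lemma univ_counit_adjoint: "adjoint_pair K C D F G"
proof -
 define \<psi> where "\<psi> = (\<lambda>x y k. Cmp D (Fob F x) (Fob F (Fob G y)) y (\<epsilon> y) (Far F x (Fob G y) k))"
 have b: "bij_betw (\<psi> x y) (Arr C x (Fob G y)) (Arr D (Fob F x) y)" if xy: "x \<in> Obj C" "y \<in> Obj D" for x y
  unfolding bij_betw_def
 proof (intro conjI inj_onI equalityI subsetI)
  fix k k' assume "k \<in> Arr C x (Fob G y)" "k' \<in> Arr C x (Fob G y)" "\<psi> x y k = \<psi> x y k'"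
  then show "k = k'" unfolding \<psi>_def by (rule univ_counit_inj[OF xy])
 next
  fix h assume "h \<in> Arr D (Fob F x) y"
  then show "h \<in> \<psi> x y ` Arr C x (Fob G y)" using univ_counitD(5)[OF xy] unfolding \<psi>_def by blast
 qed (use univ_counit_closed[OF xy] \<psi>_def in auto)
 define \<phi> where "\<phi> = (\<lambda>x y. inv_into (Arr C x (Fob G y)) (\<psi> x y))"
 have \<phi>: "\<phi> x y h \<in> Arr C x (Fob G y)" "\<psi> x y (\<phi> x y h) = h" if "x \<in> Obj C" "y \<in> Obj D" "h \<in> Arr D (Fob F x) y" for x y h
  using bij_betw_inv_into_right[OF b[OF that(1,2)] that(3)] bij_betw_inv_into[OF b[OF that(1,2)]] that(3)
  by (auto simp: \<phi>_def bij_betw_def)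
 show ?thesis
  unfolding adjoint_pair_def
 proof (intro conjI univ_counitD(1,2) exI[of _ \<phi>] ballI)
  fix x y assume "x \<in> Obj C" "y \<in> Obj D"
  then show "bij_betw (\<phi> x y) (Arr D (Fob F x) y) (Arr C x (Fob G y))"
   unfolding \<phi>_def by (rule bij_betw_inv_into[OF b])
 next
  fix x x' y y' f g h
  assume x: "x \<in> Obj C" and x': "x' \<in> Obj C" and y: "y \<in> Obj D" and y': "y' \<in> Obj D"
   and f: "f \<in> Arr C x' x" and g: "g \<in> Arr D y y'" and h: "h \<in> Arr D (Fob F x) y"
  note FD = lfD[OF univ_counitD(1)] and GD = lfD[OF univ_counitD(2)]
  note Fx = FD(1)[OF x] FD(1)[OF x'] and Ff = FD(3)[OF x' x f] and Gy = GD(1)[OF y] GD(1)[OF y'] and Gg = GD(3)[OF y y' g]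
  note k = \<phi>[OF x y h]
  note kf = catD(3)[OF C x' x Gy(1) f k(1)]
  note l = catD(3)[OF C x' Gy(1,2) kf Gg]
  note FG = FD(1)[OF Gy(1)] FD(1)[OF Gy(2)]
  have "Far F x' (Fob G y') (Cmp C x' (Fob G y) (Fob G y') (Far G y y' g) (Cmp C x' x (Fob G y) (\<phi> x y h) f)) =
   Cmp D (Fob F x') (Fob F (Fob G y)) (Fob F (Fob G y')) (Far F (Fob G y) (Fob G y') (Far G y y' g))
    (Cmp D (Fob F x') (Fob F x) (Fob F (Fob G y)) (Far F x (Fob G y) (\<phi> x y h)) (Far F x' x f))"
   using FD(4)[OF x' Gy(1,2) kf Gg] FD(4)[OF x' x Gy(1) f k(1)] by simp
  then have "\<psi> x' y' (Cmp C x' (Fob G y) (Fob G y') (Far G y y' g) (Cmp C x' x (Fob G y) (\<phi> x y h) f)) =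
   Cmp D (Fob F x') (Fob F (Fob G y)) y' (Cmp D (Fob F (Fob G y)) (Fob F (Fob G y')) y' (\<epsilon> y') (Far F (Fob G y) (Fob G y') (Far G y y' g)))
    (Cmp D (Fob F x') (Fob F x) (Fob F (Fob G y)) (Far F x (Fob G y) (\<phi> x y h)) (Far F x' x f))"
   using FG Fx y y' FD(3)[OF Gy Gg] FD(3)[OF x Gy(1) k(1)] Ff univ_counitD(3)[OF y']
   by (simp add: \<psi>_def cmp_assoc'[OF D] catD(3)[OF D])
  also have "\<dots> = Cmp D (Fob F x') y y' g (Cmp D (Fob F x') (Fob F x) y (\<psi> x y (\<phi> x y h)) (Far F x' x f))"
   using FG Fx y y' FD(3)[OF x Gy(1) k(1)] Ff univ_counitD(3)[OF y] g
   by (simp add: \<psi>_def cmp_assoc'[OF D] catD(3)[OF D] univ_counitD(4)[OF y y' g, symmetric])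
  finally have "\<psi> x' y' (Cmp C x' (Fob G y) (Fob G y') (Far G y y' g) (Cmp C x' x (Fob G y) (\<phi> x y h) f)) =
   Cmp D (Fob F x') y y' g (Cmp D (Fob F x') (Fob F x) y h (Far F x' x f))"
   using k(2) by simp
  then show "\<phi> x' y' (Cmp D (Fob F x') y y' g (Cmp D (Fob F x') (Fob F x) y h (Far F x' x f))) =
   Cmp C x' (Fob G y) (Fob G y') (Far G y y' g) (Cmp C x' x (Fob G y) (\<phi> x y h) f)"
   using bij_betw_inv_into_left[OF b[OF x' y'] l] by (simp add: \<phi>_def)
 qed
qed

lemma univ_counit_ff:
 assumes i: "\<And>y. y \<in> Obj D ==> is_iso D (Fob F (Fob G y)) y (\<epsilon> y)"
 shows "fully_faithful D C G"
 unfolding fully_faithful_def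
proof (intro ballI)
 fix x y assume x: "x \<in> Obj D" and y: "y \<in> Obj D"
 note FD = lfD[OF univ_counitD(1)] and GD = lfD[OF univ_counitD(2)]
 let ?z = "Fob F (Fob G x)"
 have z: "?z \<in> Obj D" using FD(1) GD(1) x by blast
 obtain i' where i': "i' \<in> Arr D x ?z" "Cmp D ?z x ?z i' (\<epsilon> x) = Idt D ?z" "Cmp D x ?z x (\<epsilon> x) i' = Idt D x"
  using i[OF x] by (auto simp: is_iso_def)
 note \<epsilon>x = univ_counitD(3)[OF x]
 show "bij_betw (Far G x y) (Arr D x y) (Arr C (Fob G x) (Fob G y))"
  unfolding bij_betw_def
 proof (intro conjI inj_onI equalityI subsetI)
  fix f f' assume f: "f \<in> Arr D x y" "f' \<in> Arr D x y" "Far G x y f = Far G x y f'"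
  then have "Cmp D ?z x y f (\<epsilon> x) = Cmp D ?z x y f' (\<epsilon> x)" using univ_counitD(4)[OF x y] by simp
  then have "Cmp D x ?z y (Cmp D ?z x y f (\<epsilon> x)) i' = Cmp D x ?z y (Cmp D ?z x y f' (\<epsilon> x)) i'" by simp
  then show "f = f'"
   using cmp_assoc'[OF D x z x y i'(1) \<epsilon>x] f(1,2) i'(3) catD(5)[OF D x y] by simp
 next
  fix k assume k: "k \<in> Arr C (Fob G x) (Fob G y)"
  let ?h = "Cmp D ?z (Fob F (Fob G y)) y (\<epsilon> y) (Far F (Fob G x) (Fob G y) k)"
  have h: "?h \<in> Arr D ?z y" by (rule univ_counit_closed[OF GD(1)[OF x] y k])
  let ?f = "Cmp D x ?z y ?h i'"
  have f: "?f \<in> Arr D x y" by (rule catD(3)[OF D x z y i'(1) h])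
  have "Cmp D ?z x y ?f (\<epsilon> x) = ?h"
   using cmp_assoc'[OF D z x z y \<epsilon>x i'(1) h] i'(2) catD(5)[OF D z y h] by simp
  then have "Far G x y ?f = k"
   using univ_counitD(4)[OF x y f] GD(3)[OF x y f] by (intro univ_counit_inj[OF GD(1)[OF x] y _ k]) simp_all
  with f show "k \<in> Far G x y ` Arr D x y" by (intro image_eqI[of _ _ ?f]) simp_all
 qed (use GD(3)[OF x y] in blast)
qed

end

section \<open>Equivalences and Serre quotients\<close>

lemma iso_comp:
 assumes D: "lcat D" and "x \<in> Obj D" "y \<in> Obj D" "z \<in> Obj D" and f: "is_iso D x y f" and g: "is_iso D y z g"
 shows "is_iso D x z (Cmp D x y z g f)"
proof -
 obtain f' g' where f': "f \<in> Arr D x y" "f' \<in> Arr D y x" "Cmp D x y x f' f = Idt D x" "Cmp D y x y f f' = Idt D y"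
  and g': "g \<in> Arr D y z" "g' \<in> Arr D z y" "Cmp D y z y g' g = Idt D y" "Cmp D z y z g g' = Idt D z"
  using f g by (auto simp: is_iso_def)
 note S = assms(2-4) f'(1,2) g'(1,2)
 have "Cmp D x z x (Cmp D z y x f' g') (Cmp D x y z g f) = Cmp D x y x f' (Cmp D x y y (Cmp D y z y g' g) f)"
  using S by (simp add: cmp_assoc'[OF D] catD(3)[OF D])
 moreover have "Cmp D z x z (Cmp D x y z g f) (Cmp D z y x f' g') = Cmp D z y z g (Cmp D z y y (Cmp D y x y f f') g')"
  using S by (simp add: cmp_assoc'[OF D] catD(3)[OF D])
 ultimately have "Cmp D x z x (Cmp D z y x f' g') (Cmp D x y z g f) = Idt D x"
  "Cmp D z x z (Cmp D x y z g f) (Cmp D z y x f' g') = Idt D z"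
  using S f' g' by (simp_all add: catD(4)[OF D])
 then show ?thesis using S unfolding is_iso_def by (intro conjI bexI[of _ "Cmp D z y x f' g'"] catD(3)[OF D]) auto
qed

lemma iso_cancel_right:
 assumes D: "lcat D" and o: "x \<in> Obj D" "y \<in> Obj D" "z \<in> Obj D" and s: "is_iso D x y s"
  and g: "g \<in> Arr D y z" "g' \<in> Arr D y z" and e: "Cmp D x y z g s = Cmp D x y z g' s"
 shows "g = g'"
proof -
 obtain t where t: "s \<in> Arr D x y" "t \<in> Arr D y x" "Cmp D y x y s t = Idt D y" using s by (auto simp: is_iso_def)
 have "Cmp D y x z (Cmp D x y z g s) t = Cmp D y x z (Cmp D x y z g' s) t" using e by simp
 then show ?thesis
  using o t g by (simp add: cmp_assoc'[OF D] catD(5)[OF D])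
qed

lemma iso_cancel_left:
 assumes D: "lcat D" and o: "x \<in> Obj D" "y \<in> Obj D" "z \<in> Obj D" and s: "is_iso D y z s"
  and g: "g \<in> Arr D x y" "g' \<in> Arr D x y" and e: "Cmp D x y z s g = Cmp D x y z s g'"
 shows "g = g'"
proof -
 obtain t where t: "s \<in> Arr D y z" "t \<in> Arr D z y" "Cmp D y z y t s = Idt D y" using s by (auto simp: is_iso_def)
 have "Cmp D x z y t (Cmp D x y z s g) = Cmp D x z y t (Cmp D x y z s g')" using e by simp
 then show ?thesis
  using o t g by (simp add: cmp_assoc'[OF D, symmetric] catD(4)[OF D])
qed

lemma iso_right_factor:
 assumes D: "lcat D" and o: "x \<in> Obj D" "y \<in> Obj D" "z \<in> Obj D" and s: "is_iso D x y s" and g: "g \<in> Arr D x z"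
 shows "\<exists>h\<in>Arr D y z. Cmp D x y z h s = g"
proof -
 obtain t where t: "s \<in> Arr D x y" "t \<in> Arr D y x" "Cmp D x y x t s = Idt D x" using s by (auto simp: is_iso_def)
 show ?thesis
  using o t g by (intro bexI[of _ "Cmp D y x z g t"]) (simp_all add: cmp_assoc'[OF D] catD[OF D])
qed

lemma iso_left_factor:
 assumes D: "lcat D" and o: "x \<in> Obj D" "y \<in> Obj D" "z \<in> Obj D" and s: "is_iso D y z s" and g: "g \<in> Arr D x z"
 shows "\<exists>h\<in>Arr D x y. Cmp D x y z s h = g"
proof -
 obtain t where t: "s \<in> Arr D y z" "t \<in> Arr D z y" "Cmp D z y z s t = Idt D z" using s by (auto simp: is_iso_def)
 show ?thesis
  using o t g by (intro bexI[of _ "Cmp D x z y t g"]) (simp_all add: cmp_assoc'[OF D, symmetric] catD[OF D])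
qed

lemma iso_left_inverse:
 assumes D: "lcat D" and o: "x \<in> Obj D" "y \<in> Obj D" and s: "is_iso D x y s" and g: "g \<in> Arr D y x"
  and e: "Cmp D x y x g s = Idt D x"
 shows "is_iso D y x g"
proof -
 obtain t where t: "s \<in> Arr D x y" "t \<in> Arr D y x" "Cmp D x y x t s = Idt D x" "Cmp D y x y s t = Idt D y"
  using s by (auto simp: is_iso_def)
 have "g = t" using iso_cancel_right[OF D o o(1) s g t(2)] e t(3) by simp
 then show ?thesis using t by (auto simp: is_iso_def)
qed

lemma iso_idt: "lcat D ==> x \<in> Obj D ==> is_iso D x x (Idt D x)"
 unfolding is_iso_def by (auto simp: catD intro!: bexI[of _ "Idt D x"])

text \<open>The category \<open>C\<close> is only required to be closed under its operations: the axioms of a linear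
 category are reflected by \<open>F\<close>.\<close>

lemma equivalence_from_ff:
 assumes D: "lcat D" and F: "linear_functor K C D F" and ff: "fully_faithful C D F"
  and es: "\<And>d. d \<in> Obj D ==> \<exists>c\<in>Obj C. \<exists>f. is_iso D (Fob F c) d f"
  and idt: "\<And>x. x \<in> Obj C ==> Idt C x \<in> Arr C x x"
  and cmp: "\<And>x y z f g. x \<in> Obj C ==> y \<in> Obj C ==> z \<in> Obj C ==> f \<in> Arr C x y ==> g \<in> Arr C y z ==>
   Cmp C x y z g f \<in> Arr C x z"
  and add: "\<And>x y f g. x \<in> Obj C ==> y \<in> Obj C ==> f \<in> Arr C x y ==> g \<in> Arr C x y ==> f \<oplus>\<^bsub>Hom C x y\<^esub> g \<in> Arr C x y"
  and smult: "\<And>x y f r. x \<in> Obj C ==> y \<in> Obj C ==> r \<in> carrier K ==> f \<in> Arr C x y ==> r \<odot>\<^bsub>Hom C x y\<^esub> f \<in> Arr C x y"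
 shows "category_equivalence K C D F"
proof -
 note FD = lfD[OF F]
 have inj: "f = g" if "x \<in> Obj C" "y \<in> Obj C" "f \<in> Arr C x y" "g \<in> Arr C x y" "Far F x y f = Far F x y g" for x y f g
  using ff that unfolding fully_faithful_def bij_betw_def by (meson inj_onD)
 have surj: "\<exists>f\<in>Arr C x y. Far F x y f = k" if "x \<in> Obj C" "y \<in> Obj C" "k \<in> Arr D (Fob F x) (Fob F y)" for x y k
  using ff that unfolding fully_faithful_def bij_betw_def by (metis imageE)
 have "\<exists>c t. c \<in> Obj C \<and> is_iso D (Fob F c) d t" if "d \<in> Obj D" for d using es[OF that] by blast
 then obtain g \<theta> where g: "\<And>d. d \<in> Obj D ==> g d \<in> Obj C" and \<theta>: "\<And>d. d \<in> Obj D ==> is_iso D (Fob F (g d)) d (\<theta> d)"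
  by metis
 have \<theta>a: "\<theta> d \<in> Arr D (Fob F (g d)) d" if "d \<in> Obj D" for d using \<theta>[OF that] by (simp add: is_iso_def)
 note Fg = FD(1)[OF g]
 \<comment> \<open>Since \<theta> d' is invertible and F is full, the square over \<open>f\<close>
   can be completed; the completing arrow becomes the value of the quasi-inverse on
   \<open>f\<close>.\<close>
 have "\<exists>k\<in>Arr C (g d) (g d'). Cmp D (Fob F (g d)) (Fob F (g d')) d' (\<theta> d') (Far F (g d) (g d') k) =
   Cmp D (Fob F (g d)) d d' f (\<theta> d)" if d: "d \<in> Obj D" "d' \<in> Obj D" "f \<in> Arr D d d'" for d d' f
 proof -
  have "Cmp D (Fob F (g d)) d d' f (\<theta> d) \<in> Arr D (Fob F (g d)) d'"
   by (rule catD(3)[OF D Fg[OF d(1)] d(1,2) \<theta>a[OF d(1)] d(3)])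
  from iso_left_factor[OF D Fg[OF d(1)] Fg[OF d(2)] d(2) \<theta>[OF d(2)] this]
  show ?thesis using surj[OF g[OF d(1)] g[OF d(2)]] by metis
 qed
 then have "\<exists>k. d \<in> Obj D --> d' \<in> Obj D --> f \<in> Arr D d d' --> k \<in> Arr C (g d) (g d') \<and>
   Cmp D (Fob F (g d)) (Fob F (g d')) d' (\<theta> d') (Far F (g d) (g d') k) = Cmp D (Fob F (g d)) d d' f (\<theta> d)" for d d' f
  by blast
 then obtain h where h0: "\<And>d d' f. d \<in> Obj D --> d' \<in> Obj D --> f \<in> Arr D d d' --> h d d' f \<in> Arr C (g d) (g d') \<and>
   Cmp D (Fob F (g d)) (Fob F (g d')) d' (\<theta> d') (Far F (g d) (g d') (h d d' f)) = Cmp D (Fob F (g d)) d d' f (\<theta> d)"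
  by metis
 have h: "h d d' f \<in> Arr C (g d) (g d')"
  "Cmp D (Fob F (g d)) (Fob F (g d')) d' (\<theta> d') (Far F (g d) (g d') (h d d' f)) = Cmp D (Fob F (g d)) d d' f (\<theta> d)"
  if "d \<in> Obj D" "d' \<in> Obj D" "f \<in> Arr D d d'" for d d' f
  using h0 that by blast+
 \<comment> \<open>Faithfulness makes the completing arrow unique. Every functor law for G below is
   obtained by showing that both sides complete the same square.\<close>
 have hu: "k = h d d' f" if d: "d \<in> Obj D" "d' \<in> Obj D" "f \<in> Arr D d d'" and k: "k \<in> Arr C (g d) (g d')"
  "Cmp D (Fob F (g d)) (Fob F (g d')) d' (\<theta> d') (Far F (g d) (g d') k) = Cmp D (Fob F (g d)) d d' f (\<theta> d)" for d d' f k
  using inj[OF g[OF d(1)] g[OF d(2)] k(1) h(1)[OF d]]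
   iso_cancel_left[OF D Fg[OF d(1)] Fg[OF d(2)] d(2) \<theta>[OF d(2)] FD(3)[OF g[OF d(1)] g[OF d(2)] k(1)]
    FD(3)[OF g[OF d(1)] g[OF d(2)] h(1)[OF d]]] k(2) h(2)[OF d] by simp
 define G where "G = \<lparr>Fob = g, Far = h\<rparr>"
 have G: "linear_functor K D C G"
 proof (rule lfI)
  fix d assume d: "d \<in> Obj D"
  have "Idt C (g d) = h d d (Idt D d)"
   by (rule hu[OF d d catD(2)[OF D d] idt[OF g[OF d]]])
    (simp add: FD(2)[OF g[OF d]] catD(4)[OF D Fg[OF d] d \<theta>a[OF d]] catD(5)[OF D Fg[OF d] d \<theta>a[OF d]])
  then show "Far G d d (Idt D d) = Idt C (Fob G d)" by (simp add: G_def)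
 next
  fix d d' assume d: "d \<in> Obj D" "d' \<in> Obj D"
  note S = d Fg[OF d(1)] Fg[OF d(2)] \<theta>a[OF d(1)] \<theta>a[OF d(2)] g[OF d(1)] g[OF d(2)]
  show "lin (Hom D d d') (Hom C (Fob G d) (Fob G d')) (Far G d d')"
  proof (rule linI)
   fix f k assume fk: "f \<in> Arr D d d'" "k \<in> Arr D d d'"
   have "h d d' f \<oplus>\<^bsub>Hom C (g d) (g d')\<^esub> h d d' k = h d d' (f \<oplus>\<^bsub>Hom D d d'\<^esub> k)"
    using S fk h(1)[OF d fk(1)] h(1)[OF d fk(2)]
    by (intro hu[OF d]) (simp_all add: vs_closed[OF catD(1)[OF D]] add linD(2)[OF FD(5)] cmp_add[OF D] FD(3) h(2)[OF d])
   then show "Far G d d' (f \<oplus>\<^bsub>Hom D d d'\<^esub> k) = Far G d d' f \<oplus>\<^bsub>Hom C (Fob G d) (Fob G d')\<^esub> Far G d d' k"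
    by (simp add: G_def)
  next
   fix r f assume r: "r \<in> carrier K" "f \<in> Arr D d d'"
   have "r \<odot>\<^bsub>Hom C (g d) (g d')\<^esub> h d d' f = h d d' (r \<odot>\<^bsub>Hom D d d'\<^esub> f)"
    using S r h(1)[OF d r(2)]
    by (intro hu[OF d]) (simp_all add: vs_closed[OF catD(1)[OF D]] smult linD(3)[OF FD(5)] cmp_add[OF D] FD(3) h(2)[OF d])
   then show "Far G d d' (r \<odot>\<^bsub>Hom D d d'\<^esub> f) = r \<odot>\<^bsub>Hom C (Fob G d) (Fob G d')\<^esub> Far G d d' f"
    by (simp add: G_def)
  qed (simp add: G_def h[OF d])
 next
  fix x y z f k assume d: "x \<in> Obj D" "y \<in> Obj D" "z \<in> Obj D" and fk: "f \<in> Arr D x y" "k \<in> Arr D y z"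
  note hf = h[OF d(1,2) fk(1)] and hk = h[OF d(2,3) fk(2)]
  note S = d fk Fg[OF d(1)] Fg[OF d(2)] Fg[OF d(3)] \<theta>a[OF d(1)] \<theta>a[OF d(2)] \<theta>a[OF d(3)] g[OF d(1)] g[OF d(2)] g[OF d(3)]
   hf(1) hk(1) FD(3)[OF g[OF d(1)] g[OF d(2)] hf(1)] FD(3)[OF g[OF d(2)] g[OF d(3)] hk(1)]
  have "Cmp D (Fob F (g x)) (Fob F (g z)) z (\<theta> z) (Far F (g x) (g z) (Cmp C (g x) (g y) (g z) (h y z k) (h x y f))) =
   Cmp D (Fob F (g x)) (Fob F (g y)) z (Cmp D (Fob F (g y)) (Fob F (g z)) z (\<theta> z) (Far F (g y) (g z) (h y z k))) (Far F (g x) (g y) (h x y f))"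
   using S by (simp add: FD(4) cmp_assoc'[OF D])
  also have "\<dots> = Cmp D (Fob F (g x)) y z k (Cmp D (Fob F (g x)) (Fob F (g y)) y (\<theta> y) (Far F (g x) (g y) (h x y f)))"
   using S by (simp add: hk(2) cmp_assoc'[OF D])
  also have "\<dots> = Cmp D (Fob F (g x)) x z (Cmp D x y z k f) (\<theta> x)"
   using S by (simp add: hf(2) cmp_assoc'[OF D])
  finally have "Cmp C (g x) (g y) (g z) (h y z k) (h x y f) = h x z (Cmp D x y z k f)"
   using S by (intro hu) (simp_all add: catD(3)[OF D] cmp)
  then show "Far G x z (Cmp D x y z k f) = Cmp C (Fob G x) (Fob G y) (Fob G z) (Far G y z k) (Far G x y f)"
   by (simp add: G_def)
 qed (simp add: G_def g)
 have "naturally_isomorphic D D (comp_funct F G) id_funct"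
  unfolding naturally_isomorphic_def
  by (rule exI[of _ \<theta>]) (simp add: comp_funct_def id_funct_def G_def \<theta> h(2))
 moreover have "naturally_isomorphic C C (comp_funct G F) id_funct"
 proof -
  \<comment> \<open>The other natural isomorphism is lifted from \<theta> through F; the lift is
    invertible because F is full and reflects the equations that express invertibility.\<close>
  have "\<exists>t. is_iso C (g (Fob F x)) x t \<and> Far F (g (Fob F x)) x t = \<theta> (Fob F x)" if x: "x \<in> Obj C" for x
  proof -
   let ?d = "Fob F x" let ?x = "g ?d"
   note Fx = FD(1)[OF x] and gx = g[OF FD(1)[OF x]]
   obtain \<theta>' where \<theta>': "\<theta>' \<in> Arr D ?d (Fob F ?x)" "Cmp D (Fob F ?x) ?d (Fob F ?x) \<theta>' (\<theta> ?d) = Idt D (Fob F ?x)"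
    "Cmp D ?d (Fob F ?x) ?d (\<theta> ?d) \<theta>' = Idt D ?d"
    using \<theta>[OF Fx] by (auto simp: is_iso_def)
   obtain t where t: "t \<in> Arr C ?x x" "Far F ?x x t = \<theta> ?d" using surj[OF gx x \<theta>a[OF Fx]] by blast
   obtain t' where t': "t' \<in> Arr C x ?x" "Far F x ?x t' = \<theta>'" using surj[OF x gx \<theta>'(1)] by blast
   have "Cmp C ?x x ?x t' t = Idt C ?x"
    using gx x t t' \<theta>' by (intro inj[OF gx gx]) (simp_all add: cmp idt FD(2) FD(4))
   moreover have "Cmp C x ?x x t t' = Idt C x"
    using gx x t t' \<theta>' by (intro inj[OF x x]) (simp_all add: cmp idt FD(2) FD(4))
   ultimately show ?thesis using t t' by (auto simp: is_iso_def)
  qed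
  then obtain \<tau> where \<tau>: "\<And>x. x \<in> Obj C ==> is_iso C (g (Fob F x)) x (\<tau> x)"
   "\<And>x. x \<in> Obj C ==> Far F (g (Fob F x)) x (\<tau> x) = \<theta> (Fob F x)" by metis
  have \<tau>a: "\<tau> x \<in> Arr C (g (Fob F x)) x" if "x \<in> Obj C" for x using \<tau>(1)[OF that] by (simp add: is_iso_def)
  have "Cmp C (g (Fob F x)) (g (Fob F y)) y (\<tau> y) (h (Fob F x) (Fob F y) (Far F x y f)) =
   Cmp C (g (Fob F x)) x y f (\<tau> x)" if x: "x \<in> Obj C" "y \<in> Obj C" and f: "f \<in> Arr C x y" for x y f
   using x f g[OF FD(1)[OF x(1)]] g[OF FD(1)[OF x(2)]] \<tau>a h[OF FD(1)[OF x(1)] FD(1)[OF x(2)] FD(3)[OF x f]]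
   by (intro inj[of "g (Fob F x)" y]) (simp_all add: cmp FD(4) \<tau>(2))
  then show ?thesis
   unfolding naturally_isomorphic_def
   by (intro exI[of _ \<tau>]) (simp add: comp_funct_def id_funct_def G_def \<tau>(1))
 qed
 ultimately show ?thesis using F G by (auto simp: category_equivalence_def)
qed

text \<open>A localization \<open>q\<close> with a fully faithful left adjoint \<open>L\<close>. The roof \<open>(w, s, f)\<close> represents the arrow
 \<open>q f \<circ> (q s)\<inverse>\<close>, and every roof starting in \<open>x\<close> is dominated by the counit \<open>L (q x) \<rightarrow> x\<close>; thus the class
 of a roof is the set of all roofs representing the same arrow.\<close>

lemma serre_quotient_equivalence:
 fixes Y :: "('k, 'p, 'n) lincat" and Z :: "('k, 'q, 'l) lincat"
 assumes Y: "lcat Y" and Z: "lcat Z" and u: "univ_unit Z Y L q \<eta>"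
  and \<eta>i: "\<And>z. z \<in> Obj Z ==> is_iso Z z (Fob q (Fob L z)) (\<eta> z)"
  and inv: "\<And>x y s. x \<in> Obj Y ==> y \<in> Obj Y ==> s \<in> Arr Y x y ==>
   inverted Y S x y s \<longleftrightarrow> is_iso Z (Fob q x) (Fob q y) (Far q x y s)"
 shows "\<exists>F. category_equivalence K (serre_quotient K Y S) Z F"
proof -
 define qo where "qo = Fob q"
 define qa where "qa = Far q"
 note LD = lfD[OF univ_unitD(1)[OF Z Y u]] and qD = lfD[OF univ_unitD(2)[OF Z Y u], folded qo_def qa_def]
 note inv = inv[folded qo_def qa_def]
 note uD = univ_unitD[OF Z Y u, folded qo_def qa_def] and ui = univ_unit_inj[OF Z Y u, folded qo_def qa_def]
 note \<eta>i = \<eta>i[folded qo_def]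
 note cY = catD(3)[OF Y] and cZ = catD(3)[OF Z]
 \<comment> \<open>A roof represents \<phi> if \<phi> after \<open>q s\<close> equals
   \<open>q f\<close>; stated in this way, no inverse of \<open>q s\<close> has to be named.\<close>
 define val where "val = (\<lambda>x y (w, s, f) \<phi>. Cmp Z (qo w) (qo x) (qo y) \<phi> (qa w x s) = qa w y f)"
 define Cl where "Cl = (\<lambda>x y \<phi>. {r \<in> roofs Y S x y. val x y r \<phi>})"
 have rD: "w \<in> Obj Y" "s \<in> Arr Y w x" "f \<in> Arr Y w y" "is_iso Z (qo w) (qo x) (qa w x s)"
  if "x \<in> Obj Y" "(w, s, f) \<in> roofs Y S x y" for w s f x y
 proof -
  have r: "w \<in> Obj Y" "inverted Y S w x s" "f \<in> Arr Y w y" using that by (auto simp: roofs_def)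
  then have "s \<in> Arr Y w x" by (simp add: inverted_def)
  with r inv[OF r(1) that(1)] show "w \<in> Obj Y" "s \<in> Arr Y w x" "f \<in> Arr Y w y" "is_iso Z (qo w) (qo x) (qa w x s)"
   by simp_all
 qed
 have rI: "(w, s, f) \<in> roofs Y S x y"
  if "x \<in> Obj Y" "w \<in> Obj Y" "s \<in> Arr Y w x" "f \<in> Arr Y w y" "is_iso Z (qo w) (qo x) (qa w x s)" for w s f x y
  using that inv[OF that(2,1,3)] by (simp add: roofs_def)
 have vu: "\<phi> = \<phi>'" if "x \<in> Obj Y" "y \<in> Obj Y" "(w, s, f) \<in> roofs Y S x y" "\<phi> \<in> Arr Z (qo x) (qo y)" "\<phi>' \<in> Arr Z (qo x) (qo y)"
  "val x y (w, s, f) \<phi>" "val x y (w, s, f) \<phi>'" for x y w s f \<phi> \<phi>'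
 proof -
  note r = rD[OF that(1,3)]
  show ?thesis
   by (rule iso_cancel_right[OF Z qD(1)[OF r(1)] qD(1)[OF that(1)] qD(1)[OF that(2)] r(4) that(4,5)])
    (use that(6,7) in \<open>simp add: val_def\<close>)
 qed
 \<comment> \<open>The counit: the arrow that corresponds to the identity of \<open>q x\<close>. Its
   image under q is inverse to \<eta>, hence an isomorphism, so \<epsilon> x may serve as the left
   leg of a roof.\<close>
 have "\<exists>\<epsilon>. \<forall>x\<in>Obj Y. \<epsilon> x \<in> Arr Y (Fob L (qo x)) x \<and>
   Cmp Z (qo x) (qo (Fob L (qo x))) (qo x) (qa (Fob L (qo x)) x (\<epsilon> x)) (\<eta> (qo x)) = Idt Z (qo x)"
  using uD(5)[OF qD(1) _ catD(2)[OF Z qD(1)]] by (intro bchoice ballI) blast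
 then obtain \<epsilon> where \<epsilon>: "\<And>x. x \<in> Obj Y ==> \<epsilon> x \<in> Arr Y (Fob L (qo x)) x"
  "\<And>x. x \<in> Obj Y ==> Cmp Z (qo x) (qo (Fob L (qo x))) (qo x) (qa (Fob L (qo x)) x (\<epsilon> x)) (\<eta> (qo x)) = Idt Z (qo x)"
  by blast
 define l where "l = (\<lambda>x. Fob L (qo x))"
 have l': "Fob L (qo x) = l x" for x by (simp add: l_def)
 note \<epsilon> = \<epsilon>[unfolded l']
 have lo: "l x \<in> Obj Y" if "x \<in> Obj Y" for x using that LD(1) qD(1) by (simp add: l_def)
 have \<epsilon>i: "is_iso Z (qo (l x)) (qo x) (qa (l x) x (\<epsilon> x))" if x: "x \<in> Obj Y" for x
  by (rule iso_left_inverse[OF Z qD(1)[OF x] qD(1)[OF lo[OF x]] \<eta>i[OF qD(1)[OF x], unfolded l'] qD(3)[OF lo[OF x] x \<epsilon>(1)[OF x]] \<epsilon>(2)[OF x]])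
 have lift: "\<exists>k\<in>Arr Y (l x) y. Cmp Z (qo x) (qo (l x)) (qo y) (qa (l x) y k) (\<eta> (qo x)) = \<phi>"
  if "x \<in> Obj Y" "y \<in> Obj Y" "\<phi> \<in> Arr Z (qo x) (qo y)" for x y \<phi>
  using uD(5)[OF qD(1)[OF that(1)] that(2,3)] by (simp add: l_def)
 have liftu: "k = k'" if "x \<in> Obj Y" "y \<in> Obj Y" "k \<in> Arr Y (l x) y" "k' \<in> Arr Y (l x) y"
  "Cmp Z (qo x) (qo (l x)) (qo y) (qa (l x) y k) (\<eta> (qo x)) = Cmp Z (qo x) (qo (l x)) (qo y) (qa (l x) y k') (\<eta> (qo x))" for x y k k'
  using ui[OF qD(1)[OF that(1)] that(2)] that(3-5) by (simp add: l_def)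
 have \<eta>a: "\<eta> (qo x) \<in> Arr Z (qo x) (qo (l x))" if "x \<in> Obj Y" for x using uD(3)[OF qD(1)[OF that]] by (simp add: l_def)
 \<comment> \<open>The inverse of \<open>q s\<close> corresponds under the adjunction to
   \<open>u\<close>. Then \<open>s\<close> after \<open>u\<close> corresponds to the identity and so
   is \<epsilon> x, while \<open>f\<close> after \<open>u\<close> corresponds to \<phi>.\<close>
 have dom: "\<exists>u\<in>Arr Y (l x) w. Cmp Y (l x) w x s u = \<epsilon> x \<and>
   Cmp Z (qo x) (qo (l x)) (qo y) (qa (l x) y (Cmp Y (l x) w y f u)) (\<eta> (qo x)) = \<phi>"
  if x: "x \<in> Obj Y" "y \<in> Obj Y" and r: "(w, s, f) \<in> roofs Y S x y" and \<phi>: "\<phi> \<in> Arr Z (qo x) (qo y)" and v: "val x y (w, s, f) \<phi>" for x y w s f \<phi>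
 proof -
  note r = rD[OF x(1) r]
  obtain t where t: "t \<in> Arr Z (qo x) (qo w)" "Cmp Z (qo x) (qo w) (qo x) (qa w x s) t = Idt Z (qo x)"
   using r(4) by (auto simp: is_iso_def)
  obtain u where u: "u \<in> Arr Y (l x) w" "Cmp Z (qo x) (qo (l x)) (qo w) (qa (l x) w u) (\<eta> (qo x)) = t"
   using lift[OF x(1) r(1) t(1)] by blast
  note S = x r(1-3) qD(1)[OF x(1)] qD(1)[OF x(2)] qD(1)[OF r(1)] lo[OF x(1)] qD(1)[OF lo[OF x(1)]] u(1) t(1) \<eta>a[OF x(1)]
   qD(3)[OF r(1) x(1) r(2)] qD(3)[OF r(1) x(2) r(3)] qD(3)[OF lo[OF x(1)] r(1) u(1)]
  have "Cmp Z (qo x) (qo (l x)) (qo x) (qa (l x) x (Cmp Y (l x) w x s u)) (\<eta> (qo x)) = Idt Z (qo x)"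
   using S t(2) u(2) by (simp add: qD(4) cmp_assoc'[OF Z])
  then have "Cmp Y (l x) w x s u = \<epsilon> x" using S \<epsilon>[OF x(1)] by (intro liftu[OF x(1,1)]) (simp_all add: cY)
  moreover have "Cmp Z (qo x) (qo (l x)) (qo y) (qa (l x) y (Cmp Y (l x) w y f u)) (\<eta> (qo x)) =
    Cmp Z (qo x) (qo w) (qo y) (qa w y f) t"
   using S u(2) by (simp add: qD(4) cmp_assoc'[OF Z])
  moreover have "\<dots> = Cmp Z (qo x) (qo w) (qo y) (Cmp Z (qo w) (qo x) (qo y) \<phi> (qa w x s)) t" using v by (simp add: val_def)
  moreover have "\<dots> = \<phi>" using S \<phi> t(2) by (simp add: cmp_assoc'[OF Z] catD(5)[OF Z])
  ultimately show ?thesis using u(1) by auto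
 qed
 \<comment> \<open>Equivalent roofs have the same value, because the common denominator becomes
   invertible under q and can be cancelled. Conversely, roofs with the same value become equal when
   both are refined to the left leg \<epsilon> x by \<open>dom\<close>.\<close>
 have cls: "roof_class Y S x y (w, s, f) = Cl x y \<phi>"
  if x: "x \<in> Obj Y" "y \<in> Obj Y" and r: "(w, s, f) \<in> roofs Y S x y" and \<phi>: "\<phi> \<in> Arr Z (qo x) (qo y)" and v: "val x y (w, s, f) \<phi>" for x y w s f \<phi>
 proof (intro equalityI subsetI)
  fix r' assume r': "r' \<in> roof_class Y S x y (w, s, f)"
  obtain w' s' f' where r'_def: "r' = (w', s', f')" by (cases r')
  from r' obtain v' u u' where r'r: "(w', s', f') \<in> roofs Y S x y" and v': "v' \<in> Obj Y" "u \<in> Arr Y v' w" "u' \<in> Arr Y v' w'"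
   "Cmp Y v' w x s u = Cmp Y v' w' x s' u'" "inverted Y S v' x (Cmp Y v' w x s u)"
   "Cmp Y v' w y f u = Cmp Y v' w' y f' u'"
   unfolding roof_class_def r'_def by auto
  note r = rD[OF x(1) r] and r2 = rD[OF x(1) r'r]
  note S = x r(1-3) r2(1-3) v'(1-3) qD(1)[OF x(1)] qD(1)[OF x(2)] qD(1)[OF r(1)] qD(1)[OF r2(1)] qD(1)[OF v'(1)] \<phi>
   qD(3)[OF r(1) x(1) r(2)] qD(3)[OF r(1) x(2) r(3)] qD(3)[OF r2(1) x(1) r2(2)] qD(3)[OF r2(1) x(2) r2(3)]
   qD(3)[OF v'(1) r(1) v'(2)] qD(3)[OF v'(1) r2(1) v'(3)]
  obtain \<phi>' where \<phi>': "\<phi>' \<in> Arr Z (qo x) (qo y)" "Cmp Z (qo w') (qo x) (qo y) \<phi>' (qa w' x s') = qa w' y f'"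
   using iso_right_factor[OF Z qD(1)[OF r2(1)] qD(1)[OF x(1)] qD(1)[OF x(2)] r2(4) qD(3)[OF r2(1) x(2) r2(3)]] by blast
  have i: "is_iso Z (qo v') (qo x) (qa v' x (Cmp Y v' w x s u))" using v'(5) inv[OF v'(1) x(1)] S by (simp add: cY)
  have "Cmp Z (qo v') (qo x) (qo y) \<phi> (qa v' x (Cmp Y v' w x s u)) = qa v' y (Cmp Y v' w y f u)"
   using S v by (simp add: qD(4) cmp_assoc'[OF Z, symmetric] val_def)
  moreover have "Cmp Z (qo v') (qo x) (qo y) \<phi>' (qa v' x (Cmp Y v' w' x s' u')) = qa v' y (Cmp Y v' w' y f' u')"
   using S \<phi>' by (simp add: qD(4) cmp_assoc'[OF Z, symmetric])
  ultimately have "\<phi> = \<phi>'"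
   using v'(4,6) by (intro iso_cancel_right[OF Z qD(1)[OF v'(1)] qD(1)[OF x(1)] qD(1)[OF x(2)] i \<phi> \<phi>'(1)]) simp
  then show "r' \<in> Cl x y \<phi>" using r'r \<phi>' by (simp add: Cl_def val_def r'_def)
 next
  fix r' assume r': "r' \<in> Cl x y \<phi>"
  obtain w' s' f' where r'_def: "r' = (w', s', f')" by (cases r')
  have r'r: "(w', s', f') \<in> roofs Y S x y" "val x y (w', s', f') \<phi>" using r' by (auto simp: Cl_def r'_def)
  obtain u where u: "u \<in> Arr Y (l x) w" "Cmp Y (l x) w x s u = \<epsilon> x"
   "Cmp Z (qo x) (qo (l x)) (qo y) (qa (l x) y (Cmp Y (l x) w y f u)) (\<eta> (qo x)) = \<phi>" using dom[OF x r \<phi> v] by blast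
  obtain u' where u': "u' \<in> Arr Y (l x) w'" "Cmp Y (l x) w' x s' u' = \<epsilon> x"
   "Cmp Z (qo x) (qo (l x)) (qo y) (qa (l x) y (Cmp Y (l x) w' y f' u')) (\<eta> (qo x)) = \<phi>" using dom[OF x r'r(1) \<phi> r'r(2)] by blast
  note r = rD[OF x(1) r] and r2 = rD[OF x(1) r'r(1)]
  have "Cmp Y (l x) w y f u = Cmp Y (l x) w' y f' u'"
   using u u' cY[OF lo[OF x(1)] r(1) x(2) u(1) r(3)] cY[OF lo[OF x(1)] r2(1) x(2) u'(1) r2(3)] by (intro liftu[OF x]) simp_all
  moreover have "inverted Y S (l x) x (\<epsilon> x)" using inv[OF lo[OF x(1)] x(1) \<epsilon>(1)[OF x(1)]] \<epsilon>i[OF x(1)] by simp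
  ultimately have "Cmp Y (l x) w x s u = Cmp Y (l x) w' x s' u' \<and> inverted Y S (l x) x (Cmp Y (l x) w x s u) \<and>
    Cmp Y (l x) w y f u = Cmp Y (l x) w' y f' u'"
   using u(2) u'(2) by simp
  then have "\<exists>v\<in>Obj Y. \<exists>u\<in>Arr Y v w. \<exists>u'\<in>Arr Y v w'. Cmp Y v w x s u = Cmp Y v w' x s' u' \<and>
    inverted Y S v x (Cmp Y v w x s u) \<and> Cmp Y v w y f u = Cmp Y v w' y f' u'"
   using lo[OF x(1)] u(1) u'(1) by blast
  then show "r' \<in> roof_class Y S x y (w, s, f)"
   using r'r(1) by (simp add: roof_class_def r'_def)
 qed
 \<comment> \<open>Every arrow of Z between images is represented by a roof with left leg \<epsilon>
   x. These standard representatives also provide the nonempty index sets required below.\<close>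
 have rep0: "\<exists>k. (l x, \<epsilon> x, k) \<in> roofs Y S x y \<and> val x y (l x, \<epsilon> x, k) \<phi>"
  if x: "x \<in> Obj Y" "y \<in> Obj Y" and \<phi>: "\<phi> \<in> Arr Z (qo x) (qo y)" for x y \<phi>
 proof -
  obtain k where k: "k \<in> Arr Y (l x) y" "Cmp Z (qo x) (qo (l x)) (qo y) (qa (l x) y k) (\<eta> (qo x)) = \<phi>" using lift[OF x \<phi>] by blast
  note S = x qD(1)[OF x(1)] qD(1)[OF x(2)] qD(1)[OF lo[OF x(1)]] lo[OF x(1)] \<eta>a[OF x(1)] \<phi> k(1) \<epsilon>(1)[OF x(1)]
   qD(3)[OF lo[OF x(1)] x(2) k(1)] qD(3)[OF lo[OF x(1)] x(1) \<epsilon>(1)[OF x(1)]]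
  have "Cmp Z (qo x) (qo (l x)) (qo y) (Cmp Z (qo (l x)) (qo x) (qo y) \<phi> (qa (l x) x (\<epsilon> x))) (\<eta> (qo x)) =
   Cmp Z (qo x) (qo (l x)) (qo y) (qa (l x) y k) (\<eta> (qo x))"
   using S \<epsilon>(2)[OF x(1)] k(2) by (simp add: cmp_assoc'[OF Z] catD(5)[OF Z])
  then have "val x y (l x, \<epsilon> x, k) \<phi>"
   unfolding val_def prod.case
   using iso_cancel_right[OF Z S(3) S(5) S(4) \<eta>i[OF S(3), unfolded l'] cZ[OF S(5,3,4) S(12) S(8)] S(11)] by simp
  moreover have "(l x, \<epsilon> x, k) \<in> roofs Y S x y"
   by (rule rI[OF x(1) lo[OF x(1)] \<epsilon>(1)[OF x(1)] k(1) \<epsilon>i[OF x(1)]])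
  ultimately show ?thesis by blast
 qed
 have vex: "\<exists>\<phi>\<in>Arr Z (qo x) (qo y). val x y r \<phi>" if x: "x \<in> Obj Y" "y \<in> Obj Y" and r: "r \<in> roofs Y S x y" for x y r
 proof -
  obtain w s f where r_def: "r = (w, s, f)" by (cases r)
  note r = rD[OF x(1) r[unfolded r_def]]
  show ?thesis
   using iso_right_factor[OF Z qD(1)[OF r(1)] qD(1)[OF x(1)] qD(1)[OF x(2)] r(4) qD(3)[OF r(1) x(2) r(3)]]
   by (simp add: val_def r_def)
 qed
 have car: "carrier (Hom (serre_quotient K Y S) x y) = Cl x y ` Arr Z (qo x) (qo y)" if x: "x \<in> Obj Y" "y \<in> Obj Y" for x y
 proof -
  have "roof_class Y S x y ` roofs Y S x y = Cl x y ` Arr Z (qo x) (qo y)"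
  proof (intro equalityI subsetI)
   fix P assume "P \<in> roof_class Y S x y ` roofs Y S x y"
   then obtain r where r: "r \<in> roofs Y S x y" "P = roof_class Y S x y r" by blast
   obtain \<phi> where "\<phi> \<in> Arr Z (qo x) (qo y)" "val x y r \<phi>" using vex[OF x r(1)] by blast
   then show "P \<in> Cl x y ` Arr Z (qo x) (qo y)" using r cls[OF x] by (cases r) auto
  next
   fix P assume "P \<in> Cl x y ` Arr Z (qo x) (qo y)"
   then obtain \<phi> where \<phi>: "\<phi> \<in> Arr Z (qo x) (qo y)" "P = Cl x y \<phi>" by blast
   obtain k where "(l x, \<epsilon> x, k) \<in> roofs Y S x y" "val x y (l x, \<epsilon> x, k) \<phi>" using rep0[OF x \<phi>(1)] by blast
   then show "P \<in> roof_class Y S x y ` roofs Y S x y" using cls[OF x _ \<phi>(1)] \<phi>(2) by (metis imageI)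
  qed
  then show ?thesis by (simp add: serre_quotient_def)
 qed
 have clinj: "\<phi> = \<phi>'" if x: "x \<in> Obj Y" "y \<in> Obj Y" and \<phi>: "\<phi> \<in> Arr Z (qo x) (qo y)" "\<phi>' \<in> Arr Z (qo x) (qo y)" "Cl x y \<phi> = Cl x y \<phi>'" for x y \<phi> \<phi>'
 proof -
  obtain k where k: "(l x, \<epsilon> x, k) \<in> roofs Y S x y" "val x y (l x, \<epsilon> x, k) \<phi>" using rep0[OF x \<phi>(1)] by blast
  then have "val x y (l x, \<epsilon> x, k) \<phi>'" using \<phi>(3) by (auto simp: Cl_def)
  then show ?thesis using vu[OF x k(1) \<phi>(1,2) k(2)] by blast
 qed
 \<comment> \<open>The operations of the quotient are unions over all representatives and all common
   denominators. Each contributes the same class, so only nonemptiness of the union remains to be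
   shown.\<close>
 have un: "\<Union>R = Cl x y \<phi>" if "\<And>P. P \<in> R ==> P = Cl x y \<phi>" "R \<noteq> {}" for R x y \<phi>
  using that by blast
 have ClD: "(w, s, f) \<in> roofs Y S x y" "Cmp Z (qo w) (qo x) (qo y) \<phi> (qa w x s) = qa w y f" if "(w, s, f) \<in> Cl x y \<phi>" for w s f x y \<phi>
  using that by (auto simp: Cl_def val_def)
 let ?Q = "serre_quotient K Y S"
 have idt: "Idt ?Q x = Cl x x (Idt Z (qo x))" if x: "x \<in> Obj Y" for x
  using x catD[OF Z] catD[OF Y] qD iso_idt[OF Z qD(1)[OF x]]
  by (simp add: serre_quotient_def, intro cls rI) (auto simp: val_def)
 have cmp: "Cmp ?Q x y z (Cl y z \<psi>) (Cl x y \<phi>) = Cl x z (Cmp Z (qo x) (qo y) (qo z) \<psi> \<phi>)"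
  if x: "x \<in> Obj Y" "y \<in> Obj Y" "z \<in> Obj Y" and \<phi>: "\<phi> \<in> Arr Z (qo x) (qo y)" and \<psi>: "\<psi> \<in> Arr Z (qo y) (qo z)" for x y z \<phi> \<psi>
  unfolding serre_quotient_def lincat.select_convs
 proof (rule un)
  note qx = qD(1)[OF x(1)] qD(1)[OF x(2)] qD(1)[OF x(3)]
  fix P assume "P \<in> {roof_class Y S x z (v, Cmp Y v w x s u, Cmp Y v w' z g h) |v w w' s t f g u h.
    (w, s, f) \<in> Cl x y \<phi> \<and> (w', t, g) \<in> Cl y z \<psi> \<and> v \<in> Obj Y \<and> inverted Y S v w u \<and> h \<in> Arr Y v w' \<and>
    Cmp Y v w y f u = Cmp Y v w' y t h}"
  then obtain v w w' s t f g u h where P: "P = roof_class Y S x z (v, Cmp Y v w x s u, Cmp Y v w' z g h)"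
   and a: "(w, s, f) \<in> Cl x y \<phi>" "(w', t, g) \<in> Cl y z \<psi>" "v \<in> Obj Y" "inverted Y S v w u" "h \<in> Arr Y v w'"
    "Cmp Y v w y f u = Cmp Y v w' y t h" by blast
  note r = rD[OF x(1) ClD(1)[OF a(1)]] and r2 = rD[OF x(2) ClD(1)[OF a(2)]]
  have ua: "u \<in> Arr Y v w" using a(4) by (simp add: inverted_def)
  then have ui: "is_iso Z (qo v) (qo w) (qa v w u)" using a(4) inv[OF a(3) r(1)] by simp
  note S = x qx \<phi> \<psi> a(3,5) r(1-3) r2(1-3) ua qD(1)[OF a(3)] qD(1)[OF r(1)] qD(1)[OF r2(1)]
   qD(3)[OF r(1) x(1) r(2)] qD(3)[OF r(1) x(2) r(3)] qD(3)[OF r2(1) x(2) r2(2)] qD(3)[OF r2(1) x(3) r2(3)]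
   qD(3)[OF a(3) r(1) ua] qD(3)[OF a(3) r2(1) a(5)]
  have i: "is_iso Z (qo v) (qo x) (qa v x (Cmp Y v w x s u))"
   using iso_comp[OF Z qD(1)[OF a(3)] qD(1)[OF r(1)] qx(1) ui r(4)] S by (simp add: qD(4))
  have "Cmp Z (qo v) (qo x) (qo z) (Cmp Z (qo x) (qo y) (qo z) \<psi> \<phi>) (qa v x (Cmp Y v w x s u)) =
   Cmp Z (qo v) (qo y) (qo z) \<psi> (Cmp Z (qo v) (qo w) (qo y) (Cmp Z (qo w) (qo x) (qo y) \<phi> (qa w x s)) (qa v w u))"
   using S by (simp add: qD(4) cmp_assoc'[OF Z] cZ)
  also have "\<dots> = Cmp Z (qo v) (qo y) (qo z) \<psi> (qa v y (Cmp Y v w' y t h))"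
   using S ClD(2)[OF a(1)] a(6)[symmetric] by (simp add: qD(4))
  also have "\<dots> = Cmp Z (qo v) (qo w') (qo z) (Cmp Z (qo w') (qo y) (qo z) \<psi> (qa w' y t)) (qa v w' h)"
   using S by (simp add: qD(4) cmp_assoc'[OF Z])
  also have "\<dots> = qa v z (Cmp Y v w' z g h)" using S ClD(2)[OF a(2)] by (simp add: qD(4))
  finally have "val x z (v, Cmp Y v w x s u, Cmp Y v w' z g h) (Cmp Z (qo x) (qo y) (qo z) \<psi> \<phi>)" by (simp add: val_def)
  then show "P = Cl x z (Cmp Z (qo x) (qo y) (qo z) \<psi> \<phi>)"
   unfolding P using S i by (intro cls rI) (simp_all add: cY cZ)
 next
  note qx = qD(1)[OF x(1)] qD(1)[OF x(2)] qD(1)[OF x(3)]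
  obtain f where f: "(l x, \<epsilon> x, f) \<in> roofs Y S x y" "val x y (l x, \<epsilon> x, f) \<phi>" using rep0[OF x(1,2) \<phi>] by blast
  obtain g where g: "(l y, \<epsilon> y, g) \<in> roofs Y S y z" "val y z (l y, \<epsilon> y, g) \<psi>" using rep0[OF x(2,3) \<psi>] by blast
  \<comment> \<open>To compose the standard representatives, the apex L q L q x is taken with the
    counit towards L q x. The arrow \<open>h\<close> to L q y is the adjoint of the solution
    \<open>h0\<close> of \<open>q\<close> \<epsilon> y after \<open>h0\<close> =
    \<open>q f\<close>.\<close>
  let ?w = "l x" let ?v = "l ?w"
  note lx = lo[OF x(1)] and llx = lo[OF lo[OF x(1)]] and ly = lo[OF x(2)]
  note r = rD[OF x(1) f(1)]
  obtain h0 where h0: "h0 \<in> Arr Z (qo ?w) (qo (l y))" "Cmp Z (qo ?w) (qo (l y)) (qo y) (qa (l y) y (\<epsilon> y)) h0 = qa ?w y f"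
   using iso_left_factor[OF Z qD(1)[OF lx] qD(1)[OF ly] qx(2) \<epsilon>i[OF x(2)] qD(3)[OF lx x(2) r(3)]] by blast
  obtain h where h: "h \<in> Arr Y ?v (l y)" "Cmp Z (qo ?w) (qo ?v) (qo (l y)) (qa ?v (l y) h) (\<eta> (qo ?w)) = h0"
   using lift[OF lx ly h0(1)] by blast
  note S = x qx lx llx ly qD(1)[OF lx] qD(1)[OF llx] qD(1)[OF ly] r(3) h(1) h0(1) \<epsilon>(1)[OF x(2)] \<epsilon>(1)[OF lx] \<eta>a[OF lx]
   qD(3)[OF lx x(2) r(3)] qD(3)[OF ly x(2) \<epsilon>(1)[OF x(2)]] qD(3)[OF llx ly h(1)] qD(3)[OF llx lx \<epsilon>(1)[OF lx]]
  have "Cmp Y ?v ?w y f (\<epsilon> ?w) = Cmp Y ?v (l y) y (\<epsilon> y) h"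
   using S h0(2) h(2) \<epsilon>(2)[OF lx] by (intro liftu[OF lx x(2)]) (simp_all add: cY qD(4) cmp_assoc'[OF Z] catD(5)[OF Z])
  moreover have "inverted Y S ?v ?w (\<epsilon> ?w)" using inv[OF llx lx \<epsilon>(1)[OF lx]] \<epsilon>i[OF lx] by simp
  ultimately show "{roof_class Y S x z (v, Cmp Y v w x s u, Cmp Y v w' z g h) |v w w' s t f g u h.
    (w, s, f) \<in> Cl x y \<phi> \<and> (w', t, g) \<in> Cl y z \<psi> \<and> v \<in> Obj Y \<and> inverted Y S v w u \<and> h \<in> Arr Y v w' \<and>
    Cmp Y v w y f u = Cmp Y v w' y t h} \<noteq> {}"
   using f g h(1) llx unfolding Cl_def by blast
 qed
 have addQ: "Cl x y \<phi> \<oplus>\<^bsub>Hom ?Q x y\<^esub> Cl x y \<psi> = Cl x y (\<phi> \<oplus>\<^bsub>Hom Z (qo x) (qo y)\<^esub> \<psi>)"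
  if x: "x \<in> Obj Y" "y \<in> Obj Y" and \<phi>: "\<phi> \<in> Arr Z (qo x) (qo y)" and \<psi>: "\<psi> \<in> Arr Z (qo x) (qo y)" for x y \<phi> \<psi>
  unfolding serre_quotient_def lincat.select_convs ring.select_convs
 proof (rule un)
  note qx = qD(1)[OF x(1)] qD(1)[OF x(2)]
  fix P assume "P \<in> {roof_class Y S x y (v, Cmp Y v w x s u, Cmp Y v w y f u \<oplus>\<^bsub>Hom Y v y\<^esub> Cmp Y v w' y f' u') |v w w' s s' f f' u u'.
    (w, s, f) \<in> Cl x y \<phi> \<and> (w', s', f') \<in> Cl x y \<psi> \<and> v \<in> Obj Y \<and> u \<in> Arr Y v w \<and> u' \<in> Arr Y v w' \<and>
    Cmp Y v w x s u = Cmp Y v w' x s' u' \<and> inverted Y S v x (Cmp Y v w x s u)}"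
  then obtain v w w' s s' f f' u u' where P: "P = roof_class Y S x y (v, Cmp Y v w x s u, Cmp Y v w y f u \<oplus>\<^bsub>Hom Y v y\<^esub> Cmp Y v w' y f' u')"
   and a: "(w, s, f) \<in> Cl x y \<phi>" "(w', s', f') \<in> Cl x y \<psi>" "v \<in> Obj Y" "u \<in> Arr Y v w" "u' \<in> Arr Y v w'"
    "Cmp Y v w x s u = Cmp Y v w' x s' u'" "inverted Y S v x (Cmp Y v w x s u)" by blast
  note r = rD[OF x(1) ClD(1)[OF a(1)]] and r2 = rD[OF x(1) ClD(1)[OF a(2)]]
  note S = x qx \<phi> \<psi> a(3-5) r(1-3) r2(1-3) qD(1)[OF a(3)] qD(1)[OF r(1)] qD(1)[OF r2(1)]
   qD(3)[OF r(1) x(1) r(2)] qD(3)[OF r(1) x(2) r(3)] qD(3)[OF r2(1) x(1) r2(2)] qD(3)[OF r2(1) x(2) r2(3)]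
   qD(3)[OF a(3) r(1) a(4)] qD(3)[OF a(3) r2(1) a(5)]
  have su: "Cmp Y v w x s u \<in> Arr Y v x" and fu: "Cmp Y v w y f u \<in> Arr Y v y" "Cmp Y v w' y f' u' \<in> Arr Y v y"
   using S by (simp_all add: cY)
  have i: "is_iso Z (qo v) (qo x) (qa v x (Cmp Y v w x s u))" using a(7) inv[OF a(3) x(1) su] by simp
  have 1: "Cmp Z (qo v) (qo x) (qo y) \<phi> (qa v x (Cmp Y v w x s u)) = qa v y (Cmp Y v w y f u)"
   using S ClD(2)[OF a(1)] by (simp add: qD(4) cmp_assoc'[OF Z, symmetric])
  have 2: "Cmp Z (qo v) (qo x) (qo y) \<psi> (qa v x (Cmp Y v w' x s' u')) = qa v y (Cmp Y v w' y f' u')"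
   using S ClD(2)[OF a(2)] by (simp add: qD(4) cmp_assoc'[OF Z, symmetric])
  have "val x y (v, Cmp Y v w x s u, Cmp Y v w y f u \<oplus>\<^bsub>Hom Y v y\<^esub> Cmp Y v w' y f' u') (\<phi> \<oplus>\<^bsub>Hom Z (qo x) (qo y)\<^esub> \<psi>)"
   unfolding val_def prod.case
   using 1 2 a(6) S fu qD(3)[OF a(3) x(1) su] linD(2)[OF qD(5)[OF a(3) x(2)] fu] cmp_add(1)[OF Z qD(1)[OF a(3)] qx qD(3)[OF a(3) x(1) su] \<phi> \<psi>]
   by simp
  then show "P = Cl x y (\<phi> \<oplus>\<^bsub>Hom Z (qo x) (qo y)\<^esub> \<psi>)"
   unfolding P using S i su fu by (intro cls rI) (simp_all add: vs_closed[OF catD(1)[OF Y]] vs_closed[OF catD(1)[OF Z]])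
 next
  obtain f where f: "(l x, \<epsilon> x, f) \<in> roofs Y S x y" "val x y (l x, \<epsilon> x, f) \<phi>" using rep0[OF x \<phi>] by blast
  obtain g where g: "(l x, \<epsilon> x, g) \<in> roofs Y S x y" "val x y (l x, \<epsilon> x, g) \<psi>" using rep0[OF x \<psi>] by blast
  \<comment> \<open>Both summands have a representative with left leg \<epsilon> x, so identities
    give a common denominator.\<close>
  have "Cmp Y (l x) (l x) x (\<epsilon> x) (Idt Y (l x)) = \<epsilon> x" by (rule catD(5)[OF Y lo[OF x(1)] x(1) \<epsilon>(1)[OF x(1)]])
  then have "inverted Y S (l x) x (Cmp Y (l x) (l x) x (\<epsilon> x) (Idt Y (l x)))"
   using inv[OF lo[OF x(1)] x(1) \<epsilon>(1)[OF x(1)]] \<epsilon>i[OF x(1)] by simp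
  then show "{roof_class Y S x y (v, Cmp Y v w x s u, Cmp Y v w y f u \<oplus>\<^bsub>Hom Y v y\<^esub> Cmp Y v w' y f' u') |v w w' s s' f f' u u'.
    (w, s, f) \<in> Cl x y \<phi> \<and> (w', s', f') \<in> Cl x y \<psi> \<and> v \<in> Obj Y \<and> u \<in> Arr Y v w \<and> u' \<in> Arr Y v w' \<and>
    Cmp Y v w x s u = Cmp Y v w' x s' u' \<and> inverted Y S v x (Cmp Y v w x s u)} \<noteq> {}"
   using f g lo[OF x(1)] catD(2)[OF Y lo[OF x(1)]] unfolding Cl_def by blast
 qed
 have smultQ: "r \<odot>\<^bsub>Hom ?Q x y\<^esub> Cl x y \<phi> = Cl x y (r \<odot>\<^bsub>Hom Z (qo x) (qo y)\<^esub> \<phi>)"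
  if x: "x \<in> Obj Y" "y \<in> Obj Y" and \<phi>: "\<phi> \<in> Arr Z (qo x) (qo y)" and k: "r \<in> carrier K" for x y \<phi> r
  unfolding serre_quotient_def lincat.select_convs module.select_convs
 proof (rule un)
  note qx = qD(1)[OF x(1)] qD(1)[OF x(2)]
  fix P assume "P \<in> (\<lambda>(w, s, f). roof_class Y S x y (w, s, r \<odot>\<^bsub>Hom Y w y\<^esub> f)) ` Cl x y \<phi>"
  then obtain w s f where P: "P = roof_class Y S x y (w, s, r \<odot>\<^bsub>Hom Y w y\<^esub> f)" and a: "(w, s, f) \<in> Cl x y \<phi>" by auto
  note r = rD[OF x(1) ClD(1)[OF a(1)]]
  note S = x qx \<phi> k r(1-3) qD(1)[OF r(1)] qD(3)[OF r(1) x(1) r(2)] qD(3)[OF r(1) x(2) r(3)]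
  have "val x y (w, s, r \<odot>\<^bsub>Hom Y w y\<^esub> f) (r \<odot>\<^bsub>Hom Z (qo x) (qo y)\<^esub> \<phi>)"
   unfolding val_def prod.case using S ClD(2)[OF a] linD(3)[OF qD(5)[OF r(1) x(2)] k r(3)] by (simp add: cmp_add[OF Z])
  then show "P = Cl x y (r \<odot>\<^bsub>Hom Z (qo x) (qo y)\<^esub> \<phi>)"
   unfolding P using S r(4) by (intro cls rI) (simp_all add: vs_closed[OF catD(1)[OF Y]] vs_closed[OF catD(1)[OF Z]])
 next
  show "(\<lambda>(w, s, f). roof_class Y S x y (w, s, r \<odot>\<^bsub>Hom Y w y\<^esub> f)) ` Cl x y \<phi> \<noteq> {}"
   using rep0[OF x \<phi>] unfolding Cl_def by blast
 qed
 have obj: "Obj ?Q = Obj Y" by (simp add: serre_quotient_def)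
 \<comment> \<open>The inverse of the bijection from arrows of Z to classes; all its properties are
   read off from the formulas for the operations on \<open>Cl\<close>.\<close>
 define F where "F = \<lparr>Fob = qo, Far = (\<lambda>x y. inv_into (Arr Z (qo x) (qo y)) (Cl x y))\<rparr>"
 have inj: "inj_on (Cl x y) (Arr Z (qo x) (qo y))" if "x \<in> Obj Y" "y \<in> Obj Y" for x y
  using clinj[OF that] by (auto intro: inj_onI)
 have F: "Far F x y (Cl x y \<phi>) = \<phi>" if "x \<in> Obj Y" "y \<in> Obj Y" "\<phi> \<in> Arr Z (qo x) (qo y)" for x y \<phi>
  using inv_into_f_f[OF inj[OF that(1,2)] that(3)] by (simp add: F_def)
 have Fo: "Fob F = qo" by (simp add: F_def)
 note vZ = vs_closed[OF catD(1)[OF Z qD(1) qD(1)]]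
 have "category_equivalence K ?Q Z F"
 proof (rule equivalence_from_ff[OF Z])
  show "linear_functor K ?Q Z F"
  proof (rule lfI)
   fix x y assume xy: "x \<in> Obj ?Q" "y \<in> Obj ?Q"
   then show "lin (Hom ?Q x y) (Hom Z (Fob F x) (Fob F y)) (Far F x y)"
    by (intro linI) (auto simp: obj car Fo F addQ smultQ vZ)
  qed (auto simp: obj car Fo F idt cmp qD catD(2,3)[OF Z])
  show "fully_faithful ?Q Z F"
   unfolding fully_faithful_def obj Fo
  proof (intro ballI)
   fix x y assume x: "x \<in> Obj Y" "y \<in> Obj Y"
   show "bij_betw (Far F x y) (Arr ?Q x y) (Arr Z (qo x) (qo y))"
    unfolding car[OF x] F_def funct.select_convs by (rule bij_betw_inv_into[OF inj_on_imp_bij_betw[OF inj[OF x]]])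
  qed
  fix d assume d: "d \<in> Obj Z"
  obtain t where "t \<in> Arr Z (qo (Fob L d)) d" "Cmp Z d (qo (Fob L d)) d t (\<eta> d) = Idt Z d"
   "Cmp Z (qo (Fob L d)) d (qo (Fob L d)) (\<eta> d) t = Idt Z (qo (Fob L d))" "\<eta> d \<in> Arr Z d (qo (Fob L d))"
   using \<eta>i[OF d] by (auto simp: is_iso_def)
  then show "\<exists>c\<in>Obj ?Q. \<exists>f. is_iso Z (Fob F c) d f"
   using LD(1)[OF d] by (auto simp: is_iso_def obj Fo)
 qed (auto simp: obj car idt cmp addQ smultQ vZ qD catD(2,3)[OF Z])
 then show ?thesis by blast
qed

section \<open>Tensor products\<close>


text \<open>The field as a vector space over itself, the same record that occurs inside
  \<open>dual_space\<close>; linear forms are thus instances of \<open>lin\<close>.\<close>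

definition base_space :: "('k, 'k) module" where
 "base_space = \<lparr>carrier = carrier K, mult = mult K, one = one K, zero = zero K, add = add K, smult = mult K\<rparr>"

lemma base_space_sel [simp]:
 "carrier base_space = carrier K" "zero base_space = \<zero>" "add base_space = add K" "smult base_space = mult K"
 by (simp_all add: base_space_def)

lemma base_space_vsp: "vsp base_space"
 by (rule vspI) (auto simp: a_ac m_ac l_distr r_distr)

lemma base_space_finsum: "f \<in> A \<rightarrow> carrier K ==> finsum base_space f A = finsum K f A"
proof (induction A rule: infinite_finite_induct)
 interpret B: vectorspace K base_space by (rule base_space_vsp)
 case (infinite A) then show ?case by (simp add: finsum_infinite B.finsum_infinite)
next
 interpret B: vectorspace K base_space by (rule base_space_vsp)
 case empty then show ?case by simp
next
 interpret B: vectorspace K base_space by (rule base_space_vsp)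
 case (insert x A) then show ?case by (simp add: finsum_insert B.finsum_insert)
qed

subsection \<open>Free spaces\<close>

lemma free_space_sel:
 "u \<in> carrier (free_space K S) \<longleftrightarrow> range u \<subseteq> carrier K \<and> finite {s. u s \<noteq> \<zero>} \<and> {s. u s \<noteq> \<zero>} \<subseteq> S"
 "\<zero>\<^bsub>free_space K S\<^esub> = (\<lambda>s. \<zero>)" "u \<oplus>\<^bsub>free_space K S\<^esub> v = (\<lambda>s. u s \<oplus> v s)"
 "r \<odot>\<^bsub>free_space K S\<^esub> u = (\<lambda>s. r \<otimes> u s)"
 by (simp_all add: free_space_def)

lemma free_memD:
 assumes "u \<in> carrier (free_space K S)"
 shows "u s \<in> carrier K" "finite {s. u s \<noteq> \<zero>}" "u s \<noteq> \<zero> ==> s \<in> S"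
 using assms by (auto simp: free_space_sel)

lemma free_memI:
 assumes "\<And>s. u s \<in> carrier K" "finite A" "\<And>s. u s \<noteq> \<zero> ==> s \<in> A" "\<And>s. u s \<noteq> \<zero> ==> s \<in> S"
 shows "u \<in> carrier (free_space K S)"
 using assms finite_subset[of "{s. u s \<noteq> \<zero>}" A] by (auto simp: free_space_sel)

lemma free_vsp: "vsp (free_space K S)"
proof (rule vspI)
 fix u v assume uv: "u \<in> carrier (free_space K S)" "v \<in> carrier (free_space K S)"
 have "u s \<noteq> \<zero> \<or> v s \<noteq> \<zero>" if "u s \<oplus> v s \<noteq> \<zero>" for s using that by auto
 then show "u \<oplus>\<^bsub>free_space K S\<^esub> v \<in> carrier (free_space K S)"
  using free_memD[OF uv(1)] free_memD[OF uv(2)]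
  by (intro free_memI[of _ "{s. u s \<noteq> \<zero>} \<union> {s. v s \<noteq> \<zero>}"]) (simp_all add: free_space_sel(2-), blast+)
next
 fix r u assume u: "r \<in> carrier K" "u \<in> carrier (free_space K S)"
 have "u s \<noteq> \<zero>" if "r \<otimes> u s \<noteq> \<zero>" for s using that u(1) by auto
 then show "r \<odot>\<^bsub>free_space K S\<^esub> u \<in> carrier (free_space K S)"
  using u(1) free_memD[OF u(2)]
  by (intro free_memI[of _ "{s. u s \<noteq> \<zero>}"]) (simp_all add: free_space_sel(2-), blast?)
next
 show "\<zero>\<^bsub>free_space K S\<^esub> \<in> carrier (free_space K S)" by (simp add: free_space_sel)
qed (auto simp: free_space_sel(2-) fun_eq_iff free_memD(1) a_ac m_ac l_distr r_distr)

lemma basis_vec_mem: "s \<in> S ==> basis_vec K s \<in> carrier (free_space K S)"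
 by (rule free_memI[of _ "{s}"]) (auto simp: basis_vec_def split: if_splits)

text \<open>Induction on the size of a finite set containing the support: one coordinate is set to
  zero and restored as a multiple of a basis vector.\<close>

lemma free_induct:
 assumes N: "subsp (free_space K S) N" and b: "\<And>s. s \<in> S ==> basis_vec K s \<in> N" and u: "u \<in> carrier (free_space K S)"
 shows "u \<in> N"
proof -
 have "finite A ==> u \<in> carrier (free_space K S) ==> {s. u s \<noteq> \<zero>} \<subseteq> A ==> u \<in> N" for A u
 proof (induction A arbitrary: u rule: finite_induct)
  case empty
  then have "u = \<zero>\<^bsub>free_space K S\<^esub>" by (auto simp: free_space_sel)
  then show ?case using subspD(2)[OF N] by simp
 next
  case (insert a A)
  note u = free_memD[OF insert.prems(1)]
  let ?v = "u(a := \<zero>)"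
  have v: "?v \<in> carrier (free_space K S)"
   by (rule free_memI[of _ "{s. u s \<noteq> \<zero>}"]) (use u in \<open>auto split: if_splits\<close>)
  have vN: "?v \<in> N" by (rule insert.IH[OF v]) (use insert.prems(2) in auto)
  show ?case
  proof (cases "u a = \<zero>")
   case True then show ?thesis using vN by (metis fun_upd_triv)
  next
   case False
   have "u = ?v \<oplus>\<^bsub>free_space K S\<^esub> (u a \<odot>\<^bsub>free_space K S\<^esub> basis_vec K a)"
    using u(1) by (auto simp: free_space_sel basis_vec_def fun_eq_iff)
   also have "\<dots> \<in> N" by (intro subspD(3)[OF N vN] subspD(4)[OF N] b u(1) u(3)[OF False])
   finally show ?thesis .
  qed
 qed
 then show ?thesis using free_memD(2)[OF u] u by blast
qed

definition free_lin :: "('k, 'w) module => ('s => 'w) => ('s => 'k) => 'w" where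
 "free_lin W b u = (\<Oplus>\<^bsub>W\<^esub>s\<in>{s. u s \<noteq> \<zero>}. u s \<odot>\<^bsub>W\<^esub> b s)"

context
 fixes W :: "('k, 'w) module" and S :: "'s set" and b
 assumes W: "vsp W" and b: "\<And>s. s \<in> S ==> b s \<in> carrier W"
begin

interpretation W: vectorspace K W by (rule W)

text \<open>The supports of \<open>u\<close>, \<open>v\<close> and their sum differ, so additivity
  of \<open>free_lin\<close> can only be checked over a common finite set of indices.\<close>

lemma free_lin_sum:
 assumes u: "u \<in> carrier (free_space K S)" and A: "finite A" "{s. u s \<noteq> \<zero>} \<subseteq> A" "A \<subseteq> S"
 shows "free_lin W b u = (\<Oplus>\<^bsub>W\<^esub>s\<in>A. u s \<odot>\<^bsub>W\<^esub> b s)"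
 unfolding free_lin_def
 by (rule W.add.finprod_mono_neutral_cong_left[OF A(1,2)]) (use free_memD[OF u] b A(3) in auto)

lemma free_lin_lin: "lin (free_space K S) W (free_lin W b)"
proof (rule linI)
 fix u assume u: "u \<in> carrier (free_space K S)"
 show "free_lin W b u \<in> carrier W"
  unfolding free_lin_def by (rule W.finsum_closed) (use free_memD[OF u] b in auto)
next
 fix u v assume u: "u \<in> carrier (free_space K S)" and v: "v \<in> carrier (free_space K S)"
 let ?A = "{s. u s \<noteq> \<zero>} \<union> {s. v s \<noteq> \<zero>}"
 note U = free_memD[OF u] free_memD[OF v]
 have A: "finite ?A" "?A \<subseteq> S" using U by auto
 have t: "u s \<odot>\<^bsub>W\<^esub> b s \<in> carrier W" "v s \<odot>\<^bsub>W\<^esub> b s \<in> carrier W" if "s \<in> ?A" for s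
  using that A(2) U(1,4) b by blast+
 have uv: "u \<oplus>\<^bsub>free_space K S\<^esub> v \<in> carrier (free_space K S)" by (rule vs_closed(2)[OF free_vsp u v])
 have "free_lin W b (u \<oplus>\<^bsub>free_space K S\<^esub> v) = (\<Oplus>\<^bsub>W\<^esub>s\<in>?A. (u s \<oplus> v s) \<odot>\<^bsub>W\<^esub> b s)"
  by (subst free_lin_sum[OF uv A(1) _ A(2)]) (auto simp: free_space_sel(3))
 also have "\<dots> = (\<Oplus>\<^bsub>W\<^esub>s\<in>?A. u s \<odot>\<^bsub>W\<^esub> b s \<oplus>\<^bsub>W\<^esub> v s \<odot>\<^bsub>W\<^esub> b s)"
  by (rule W.finsum_cong') (use t A b U in \<open>auto intro!: W.smult_l_distr\<close>)
 also have "\<dots> = free_lin W b u \<oplus>\<^bsub>W\<^esub> free_lin W b v"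
  using t by (subst W.finsum_addf) (auto simp: free_lin_sum[OF u A(1) _ A(2)] free_lin_sum[OF v A(1) _ A(2)])
 finally show "free_lin W b (u \<oplus>\<^bsub>free_space K S\<^esub> v) = free_lin W b u \<oplus>\<^bsub>W\<^esub> free_lin W b v" .
next
 fix r u assume r: "r \<in> carrier K" and u: "u \<in> carrier (free_space K S)"
 let ?A = "{s. u s \<noteq> \<zero>}"
 note U = free_memD[OF u]
 have A: "finite ?A" "?A \<subseteq> S" using U by auto
 have ru: "r \<odot>\<^bsub>free_space K S\<^esub> u \<in> carrier (free_space K S)" by (rule vs_closed(5)[OF free_vsp r u])
 have t: "u s \<odot>\<^bsub>W\<^esub> b s \<in> carrier W" if "s \<in> ?A" for s
  using that A(2) U(1) b by blast
 have "free_lin W b (r \<odot>\<^bsub>free_space K S\<^esub> u) = (\<Oplus>\<^bsub>W\<^esub>s\<in>?A. (r \<otimes> u s) \<odot>\<^bsub>W\<^esub> b s)"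
  using r by (subst free_lin_sum[OF ru A(1) _ A(2)]) (auto simp: free_space_sel(4))
 also have "\<dots> = (\<Oplus>\<^bsub>W\<^esub>s\<in>?A. r \<odot>\<^bsub>W\<^esub> (u s \<odot>\<^bsub>W\<^esub> b s))"
  by (rule W.finsum_cong') (use t r A b U in \<open>auto intro!: W.smult_assoc1\<close>)
 also have "\<dots> = r \<odot>\<^bsub>W\<^esub> free_lin W b u"
  unfolding free_lin_def using t by (intro W.finsum_smult_ldistr[OF A(1) r, symmetric]) auto
 finally show "free_lin W b (r \<odot>\<^bsub>free_space K S\<^esub> u) = r \<odot>\<^bsub>W\<^esub> free_lin W b u" .
qed

lemma free_lin_basis: "s \<in> S ==> free_lin W b (basis_vec K s) = b s"
 using b by (subst free_lin_sum[OF basis_vec_mem, of s "{s}"])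
  (auto simp: basis_vec_def W.finsum_insert)

end

text \<open>Each coordinate of \<open>free_map\<close> is the linear extension of the indicator of a
  fibre of \<open>g\<close>, so linearity is inherited from \<open>free_lin\<close>.\<close>

lemma free_map_eq:
 assumes u: "u \<in> carrier (free_space K S)"
 shows "free_map K g u t = free_lin base_space (\<lambda>s. if g s = t then \<one> else \<zero>) u"
proof -
 have "free_lin base_space (\<lambda>s. if g s = t then \<one> else \<zero>) u =
  (\<Oplus>s\<in>{s. u s \<noteq> \<zero>}. u s \<otimes> (if g s = t then \<one> else \<zero>))"
  using free_memD(1)[OF u] by (simp add: free_lin_def) (rule base_space_finsum, auto)
 also have "\<dots> = free_map K g u t"
  unfolding free_map_def
  by (rule add.finprod_mono_neutral_cong_left[symmetric]) (use free_memD[OF u] in auto)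
 finally show ?thesis by simp
qed

lemma free_map_lin:
 assumes g: "\<And>s. s \<in> S ==> g s \<in> S'"
 shows "lin (free_space K S) (free_space K S') (free_map K g)"
proof -
 have l: "lin (free_space K S) base_space (free_lin base_space (\<lambda>s. if g s = t then \<one> else \<zero>))" for t
  by (rule free_lin_lin[OF base_space_vsp]) simp
 note V = vs_closed[OF free_vsp]
 show ?thesis
 proof (rule linI)
  fix u assume u: "u \<in> carrier (free_space K S)"
  have nz: "\<exists>s. u s \<noteq> \<zero> \<and> g s = t" if "free_map K g u t \<noteq> \<zero>" for t
  proof (rule ccontr)
   assume "\<not> ?thesis"
   then have e: "{s. u s \<noteq> \<zero> \<and> g s = t} = {}" by blast
   have "free_map K g u t = \<zero>" unfolding free_map_def e by simp
   then show False using that by simp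
  qed
  show "free_map K g u \<in> carrier (free_space K S')"
  proof (rule free_memI[of _ "g ` {s. u s \<noteq> \<zero>}"])
   show "free_map K g u t \<in> carrier K" for t using linD(1)[OF l u] by (simp add: free_map_eq[OF u])
  qed (use nz free_memD[OF u] g in auto)
 next
  fix u v assume u: "u \<in> carrier (free_space K S)" and v: "v \<in> carrier (free_space K S)"
  show "free_map K g (u \<oplus>\<^bsub>free_space K S\<^esub> v) = free_map K g u \<oplus>\<^bsub>free_space K S'\<^esub> free_map K g v"
   using linD(2)[OF l u v] by (auto simp: fun_eq_iff free_space_sel(3)[where S = S'] free_map_eq[OF u] free_map_eq[OF v] free_map_eq[OF V(2)[OF u v]])
 next
  fix r u assume r: "r \<in> carrier K" and u: "u \<in> carrier (free_space K S)"
  show "free_map K g (r \<odot>\<^bsub>free_space K S\<^esub> u) = r \<odot>\<^bsub>free_space K S'\<^esub> free_map K g u"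
   using linD(3)[OF l r u] by (auto simp: fun_eq_iff free_space_sel(4)[where S = S'] free_map_eq[OF u] free_map_eq[OF V(5)[OF r u]])
 qed
qed

lemma free_map_basis: "free_map K g (basis_vec K s) = basis_vec K (g s)"
proof
 fix t
 have "free_map K g (basis_vec K s) t = free_lin base_space (\<lambda>s. if g s = t then \<one> else \<zero>) (basis_vec K s)"
  by (rule free_map_eq[OF basis_vec_mem[of s "{s}"]]) simp
 also have "\<dots> = (if g s = t then \<one> else \<zero>)"
  by (rule free_lin_basis[OF base_space_vsp, of "{s}"]) auto
 finally show "free_map K g (basis_vec K s) t = basis_vec K (g s) t" by (auto simp: basis_vec_def)
qed

subsection \<open>The universal property\<close>

definition balanced :: "('k, 'o, 'm) lincat => ('k, 'o, 'm, 'v) cmod => ('k, 'o, 'm, 'w) cmod => ('k, 'u) module =>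
  ('o => 'v => 'w => 'u) => bool" where
 "balanced C Y Z W b \<longleftrightarrow>
   (\<forall>c\<in>Obj C. \<forall>z\<in>El Z c. lin (Val Y c) W (\<lambda>y. b c y z)) \<and>
   (\<forall>c\<in>Obj C. \<forall>y\<in>El Y c. lin (Val Z c) W (\<lambda>z. b c y z)) \<and>
   (\<forall>c\<in>Obj C. \<forall>d\<in>Obj C. \<forall>f\<in>Arr C c d. \<forall>y\<in>El Y d. \<forall>z\<in>El Z c.
    b c (Act Y c d f y) z = b d y (Act Z d c f z))"

lemma balancedD:
 assumes "balanced C Y Z W b"
 shows "c \<in> Obj C ==> z \<in> El Z c ==> lin (Val Y c) W (\<lambda>y. b c y z)"
  "c \<in> Obj C ==> y \<in> El Y c ==> lin (Val Z c) W (\<lambda>z. b c y z)"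
  "c \<in> Obj C ==> d \<in> Obj C ==> f \<in> Arr C c d ==> y \<in> El Y d ==> z \<in> El Z c ==>
    b c (Act Y c d f y) z = b d y (Act Z d c f z)"
 using assms by (auto simp: balanced_def)

definition tens :: "('k, 'o, 'm) lincat => ('k, 'o, 'm, 'v) cmod => ('k, 'o, 'm, 'w) cmod => 'o => 'v => 'w =>
  ('o \<times> 'v \<times> 'w => 'k) set" where
 "tens C Y Z c y z = tensor_rel K C Y Z +>\<^bsub>tensor_free K C Y Z\<^esub> basis_vec K (c, y, z)"

context
 fixes C :: "('k, 'o, 'm) lincat" and Y :: "('k, 'o, 'm, 'v) cmod" and Z :: "('k, 'o, 'm, 'w) cmod"
 assumes Y: "cmd C Y" and Z: "cmd (op_cat C) Z"
begin

abbreviation (input) tfree where "tfree \<equiv> tensor_free K C Y Z"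

lemma op_val: "c \<in> Obj C ==> vsp (Val Z c)"
 "c \<in> Obj C ==> d \<in> Obj C ==> f \<in> Arr C c d ==> z \<in> El Z c ==> Act Z d c f z \<in> El Z d"
 using cmdD(1)[OF Z] cmdD(4)[OF Z] by simp_all

lemma T_vsp: "vsp tfree"
 unfolding tensor_free_def by (rule free_vsp)

lemma T_basis: "c \<in> Obj C ==> y \<in> El Y c ==> z \<in> El Z c ==> basis_vec K (c, y, z) \<in> carrier tfree"
 unfolding tensor_free_def by (rule basis_vec_mem) simp

text \<open>The relations whose span is \<open>tensor_rel\<close>, with the local abbreviations of
  that definition expanded.\<close>

definition gens where "gens = {basis_vec K (c, y \<oplus>\<^bsub>Val Y c\<^esub> y', z) \<ominus>\<^bsub>tfree\<^esub> (basis_vec K (c, y, z) \<oplus>\<^bsub>tfree\<^esub> basis_vec K (c, y', z)) | c y y' z.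
      c \<in> Obj C \<and> y \<in> El Y c \<and> y' \<in> El Y c \<and> z \<in> El Z c} \<union>
    {basis_vec K (c, y, z \<oplus>\<^bsub>Val Z c\<^esub> z') \<ominus>\<^bsub>tfree\<^esub> (basis_vec K (c, y, z) \<oplus>\<^bsub>tfree\<^esub> basis_vec K (c, y, z')) | c y z z'.
      c \<in> Obj C \<and> y \<in> El Y c \<and> z \<in> El Z c \<and> z' \<in> El Z c} \<union>
    {basis_vec K (c, r \<odot>\<^bsub>Val Y c\<^esub> y, z) \<ominus>\<^bsub>tfree\<^esub> (r \<odot>\<^bsub>tfree\<^esub> basis_vec K (c, y, z)) | c r y z.
      c \<in> Obj C \<and> r \<in> carrier K \<and> y \<in> El Y c \<and> z \<in> El Z c} \<union>
    {basis_vec K (c, y, r \<odot>\<^bsub>Val Z c\<^esub> z) \<ominus>\<^bsub>tfree\<^esub> (r \<odot>\<^bsub>tfree\<^esub> basis_vec K (c, y, z)) | c r y z.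
      c \<in> Obj C \<and> r \<in> carrier K \<and> y \<in> El Y c \<and> z \<in> El Z c} \<union>
    {basis_vec K (c, Act Y c d f y, z) \<ominus>\<^bsub>tfree\<^esub> basis_vec K (d, y, Act Z d c f z) | c d f y z.
      c \<in> Obj C \<and> d \<in> Obj C \<and> f \<in> Arr C c d \<and>
      y \<in> El Y d \<and> z \<in> El Z c}"

lemma tensor_rel_eq: "tensor_rel K C Y Z = module.span K tfree gens"
 unfolding tensor_rel_def gens_def Let_def by (rule refl)

lemma gens_closed: "gens \<subseteq> carrier tfree"
 unfolding gens_def
 using vs_closed[OF T_vsp] T_basis vs_closed[OF cmdD(1)[OF Y]] vs_closed[OF op_val(1)] cmdD(4)[OF Y] op_val(2) by auto

lemma rel_subsp: "subsp tfree (tensor_rel K C Y Z)"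
proof -
 interpret T: vectorspace K tfree by (rule T_vsp)
 have "submodule K (T.span gens) tfree" by (rule T.span_is_submodule[OF gens_closed])
 then show ?thesis unfolding tensor_rel_eq subsp_def submodule_def by blast
qed

lemma rel_gens: "gens \<subseteq> tensor_rel K C Y Z"
proof -
 interpret T: vectorspace K tfree by (rule T_vsp)
 show ?thesis unfolding tensor_rel_eq by (rule T.in_own_span[OF gens_closed])
qed

text \<open>The kernel of \<open>f\<close> is a submodule, and balancedness says exactly that it
  contains the generating relations.\<close>

lemma rel_vanish:
 assumes W: "vsp W" and f: "lin tfree W f" and b: "balanced C Y Z W (\<lambda>c y z. f (basis_vec K (c, y, z)))"
  and n: "n \<in> tensor_rel K C Y Z"
 shows "f n = \<zero>\<^bsub>W\<^esub>"
proof -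
 interpret T: vectorspace K tfree by (rule T_vsp)
 let ?N = "{v \<in> carrier tfree. f v = \<zero>\<^bsub>W\<^esub>}"
 note s = subsp_ker[OF f T_vsp W]
 have "submodule K ?N tfree" using s T.module_axioms by (auto simp: subsp_def submodule_def)
 moreover have "f v = \<zero>\<^bsub>W\<^esub>" if v: "v \<in> gens" for v
 proof -
  note B = linD(2,3)[OF balancedD(1)[OF b]] linD(2,3)[OF balancedD(2)[OF b]] balancedD(3)[OF b]
  note S = lin_diff[OF f T_vsp W] linD[OF f] vs_closed[OF T_vsp] T_basis vs_closed[OF cmdD(1)[OF Y]]
   vs_closed[OF op_val(1)] cmdD(4)[OF Y] op_val(2) B vs_closed[OF W] vs_diff_zero[OF W]
  from v show ?thesis unfolding gens_def
   by (elim UnE CollectE exE conjE) (simp_all add: S)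
 qed
 then have "gens \<subseteq> ?N" using gens_closed by auto
 ultimately show ?thesis using T.span_is_subset[of gens ?N] n unfolding tensor_rel_eq by blast
qed

lemma tensor_vsp: "vsp (tensor K C Y Z)"
 unfolding tensor_def by (rule quot_vsp[OF T_vsp rel_subsp])

lemma tens_lin0: "lin tfree (tensor K C Y Z) (\<lambda>u. tensor_rel K C Y Z +>\<^bsub>tfree\<^esub> u)"
 unfolding tensor_def by (rule quot_lin[OF T_vsp rel_subsp])

lemma tens_mem: "c \<in> Obj C ==> y \<in> El Y c ==> z \<in> El Z c ==> tens C Y Z c y z \<in> carrier (tensor K C Y Z)"
 unfolding tens_def by (intro linD(1)[OF tens_lin0] T_basis)

lemma tens_gen_eq:
 assumes "u \<in> carrier tfree" "v \<in> carrier tfree" "u \<ominus>\<^bsub>tfree\<^esub> v \<in> gens"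
 shows "tensor_rel K C Y Z +>\<^bsub>tfree\<^esub> u = tensor_rel K C Y Z +>\<^bsub>tfree\<^esub> v"
 using coset_eq[OF T_vsp rel_subsp assms(1,2)] assms(3) rel_gens by blast

lemma tens_balanced: "balanced C Y Z (tensor K C Y Z) (tens C Y Z)"
proof -
 note S = vs_closed[OF T_vsp] T_basis vs_closed[OF cmdD(1)[OF Y]] vs_closed[OF op_val(1)] cmdD(4)[OF Y] op_val(2)
 note L = linD(2,3)[OF tens_lin0, symmetric]
 show ?thesis
  unfolding balanced_def
 proof (intro conjI ballI linI)
  fix c z y assume "c \<in> Obj C" "z \<in> El Z c" "y \<in> El Y c"
  then show "tens C Y Z c y z \<in> carrier (tensor K C Y Z)" by (intro tens_mem)
 next
  fix c z y y' assume h: "c \<in> Obj C" "z \<in> El Z c" "y \<in> El Y c" "y' \<in> El Y c"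
  have "basis_vec K (c, y \<oplus>\<^bsub>Val Y c\<^esub> y', z) \<ominus>\<^bsub>tfree\<^esub> (basis_vec K (c, y, z) \<oplus>\<^bsub>tfree\<^esub> basis_vec K (c, y', z)) \<in> gens"
   unfolding gens_def by (rule UnI1, rule UnI1, rule UnI1, rule UnI1, rule CollectI, intro exI conjI, rule refl) (rule h)+
  from tens_gen_eq[OF _ _ this]
  show "tens C Y Z c (y \<oplus>\<^bsub>Val Y c\<^esub> y') z = tens C Y Z c y z \<oplus>\<^bsub>tensor K C Y Z\<^esub> tens C Y Z c y' z"
   unfolding tens_def using h by (simp add: S L)
 next
  fix c z y r assume h: "c \<in> Obj C" "z \<in> El Z c" "r \<in> carrier K" "y \<in> El Y c"
  have "basis_vec K (c, r \<odot>\<^bsub>Val Y c\<^esub> y, z) \<ominus>\<^bsub>tfree\<^esub> (r \<odot>\<^bsub>tfree\<^esub> basis_vec K (c, y, z)) \<in> gens"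
   unfolding gens_def by (rule UnI1, rule UnI1, rule UnI2, rule CollectI, intro exI conjI, rule refl) (rule h)+
  from tens_gen_eq[OF _ _ this]
  show "tens C Y Z c (r \<odot>\<^bsub>Val Y c\<^esub> y) z = r \<odot>\<^bsub>tensor K C Y Z\<^esub> tens C Y Z c y z"
   unfolding tens_def using h by (simp add: S L)
 next
  fix c z y assume "c \<in> Obj C" "y \<in> El Y c" "z \<in> El Z c"
  then show "tens C Y Z c y z \<in> carrier (tensor K C Y Z)" by (intro tens_mem)
 next
  fix c y z z' assume h: "c \<in> Obj C" "y \<in> El Y c" "z \<in> El Z c" "z' \<in> El Z c"
  have "basis_vec K (c, y, z \<oplus>\<^bsub>Val Z c\<^esub> z') \<ominus>\<^bsub>tfree\<^esub> (basis_vec K (c, y, z) \<oplus>\<^bsub>tfree\<^esub> basis_vec K (c, y, z')) \<in> gens"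
   unfolding gens_def by (rule UnI1, rule UnI1, rule UnI1, rule UnI2, rule CollectI, intro exI conjI, rule refl) (rule h)+
  from tens_gen_eq[OF _ _ this]
  show "tens C Y Z c y (z \<oplus>\<^bsub>Val Z c\<^esub> z') = tens C Y Z c y z \<oplus>\<^bsub>tensor K C Y Z\<^esub> tens C Y Z c y z'"
   unfolding tens_def using h by (simp add: S L)
 next
  fix c y r z assume h: "c \<in> Obj C" "y \<in> El Y c" "r \<in> carrier K" "z \<in> El Z c"
  have "basis_vec K (c, y, r \<odot>\<^bsub>Val Z c\<^esub> z) \<ominus>\<^bsub>tfree\<^esub> (r \<odot>\<^bsub>tfree\<^esub> basis_vec K (c, y, z)) \<in> gens"
   unfolding gens_def by (rule UnI1, rule UnI2, rule CollectI, intro exI conjI, rule refl) (rule h)+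
  from tens_gen_eq[OF _ _ this]
  show "tens C Y Z c y (r \<odot>\<^bsub>Val Z c\<^esub> z) = r \<odot>\<^bsub>tensor K C Y Z\<^esub> tens C Y Z c y z"
   unfolding tens_def using h by (simp add: S L)
 next
  fix c d f y z assume h: "c \<in> Obj C" "d \<in> Obj C" "f \<in> Arr C c d" "y \<in> El Y d" "z \<in> El Z c"
  have "basis_vec K (c, Act Y c d f y, z) \<ominus>\<^bsub>tfree\<^esub> basis_vec K (d, y, Act Z d c f z) \<in> gens"
   unfolding gens_def by (rule UnI2, rule CollectI, intro exI conjI, rule refl) (rule h)+
  from tens_gen_eq[OF _ _ this]
  show "tens C Y Z c (Act Y c d f y) z = tens C Y Z d y (Act Z d c f z)"
   unfolding tens_def using h by (simp add: S)
 qed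
qed

lemma tensor_ext:
 assumes W: "vsp W" and b: "balanced C Y Z W b"
 shows "\<exists>f. lin (tensor K C Y Z) W f \<and>
  (\<forall>c\<in>Obj C. \<forall>y\<in>El Y c. \<forall>z\<in>El Z c. f (tens C Y Z c y z) = b c y z)"
proof -
 let ?S = "{(c, y, z). c \<in> Obj C \<and> y \<in> El Y c \<and> z \<in> El Z c}"
 let ?b = "\<lambda>(c, y, z). b c y z"
 have bc: "?b s \<in> carrier W" if "s \<in> ?S" for s using that linD(1)[OF balancedD(1)[OF b]] by auto
 have l: "lin tfree W (free_lin W ?b)"
  unfolding tensor_free_def by (rule free_lin_lin[OF W bc])
 have v: "free_lin W ?b (basis_vec K (c, y, z)) = b c y z" if "c \<in> Obj C" "y \<in> El Y c" "z \<in> El Z c" for c y z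
  using free_lin_basis[where S = ?S and s = "(c, y, z)", OF W bc] that by simp
 have "balanced C Y Z W (\<lambda>c y z. free_lin W ?b (basis_vec K (c, y, z)))"
  unfolding balanced_def
 proof (intro conjI ballI)
  fix c z assume h: "c \<in> Obj C" "z \<in> El Z c"
  show "lin (Val Y c) W (\<lambda>y. free_lin W ?b (basis_vec K (c, y, z)))"
   by (rule lin_cong[OF balancedD(1)[OF b h]]) (simp_all add: v h cmdD[OF Y])
 next
  fix c y assume h: "c \<in> Obj C" "y \<in> El Y c"
  show "lin (Val Z c) W (\<lambda>z. free_lin W ?b (basis_vec K (c, y, z)))"
   by (rule lin_cong[OF balancedD(2)[OF b h]]) (simp_all add: v h op_val)
 qed (simp add: v cmdD[OF Y] op_val balancedD(3)[OF b])
 from quot_lift[OF T_vsp rel_subsp W l rel_vanish[OF W l this]] show ?thesis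
  unfolding tensor_def tens_def using v T_basis by metis
qed

text \<open>Generation by pure tensors, phrased through subspaces so that no expression of an
  element as a sum has to be chosen.\<close>

lemma tensor_induct:
 assumes N: "subsp (tensor K C Y Z) N"
  and t: "\<And>c y z. c \<in> Obj C ==> y \<in> El Y c ==> z \<in> El Z c ==> tens C Y Z c y z \<in> N"
  and v: "v \<in> carrier (tensor K C Y Z)"
 shows "v \<in> N"
proof -
 let ?p = "\<lambda>u. tensor_rel K C Y Z +>\<^bsub>tfree\<^esub> u"
 have "subsp tfree {u \<in> carrier tfree. ?p u \<in> N}"
  unfolding subsp_def using subspD[OF N] vs_closed[OF T_vsp] linD[OF tens_lin0] lin_zero[OF tens_lin0 T_vsp tensor_vsp] by auto
 then have "subsp (free_space K {(c, y, z). c \<in> Obj C \<and> y \<in> El Y c \<and> z \<in> El Z c}) {u \<in> carrier tfree. ?p u \<in> N}"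
  by (simp add: tensor_free_def)
 from free_induct[OF this] have *: "u \<in> carrier tfree ==> ?p u \<in> N" for u
  using t T_basis by (fastforce simp: tens_def tensor_free_def)
 obtain u where "u \<in> carrier tfree" "v = ?p u"
  using v unfolding tensor_def quot_sel[OF T_vsp rel_subsp] by blast
 then show ?thesis using * by simp
qed

lemma tensor_eq:
 assumes W: "vsp W" and f: "lin (tensor K C Y Z) W f" and g: "lin (tensor K C Y Z) W g"
  and e: "\<And>c y z. c \<in> Obj C ==> y \<in> El Y c ==> z \<in> El Z c ==> f (tens C Y Z c y z) = g (tens C Y Z c y z)"
  and v: "v \<in> carrier (tensor K C Y Z)"
 shows "f v = g v"
proof -
 have "subsp (tensor K C Y Z) {v \<in> carrier (tensor K C Y Z). f v = g v}"
  unfolding subsp_def using vs_closed[OF tensor_vsp] linD[OF f] linD[OF g] lin_zero[OF f tensor_vsp W] lin_zero[OF g tensor_vsp W] by auto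
 from tensor_induct[OF this _ v] show ?thesis using e tens_mem by blast
qed

end

lemma tensor_map:
 assumes Y: "cmd C Y" and Z: "cmd (op_cat C) Z" and Y': "cmd C Y'" and Z': "cmd (op_cat C) Z'"
  and \<phi>: "nt C Y Y' \<phi>" and \<psi>: "nt (op_cat C) Z Z' \<psi>"
 shows "lin (tensor K C Y Z) (tensor K C Y' Z') (tensor_map K C Y' Z' \<phi> \<psi>)"
  and "c \<in> Obj C ==> y \<in> El Y c ==> z \<in> El Z c ==>
   tensor_map K C Y' Z' \<phi> \<psi> (tens C Y Z c y z) = tens C Y' Z' c (\<phi> c y) (\<psi> c z)"
proof -
 let ?T = "tensor_free K C Y Z" let ?T' = "tensor_free K C Y' Z'"
 let ?R = "tensor_rel K C Y Z" let ?R' = "tensor_rel K C Y' Z'"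
 let ?g = "\<lambda>(c, y, z). (c, \<phi> c y, \<psi> c z)"
 note V = T_vsp[OF Y Z] and V' = T_vsp[OF Y' Z'] and N = rel_subsp[OF Y Z] and N' = rel_subsp[OF Y' Z']
 note \<psi>D = ntD[OF \<psi>, simplified]
 have g: "lin ?T ?T' (free_map K ?g)"
  unfolding tensor_free_def by (rule free_map_lin) (auto simp: ntD(3)[OF \<phi>] \<psi>D(3))
 note q = lin_comp[OF g tens_lin0[OF Y' Z']]
 have qb: "?R' +>\<^bsub>?T'\<^esub> free_map K ?g (basis_vec K (c, y, z)) = tens C Y' Z' c (\<phi> c y) (\<psi> c z)" for c y z
  by (simp add: free_map_basis tens_def)
 note B = tens_balanced[OF Y' Z']
 have "balanced C Y Z (tensor K C Y' Z') (\<lambda>c y z. ?R' +>\<^bsub>?T'\<^esub> free_map K ?g (basis_vec K (c, y, z)))"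
  unfolding qb balanced_def
 proof (intro conjI ballI)
  fix c z assume h: "c \<in> Obj C" "z \<in> El Z c"
  show "lin (Val Y c) (tensor K C Y' Z') (\<lambda>y. tens C Y' Z' c (\<phi> c y) (\<psi> c z))"
   by (rule lin_comp[OF ntD(1)[OF \<phi> h(1)] balancedD(1)[OF B h(1) \<psi>D(3)[OF h]]])
 next
  fix c y assume h: "c \<in> Obj C" "y \<in> El Y c"
  show "lin (Val Z c) (tensor K C Y' Z') (\<lambda>z. tens C Y' Z' c (\<phi> c y) (\<psi> c z))"
   by (rule lin_comp[OF \<psi>D(1)[OF h(1)] balancedD(2)[OF B h(1) ntD(3)[OF \<phi> h]]])
 next
  fix c d f y z assume h: "c \<in> Obj C" "d \<in> Obj C" "f \<in> Arr C c d" "y \<in> El Y d" "z \<in> El Z c"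
  show "tens C Y' Z' c (\<phi> c (Act Y c d f y)) (\<psi> c z) = tens C Y' Z' d (\<phi> d y) (\<psi> d (Act Z d c f z))"
   using balancedD(3)[OF B h(1-3) ntD(3)[OF \<phi> h(2,4)] \<psi>D(3)[OF h(1,5)]] ntD(2)[OF \<phi> h(1-4)] \<psi>D(2)[OF h(2,1,3,5)] by simp
 qed
 note van = rel_vanish[OF Y Z tensor_vsp[OF Y' Z'] q this]
 \<comment> \<open>The free map followed by the projection is balanced, so it kills the relations;
   hence relations go to relations and the union in \<open>tensor_map\<close> is a single
   coset.\<close>
 have fR: "free_map K ?g n \<in> ?R'" if n: "n \<in> ?R" for n
 proof -
  have "?R' +>\<^bsub>?T'\<^esub> free_map K ?g n = ?R'" using van[OF n] by (simp add: tensor_def quot_sel[OF V' N'])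
  then show ?thesis using coset_eq_zero[OF V' N' linD(1)[OF g subspD(1)[OF N n]]] by simp
 qed
 have m: "tensor_map K C Y' Z' \<phi> \<psi> (?R +>\<^bsub>?T\<^esub> u) = ?R' +>\<^bsub>?T'\<^esub> free_map K ?g u" if u: "u \<in> carrier ?T" for u
  unfolding tensor_map_def by (rule Union_coset[OF V N V' N' g fR u])
 show "c \<in> Obj C ==> y \<in> El Y c ==> z \<in> El Z c ==>
   tensor_map K C Y' Z' \<phi> \<psi> (tens C Y Z c y z) = tens C Y' Z' c (\<phi> c y) (\<psi> c z)"
  using m[OF T_basis[OF Y Z]] qb by (simp add: tens_def)
 obtain h where h: "lin (quot_space ?T ?R) (tensor K C Y' Z') h"
  "\<forall>v\<in>carrier ?T. h (?R +>\<^bsub>?T\<^esub> v) = ?R' +>\<^bsub>?T'\<^esub> free_map K ?g v"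
  using quot_lift[OF V N tensor_vsp[OF Y' Z'] q van] by blast
 show "lin (tensor K C Y Z) (tensor K C Y' Z') (tensor_map K C Y' Z' \<phi> \<psi>)"
 proof (rule lin_cong[OF _ _ tensor_vsp[OF Y Z]])
  show "lin (tensor K C Y Z) (tensor K C Y' Z') h" using h(1) by (simp add: tensor_def)
  fix v assume "v \<in> carrier (tensor K C Y Z)"
  then obtain u where "u \<in> carrier ?T" "v = ?R +>\<^bsub>?T\<^esub> u" unfolding tensor_def quot_sel[OF V N] by blast
  then show "h v = tensor_map K C Y' Z' \<phi> \<psi> v" using h(2) m by simp
 qed
qed

subsection \<open>Sizes\<close>

text \<open>The cardinality of the set is at most that of \<open>'v\<close>.\<close>

definition fits :: "'v itself => 'a set => bool" where
 "fits (_ :: 'v itself) S \<longleftrightarrow> (\<exists>e :: 'a => 'v. inj_on e S)"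

lemma fitsD: "fits TYPE('v) S ==> \<exists>e :: 'a => 'v. inj_on e (S :: 'a set)"
 by (simp add: fits_def)

lemma fits_image:
 assumes "fits TYPE('v) S" "T \<subseteq> f ` S" shows "fits TYPE('v) T"
proof -
 obtain e :: "_ => 'v" where e: "inj_on e S" using assms(1) by (auto simp: fits_def)
 have *: "inv_into S f t \<in> S" "f (inv_into S f t) = t" if "t \<in> T" for t
  using that assms(2) by (auto intro: inv_into_into f_inv_into_f)
 have "inj_on (\<lambda>t. e (inv_into S f t)) T"
 proof (rule inj_onI)
  fix s t assume st: "s \<in> T" "t \<in> T" "e (inv_into S f s) = e (inv_into S f t)"
  then have "inv_into S f s = inv_into S f t" using e * by (auto dest: inj_onD)
  then show "s = t" using * st by metis
 qed
 then show ?thesis unfolding fits_def by blast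
qed

lemma fits_mono: "fits TYPE('v) S ==> T \<subseteq> S ==> fits TYPE('v) T"
 using fits_image[of S T "\<lambda>x. x"] by simp

context
 fixes j :: "('o \<times> 'm \<times> nat => 'v) => 'v" and a b :: 'v
 assumes j: "inj j" and ab: "a \<noteq> b"
begin

text \<open>A sequence is a family that depends on the third index only.\<close>

lemma fits_seq: "\<exists>i :: (nat => 'v) => 'v. inj i"
proof
 show "inj (\<lambda>f. j (\<lambda>(_, _, n). f n))"
  by (rule injI) (drule injD[OF j], auto simp: fun_eq_iff)
qed

text \<open>An index is coded by its indicator family, with the distinct elements \<open>a\<close>
  and \<open>b\<close> as truth values.\<close>

lemma fits_delta:
 "fits TYPE('v) (UNIV :: 'o set)" "fits TYPE('v) (UNIV :: 'm set)" "fits TYPE('v) (UNIV :: nat set)"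
proof -
 have "inj (\<lambda>x. j (\<lambda>(y, _, _). if y = x then a else b))"
  by (rule injI, drule injD[OF j]) (use ab in \<open>auto simp: fun_eq_iff split: if_splits\<close>)
 then show "fits TYPE('v) (UNIV :: 'o set)" unfolding fits_def by blast
 have "inj (\<lambda>x. j (\<lambda>(_, y, _). if y = x then a else b))"
  by (rule injI, drule injD[OF j]) (use ab in \<open>auto simp: fun_eq_iff split: if_splits\<close>)
 then show "fits TYPE('v) (UNIV :: 'm set)" unfolding fits_def by blast
 have "inj (\<lambda>x. j (\<lambda>(_, _, y). if y = x then a else b))"
  by (rule injI, drule injD[OF j]) (use ab in \<open>auto simp: fun_eq_iff split: if_splits\<close>)
 then show "fits TYPE('v) (UNIV :: nat set)" unfolding fits_def by blast
qed

lemma fits_prod: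
 assumes "fits TYPE('v) S" "fits TYPE('v) T"
 shows "fits TYPE('v) (S \<times> T)"
proof -
 obtain e :: "_ => 'v" and e' :: "_ => 'v" where e: "inj_on e S" "inj_on e' T" using assms by (auto simp: fits_def)
 obtain i :: "(nat => 'v) => 'v" where i: "inj i" using fits_seq by blast
 have "inj_on (\<lambda>(s, t). i (\<lambda>n. if n = 0 then e s else e' t)) (S \<times> T)"
 proof (rule inj_onI, clarify)
  fix s t s' t' assume h: "s \<in> S" "t \<in> T" "s' \<in> S" "t' \<in> T"
   "i (\<lambda>n. if n = 0 then e s else e' t) = i (\<lambda>n. if n = 0 then e s' else e' t')"
  have q: "(\<lambda>n::nat. if n = 0 then e s else e' t) = (\<lambda>n. if n = 0 then e s' else e' t')" by (rule injD[OF i]) (rule h(5))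
  from fun_cong[OF q, of 0] fun_cong[OF q, of 1] show "s = s' \<and> t = t'" using e h by (auto dest: inj_onD)
 qed
 then show ?thesis unfolding fits_def by blast
qed

lemma fits_lists:
 assumes "fits TYPE('v) S"
 shows "fits TYPE('v) (lists S)"
proof -
 obtain e :: "_ => 'v" where e: "inj_on e S" using assms by (auto simp: fits_def)
 obtain \<nu> :: "nat => 'v" where \<nu>: "inj \<nu>" using fits_delta(3) by (auto simp: fits_def)
 obtain i :: "(nat => 'v) => 'v" where i: "inj i" using fits_seq by blast
 \<comment> \<open>Entry 0 codes the length, which separates the genuine entries from the padding by
   \<open>a\<close>; the list element with index k sits at position k + 1.\<close>
 let ?f = "\<lambda>xs n. case n of 0 => \<nu> (length xs) | Suc k => if k < length xs then e (xs ! k) else a"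
 have "inj_on (\<lambda>xs. i (?f xs)) (lists S)"
 proof (rule inj_onI)
  fix xs ys assume h: "xs \<in> lists S" "ys \<in> lists S" "i (?f xs) = i (?f ys)"
  have q: "?f xs = ?f ys" by (rule injD[OF i]) (rule h(3))
  from fun_cong[OF q, of 0] have l: "length xs = length ys" using \<nu> by (simp add: inj_eq)
  show "xs = ys"
  proof (rule nth_equalityI[OF l])
   fix k assume k: "k < length xs"
   then have "e (xs ! k) = e (ys ! k)" using fun_cong[OF q, of "Suc k"] l by simp
   moreover have "xs ! k \<in> S" "ys ! k \<in> S" using h(1,2) k l by (auto simp: in_lists_conv_set)
   ultimately show "xs ! k = ys ! k" using e by (auto dest: inj_onD)
  qed
 qed
 then show ?thesis unfolding fits_def by blast
qed

text \<open>Every element of the tensor product is a finite sum of terms k (y \<otimes> z), hence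
  the value of a list of codes (k, c, y, m), where \<open>m\<close> names \<open>z\<close> through
  \<open>r c\<close>. Such lists fit into \<open>'v\<close>, and so does every image of
  them.\<close>

lemma fits_tensor:
 fixes Y :: "('k, 'o, 'x, 'v) cmod" and Z :: "('k, 'o, 'x, 'w) cmod"
 assumes Y: "cmd C Y" and Z: "cmd (op_cat C) Z" and Kf: "fits TYPE('v) (carrier K)"
  and r: "\<And>c. c \<in> Obj C ==> \<exists>r :: 'm => 'w. El Z c \<subseteq> range r"
 shows "fits TYPE('v) (carrier (tensor K C Y Z))"
proof -
 let ?W = "tensor K C Y Z"
 interpret W: vectorspace K ?W by (rule tensor_vsp[OF Y Z])
 obtain r :: "'o => 'm => 'w" where r: "\<And>c. c \<in> Obj C ==> El Z c \<subseteq> range (r c)" using r by metis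
 let ?D = "carrier K \<times> ((UNIV :: 'o set) \<times> ((UNIV :: 'v set) \<times> (UNIV :: 'm set)))"
 let ?ok = "\<lambda>(k, c, y, m). c \<in> Obj C \<and> y \<in> El Y c \<and> r c m \<in> El Z c"
 let ?A = "{p \<in> ?D. ?ok p}"
 let ?t = "\<lambda>(k, c, y, m). k \<odot>\<^bsub>?W\<^esub> tens C Y Z c y (r c m)"
 let ?ev = "\<lambda>xs. foldr (\<lambda>p w. ?t p \<oplus>\<^bsub>?W\<^esub> w) xs \<zero>\<^bsub>?W\<^esub>"
 have t: "?t p \<in> carrier ?W" if "p \<in> ?A" for p
  using that tens_mem[OF Y Z] by (cases p) auto
 have evc: "?ev xs \<in> carrier ?W" if "xs \<in> lists ?A" for xs
  using that
 proof (induction xs)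
  case (Cons p xs)
  show ?case
   unfolding foldr.simps o_apply by (rule W.a_closed[OF t[OF Cons.hyps(1)] Cons.IH])
 qed simp
 have app: "?ev (xs @ ys) = ?ev xs \<oplus>\<^bsub>?W\<^esub> ?ev ys" if "xs \<in> lists ?A" "ys \<in> lists ?A" for xs ys
  using that(1)
 proof (induction xs)
  case Nil then show ?case using evc[OF that(2)] by simp
 next
  case (Cons p xs)
  show ?case
   unfolding foldr.simps o_apply append_Cons Cons.IH
   by (rule W.a_assoc[OF t[OF Cons.hyps(1)] evc[OF Cons.hyps(2)] evc[OF that(2)], symmetric])
 qed
 \<comment> \<open>A scalar is absorbed into the coefficients of the list; together with
   concatenation this makes the values of lists a subspace.\<close>
 have sm: "\<exists>ys\<in>lists ?A. ?ev ys = k \<odot>\<^bsub>?W\<^esub> ?ev xs" if k: "k \<in> carrier K" and "xs \<in> lists ?A" for k xs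
  using that(2)
 proof (induction xs)
  case Nil then show ?case using k by (intro bexI[of _ "[]"]) auto
 next
  case (Cons p xs)
  then obtain ys where ys: "ys \<in> lists ?A" "?ev ys = k \<odot>\<^bsub>?W\<^esub> ?ev xs" by blast
  obtain k' c y m where p: "p = (k', c, y, m)" by (cases p)
  have pa: "k' \<in> carrier K" "c \<in> Obj C" "y \<in> El Y c" "r c m \<in> El Z c"
   using Cons.hyps p by auto
  show ?case
  proof (rule bexI[of _ "(k \<otimes> k', c, y, m) # ys"])
   show "?ev ((k \<otimes> k', c, y, m) # ys) = k \<odot>\<^bsub>?W\<^esub> ?ev (p # xs)"
    using ys p k pa evc[of xs] Cons.hyps tens_mem[OF Y Z pa(2-4)] by (simp add: W.smult_r_distr W.smult_assoc1)
   show "(k \<otimes> k', c, y, m) # ys \<in> lists ?A" using ys k pa by simp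
  qed
 qed
 have "subsp ?W (?ev ` lists ?A)"
  unfolding subsp_def
 proof (intro conjI ballI subsetI)
  fix v assume "v \<in> ?ev ` lists ?A" then show "v \<in> carrier ?W" using evc by blast
 next
  show "\<zero>\<^bsub>?W\<^esub> \<in> ?ev ` lists ?A" by (rule image_eqI[of _ _ "[]"]) auto
 next
  fix v w assume "v \<in> ?ev ` lists ?A" "w \<in> ?ev ` lists ?A"
  then obtain xs ys where "xs \<in> lists ?A" "ys \<in> lists ?A" "v = ?ev xs" "w = ?ev ys" by blast
  then show "v \<oplus>\<^bsub>?W\<^esub> w \<in> ?ev ` lists ?A" by (intro image_eqI[of _ _ "xs @ ys"]) (simp_all only: app append_in_lists_conv)
 next
  fix k v assume k: "k \<in> carrier K" "v \<in> ?ev ` lists ?A"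
  then obtain xs where xs: "xs \<in> lists ?A" "v = ?ev xs" by blast
  obtain ys where ys: "ys \<in> lists ?A" "?ev ys = k \<odot>\<^bsub>?W\<^esub> ?ev xs" using sm[OF k(1) xs(1)] by blast
  show "k \<odot>\<^bsub>?W\<^esub> v \<in> ?ev ` lists ?A"
   unfolding xs(2) ys(2)[symmetric] by (rule imageI[OF ys(1)])
 qed
 moreover have "tens C Y Z c y z \<in> ?ev ` lists ?A" if h: "c \<in> Obj C" "y \<in> El Y c" "z \<in> El Z c" for c y z
 proof -
  obtain m where m: "z = r c m" using r[OF h(1)] h(3) by blast
  show ?thesis
   by (rule image_eqI[of _ _ "[(\<one>, c, y, m)]"]) (use h m tens_mem[OF Y Z h] in auto)
 qed
 ultimately have "v \<in> ?ev ` lists ?A" if "v \<in> carrier ?W" for v by (rule tensor_induct[OF Y Z _ _ that])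
 then have sub: "carrier ?W \<subseteq> ?ev ` lists ?A" by (rule subsetI)
 have "fits TYPE('v) (UNIV :: 'v set)" unfolding fits_def by (rule exI[of _ "\<lambda>x. x"]) simp
 then have D: "fits TYPE('v) ?D" by (intro fits_prod Kf fits_delta)
 have "fits TYPE('v) ?A" by (rule fits_mono[OF D]) (rule Collect_subset)
 then have "fits TYPE('v) (lists ?A)" by (rule fits_lists)
 from fits_image[OF this sub] show ?thesis .
qed

text \<open>A transformation is a family of values indexed by objects and elements of
  \<open>X\<close>. Over A/[B] those elements are cosets, of type \<open>'m set\<close>; naming each
  by a representative in \<open>'m\<close> keeps the index set within the one for which the universe
  is closed.\<close>

lemma fits_nat_hom:
 fixes X :: "('k, 'o, 'x, 'w) cmod" and Y :: "('k, 'o, 'x, 'v) cmod"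
 assumes r: "\<And>c. c \<in> Obj C ==> \<exists>r :: 'm => 'w. El X c \<subseteq> range r"
 shows "fits TYPE('v) (Nats C X Y)"
proof -
 obtain r :: "'o => 'm => 'w" where r: "\<And>c. c \<in> Obj C ==> El X c \<subseteq> range (r c)" using r by metis
 have "inj_on (\<lambda>\<eta>. j (\<lambda>(c, m, _). \<eta> c (r c m))) (Nats C X Y)"
 proof (rule inj_onI)
  fix \<eta> \<theta> assume h: "\<eta> \<in> Nats C X Y" "\<theta> \<in> Nats C X Y"
   "j (\<lambda>(c, m, _). \<eta> c (r c m)) = j (\<lambda>(c, m, _). \<theta> c (r c m))"
  have q: "(\<lambda>(c, m, _). \<eta> c (r c m)) = (\<lambda>(c, m, _::nat). \<theta> c (r c m))" by (rule injD[OF j]) (rule h(3))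
  show "\<eta> = \<theta>"
  proof (rule nat_hom_eqI[OF h(1,2)])
   fix c v assume c: "c \<in> Obj C" "v \<in> El X c"
   then obtain m where "v = r c m" using r by blast
   then show "\<eta> c v = \<theta> c v" using fun_cong[OF q, of "(c, m, 0)"] by simp
  qed
 qed
 then show ?thesis unfolding fits_def by blast
qed

end

section \<open>Restriction along a functor and its adjoints\<close>


lemma precomp_sel [simp]: "Val (precomp F X) = (\<lambda>c. Val X (Fob F c))"
 "Act (precomp F X) = (\<lambda>x y f. Act X (Fob F x) (Fob F y) (Far F x y f))"
 by (simp_all add: precomp_def)

lemma op_lf:
 assumes F: "linear_functor K C D F"
 shows "linear_functor K (op_cat C) (op_cat D) (op_funct F)"
 by (rule lfI) (auto simp: op_funct_def lfD[OF F])

lemma precomp_cmd: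
 assumes F: "linear_functor K C D F" and X: "cmd D X"
 shows "cmd C (precomp F X)"
proof (rule cmdI)
 fix x y v assume h: "x \<in> Obj C" "y \<in> Obj C" "v \<in> El (precomp F X) y"
 show "lin (Hom C x y) (Val (precomp F X) x) (\<lambda>f. Act (precomp F X) x y f v)"
  using lin_comp[OF lfD(5)[OF F h(1,2)] act_lin(2)[OF X lfD(1)[OF F h(1)] lfD(1)[OF F h(2)]]] h(3) by simp
qed (auto simp: lfD[OF F] cmdD[OF X] act_lin[OF X])

lemma precomp_nt:
 assumes F: "linear_functor K C D F" and \<eta>: "nt D X Y \<eta>"
 shows "nt C (precomp F X) (precomp F Y) (\<lambda>c. \<eta> (Fob F c))"
 by (rule ntI) (auto simp: lfD[OF F] ntD[OF \<eta>])

lemma pullback_sel: "Fob (pullback C F) = precomp F" "Far (pullback C F) X Y \<eta> = (\<lambda>c\<in>Obj C. \<eta> (Fob F c))"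
 by (simp_all add: pullback_def)

lemma pullback_far:
 assumes F: "linear_functor K C D F" and \<eta>: "\<eta> \<in> Nats D X Y"
 shows "Far (pullback C F) X Y \<eta> = ex C (precomp F X) (\<lambda>c. \<eta> (Fob F c))"
proof -
 have "\<eta> (Fob F c) = (\<lambda>v\<in>El X (Fob F c). \<eta> (Fob F c) v)" if "c \<in> Obj C" for c
  using fun_cong[OF nat_homD(2)[OF \<eta>], of "Fob F c"] lfD(1)[OF F that] by (simp add: ex_def)
 then show ?thesis by (auto simp: pullback_sel ex_def restrict_def fun_eq_iff)
qed

lemma pullback_lf:
 fixes C :: "('k, 'o, 'm) lincat" and D :: "('k, 'p, 'n) lincat"
 assumes F: "linear_functor K C D F" and C: "lcat C" and D: "lcat D"
 shows "linear_functor K (Mod_cat K D :: ('k, 'p, 'n, 'v) modcat) (Mod_cat K C) (pullback C F)"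
proof (rule lfI)
 note FD = lfD[OF F]
 fix X Y Z :: "('k, 'p, 'n, 'v) cmod"
 assume "X \<in> Obj (Mod_cat K D)"
 then have X: "cmd D X" by simp
 show "Fob (pullback C F) X \<in> Obj (Mod_cat K C)" using precomp_cmd[OF F X] by (simp add: pullback_sel)
 show "Far (pullback C F) X X (Idt (Mod_cat K D) X) = Idt (Mod_cat K C) (Fob (pullback C F) X)"
  using pullback_far[OF F nat_homI[OF nt_id X]] FD(1) by (simp add: pullback_sel(1) ex_eq_iff)
 assume "Y \<in> Obj (Mod_cat K D)"
 then have Y: "cmd D Y" by simp
 note pX = precomp_cmd[OF F X] and V = vs_closed[OF nat_hom_vsp[OF X Y]]
 show "lin (Hom (Mod_cat K D) X Y) (Hom (Mod_cat K C) (Fob (pullback C F) X) (Fob (pullback C F) Y)) (Far (pullback C F) X Y)"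
 proof (rule linI, unfold Mod_cat_sel pullback_sel(1))
  fix \<eta> assume \<eta>: "\<eta> \<in> Nats D X Y"
  show "Far (pullback C F) X Y \<eta> \<in> Nats C (precomp F X) (precomp F Y)"
   unfolding pullback_far[OF F \<eta>] by (rule nat_homI[OF precomp_nt[OF F nat_homD(1)[OF \<eta>]] pX])
  fix \<theta> assume \<theta>: "\<theta> \<in> Nats D X Y"
  show "Far (pullback C F) X Y (\<eta> \<oplus>\<^bsub>nat_hom K D X Y\<^esub> \<theta>) =
    Far (pullback C F) X Y \<eta> \<oplus>\<^bsub>nat_hom K C (precomp F X) (precomp F Y)\<^esub> Far (pullback C F) X Y \<theta>"
   unfolding pullback_far[OF F \<eta>] pullback_far[OF F \<theta>] pullback_far[OF F V(2)[OF \<eta> \<theta>]]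
   by (simp add: nat_hom_sel ex_eq_iff FD)
 next
  fix r \<eta> assume r: "r \<in> carrier K" and \<eta>: "\<eta> \<in> Nats D X Y"
  show "Far (pullback C F) X Y (r \<odot>\<^bsub>nat_hom K D X Y\<^esub> \<eta>) =
    r \<odot>\<^bsub>nat_hom K C (precomp F X) (precomp F Y)\<^esub> Far (pullback C F) X Y \<eta>"
   unfolding pullback_far[OF F \<eta>] pullback_far[OF F V(5)[OF r \<eta>]]
   by (simp add: nat_hom_sel ex_eq_iff FD)
 qed
 fix \<eta> \<theta> assume "Z \<in> Obj (Mod_cat K D)" "\<eta> \<in> Arr (Mod_cat K D) X Y" "\<theta> \<in> Arr (Mod_cat K D) Y Z"
 then have \<eta>: "\<eta> \<in> Nats D X Y" and \<theta>: "\<theta> \<in> Nats D Y Z" by simp_all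
 note \<eta>\<theta> = nat_homI[OF nt_comp[OF nat_homD(1)[OF \<eta>] nat_homD(1)[OF \<theta>]] X]
 show "Far (pullback C F) X Z (Cmp (Mod_cat K D) X Y Z \<theta> \<eta>) =
   Cmp (Mod_cat K C) (Fob (pullback C F) X) (Fob (pullback C F) Y) (Fob (pullback C F) Z)
    (Far (pullback C F) Y Z \<theta>) (Far (pullback C F) X Y \<eta>)"
  using FD(1) ntD(3)[OF nat_homD(1)[OF \<eta>]]
  by (simp add: pullback_far[OF F \<eta>\<theta>] pullback_far[OF F \<eta>] pullback_far[OF F \<theta>] pullback_sel(1) ex_eq_iff)
qed

lemma copy_trans_eq: "copy_trans D X Y \<eta> = ex D (copy_mod X) (\<lambda>d v. code (Val Y d) (\<eta> d (decode (Val X d) v)))"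
 by (simp add: copy_trans_def ex_def copy_mod_sel)

text \<open>The common shape of \<open>left_ext\<close> and \<open>right_ext\<close>: a functor with
  values in a larger type, followed by the copy into \<open>'v\<close>. The functor laws are needed
  only on elements, before copying.\<close>

lemma copy_functor:
 fixes L :: "('k, 'o, 'm, 'v) cmod => ('k, 'p, 'n, 'w) cmod" and Lm
 assumes Lc: "\<And>Y. cmd C Y ==> cmd D (L Y)"
  and fit: "\<And>Y d. cmd C Y ==> d \<in> Obj D ==> \<exists>e :: 'w => 'v. inj_on e (El (L Y) d)"
  and Ln: "\<And>Y Y' \<eta>. cmd C Y ==> cmd C Y' ==> \<eta> \<in> Nats C Y Y' ==> nt D (L Y) (L Y') (Lm Y Y' \<eta>)"
  and Lid: "\<And>Y d t. cmd C Y ==> d \<in> Obj D ==> t \<in> El (L Y) d ==> Lm Y Y (ex C Y (\<lambda>c v. v)) d t = t"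
  and Lcomp: "\<And>Y Y' Y'' \<eta> \<theta> d t. cmd C Y ==> cmd C Y' ==> cmd C Y'' ==> \<eta> \<in> Nats C Y Y' ==>
   \<theta> \<in> Nats C Y' Y'' ==> d \<in> Obj D ==> t \<in> El (L Y) d ==>
   Lm Y Y'' (ex C Y (\<lambda>c v. \<theta> c (\<eta> c v))) d t = Lm Y' Y'' \<theta> d (Lm Y Y' \<eta> d t)"
  and Ladd: "\<And>Y Y' \<eta> \<theta> d t. cmd C Y ==> cmd C Y' ==> \<eta> \<in> Nats C Y Y' ==>
   \<theta> \<in> Nats C Y Y' ==> d \<in> Obj D ==> t \<in> El (L Y) d ==>
   Lm Y Y' (\<eta> \<oplus>\<^bsub>nat_hom K C Y Y'\<^esub> \<theta>) d t = Lm Y Y' \<eta> d t \<oplus>\<^bsub>Val (L Y') d\<^esub> Lm Y Y' \<theta> d t"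
  and Lsmult: "\<And>Y Y' \<eta> r d t. cmd C Y ==> cmd C Y' ==> r \<in> carrier K ==> \<eta> \<in> Nats C Y Y' ==>
   d \<in> Obj D ==> t \<in> El (L Y) d ==>
   Lm Y Y' (r \<odot>\<^bsub>nat_hom K C Y Y'\<^esub> \<eta>) d t = r \<odot>\<^bsub>Val (L Y') d\<^esub> Lm Y Y' \<eta> d t"
 shows "linear_functor K (Mod_cat K C) (Mod_cat K D)
  (\<lparr>Fob = (\<lambda>Y. copy_mod (L Y)), Far = (\<lambda>Y Y' \<eta>. copy_trans D (L Y) (L Y') (Lm Y Y' \<eta>))\<rparr> ::
   (('k, 'o, 'm, 'v) cmod, 'o => 'v => 'v, ('k, 'p, 'n, 'v) cmod, 'p => 'v => 'v) funct)"
proof -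
 note cp = copy_mod[OF Lc fit]
 have k: "nt D (L Y) (copy_mod (L Y) :: ('k, 'p, 'n, 'v) cmod) (\<lambda>d. code (Val (L Y) d))"
  and dn: "nt D (copy_mod (L Y) :: ('k, 'p, 'n, 'v) cmod) (L Y) (\<lambda>d. decode (Val (L Y) d))" if "cmd C Y" for Y
  using cp(2,3)[OF that that] by (auto simp: niso_def)
 have dk: "decode (Val (L Y) d) (code (Val (L Y) d) t :: 'v) = t" if "cmd C Y" "d \<in> Obj D" "t \<in> El (L Y) d" for Y d t
  by (rule decode_code[OF cmdD(1)[OF Lc[OF that(1)] that(2)] fit[OF that(1,2)] that(3)])
 have kd: "code (Val (L Y) d) (decode (Val (L Y) d) v) = v"
  if "cmd C Y" "d \<in> Obj D" "v \<in> El (copy_mod (L Y) :: ('k, 'p, 'n, 'v) cmod) d" for Y d and v :: 'v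
  using that dk by (auto simp: copy_mod_sel copy_space_carrier)
 let ?G = "\<lparr>Fob = (\<lambda>Y. copy_mod (L Y)), Far = (\<lambda>Y Y' \<eta>. copy_trans D (L Y) (L Y') (Lm Y Y' \<eta>))\<rparr> ::
  (('k, 'o, 'm, 'v) cmod, 'o => 'v => 'v, ('k, 'p, 'n, 'v) cmod, 'p => 'v => 'v) funct"
 show ?thesis
 proof (rule lfI)
  fix Y assume "Y \<in> Obj (Mod_cat K C :: ('k, 'o, 'm, 'v) modcat)"
  then have Y: "cmd C Y" by simp
  show "Fob ?G Y
   \<in> Obj (Mod_cat K D :: ('k, 'p, 'n, 'v) modcat)"
   using cp(1)[OF Y Y] by simp
  show "Far ?G Y Y
    (Idt (Mod_cat K C) Y) = Idt (Mod_cat K D) (Fob ?G Y)"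
   by (simp add: copy_trans_eq ex_eq_iff Lid[OF Y] ntD(3)[OF dn[OF Y]] kd[OF Y])
  fix Y' assume "Y' \<in> Obj (Mod_cat K C :: ('k, 'o, 'm, 'v) modcat)"
  then have Y': "cmd C Y'" by simp
  have Lmc: "Lm Y Y' \<eta> d t \<in> El (L Y') d" if "\<eta> \<in> Nats C Y Y'" "d \<in> Obj D" "t \<in> El (L Y) d" for \<eta> d t
   by (rule ntD(3)[OF Ln[OF Y Y' that(1)] that(2,3)])
  show "lin (Hom (Mod_cat K C) Y Y') (Hom (Mod_cat K D)
    (Fob ?G Y)
    (Fob ?G Y'))
   (Far ?G Y Y')"
  proof (rule linI, unfold Mod_cat_sel funct.select_convs)
   fix \<eta> assume \<eta>: "\<eta> \<in> Nats C Y Y'"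
   show "copy_trans D (L Y) (L Y') (Lm Y Y' \<eta>) \<in> Nats D (copy_mod (L Y) :: ('k, 'p, 'n, 'v) cmod) (copy_mod (L Y') :: ('k, 'p, 'n, 'v) cmod)"
    unfolding copy_trans_eq by (rule nat_homI[OF nt_comp[OF nt_comp[OF dn[OF Y] Ln[OF Y Y' \<eta>]] k[OF Y']] cp(1)[OF Y Y]])
   fix \<theta> assume \<theta>: "\<theta> \<in> Nats C Y Y'"
   show "copy_trans D (L Y) (L Y') (Lm Y Y' (\<eta> \<oplus>\<^bsub>nat_hom K C Y Y'\<^esub> \<theta>)) =
     copy_trans D (L Y) (L Y') (Lm Y Y' \<eta>) \<oplus>\<^bsub>nat_hom K D (copy_mod (L Y) :: ('k, 'p, 'n, 'v) cmod) (copy_mod (L Y') :: ('k, 'p, 'n, 'v) cmod)\<^esub> copy_trans D (L Y) (L Y') (Lm Y Y' \<theta>)"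
    by (simp add: copy_trans_eq nat_hom_sel(2)[where C = D] ex_eq_iff Ladd[OF Y Y' \<eta> \<theta>] ntD(3)[OF dn[OF Y]] ntD(4)[OF k[OF Y']] Lmc \<eta> \<theta>)
  next
   fix r \<eta> assume r: "r \<in> carrier K" and \<eta>: "\<eta> \<in> Nats C Y Y'"
   show "copy_trans D (L Y) (L Y') (Lm Y Y' (r \<odot>\<^bsub>nat_hom K C Y Y'\<^esub> \<eta>)) =
     r \<odot>\<^bsub>nat_hom K D (copy_mod (L Y) :: ('k, 'p, 'n, 'v) cmod) (copy_mod (L Y') :: ('k, 'p, 'n, 'v) cmod)\<^esub> copy_trans D (L Y) (L Y') (Lm Y Y' \<eta>)"
    by (simp add: copy_trans_eq nat_hom_sel(3)[where C = D] ex_eq_iff Lsmult[OF Y Y' r \<eta>] ntD(3)[OF dn[OF Y]] ntD(5)[OF k[OF Y']] Lmc \<eta> r)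
  qed
  fix Y'' \<eta> \<theta> assume "Y'' \<in> Obj (Mod_cat K C :: ('k, 'o, 'm, 'v) modcat)"
   "\<eta> \<in> Arr (Mod_cat K C) Y Y'" "\<theta> \<in> Arr (Mod_cat K C) Y' Y''"
  then have Y'': "cmd C Y''" and \<eta>: "\<eta> \<in> Nats C Y Y'" and \<theta>: "\<theta> \<in> Nats C Y' Y''" by simp_all
  show "Far ?G Y Y''
    (Cmp (Mod_cat K C) Y Y' Y'' \<theta> \<eta>) = Cmp (Mod_cat K D)
    (Fob ?G Y)
    (Fob ?G Y')
    (Fob ?G Y'')
    (Far ?G Y' Y'' \<theta>)
    (Far ?G Y Y' \<eta>)"
   by (simp add: copy_trans_eq ex_eq_iff Lcomp[OF Y Y' Y'' \<eta> \<theta>] ntD(3)[OF dn[OF Y]] ntD(3)[OF k[OF Y']] Lmc \<eta> dk[OF Y'])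
 qed
qed

subsection \<open>The left adjoint\<close>

definition left_unit :: "('k, 'o, 'm) lincat => ('k, 'p, 'n) lincat => ('o, 'm, 'p, 'n) funct => ('k, 'o, 'm, 'v) cmod =>
  'o => 'v => ('o \<times> 'v \<times> 'n => 'k) set" where
 "left_unit C D F Y c y = tens C Y (corep_along D F (Fob F c)) c y (Idt D (Fob F c))"

context
 fixes C :: "('k, 'o, 'm) lincat" and D :: "('k, 'p, 'n) lincat" and F :: "('o, 'm, 'p, 'n) funct"
 assumes C: "lcat C" and D: "lcat D" and F: "linear_functor K C D F"
begin

lemma corep_sel: "Val (corep_along D F d) = (\<lambda>c. Hom D d (Fob F c))"
 "Act (corep_along D F d) x y f h = Cmp D d (Fob F y) (Fob F x) (Far F y x f) h"
 by (simp_all add: corep_along_def op_funct_def)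

lemma corep_cmd: "d \<in> Obj D ==> cmd (op_cat C) (corep_along D F d)"
 unfolding corep_along_def by (rule precomp_cmd[OF op_lf[OF F] rep_cmd[OF op_lcat[OF D]]]) simp

lemma corep_nt:
 assumes "d \<in> Obj D" "d' \<in> Obj D" "g \<in> Arr D d d'"
 shows "nt (op_cat C) (corep_along D F d') (corep_along D F d) (\<lambda>c h. Cmp D d d' (Fob F c) h g)"
proof (rule ntI)
 fix c assume "c \<in> Obj (op_cat C)"
 then show "lin (Val (corep_along D F d') c) (Val (corep_along D F d) c) (\<lambda>h. Cmp D d d' (Fob F c) h g)"
  unfolding corep_sel using assms lfD(1)[OF F] by (intro cmp_lin(1)[OF D]) simp_all
next
 fix x y f v assume "x \<in> Obj (op_cat C)" "y \<in> Obj (op_cat C)" "f \<in> Arr (op_cat C) x y" "v \<in> El (corep_along D F d') y"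
 then have h: "x \<in> Obj C" "y \<in> Obj C" "f \<in> Arr C y x" "v \<in> Arr D d' (Fob F y)" by (simp_all add: corep_sel)
 show "Cmp D d d' (Fob F x) (Act (corep_along D F d') x y f v) g = Act (corep_along D F d) x y f (Cmp D d d' (Fob F y) v g)"
  unfolding corep_sel
  by (rule cmp_assoc'[OF D assms(1,2) lfD(1)[OF F h(2)] lfD(1)[OF F h(1)] assms(3) h(4) lfD(3)[OF F h(2,1,3)]])
qed

abbreviation (input) lext where "lext \<equiv> left_ext_mod K C D F"
abbreviation (input) tn where "tn Y d \<equiv> tens C Y (corep_along D F d)"

lemma lext_sel: "Val (lext Y) d = tensor K C Y (corep_along D F d)"
 "Act (lext Y) d d' g = tensor_map K C Y (corep_along D F d) (\<lambda>c y. y) (\<lambda>c h. Cmp D d d' (Fob F c) h g)"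
 by (simp_all add: left_ext_mod_def)

context
 fixes Y :: "('k, 'o, 'm, 'v) cmod"
 assumes Y: "cmd C Y"
begin

lemma tn_lin: "d \<in> Obj D ==> c \<in> Obj C ==> h \<in> Arr D d (Fob F c) ==> lin (Val Y c) (Val (lext Y) d) (\<lambda>y. tn Y d c y h)"
 "d \<in> Obj D ==> c \<in> Obj C ==> y \<in> El Y c ==> lin (Hom D d (Fob F c)) (Val (lext Y) d) (\<lambda>h. tn Y d c y h)"
 unfolding lext_sel using balancedD(1,2)[OF tens_balanced[OF Y corep_cmd]] by (simp_all add: corep_sel)

lemma tn_bal: "d \<in> Obj D ==> c \<in> Obj C ==> c' \<in> Obj C ==> f \<in> Arr C c c' ==> y \<in> El Y c' ==> h \<in> Arr D d (Fob F c) ==>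
  tn Y d c (Act Y c c' f y) h = tn Y d c' y (Cmp D d (Fob F c) (Fob F c') (Far F c c' f) h)"
 using balancedD(3)[OF tens_balanced[OF Y corep_cmd]] by (simp add: corep_sel)

lemma lext_vsp: "d \<in> Obj D ==> vsp (Val (lext Y) d)"
 unfolding lext_sel by (rule tensor_vsp[OF Y corep_cmd])

lemma lext_act:
 assumes "d \<in> Obj D" "d' \<in> Obj D" "g \<in> Arr D d d'"
 shows "lin (Val (lext Y) d') (Val (lext Y) d) (Act (lext Y) d d' g)"
  "c \<in> Obj C ==> y \<in> El Y c ==> h \<in> Arr D d' (Fob F c) ==>
   Act (lext Y) d d' g (tn Y d' c y h) = tn Y d c y (Cmp D d d' (Fob F c) h g)"
 unfolding lext_sel
 using tensor_map[OF Y corep_cmd[OF assms(2)] Y corep_cmd[OF assms(1)] nt_id corep_nt[OF assms]] by (simp_all add: corep_sel)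

lemma lext_eq:
 assumes d: "d \<in> Obj D" and W: "vsp W" and f: "lin (Val (lext Y) d) W f" and g: "lin (Val (lext Y) d) W g"
  and e: "\<And>c y h. c \<in> Obj C ==> y \<in> El Y c ==> h \<in> Arr D d (Fob F c) ==> f (tn Y d c y h) = g (tn Y d c y h)"
  and t: "t \<in> El (lext Y) d"
 shows "f t = g t"
 by (rule tensor_eq[OF Y corep_cmd[OF d] W f[unfolded lext_sel] g[unfolded lext_sel] _ t[unfolded lext_sel]])
  (rule e, simp_all add: corep_sel)

lemma lext_cmd: "cmd D (lext Y)"
proof (rule cmdI)
 note FD = lfD[OF F]
 fix d t assume d: "d \<in> Obj D" and t: "t \<in> El (lext Y) d"
 show "Act (lext Y) d d (Idt D d) t = t"
  by (rule lext_eq[OF d lext_vsp[OF d] lext_act(1)[OF d d catD(2)[OF D d]] lin_id _ t])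
   (simp add: lext_act(2)[OF d d catD(2)[OF D d]] catD[OF D] d FD)
next
 note FD = lfD[OF F]
 fix d d' t assume d: "d \<in> Obj D" "d' \<in> Obj D" and t: "t \<in> El (lext Y) d'"
 note H = catD(1)[OF D d] and l = lext_act[OF d]
 show "lin (Hom D d d') (Val (lext Y) d) (\<lambda>g. Act (lext Y) d d' g t)"
 proof (rule linI)
  fix g assume g: "g \<in> Arr D d d'"
  show "Act (lext Y) d d' g t \<in> El (lext Y) d" by (rule linD(1)[OF l(1)[OF g] t])
  fix g' assume g': "g' \<in> Arr D d d'"
  note gg = vs_closed(2)[OF H g g']
  show "Act (lext Y) d d' (g \<oplus>\<^bsub>Hom D d d'\<^esub> g') t = Act (lext Y) d d' g t \<oplus>\<^bsub>Val (lext Y) d\<^esub> Act (lext Y) d d' g' t"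
   by (rule lext_eq[OF d(2) lext_vsp[OF d(1)] l(1)[OF gg] lin_add[OF l(1)[OF g] l(1)[OF g'] lext_vsp[OF d(1)]] _ t])
    (simp add: l(2)[OF gg] l(2)[OF g] l(2)[OF g'] cmp_add[OF D] d g g' FD linD[OF tn_lin(2)] catD(3)[OF D])
 next
  fix r g assume r: "r \<in> carrier K" and g: "g \<in> Arr D d d'"
  note rg = vs_closed(5)[OF H r g]
  show "Act (lext Y) d d' (r \<odot>\<^bsub>Hom D d d'\<^esub> g) t = r \<odot>\<^bsub>Val (lext Y) d\<^esub> Act (lext Y) d d' g t"
   by (rule lext_eq[OF d(2) lext_vsp[OF d(1)] l(1)[OF rg] lin_smult[OF l(1)[OF g] lext_vsp[OF d(1)] r] _ t])
    (simp add: l(2)[OF rg] l(2)[OF g] cmp_add[OF D] d g r FD linD[OF tn_lin(2)] catD(3)[OF D])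
 qed
next
 note FD = lfD[OF F]
 fix x y z f g t assume o: "x \<in> Obj D" "y \<in> Obj D" "z \<in> Obj D" and f: "f \<in> Arr D x y" and g: "g \<in> Arr D y z"
  and t: "t \<in> El (lext Y) z"
 note gf = catD(3)[OF D o f g]
 show "Act (lext Y) x z (Cmp D x y z g f) t = Act (lext Y) x y f (Act (lext Y) y z g t)"
  by (rule lext_eq[OF o(3) lext_vsp[OF o(1)] lext_act(1)[OF o(1,3) gf] lin_comp[OF lext_act(1)[OF o(2,3) g] lext_act(1)[OF o(1,2) f]] _ t])
   (simp add: lext_act(2)[OF o(1,3) gf] lext_act(2)[OF o(2,3) g] lext_act(2)[OF o(1,2) f] o f g FD catD(3)[OF D] cmp_assoc'[OF D])
qed (simp_all add: lext_vsp lext_act)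

abbreviation (input) lunit where "lunit \<equiv> left_unit C D F Y"

lemma lunit_nt: "nt C Y (precomp F (lext Y)) lunit"
proof (rule ntI)
 note FD = lfD[OF F]
 fix c assume "c \<in> Obj C"
 then show "lin (Val Y c) (Val (precomp F (lext Y)) c) (lunit c)"
  unfolding left_unit_def precomp_sel by (intro tn_lin(1) FD catD(2)[OF D])
next
 note FD = lfD[OF F]
 fix x y f v assume "x \<in> Obj C" "y \<in> Obj C" "f \<in> Arr C x y" "v \<in> El Y y"
 then show "lunit x (Act Y x y f v) = Act (precomp F (lext Y)) x y f (lunit y v)"
  by (simp add: left_unit_def tn_bal FD catD[OF D] lext_act(2))
qed

lemma lunit_act: "d \<in> Obj D ==> c \<in> Obj C ==> y \<in> El Y c ==> h \<in> Arr D d (Fob F c) ==>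
  Act (lext Y) d (Fob F c) h (lunit c y) = tn Y d c y h"
 by (simp add: left_unit_def lext_act(2) lfD[OF F] catD[OF D])

text \<open>The map y \<otimes> g \<mapsto> X(g)(h y) is balanced because \<open>h\<close> is
  natural. The target may have values in any type, which is used for the cokernel in
  \<open>left_ext_pres\<close>.\<close>

lemma left_universal:
 fixes X :: "('k, 'p, 'n, 'u) cmod"
 assumes X: "cmd D X" and h: "nt C Y (precomp F X) h"
 shows "\<exists>k. nt D (lext Y) X k \<and> (\<forall>d\<in>Obj D. \<forall>c\<in>Obj C. \<forall>y\<in>El Y c. \<forall>g\<in>Arr D d (Fob F c).
   k d (tn Y d c y g) = Act X d (Fob F c) g (h c y)) \<and> (\<forall>c\<in>Obj C. \<forall>y\<in>El Y c. k (Fob F c) (lunit c y) = h c y)"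
proof -
 note FD = lfD[OF F] and hD = ntD[OF h, unfolded precomp_sel]
 have "\<exists>k. lin (Val (lext Y) d) (Val X d) k \<and> (\<forall>c\<in>Obj C. \<forall>y\<in>El Y c. \<forall>g\<in>Arr D d (Fob F c).
   k (tn Y d c y g) = Act X d (Fob F c) g (h c y))" if d: "d \<in> Obj D" for d
 proof -
  have "balanced C Y (corep_along D F d) (Val X d) (\<lambda>c y g. Act X d (Fob F c) g (h c y))"
   unfolding balanced_def
  proof (intro conjI ballI)
   fix c g assume c: "c \<in> Obj C" "g \<in> El (corep_along D F d) c"
   then have g: "g \<in> Arr D d (Fob F c)" by (simp add: corep_sel)
   show "lin (Val Y c) (Val X d) (\<lambda>y. Act X d (Fob F c) g (h c y))"
    by (rule lin_comp[OF hD(1)[OF c(1)] act_lin(1)[OF X d FD(1)[OF c(1)] g]])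
  next
   fix c y assume "c \<in> Obj C" "y \<in> El Y c"
   then show "lin (Val (corep_along D F d) c) (Val X d) (\<lambda>g. Act X d (Fob F c) g (h c y))"
    unfolding corep_sel by (intro act_lin(2)[OF X d] FD(1) hD(3))
  next
   fix c c' f y z assume "c \<in> Obj C" "c' \<in> Obj C" "f \<in> Arr C c c'" "y \<in> El Y c'" "z \<in> El (corep_along D F d) c"
   then show "Act X d (Fob F c) z (h c (Act Y c c' f y)) = Act X d (Fob F c') (Act (corep_along D F d) c' c f z) (h c' y)"
    by (simp add: corep_sel hD cmdD(3)[OF X] d FD)
  qed
  from tensor_ext[OF Y corep_cmd[OF d] cmdD(1)[OF X d] this] show ?thesis by (simp add: lext_sel corep_sel)
 qed
 then have "\<exists>k. \<forall>d\<in>Obj D. lin (Val (lext Y) d) (Val X d) (k d) \<and> (\<forall>c\<in>Obj C. \<forall>y\<in>El Y c. \<forall>g\<in>Arr D d (Fob F c).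
   k d (tn Y d c y g) = Act X d (Fob F c) g (h c y))"
  by (intro bchoice ballI)
 then obtain k where kl: "\<And>d. d \<in> Obj D ==> lin (Val (lext Y) d) (Val X d) (k d)"
  and kt: "\<And>d c y g. d \<in> Obj D ==> c \<in> Obj C ==> y \<in> El Y c ==> g \<in> Arr D d (Fob F c) ==>
   k d (tn Y d c y g) = Act X d (Fob F c) g (h c y)" by blast
 have "nt D (lext Y) X k"
 proof (rule ntI[OF kl])
  fix d d' g t assume d: "d \<in> Obj D" "d' \<in> Obj D" and g: "g \<in> Arr D d d'" and t: "t \<in> El (lext Y) d'"
  show "k d (Act (lext Y) d d' g t) = Act X d d' g (k d' t)"
   by (rule lext_eq[OF d(2) cmdD(1)[OF X d(1)] lin_comp[OF lext_act(1)[OF d g] kl[OF d(1)]] lin_comp[OF kl[OF d(2)] act_lin(1)[OF X d g]] _ t])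
    (simp add: lext_act(2)[OF d g] kt d g FD catD(3)[OF D] cmdD(3)[OF X] hD(3))
 qed
 moreover have "k (Fob F c) (lunit c y) = h c y" if "c \<in> Obj C" "y \<in> El Y c" for c y
  using that by (simp add: left_unit_def kt FD catD(2)[OF D] cmdD(2)[OF X] hD(3))
 ultimately show ?thesis using kt by blast
qed

text \<open>Every pure tensor y \<otimes> h is obtained from y \<otimes> 1 by the action of
  \<open>h\<close>.\<close>

lemma left_unique:
 fixes X :: "('k, 'p, 'n, 'u) cmod"
 assumes X: "cmd D X" and k: "nt D (lext Y) X k" and k': "nt D (lext Y) X k'"
  and e: "\<And>c y. c \<in> Obj C ==> y \<in> El Y c ==> k (Fob F c) (lunit c y) = k' (Fob F c) (lunit c y)"
  and d: "d \<in> Obj D" and t: "t \<in> El (lext Y) d"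
 shows "k d t = k' d t"
proof (rule lext_eq[OF d cmdD(1)[OF X d] ntD(1)[OF k d] ntD(1)[OF k' d] _ t])
 fix c y h assume h: "c \<in> Obj C" "y \<in> El Y c" "h \<in> Arr D d (Fob F c)"
 note Fc = lfD(1)[OF F h(1)] and lu = ntD(3)[OF lunit_nt h(1,2), unfolded precomp_sel]
 show "k d (tn Y d c y h) = k' d (tn Y d c y h)"
  unfolding lunit_act[OF d h, symmetric] ntD(2)[OF k d Fc h(3) lu] ntD(2)[OF k' d Fc h(3) lu] e[OF h(1,2)] by (rule refl)
qed

text \<open>With y = f m, the tensor y \<otimes> h equals m \<otimes> F(f) h, so m \<otimes> 1
  generates. That F(g) accounts for all relations is seen by mapping the extension to the cokernel
  of F(g) on representables.\<close>

lemma left_ext_pres: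
 assumes p: "pres C Y c1 c0 g m"
 shows "pres D (lext Y) (Fob F c1) (Fob F c0) (Far F c1 c0 g) (lunit c0 m)"
proof -
 note FD = lfD[OF F] and p = presD[OF p]
 note Fc = FD(1)[OF p(1)] FD(1)[OF p(4)] and Fg = FD(3)[OF p(1,4,2)]
 note lu = ntD(3)[OF lunit_nt p(4,5), unfolded precomp_sel]
 have gm: "Act Y c1 c0 g m = zr Y c1"
  using p(7)[OF p(1,2)] catD(5)[OF C p(1,4,2), symmetric] catD(2)[OF C p(1)] by blast
 note R = rep_cmd[OF D Fc(2)] and R1 = rep_cmd[OF D Fc(1)]
 have gl: "nt D (rep D (Fob F c1)) (rep D (Fob F c0)) (\<lambda>d l. Cmp D d (Fob F c1) (Fob F c0) (Far F c1 c0 g) l)"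
  using yoneda_nt[OF D R Fc(1), of "Far F c1 c0 g"] Fg by simp
 note N = submod_image[OF gl R1 R, unfolded rep_sel]
 define N where "N = (\<lambda>d. (\<lambda>l. Cmp D d (Fob F c1) (Fob F c0) (Far F c1 c0 g) l) ` Arr D d (Fob F c1))"
 note N = N[folded N_def]
 \<comment> \<open>The cokernel that the extension should be isomorphic to.\<close>
 let ?Q = "quot_mod (rep D (Fob F c0)) N"
 let ?q = "\<lambda>d v. N d +>\<^bsub>Hom D d (Fob F c0)\<^esub> v"
 note Qc = quot_mod_cmd[OF D R N] and Qp = quot_mod_proj[OF D R N, unfolded rep_sel]
  and Q0 = quot_mod_eq_zero[OF D R N, unfolded rep_sel] and Qa = quot_mod_act[OF D R N, unfolded rep_sel]
 note Rc = rep_cmd[OF C p(4)]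
 have Ff: "nt C (rep C c0) (precomp F (rep D (Fob F c0))) (\<lambda>c f. Far F c c0 f)"
  by (rule ntI) (auto simp: p FD)
 \<comment> \<open>The presentation of Y lets the generator \<open>m\<close> go to the class of the
   identity. The resulting map out of the extension takes m \<otimes> h to the class of
   \<open>h\<close>, which detects whether \<open>h\<close> is a relation.\<close>
 have "\<exists>u. nt C Y (precomp F ?Q) u \<and> (\<forall>c\<in>Obj C. \<forall>f\<in>El (rep C c0) c. u c (Act Y c c0 f m) = ?q (Fob F c) (Far F c c0 f))"
 proof (rule nt_factor_surj[OF Rc Y precomp_cmd[OF F Qc] yoneda_nt[OF C Y p(4,5)] _ nt_comp[OF Ff precomp_nt[OF F Qp]]])
  fix c z assume "c \<in> Obj C" "z \<in> El Y c"
  then show "\<exists>f\<in>El (rep C c0) c. z = Act Y c c0 f m" using p(6) by simp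
 next
  fix c f assume h: "c \<in> Obj C" "f \<in> El (rep C c0) c" "Act Y c c0 f m = zr Y c"
  then obtain l where l: "l \<in> Arr C c c1" "f = Cmp C c c1 c0 g l" using p(7)[of c f] by auto
  have "Far F c c0 f \<in> N (Fob F c)" unfolding N_def l(2) FD(4)[OF h(1) p(1,4) l(1) p(2)]
   by (rule imageI) (rule FD(3)[OF h(1) p(1) l(1)])
  then show "?q (Fob F c) (Far F c c0 f) = zr (precomp F ?Q) c"
   using Q0[OF FD(1)[OF h(1)]] FD(3)[OF h(1) p(4)] h(2) by simp
 qed
 then obtain u where u: "nt C Y (precomp F ?Q) u" "\<forall>c\<in>Obj C. \<forall>f\<in>Arr C c c0. u c (Act Y c c0 f m) = ?q (Fob F c) (Far F c c0 f)" by auto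
 have um: "u c0 m = ?q (Fob F c0) (Idt D (Fob F c0))"
  using u(2)[rule_format, OF p(4) catD(2)[OF C p(4)]] cmdD(2)[OF Y p(4,5)] FD(2)[OF p(4)] by simp
 obtain k where k: "nt D (lext Y) ?Q k" "\<And>d c y g. d\<in>Obj D ==> c\<in>Obj C ==> y\<in>El Y c ==> g\<in>Arr D d (Fob F c) ==>
   k d (tn Y d c y g) = Act ?Q d (Fob F c) g (u c y)"
  using left_universal[OF Qc u(1)] by blast
 show ?thesis
  unfolding pres_def gen_def
 proof (intro conjI ballI Fc Fg lu)
  fix d v assume d: "d \<in> Obj D" and v: "v \<in> El (lext Y) d"
  have s: "subsp (Val (lext Y) d) ((\<lambda>h. Act (lext Y) d (Fob F c0) h (lunit c0 m)) ` Arr D d (Fob F c0))"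
   by (rule subsp_image[OF act_lin(2)[OF lext_cmd d Fc(2) lu] catD(1)[OF D d Fc(2)] lext_vsp[OF d]])
  have "v \<in> (\<lambda>h. Act (lext Y) d (Fob F c0) h (lunit c0 m)) ` Arr D d (Fob F c0)"
  proof (rule tensor_induct[OF Y corep_cmd[OF d]])
   show "subsp (tensor K C Y (corep_along D F d)) ((\<lambda>h. Act (lext Y) d (Fob F c0) h (lunit c0 m)) ` Arr D d (Fob F c0))"
    using s by (simp add: lext_sel(1))
   show "v \<in> carrier (tensor K C Y (corep_along D F d))" using v by (simp add: lext_sel(1))
   fix c y h assume "c \<in> Obj C" "y \<in> El Y c" "h \<in> El (corep_along D F d) c"
   then have h: "c \<in> Obj C" "y \<in> El Y c" "h \<in> Arr D d (Fob F c)" by (simp_all add: corep_sel)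
   obtain f where f: "f \<in> Arr C c c0" "y = Act Y c c0 f m" using p(6)[OF h(1,2)] by blast
   let ?h = "Cmp D d (Fob F c) (Fob F c0) (Far F c c0 f) h"
   have hc: "?h \<in> Arr D d (Fob F c0)" by (rule catD(3)[OF D d FD(1)[OF h(1)] Fc(2) h(3) FD(3)[OF h(1) p(4) f(1)]])
   show "tn Y d c y h \<in> (\<lambda>h. Act (lext Y) d (Fob F c0) h (lunit c0 m)) ` Arr D d (Fob F c0)"
    unfolding f(2) tn_bal[OF d h(1) p(4) f(1) p(5) h(3)]
    by (rule image_eqI[OF _ hc]) (rule lunit_act[OF d p(4,5) hc, symmetric])
  qed
  then show "\<exists>f\<in>Arr D d (Fob F c0). v = Act (lext Y) d (Fob F c0) f (lunit c0 m)" by blast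
 next
  fix d h assume d: "d \<in> Obj D" and h: "h \<in> Arr D d (Fob F c0)"
  have la: "Act (lext Y) d (Fob F c0) h (lunit c0 m) = tn Y d c0 m h" by (rule lunit_act[OF d p(4,5) h])
  show "Act (lext Y) d (Fob F c0) h (lunit c0 m) = zr (lext Y) d \<longleftrightarrow>
   (\<exists>l\<in>Arr D d (Fob F c1). h = Cmp D d (Fob F c1) (Fob F c0) (Far F c1 c0 g) l)"
   unfolding la
  proof
   assume z: "tn Y d c0 m h = zr (lext Y) d"
   have "Act ?Q d (Fob F c0) h (u c0 m) = zr ?Q d"
    using k(2)[OF d p(4,5) h] nt_zero_app[OF k(1) lext_cmd Qc d] z by simp
   then have "?q d h = zr ?Q d"
    using Qa[OF d Fc(2) h catD(2)[OF D Fc(2)]] catD(4)[OF D d Fc(2) h] by (simp add: um)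
   then have "h \<in> N d" using Q0[OF d h] by simp
   then show "\<exists>l\<in>Arr D d (Fob F c1). h = Cmp D d (Fob F c1) (Fob F c0) (Far F c1 c0 g) l" by (auto simp: N_def)
  next
   assume "\<exists>l\<in>Arr D d (Fob F c1). h = Cmp D d (Fob F c1) (Fob F c0) (Far F c1 c0 g) l"
   then obtain l where l: "l \<in> Arr D d (Fob F c1)" "h = Cmp D d (Fob F c1) (Fob F c0) (Far F c1 c0 g) l" by blast
   have "tn Y d c0 m h = tn Y d c1 \<zero>\<^bsub>Val Y c1\<^esub> l" unfolding l(2) tn_bal[OF d p(1,4,2,5) l(1), symmetric] gm ..
   also have "\<dots> = zr (lext Y) d" by (rule lin_zero[OF tn_lin(1)[OF d p(1) l(1)] cmdD(1)[OF Y p(1)] lext_vsp[OF d]])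
   finally show "tn Y d c0 m h = zr (lext Y) d" .
  qed
 qed
qed

lemma left_ext_mod_fp: "fp C Y ==> fp D (lext Y)"
 using left_ext_pres fp_iff[OF C, of Y] fp_iff[OF D, of "lext Y"] lext_cmd by blast

end

abbreviation (input) lmap where "lmap Y' \<eta> d \<equiv> tensor_map K C Y' (corep_along D F d) \<eta> (\<lambda>c h. h)"

lemma lmap:
 assumes Y: "cmd C Y" and Y': "cmd C Y'" and \<eta>: "nt C Y Y' \<eta>"
 shows "nt D (lext Y) (lext Y') (\<lambda>d. lmap Y' \<eta> d)"
  "d \<in> Obj D ==> c \<in> Obj C ==> y \<in> El Y c ==> h \<in> Arr D d (Fob F c) ==> lmap Y' \<eta> d (tn Y d c y h) = tn Y' d c (\<eta> c y) h"
  "d \<in> Obj D ==> lin (Val (lext Y) d) (Val (lext Y') d) (lmap Y' \<eta> d)"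
proof -
 note tm = tensor_map[OF Y corep_cmd Y' corep_cmd \<eta> nt_id]
 show l: "lin (Val (lext Y) d) (Val (lext Y') d) (lmap Y' \<eta> d)" if "d \<in> Obj D" for d
  using tm(1)[OF that that] by (simp add: lext_sel)
 show v: "lmap Y' \<eta> d (tn Y d c y h) = tn Y' d c (\<eta> c y) h"
  if "d \<in> Obj D" "c \<in> Obj C" "y \<in> El Y c" "h \<in> Arr D d (Fob F c)" for d c y h
  using tm(2)[OF that(1,1)] that by (simp add: corep_sel)
 show "nt D (lext Y) (lext Y') (\<lambda>d. lmap Y' \<eta> d)"
 proof (rule ntI[OF l])
  fix d d' g t assume d: "d \<in> Obj D" "d' \<in> Obj D" and g: "g \<in> Arr D d d'" and t: "t \<in> El (lext Y) d'"
  show "lmap Y' \<eta> d (Act (lext Y) d d' g t) = Act (lext Y') d d' g (lmap Y' \<eta> d' t)"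
   by (rule lext_eq[OF Y d(2) lext_vsp[OF Y' d(1)] lin_comp[OF lext_act(1)[OF Y d g] l[OF d(1)]] lin_comp[OF l[OF d(2)] lext_act(1)[OF Y' d g]] _ t])
    (simp add: lext_act(2)[OF Y d g] lext_act(2)[OF Y' d g] v d g lfD[OF F] catD(3)[OF D] ntD(3)[OF \<eta>])
 qed
qed

end


text \<open>The two distinct elements of \<open>'v\<close> are the images of one and zero of the
  field.\<close>

lemma universe_fits:
 assumes "module_universe TYPE('v) K (A :: ('k, 'o, 'm) lincat)"
 obtains j :: "('o \<times> 'm \<times> nat => 'v) => 'v" and a b :: 'v where "inj j" "a \<noteq> b" "fits TYPE('v) (carrier K)"
proof -
 obtain j :: "('o \<times> 'm \<times> nat => 'v) => 'v" and i :: "'k => 'v" where ji: "inj j" "inj_on i (carrier K)"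
  using assms by (auto simp: module_universe_def)
 have "i \<one> \<noteq> i \<zero>" using inj_onD[OF ji(2), of \<one> \<zero>] by auto
 then show thesis using that ji by (auto simp: fits_def)
qed

lemma ex1_conj_cong: "\<exists>!l. l \<in> S \<and> P l ==> (\<And>l. l \<in> S ==> Q l \<longleftrightarrow> P l) ==> \<exists>!l. l \<in> S \<and> Q l"
 by auto

text \<open>The maps \<open>r\<close> name the relevant arrows of D by elements of
  \<open>'l\<close>, the arrow type for which the universe is given. The formula for the unit is
  recorded because its invertibility on B is needed later.\<close>

lemma left_ext_univ:
 fixes C :: "('k, 'o, 'm) lincat" and D :: "('k, 'p, 'n) lincat" and F :: "('o, 'm, 'p, 'n) funct"
  and A :: "('k, 'o, 'l) lincat"
 assumes C: "lcat C" and D: "lcat D" and F: "linear_functor K C D F" and U: "module_universe TYPE('v) K A"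
  and r: "\<And>d c. d \<in> Obj D ==> c \<in> Obj C ==> \<exists>r :: 'l => 'n. Arr D d (Fob F c) \<subseteq> range r"
 shows "\<exists>\<eta>. univ_unit (Mod_cat K C :: ('k, 'o, 'm, 'v) modcat) (Mod_cat K D)
   (left_ext K C D F) (pullback C F) \<eta> \<and>
   (\<forall>Y. cmd C Y --> \<eta> Y = ex C Y (\<lambda>c y. code (Val (left_ext_mod K C D F Y) (Fob F c)) (left_unit C D F Y c y)))"
  and "\<And>Y :: ('k, 'o, 'm, 'v) cmod. cmd C Y ==> niso D (left_ext_mod K C D F Y) (copy_mod (left_ext_mod K C D F Y) :: ('k, 'p, 'n, 'v) cmod)
   (\<lambda>d. code (Val (left_ext_mod K C D F Y) d))"
  and "\<And>Y :: ('k, 'o, 'm, 'v) cmod. cmd C Y ==> cmd D (copy_mod (left_ext_mod K C D F Y) :: ('k, 'p, 'n, 'v) cmod)"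
proof -
 let ?L = "\<lambda>Y. left_ext_mod K C D F Y" let ?c = "\<lambda>Y. copy_mod (left_ext_mod K C D F Y) :: ('k, 'p, 'n, 'v) cmod"
 let ?m = "\<lambda>Y' \<eta> d. tensor_map K C Y' (corep_along D F d) \<eta> (\<lambda>c h. h)"
 let ?u = "\<lambda>Y. left_unit C D F Y"
 note FD = lfD[OF F]
 obtain j :: "('o \<times> 'l \<times> nat => 'v) => 'v" and a b :: 'v where j: "inj j" "a \<noteq> b" "fits TYPE('v) (carrier K)" by (rule universe_fits[OF U])
 note Lc = lext_cmd[OF C D F]
 have fit: "\<exists>e :: ('o \<times> 'v \<times> 'n => 'k) set => 'v. inj_on e (El (?L Y) d)" if Y: "cmd C Y" and d: "d \<in> Obj D" for Y :: "('k, 'o, 'm, 'v) cmod" and d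
  unfolding lext_sel[OF C D F]
 proof (rule fitsD, rule fits_tensor[OF j(1,2) Y corep_cmd[OF C D F d] j(3)])
  fix c assume "c \<in> Obj C"
  then show "\<exists>r :: 'l => 'n. El (corep_along D F d) c \<subseteq> range r" using r[OF d] by (simp add: corep_sel[OF C D F])
 qed
 note m = lmap[OF C D F]
 note cp = copy_mod[OF Lc fit]
 show cn: "niso D (?L Y) (?c Y) (\<lambda>d. code (Val (?L Y) d))" if "cmd C Y" for Y :: "('k, 'o, 'm, 'v) cmod" by (rule cp(2)[OF that that])
 show cc: "cmd D (?c Y)" if "cmd C Y" for Y :: "('k, 'o, 'm, 'v) cmod" by (rule cp(1)[OF that that])
 have k: "nt D (?L Y) (?c Y) (\<lambda>d. code (Val (?L Y) d))" and dn: "nt D (?c Y) (?L Y) (\<lambda>d. decode (Val (?L Y) d))"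
  if "cmd C Y" for Y :: "('k, 'o, 'm, 'v) cmod"
  using cp(2,3)[OF that that] by (auto simp: niso_def)
 have dk: "decode (Val (?L Y) d) (code (Val (?L Y) d) t :: 'v) = t" if "cmd C Y" "d \<in> Obj D" "t \<in> El (?L Y) d"
  for Y :: "('k, 'o, 'm, 'v) cmod" and d t
  by (rule decode_code[OF cmdD(1)[OF Lc[OF that(1)] that(2)] fit[OF that(1,2)] that(3)])
 have kd: "code (Val (?L Y) d) (decode (Val (?L Y) d) v) = v"
  if "cmd C Y" "d \<in> Obj D" "v \<in> El (?c Y) d" for Y :: "('k, 'o, 'm, 'v) cmod" and d and v :: 'v
  using that dk by (auto simp: copy_mod_sel copy_space_carrier)
 have lf: "linear_functor K (Mod_cat K C) (Mod_cat K D) (left_ext K C D F ::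
   (('k, 'o, 'm, 'v) cmod, 'o => 'v => 'v, ('k, 'p, 'n, 'v) cmod, 'p => 'v => 'v) funct)"
  unfolding left_ext_def
 proof (rule copy_functor[OF Lc fit])
  fix Y Y' Y'' :: "('k, 'o, 'm, 'v) cmod" and \<eta> \<theta> d t r
  assume Y: "cmd C Y"
  { assume d: "d \<in> Obj D" and t: "t \<in> El (?L Y) d"
   note i = m(2,3)[OF Y Y nt_ex[OF nt_id Y]]
   show "?m Y (ex C Y (\<lambda>c v. v)) d t = t"
    by (rule lext_eq[OF C D F Y d cmdD(1)[OF Lc[OF Y] d] i(2)[OF d] lin_id _ t]) (simp add: i(1) d) }
  assume Y': "cmd C Y'" and "\<eta> \<in> Nats C Y Y'"
  then have \<eta>: "nt C Y Y' \<eta>" by (simp add: nat_hom_iff)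
  note e = m(2,3)[OF Y Y' \<eta>]
  show "nt D (?L Y) (?L Y') (\<lambda>d. ?m Y' \<eta> d)" by (rule m(1)[OF Y Y' \<eta>])
  assume d: "d \<in> Obj D" and t: "t \<in> El (?L Y) d"
  note W' = cmdD(1)[OF Lc[OF Y'] d]
  { assume Y'': "cmd C Y''" and "\<theta> \<in> Nats C Y' Y''"
   then have \<theta>: "nt C Y' Y'' \<theta>" by (simp add: nat_hom_iff)
   note f = m(2,3)[OF Y' Y'' \<theta>] and g = m(2,3)[OF Y Y'' nt_ex[OF nt_comp[OF \<eta> \<theta>] Y]]
   show "?m Y'' (ex C Y (\<lambda>c v. \<theta> c (\<eta> c v))) d t = ?m Y'' \<theta> d (?m Y' \<eta> d t)"
    by (rule lext_eq[OF C D F Y d cmdD(1)[OF Lc[OF Y''] d] g(2)[OF d] lin_comp[OF e(2)[OF d] f(2)[OF d]] _ t])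
     (simp add: e f g d ntD(3)[OF \<eta>]) }
  { assume "\<theta> \<in> Nats C Y Y'"
   then have \<theta>: "nt C Y Y' \<theta>" by (simp add: nat_hom_iff)
   note f = m(2,3)[OF Y Y' \<theta>] and g = m(2,3)[OF Y Y' nt_ex[OF nt_add[OF \<eta> \<theta> Y'] Y]]
   show "?m Y' (\<eta> \<oplus>\<^bsub>nat_hom K C Y Y'\<^esub> \<theta>) d t = ?m Y' \<eta> d t \<oplus>\<^bsub>Val (?L Y') d\<^esub> ?m Y' \<theta> d t"
    unfolding nat_hom_sel
    by (rule lext_eq[OF C D F Y d W' g(2)[OF d] lin_add[OF e(2)[OF d] f(2)[OF d] W'] _ t])
     (simp add: e f g d ntD(3)[OF \<eta>] ntD(3)[OF \<theta>] linD(2)[OF tn_lin(1)[OF C D F Y']]) }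
  { assume r: "r \<in> carrier K"
   note g = m(2,3)[OF Y Y' nt_ex[OF nt_smult[OF \<eta> r Y'] Y]]
   show "?m Y' (r \<odot>\<^bsub>nat_hom K C Y Y'\<^esub> \<eta>) d t = r \<odot>\<^bsub>Val (?L Y') d\<^esub> ?m Y' \<eta> d t"
    unfolding nat_hom_sel
    by (rule lext_eq[OF C D F Y d W' g(2)[OF d] lin_smult[OF e(2)[OF d] W' r] _ t])
     (simp add: e g d r ntD(3)[OF \<eta>] linD(3)[OF tn_lin(1)[OF C D F Y']]) }
 qed
 define \<eta> where "\<eta> = (\<lambda>Y :: ('k, 'o, 'm, 'v) cmod. ex C Y (\<lambda>c y. code (Val (?L Y) (Fob F c)) (?u Y c y) :: 'v))"
 note un = lunit_nt[OF C D F]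
 have uc: "?u Y c y \<in> El (?L Y) (Fob F c)" if "cmd C Y" "c \<in> Obj C" "y \<in> El Y c" for Y :: "('k, 'o, 'm, 'v) cmod" and c y
  using ntD(3)[OF un[OF that(1)] that(2,3)] by simp
 note pc = precomp_cmd[OF F]
 have \<eta>n: "nt C Y (precomp F (?c Y)) (\<lambda>c y. code (Val (?L Y) (Fob F c)) (?u Y c y))" if "cmd C Y" for Y :: "('k, 'o, 'm, 'v) cmod"
  using nt_comp[OF un[OF that] precomp_nt[OF F k[OF that]]] .
 have \<eta>a: "\<eta> Y \<in> Nats C Y (precomp F (?c Y))" if "cmd C Y" for Y :: "('k, 'o, 'm, 'v) cmod"
  unfolding \<eta>_def by (rule nat_homI[OF \<eta>n[OF that] that])
 have "univ_unit (Mod_cat K C :: ('k, 'o, 'm, 'v) modcat) (Mod_cat K D) (left_ext K C D F) (pullback C F) \<eta>"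
  unfolding univ_unit_def
 proof (intro conjI ballI lf pullback_lf[OF F C D])
  have Fl: "Fob (left_ext K C D F) Y = ?c Y" for Y :: "('k, 'o, 'm, 'v) cmod" by (simp add: left_ext_def)
  fix Y assume "Y \<in> Obj (Mod_cat K C :: ('k, 'o, 'm, 'v) modcat)"
  then have Y: "cmd C Y" by simp
  show "\<eta> Y \<in> Arr (Mod_cat K C) Y (Fob (pullback C F) (Fob (left_ext K C D F) Y))"
   using \<eta>a[OF Y] by (simp add: Fl pullback_sel)
  { fix Y' f assume "Y' \<in> Obj (Mod_cat K C :: ('k, 'o, 'm, 'v) modcat)" "f \<in> Arr (Mod_cat K C) Y Y'"
   then have Y': "cmd C Y'" and fa: "f \<in> Nats C Y Y'" by simp_all
   note f = nat_homD(1)[OF fa]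
   have Fm: "Far (left_ext K C D F) Y Y' f \<in> Nats D (?c Y) (?c Y')"
    using lfD(3)[OF lf, of Y Y' f] Y Y' fa by (simp add: Fl)
   show "Cmp (Mod_cat K C) Y Y' (Fob (pullback C F) (Fob (left_ext K C D F) Y')) (\<eta> Y') f =
     Cmp (Mod_cat K C) Y (Fob (pullback C F) (Fob (left_ext K C D F) Y)) (Fob (pullback C F) (Fob (left_ext K C D F) Y'))
      (Far (pullback C F) (Fob (left_ext K C D F) Y) (Fob (left_ext K C D F) Y') (Far (left_ext K C D F) Y Y' f)) (\<eta> Y)"
   proof (simp add: Fl pullback_far[OF F Fm] ex_eq_iff, intro ballI)
    fix c y assume c: "c \<in> Obj C" "y \<in> El Y c"
    note Fc = FD(1)[OF c(1)] and fy = ntD(3)[OF f c]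
    have kc: "code (Val (?L Y) (Fob F c)) (?u Y c y) \<in> El (?c Y) (Fob F c)" by (rule ntD(3)[OF k[OF Y] Fc uc[OF Y c]])
    show "\<eta> Y' c (f c y) = ex C (precomp F (?c Y)) (\<lambda>c. Far (left_ext K C D F) Y Y' f (Fob F c)) c (\<eta> Y c y)"
     using c Fc fy kc uc[OF Y c] uc[OF Y' c(1) fy]
     by (simp add: \<eta>_def left_ext_def copy_trans_eq dk[OF Y] left_unit_def m(2)[OF Y Y' f] catD(2)[OF D])
   qed }
  fix X h assume "X \<in> Obj (Mod_cat K D :: ('k, 'p, 'n, 'v) modcat)" "h \<in> Arr (Mod_cat K C) Y (Fob (pullback C F) X)"
  then have X: "cmd D X" and ha: "h \<in> Nats C Y (precomp F X)" by (simp_all add: pullback_sel)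
  note h = nat_homD[OF ha]
  have pf: "Cmp (Mod_cat K C) Y (Fob (pullback C F) (Fob (left_ext K C D F) Y)) (Fob (pullback C F) X)
     (Far (pullback C F) (Fob (left_ext K C D F) Y) X l) (\<eta> Y) = ex C Y (\<lambda>c y. l (Fob F c) (\<eta> Y c y))"
   if l: "l \<in> Nats D (?c Y) X" for l
   using ntD(3)[OF nat_homD(1)[OF \<eta>a[OF Y]]] by (simp add: Fl pullback_far[OF F l] ex_eq_iff)
  obtain k0 where k0: "nt D (?L Y) X k0" "\<And>c y. c \<in> Obj C ==> y \<in> El Y c ==> k0 (Fob F c) (?u Y c y) = h c y"
   using left_universal[OF C D F Y X h(1)] by blast
  let ?l = "ex D (?c Y) (\<lambda>d v. k0 d (decode (Val (?L Y) d) v))"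
  have la: "?l \<in> Nats D (?c Y) X" by (rule nat_homI[OF nt_comp[OF dn[OF Y] k0(1)] cc[OF Y]])
  have lv: "?l (Fob F c) (\<eta> Y c y) = h c y" if c: "c \<in> Obj C" "y \<in> El Y c" for c y
   using c FD(1)[OF c(1)] uc[OF Y c] ntD(3)[OF k[OF Y] FD(1)[OF c(1)] uc[OF Y c]] by (simp add: \<eta>_def dk[OF Y] k0(2))
  have "\<exists>!l. l \<in> Nats D (?c Y) X \<and> ex C Y (\<lambda>c y. l (Fob F c) (\<eta> Y c y)) = h"
  proof (rule ex1I[of _ ?l], intro conjI la)
   have "ex C Y (\<lambda>c y. ?l (Fob F c) (\<eta> Y c y)) = ex C Y h" unfolding ex_eq_iff using lv by blast
   then show "ex C Y (\<lambda>c y. ?l (Fob F c) (\<eta> Y c y)) = h" using h(2) by simp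
   fix l assume l: "l \<in> Nats D (?c Y) X \<and> ex C Y (\<lambda>c y. l (Fob F c) (\<eta> Y c y)) = h"
   note ln = nat_homD(1)[OF conjunct1[OF l]]
   show "l = ?l"
   proof (rule nat_hom_eqI[OF conjunct1[OF l] la])
    fix d v assume d: "d \<in> Obj D" "v \<in> El (?c Y) d"
    note t = ntD(3)[OF dn[OF Y] d]
    have "l d (code (Val (?L Y) d) (decode (Val (?L Y) d) v)) = k0 d (decode (Val (?L Y) d) v)"
    proof (rule left_unique[OF C D F Y X nt_comp[OF k[OF Y] ln] k0(1) _ d(1) t])
     fix c y assume c: "c \<in> Obj C" "y \<in> El Y c"
     show "l (Fob F c) (code (Val (?L Y) (Fob F c)) (?u Y c y)) = k0 (Fob F c) (?u Y c y)"
      using ex_eqD[OF conjunct2[OF l] c] c by (simp add: \<eta>_def k0(2))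
    qed
    then show "l d v = ?l d v" using d kd[OF Y d] by simp
   qed
  qed
  then show "\<exists>!l. l \<in> Arr (Mod_cat K D) (Fob (left_ext K C D F) Y) X \<and>
    Cmp (Mod_cat K C) Y (Fob (pullback C F) (Fob (left_ext K C D F) Y)) (Fob (pullback C F) X)
     (Far (pullback C F) (Fob (left_ext K C D F) Y) X l) (\<eta> Y) = h"
   unfolding Mod_cat_sel Fl by (rule ex1_conj_cong) (simp only: pf[unfolded Mod_cat_sel Fl])
 qed
 then show "\<exists>\<eta>. univ_unit (Mod_cat K C :: ('k, 'o, 'm, 'v) modcat) (Mod_cat K D)
   (left_ext K C D F) (pullback C F) \<eta> \<and>
   (\<forall>Y. cmd C Y --> \<eta> Y = ex C Y (\<lambda>c y. code (Val (left_ext_mod K C D F Y) (Fob F c)) (left_unit C D F Y c y)))"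
  unfolding \<eta>_def by blast
qed

subsection \<open>The right adjoint\<close>

definition right_counit :: "('k, 'p, 'n) lincat => ('o, 'm, 'p, 'n) funct => 'o => ('o => 'n => 'v) => 'v" where
 "right_counit D F c \<phi> = \<phi> c (Idt D (Fob F c))"

context
 fixes C :: "('k, 'o, 'm) lincat" and D :: "('k, 'p, 'n) lincat" and F :: "('o, 'm, 'p, 'n) funct"
 assumes C: "lcat C" and D: "lcat D" and F: "linear_functor K C D F"
begin

abbreviation (input) prep where "prep d \<equiv> precomp F (rep D d)"

lemma prep_cmd: "d \<in> Obj D ==> cmd C (prep d)"
 by (rule precomp_cmd[OF F rep_cmd[OF D]])

lemma prep_nt:
 assumes "d \<in> Obj D" "d' \<in> Obj D" "g \<in> Arr D d d'"
 shows "nt C (prep d) (prep d') (\<lambda>c h. Cmp D (Fob F c) d d' g h)"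
 using precomp_nt[OF F yoneda_nt[OF D rep_cmd[OF D assms(2)] assms(1)], of g] assms(3) by simp

abbreviation (input) rext where "rext \<equiv> right_ext_mod K C D F"

lemma rext_sel: "Val (rext M) d = nat_hom K C (prep d) M"
 "Act (rext M) d d' g \<phi> = ex C (prep d) (\<lambda>c h. \<phi> c (Cmp D (Fob F c) d d' g h))"
 by (simp_all add: right_ext_mod_def ex_def)

context
 fixes M :: "('k, 'o, 'm, 'v) cmod"
 assumes M: "cmd C M"
begin

lemma rext_cmd: "cmd D (rext M)"
proof (rule cmdI)
 note FD = lfD[OF F]
 show "vsp (Val (rext M) d)" if "d \<in> Obj D" for d
  unfolding rext_sel by (rule nat_hom_vsp[OF prep_cmd[OF that] M])
 fix d \<phi> assume d: "d \<in> Obj D" and "\<phi> \<in> El (rext M) d"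
 then have \<phi>: "\<phi> \<in> Nats C (prep d) M" by (simp add: rext_sel)
 have "ex C (prep d) (\<lambda>c h. \<phi> c (Cmp D (Fob F c) d d (Idt D d) h)) = ex C (prep d) \<phi>"
  by (simp add: ex_eq_iff catD(4)[OF D] d FD(1))
 then show "Act (rext M) d d (Idt D d) \<phi> = \<phi>" using nat_homD(2)[OF \<phi>] by (simp add: rext_sel)
next
 note FD = lfD[OF F]
 fix d d' g assume d: "d \<in> Obj D" "d' \<in> Obj D" and g: "g \<in> Arr D d d'"
 show "lin (Val (rext M) d') (Val (rext M) d) (Act (rext M) d d' g)"
  unfolding rext_sel
 proof (rule linI)
  fix \<phi> assume \<phi>: "\<phi> \<in> Nats C (prep d') M"
  show "ex C (prep d) (\<lambda>c h. \<phi> c (Cmp D (Fob F c) d d' g h)) \<in> Nats C (prep d) M"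
   by (rule nat_homI[OF nt_comp[OF prep_nt[OF d g] nat_homD(1)[OF \<phi>]] prep_cmd[OF d(1)]])
 qed (simp_all add: nat_hom_sel ex_eq_iff catD(3)[OF D] d g FD(1))
next
 note FD = lfD[OF F]
 fix d d' \<phi> assume d: "d \<in> Obj D" "d' \<in> Obj D" and "\<phi> \<in> El (rext M) d'"
 then have \<phi>: "\<phi> \<in> Nats C (prep d') M" by (simp add: rext_sel)
 note \<phi>D = ntD[OF nat_homD(1)[OF \<phi>], unfolded precomp_sel rep_sel]
 show "lin (Hom D d d') (Val (rext M) d) (\<lambda>g. Act (rext M) d d' g \<phi>)"
  unfolding rext_sel
 proof (rule linI)
  fix g assume g: "g \<in> Arr D d d'"
  show "ex C (prep d) (\<lambda>c h. \<phi> c (Cmp D (Fob F c) d d' g h)) \<in> Nats C (prep d) M"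
   by (rule nat_homI[OF nt_comp[OF prep_nt[OF d g] nat_homD(1)[OF \<phi>]] prep_cmd[OF d(1)]])
 qed (simp_all add: nat_hom_sel ex_eq_iff catD(3)[OF D] d FD(1) cmp_add[OF D] \<phi>D)
next
 note FD = lfD[OF F]
 fix x y z f g \<phi> assume "x \<in> Obj D" "y \<in> Obj D" "z \<in> Obj D" "f \<in> Arr D x y" "g \<in> Arr D y z" "\<phi> \<in> El (rext M) z"
 then show "Act (rext M) x z (Cmp D x y z g f) \<phi> = Act (rext M) x y f (Act (rext M) y z g \<phi>)"
  by (simp add: rext_sel ex_eq_iff catD(3)[OF D] cmp_assoc'[OF D] FD(1))
qed

abbreviation (input) rcounit where "rcounit \<equiv> right_counit D F"

lemma rcounit_nt: "nt C (precomp F (rext M)) M rcounit"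
proof (rule ntI)
 note FD = lfD[OF F]
 fix c assume c: "c \<in> Obj C"
 show "lin (Val (precomp F (rext M)) c) (Val M c) (rcounit c)"
  unfolding precomp_sel rext_sel right_counit_def by (rule eval_lin[OF c]) (simp add: catD(2)[OF D] FD c)
next
 note FD = lfD[OF F]
 fix x y f \<phi> assume h: "x \<in> Obj C" "y \<in> Obj C" "f \<in> Arr C x y" and "\<phi> \<in> El (precomp F (rext M)) y"
 then have \<phi>: "\<phi> \<in> Nats C (prep (Fob F y)) M" by (simp add: rext_sel)
 note Fo = FD(1)[OF h(1)] FD(1)[OF h(2)] and Ff = FD(3)[OF h]
 show "rcounit x (Act (precomp F (rext M)) x y f \<phi>) = Act M x y f (rcounit y \<phi>)"
  using ntD(2)[OF nat_homD(1)[OF \<phi>] h, of "Idt D (Fob F y)"] Fo Ff h by (simp add: right_counit_def rext_sel catD[OF D])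
qed

lemma right_universal:
 fixes X :: "('k, 'p, 'n, 'u) cmod"
 assumes X: "cmd D X" and h: "nt C (precomp F X) M h"
 shows "nt D X (rext M) (\<lambda>d x. ex C (prep d) (\<lambda>c g. h c (Act X (Fob F c) d g x)))"
  "c \<in> Obj C ==> x \<in> El X (Fob F c) ==>
   rcounit c (ex C (prep (Fob F c)) (\<lambda>c' g. h c' (Act X (Fob F c') (Fob F c) g x))) = h c x"
proof -
 note FD = lfD[OF F] and hD = ntD[OF h, unfolded precomp_sel]
 show "nt D X (rext M) (\<lambda>d x. ex C (prep d) (\<lambda>c g. h c (Act X (Fob F c) d g x)))"
 proof (rule ntI)
  fix d assume d: "d \<in> Obj D"
  show "lin (Val X d) (Val (rext M) d) (\<lambda>x. ex C (prep d) (\<lambda>c g. h c (Act X (Fob F c) d g x)))"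
   unfolding rext_sel
  proof (rule linI)
   fix x assume x: "x \<in> El X d"
   show "ex C (prep d) (\<lambda>c g. h c (Act X (Fob F c) d g x)) \<in> Nats C (prep d) M"
    by (rule nat_homI[OF nt_comp[OF precomp_nt[OF F yoneda_nt[OF D X d x]] h] prep_cmd[OF d]])
  qed (simp_all add: nat_hom_sel ex_eq_iff act_add[OF X] d FD hD cmdD(4)[OF X])
 next
  fix d d' g x assume "d \<in> Obj D" "d' \<in> Obj D" "g \<in> Arr D d d'" "x \<in> El X d'"
  then show "ex C (prep d) (\<lambda>c g'. h c (Act X (Fob F c) d g' (Act X d d' g x))) =
    Act (rext M) d d' g (ex C (prep d') (\<lambda>c g. h c (Act X (Fob F c) d' g x)))"
   by (simp add: rext_sel ex_eq_iff catD(3)[OF D] FD cmdD(3)[OF X])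
 qed
 show "c \<in> Obj C ==> x \<in> El X (Fob F c) ==>
   rcounit c (ex C (prep (Fob F c)) (\<lambda>c' g. h c' (Act X (Fob F c') (Fob F c) g x))) = h c x"
  by (simp add: right_counit_def catD(2)[OF D] FD cmdD(2)[OF X])
qed

text \<open>The value of the transformation \<open>k d x\<close> at \<open>g\<close> is, by
  naturality of \<open>k\<close>, the counit applied to \<open>k\<close> of X(g) x; so the counit
  determines \<open>k\<close>.\<close>

lemma right_unique:
 fixes X :: "('k, 'p, 'n, 'u) cmod"
 assumes X: "cmd D X" and k: "nt D X (rext M) k"
  and e: "\<And>c x. c \<in> Obj C ==> x \<in> El X (Fob F c) ==> rcounit c (k (Fob F c) x) = h c x"
  and d: "d \<in> Obj D" and x: "x \<in> El X d"
 shows "k d x = ex C (prep d) (\<lambda>c g. h c (Act X (Fob F c) d g x))"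
proof -
 note FD = lfD[OF F]
 have kx: "k d x \<in> Nats C (prep d) M" using ntD(3)[OF k d x] by (simp add: rext_sel)
 have "k d x c g = h c (Act X (Fob F c) d g x)" if c: "c \<in> Obj C" and g: "g \<in> Arr D (Fob F c) d" for c g
 proof -
  note Fc = FD(1)[OF c]
  have "h c (Act X (Fob F c) d g x) = rcounit c (Act (rext M) (Fob F c) d g (k d x))"
   using e[OF c cmdD(4)[OF X Fc d g x]] ntD(2)[OF k Fc d g x] by simp
  also have "\<dots> = k d x c g" using c Fc d g by (simp add: right_counit_def rext_sel catD[OF D])
  finally show ?thesis by simp
 qed
 then have "ex C (prep d) (k d x) = ex C (prep d) (\<lambda>c g. h c (Act X (Fob F c) d g x))" by (simp add: ex_eq_iff)
 then show ?thesis using nat_homD(2)[OF kx] by simp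
qed

end

end

lemma right_ext_univ:
 fixes C :: "('k, 'o, 'm) lincat" and D :: "('k, 'p, 'n) lincat" and F :: "('o, 'm, 'p, 'n) funct"
  and A :: "('k, 'o, 'l) lincat"
 assumes C: "lcat C" and D: "lcat D" and F: "linear_functor K C D F" and U: "module_universe TYPE('v) K A"
  and r: "\<And>d c. d \<in> Obj D ==> c \<in> Obj C ==> \<exists>r :: 'l => 'n. Arr D (Fob F c) d \<subseteq> range r"
 shows "\<exists>\<epsilon>. univ_counit (Mod_cat K D) (Mod_cat K C :: ('k, 'o, 'm, 'v) modcat)
   (pullback C F) (right_ext K C D F) \<epsilon> \<and>
   (\<forall>M. cmd C M --> \<epsilon> M = ex C (precomp F (copy_mod (right_ext_mod K C D F M)))
    (\<lambda>c v. right_counit D F c (decode (Val (right_ext_mod K C D F M) (Fob F c)) v)))"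
  and "\<And>M :: ('k, 'o, 'm, 'v) cmod. cmd C M ==> niso D (copy_mod (right_ext_mod K C D F M) :: ('k, 'p, 'n, 'v) cmod) (right_ext_mod K C D F M)
   (\<lambda>d. decode (Val (right_ext_mod K C D F M) d))"
  and "\<And>M :: ('k, 'o, 'm, 'v) cmod. cmd C M ==> niso D (right_ext_mod K C D F M) (copy_mod (right_ext_mod K C D F M) :: ('k, 'p, 'n, 'v) cmod)
   (\<lambda>d. code (Val (right_ext_mod K C D F M) d))"
  and "\<And>M :: ('k, 'o, 'm, 'v) cmod. cmd C M ==> cmd D (copy_mod (right_ext_mod K C D F M) :: ('k, 'p, 'n, 'v) cmod)"
proof -
 let ?R = "\<lambda>M. right_ext_mod K C D F M" let ?c = "\<lambda>M. copy_mod (right_ext_mod K C D F M) :: ('k, 'p, 'n, 'v) cmod"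
 let ?P = "\<lambda>d. precomp F (rep D d)"
 note FD = lfD[OF F]
 obtain j :: "('o \<times> 'l \<times> nat => 'v) => 'v" and a b :: 'v where j: "inj j" "a \<noteq> b" "fits TYPE('v) (carrier K)" by (rule universe_fits[OF U])
 note Rc = rext_cmd[OF C D F] and Rs = rext_sel[OF C D F] and Pc = prep_cmd[OF C D F]
 have fit: "\<exists>e :: ('o => 'n => 'v) => 'v. inj_on e (El (?R M) d)" if d: "d \<in> Obj D" for M :: "('k, 'o, 'm, 'v) cmod" and d
  unfolding Rs
 proof (rule fitsD, rule fits_nat_hom[OF j(1,2)])
  fix c assume "c \<in> Obj C"
  then show "\<exists>r :: 'l => 'n. El (?P d) c \<subseteq> range r" using r[OF d] by simp
 qed
 note cp = copy_mod[OF Rc fit]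
 show cn: "niso D (?c Y) (?R Y) (\<lambda>d. decode (Val (?R Y) d))" if "cmd C Y" for Y :: "('k, 'o, 'm, 'v) cmod" by (rule cp(3)[OF that])
 show cn': "niso D (?R Y) (?c Y) (\<lambda>d. code (Val (?R Y) d))" if "cmd C Y" for Y :: "('k, 'o, 'm, 'v) cmod" by (rule cp(2)[OF that])
 show cc: "cmd D (?c Y)" if "cmd C Y" for Y :: "('k, 'o, 'm, 'v) cmod" by (rule cp(1)[OF that])
 have k: "nt D (?R Y) (?c Y) (\<lambda>d. code (Val (?R Y) d))" and dn: "nt D (?c Y) (?R Y) (\<lambda>d. decode (Val (?R Y) d))"
  if "cmd C Y" for Y :: "('k, 'o, 'm, 'v) cmod"
  using cp(2,3)[OF that] by (auto simp: niso_def)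
 have dk: "decode (Val (?R Y) d) (code (Val (?R Y) d) t :: 'v) = t" if "cmd C Y" "d \<in> Obj D" "t \<in> El (?R Y) d"
  for Y :: "('k, 'o, 'm, 'v) cmod" and d t
  by (rule decode_code[OF cmdD(1)[OF Rc[OF that(1)] that(2)] fit[OF that(2)] that(3)])
 have kd: "code (Val (?R Y) d) (decode (Val (?R Y) d) v) = v"
  if "cmd C Y" "d \<in> Obj D" "v \<in> El (?c Y) d" for Y :: "('k, 'o, 'm, 'v) cmod" and d and v :: 'v
  using that dk by (auto simp: copy_mod_sel copy_space_carrier)
 let ?m = "\<lambda>\<eta> d \<phi>. \<lambda>c\<in>Obj C. \<lambda>h\<in>Arr D (Fob F c) d. \<eta> c (\<phi> c h)"
 have me: "?m \<eta> d \<phi> = ex C (?P d) (\<lambda>c h. \<eta> c (\<phi> c h))" for \<eta> :: "'o => 'v => 'v" and d and \<phi> :: "'o => 'n => 'v"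
  by (simp add: ex_def)
 have tm: "\<phi> \<in> Nats C (?P d) Y" if "\<phi> \<in> El (?R Y) d" for \<phi> d and Y :: "('k, 'o, 'm, 'v) cmod"
  using that by (simp add: Rs)
 have tm': "\<phi> \<in> El (?R Y) d" if "\<phi> \<in> Nats C (?P d) Y" for \<phi> d and Y :: "('k, 'o, 'm, 'v) cmod"
  using that by (simp add: Rs)
 have lf: "linear_functor K (Mod_cat K C) (Mod_cat K D) (right_ext K C D F ::
   (('k, 'o, 'm, 'v) cmod, 'o => 'v => 'v, ('k, 'p, 'n, 'v) cmod, 'p => 'v => 'v) funct)"
  unfolding right_ext_def
 proof (rule copy_functor[OF Rc fit], simp_all only: me)
  fix Y Y' Y'' :: "('k, 'o, 'm, 'v) cmod" and \<eta> \<theta> d t r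
  assume Y: "cmd C Y"
  { assume "d \<in> Obj D" and t: "t \<in> El (?R Y) d"
   note t = tm[OF t]
   have "ex C (?P d) (\<lambda>c h. ex C Y (\<lambda>c v. v) c (t c h)) = ex C (?P d) t"
    using ntD(3)[OF nat_homD(1)[OF t]] by (simp add: ex_eq_iff)
   then show "ex C (?P d) (\<lambda>c h. ex C Y (\<lambda>c v. v) c (t c h)) = t" using nat_homD(2)[OF t] by simp }
  assume Y': "cmd C Y'" and "\<eta> \<in> Nats C Y Y'"
  then have \<eta>: "nt C Y Y' \<eta>" by (simp add: nat_hom_iff)
  show "nt D (?R Y) (?R Y') (\<lambda>d \<phi>. ex C (?P d) (\<lambda>c h. \<eta> c (\<phi> c h)))"
  proof (rule ntI)
   fix d assume d: "d \<in> Obj D"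
   show "lin (Val (?R Y) d) (Val (?R Y') d) (\<lambda>\<phi>. ex C (?P d) (\<lambda>c h. \<eta> c (\<phi> c h)))"
    unfolding Rs
   proof (rule linI)
    fix \<phi> assume \<phi>: "\<phi> \<in> Nats C (?P d) Y"
    note \<phi>n = ntD(3)[OF nat_homD(1)[OF \<phi>]]
    show "ex C (?P d) (\<lambda>c h. \<eta> c (\<phi> c h)) \<in> Nats C (?P d) Y'"
     by (rule nat_homI[OF nt_comp[OF nat_homD(1)[OF \<phi>] \<eta>] Pc[OF d]])
    { fix \<psi> assume \<psi>: "\<psi> \<in> Nats C (?P d) Y"
     show "ex C (?P d) (\<lambda>c h. \<eta> c ((\<phi> \<oplus>\<^bsub>nat_hom K C (?P d) Y\<^esub> \<psi>) c h)) =
      ex C (?P d) (\<lambda>c h. \<eta> c (\<phi> c h)) \<oplus>\<^bsub>nat_hom K C (?P d) Y'\<^esub> ex C (?P d) (\<lambda>c h. \<eta> c (\<psi> c h))"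
      using \<phi>n ntD(3)[OF nat_homD(1)[OF \<psi>]] by (simp add: nat_hom_sel ex_eq_iff ntD(4)[OF \<eta>]) }
    { fix r assume "r \<in> carrier K"
     then show "ex C (?P d) (\<lambda>c h. \<eta> c ((r \<odot>\<^bsub>nat_hom K C (?P d) Y\<^esub> \<phi>) c h)) =
      r \<odot>\<^bsub>nat_hom K C (?P d) Y'\<^esub> ex C (?P d) (\<lambda>c h. \<eta> c (\<phi> c h))"
      using \<phi>n by (simp add: nat_hom_sel ex_eq_iff ntD(5)[OF \<eta>]) }
   qed
  qed (simp add: Rs ex_eq_iff catD(3)[OF D] FD)
  assume d: "d \<in> Obj D" and t: "t \<in> El (?R Y) d"
  note tn = ntD(3)[OF nat_homD(1)[OF tm[OF t]], unfolded precomp_sel rep_sel]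
  { assume "\<theta> \<in> Nats C Y' Y''"
   show "ex C (?P d) (\<lambda>c h. ex C Y (\<lambda>c v. \<theta> c (\<eta> c v)) c (t c h)) = ex C (?P d) (\<lambda>c h. \<theta> c (ex C (?P d) (\<lambda>c h. \<eta> c (t c h)) c h))"
    using tn by (simp add: ex_eq_iff) }
  { assume "\<theta> \<in> Nats C Y Y'"
   show "ex C (?P d) (\<lambda>c h. (\<eta> \<oplus>\<^bsub>nat_hom K C Y Y'\<^esub> \<theta>) c (t c h)) =
     ex C (?P d) (\<lambda>c h. \<eta> c (t c h)) \<oplus>\<^bsub>Val (?R Y') d\<^esub> ex C (?P d) (\<lambda>c h. \<theta> c (t c h))"
    using tn by (simp add: Rs nat_hom_sel ex_eq_iff) }
  { assume "r \<in> carrier K"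
   show "ex C (?P d) (\<lambda>c h. (r \<odot>\<^bsub>nat_hom K C Y Y'\<^esub> \<eta>) c (t c h)) = r \<odot>\<^bsub>Val (?R Y') d\<^esub> ex C (?P d) (\<lambda>c h. \<eta> c (t c h))"
    using tn by (simp add: Rs nat_hom_sel ex_eq_iff) }
 qed
 define \<epsilon> where "\<epsilon> = (\<lambda>M :: ('k, 'o, 'm, 'v) cmod. ex C (precomp F (?c M)) (\<lambda>c v. right_counit D F c (decode (Val (?R M) (Fob F c)) v)))"
 note en = rcounit_nt[OF C D F]
 have \<epsilon>n: "nt C (precomp F (?c M)) M (\<lambda>c v. right_counit D F c (decode (Val (?R M) (Fob F c)) v))" if "cmd C M" for M :: "('k, 'o, 'm, 'v) cmod"
  using nt_comp[OF precomp_nt[OF F dn[OF that]] en[OF that]] .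
 have \<epsilon>a: "\<epsilon> M \<in> Nats C (precomp F (?c M)) M" if "cmd C M" for M :: "('k, 'o, 'm, 'v) cmod"
  unfolding \<epsilon>_def by (rule nat_homI[OF \<epsilon>n[OF that] precomp_cmd[OF F cc[OF that]]])
 have "univ_counit (Mod_cat K D) (Mod_cat K C :: ('k, 'o, 'm, 'v) modcat) (pullback C F) (right_ext K C D F) \<epsilon>"
  unfolding univ_counit_def
 proof (intro conjI ballI lf pullback_lf[OF F C D])
  have Fr: "Fob (right_ext K C D F) Y = ?c Y" for Y :: "('k, 'o, 'm, 'v) cmod" by (simp add: right_ext_def)
  fix M assume "M \<in> Obj (Mod_cat K C :: ('k, 'o, 'm, 'v) modcat)"
  then have M: "cmd C M" by simp
  show "\<epsilon> M \<in> Arr (Mod_cat K C) (Fob (pullback C F) (Fob (right_ext K C D F) M)) M"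
   using \<epsilon>a[OF M] by (simp add: Fr pullback_sel)
  { fix M' f assume "M' \<in> Obj (Mod_cat K C :: ('k, 'o, 'm, 'v) modcat)" "f \<in> Arr (Mod_cat K C) M M'"
   then have M': "cmd C M'" and fa: "f \<in> Nats C M M'" by simp_all
   note f = nat_homD(1)[OF fa]
   have Fm: "Far (right_ext K C D F) M M' f \<in> Nats D (?c M) (?c M')"
    using lfD(3)[OF lf, of M M' f] M M' fa by (simp add: Fr)
   show "Cmp (Mod_cat K C) (Fob (pullback C F) (Fob (right_ext K C D F) M)) M M' f (\<epsilon> M) =
    Cmp (Mod_cat K C) (Fob (pullback C F) (Fob (right_ext K C D F) M)) (Fob (pullback C F) (Fob (right_ext K C D F) M')) M' (\<epsilon> M')
     (Far (pullback C F) (Fob (right_ext K C D F) M) (Fob (right_ext K C D F) M') (Far (right_ext K C D F) M M' f))"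
   proof (simp add: Fr pullback_far[OF F Fm] pullback_sel(1) ex_eq_iff, intro ballI)
    fix c v assume c: "c \<in> Obj C" and v: "v \<in> El (?c M) (Fob F c)"
    note Fc = FD(1)[OF c] and t = ntD(3)[OF dn[OF M] FD(1)[OF c] v]
    have s: "Far (right_ext K C D F) M M' f (Fob F c) v \<in> El (?c M') (Fob F c)" by (rule ntD(3)[OF nat_homD(1)[OF Fm] Fc v])
    have w: "ex C (?P (Fob F c)) (\<lambda>c' h. f c' (decode (Val (?R M) (Fob F c)) v c' h)) \<in> El (?R M') (Fob F c)"
     by (rule tm'[OF nat_homI[OF nt_comp[OF nat_homD(1)[OF tm[OF t]] f] Pc[OF Fc]]])
    show "f c (\<epsilon> M c v) = \<epsilon> M' c (Far (right_ext K C D F) M M' f (Fob F c) v)"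
     using c v s Fc dk[OF M' Fc w]
     by (simp add: \<epsilon>_def right_ext_def copy_trans_eq me right_counit_def catD(2)[OF D])
   qed }
  fix X h assume "X \<in> Obj (Mod_cat K D :: ('k, 'p, 'n, 'v) modcat)"
  then have X: "cmd D X" by simp
  note pX = precomp_cmd[OF F X]
  assume "h \<in> Arr (Mod_cat K C) (Fob (pullback C F) X) M"
  then have ha: "h \<in> Nats C (precomp F X) M" by (simp add: pullback_sel)
  note h = nat_homD[OF ha] and ru = right_universal[OF C D F M X nat_homD(1)[OF ha]]
  have pf: "Cmp (Mod_cat K C) (Fob (pullback C F) X) (Fob (pullback C F) (Fob (right_ext K C D F) M)) M (\<epsilon> M)
     (Far (pullback C F) X (Fob (right_ext K C D F) M) l) = ex C (precomp F X) (\<lambda>c x. \<epsilon> M c (l (Fob F c) x))"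
   if l: "l \<in> Nats D X (?c M)" for l
   by (simp add: Fr pullback_far[OF F l] ex_eq_iff pullback_sel(1))
  let ?k = "\<lambda>d x. ex C (?P d) (\<lambda>c g. h c (Act X (Fob F c) d g x))"
  let ?l = "ex D X (\<lambda>d x. code (Val (?R M) d) (?k d x))"
  have la: "?l \<in> Nats D X (?c M)" by (rule nat_homI[OF nt_comp[OF ru(1) k[OF M]] X])
  have lv: "\<epsilon> M c (?l (Fob F c) x) = h c x" if c: "c \<in> Obj C" "x \<in> El X (Fob F c)" for c x
  proof -
   note Fc = FD(1)[OF c(1)] and kx = ntD(3)[OF ru(1) FD(1)[OF c(1)] c(2)]
   show ?thesis using c Fc ntD(3)[OF k[OF M] Fc kx] dk[OF M Fc kx] ru(2)[OF c] by (simp add: \<epsilon>_def)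
  qed
  have "\<exists>!l. l \<in> Nats D X (?c M) \<and> ex C (precomp F X) (\<lambda>c x. \<epsilon> M c (l (Fob F c) x)) = h"
  proof (rule ex1I[of _ ?l], intro conjI la)
   have "ex C (precomp F X) (\<lambda>c x. \<epsilon> M c (?l (Fob F c) x)) = ex C (precomp F X) h" unfolding ex_eq_iff precomp_sel using lv by blast
   then show "ex C (precomp F X) (\<lambda>c x. \<epsilon> M c (?l (Fob F c) x)) = h" using h(2) by simp
   fix l assume l: "l \<in> Nats D X (?c M) \<and> ex C (precomp F X) (\<lambda>c x. \<epsilon> M c (l (Fob F c) x)) = h"
   note ln = nat_homD(1)[OF conjunct1[OF l]]
   show "l = ?l"
   proof (rule nat_hom_eqI[OF conjunct1[OF l] la])
    fix d x assume d: "d \<in> Obj D" "x \<in> El X d"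
    have "decode (Val (?R M) d) (l d x) = ?k d x"
    proof (rule right_unique[OF C D F M X nt_comp[OF ln dn[OF M]] _ d])
     fix c x assume c: "c \<in> Obj C" "x \<in> El X (Fob F c)"
     show "right_counit D F c (decode (Val (?R M) (Fob F c)) (l (Fob F c) x)) = h c x"
      using ex_eqD[OF conjunct2[OF l] c(1), of x] c ntD(3)[OF ln FD(1)[OF c(1)] c(2)] by (simp add: \<epsilon>_def)
    qed
    then show "l d x = ?l d x" using d kd[OF M d(1) ntD(3)[OF ln d]] by simp
   qed
  qed
  then show "\<exists>!l. l \<in> Arr (Mod_cat K D) X (Fob (right_ext K C D F) M) \<and>
    Cmp (Mod_cat K C) (Fob (pullback C F) X) (Fob (pullback C F) (Fob (right_ext K C D F) M)) M (\<epsilon> M)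
     (Far (pullback C F) X (Fob (right_ext K C D F) M) l) = h"
   unfolding Mod_cat_sel Fr by (rule ex1_conj_cong) (simp only: pf[unfolded Mod_cat_sel Fr])
 qed
 then show "\<exists>\<epsilon>. univ_counit (Mod_cat K D) (Mod_cat K C :: ('k, 'o, 'm, 'v) modcat)
   (pullback C F) (right_ext K C D F) \<epsilon> \<and>
   (\<forall>M. cmd C M --> \<epsilon> M = ex C (precomp F (copy_mod (right_ext_mod K C D F M)))
    (\<lambda>c v. right_counit D F c (decode (Val (right_ext_mod K C D F M) (Fob F c)) v)))"
  unfolding \<epsilon>_def by blast
qed

section \<open>Duality\<close>


text \<open>Links arrows that are invertible in the category to pointwise bijections, in which form
  all isomorphisms are constructed.\<close>

lemma iso_mod_iff:
 assumes X: "fp C X" and Y: "fp C Y"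
 shows "is_iso (mod_cat K C) X Y f \<longleftrightarrow> f \<in> Nats C X Y \<and> niso C X Y f"
proof
 note Xc = fp_cmd[OF X] and Yc = fp_cmd[OF Y]
 assume "is_iso (mod_cat K C) X Y f"
 then obtain g where f: "f \<in> Nats C X Y" and g: "g \<in> Nats C Y X"
  and gf: "ex C X (\<lambda>c v. g c (f c v)) = ex C X (\<lambda>c v. v)" and fg: "ex C Y (\<lambda>c v. f c (g c v)) = ex C Y (\<lambda>c v. v)"
  by (auto simp: is_iso_def)
 have "niso C X Y f"
  unfolding niso_def
 proof (intro conjI ballI nat_homD(1)[OF f])
  fix c assume c: "c \<in> Obj C"
  show "bij_betw (f c) (El X c) (El Y c)"
   by (rule bij_betwI[of _ _ _ "g c"])
    (use c ntD(3)[OF nat_homD(1)[OF f]] ntD(3)[OF nat_homD(1)[OF g]] ex_eqD[OF gf c] ex_eqD[OF fg c] in auto)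
 qed
 then show "f \<in> Nats C X Y \<and> niso C X Y f" using f by blast
next
 note Xc = fp_cmd[OF X] and Yc = fp_cmd[OF Y]
 assume *: "f \<in> Nats C X Y \<and> niso C X Y f"
 let ?g = "\<lambda>c. inv_into (El X c) (f c)"
 have g: "nt C Y X ?g" using niso_inv[OF conjunct2[OF *] Xc Yc] by (simp add: niso_def)
 have b: "bij_betw (f c) (El X c) (El Y c)" if "c \<in> Obj C" for c using * that by (simp add: niso_def)
 have "f c v \<in> El Y c" if "c \<in> Obj C" "v \<in> El X c" for c v by (rule ntD(3)[OF nat_homD(1)[OF conjunct1[OF *]] that])
 then show "is_iso (mod_cat K C) X Y f"
  unfolding is_iso_def using * nat_homI[OF g Yc] ntD(3)[OF g] bij_betw_inv_into_right[OF b] bij_betw_inv_into_left[OF b]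
  by (auto simp: ex_eq_iff intro!: bexI[of _ "ex C Y ?g"])
qed

section \<open>Dual spaces, dual modules and double duals\<close>

definition dual_mod :: "('k, 'o, 'm, 'v) cmod => ('k, 'o, 'm, 'v => 'k) cmod" where
 "dual_mod X = \<lparr>Val = (\<lambda>c. dual_space K (Val X c)), Act = (\<lambda>x y f \<phi>. \<lambda>v\<in>El X x. \<phi> (Act X y x f v))\<rparr>"

definition dual_map :: "('k, 'o, 'm, 'v) cmod => ('o => 'v => 'w) => 'o => ('w => 'k) => 'v => 'k" where
 "dual_map X \<eta> c \<phi> = (\<lambda>v\<in>El X c. \<phi> (\<eta> c v))"

definition evaluation :: "('k, 'o, 'm, 'v) cmod => 'o => 'v => ('v => 'k) => 'k" where
 "evaluation X c v = (\<lambda>\<phi>\<in>carrier (dual_space K (Val X c)). \<phi> v)"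

lemma dual_sel:
 "Val (dual_mod X) = (\<lambda>c. dual_space K (Val X c))"
 "Act (dual_mod X) = (\<lambda>x y f \<phi>. \<lambda>v\<in>El X x. \<phi> (Act X y x f v))"
 "Fob (dual_funct K C) X = dual_mod X"
 by (simp_all add: dual_mod_def dual_funct_def)

lemma dual_space_mem: "\<phi> \<in> carrier (dual_space K V) \<longleftrightarrow> \<phi> \<in> extensional (carrier V) \<and> lin V base_space \<phi>"
 by (simp add: dual_space_def base_space_def)

lemma dual_space_sel:
 "\<zero>\<^bsub>dual_space K V\<^esub> = (\<lambda>v\<in>carrier V. \<zero>)"
 "\<phi> \<oplus>\<^bsub>dual_space K V\<^esub> \<psi> = (\<lambda>v\<in>carrier V. \<phi> v \<oplus> \<psi> v)"
 "r \<odot>\<^bsub>dual_space K V\<^esub> \<phi> = (\<lambda>v\<in>carrier V. r \<otimes> \<phi> v)"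
 by (simp_all add: dual_space_def)

lemma dual_restrict: "lin V base_space \<phi> ==> vsp V ==> (\<lambda>v\<in>carrier V. \<phi> v) \<in> carrier (dual_space K V)"
 using lin_cong[where V = V and W = base_space and f = \<phi> and g = "\<lambda>v\<in>carrier V. \<phi> v"] by (simp add: dual_space_mem)

lemma dual_eqI: "\<phi> \<in> carrier (dual_space K V) ==> \<psi> \<in> carrier (dual_space K V) ==> (\<And>v. v \<in> carrier V ==> \<phi> v = \<psi> v) ==> \<phi> = \<psi>"
 unfolding dual_space_mem by (blast intro: extensionalityI)

lemma dual_spaceD:
 assumes "\<phi> \<in> carrier (dual_space K V)"
 shows "lin V base_space \<phi>" "v \<in> carrier V ==> \<phi> v \<in> carrier K"
 using assms linD(1)[of \<phi> V base_space v] by (auto simp: dual_space_mem)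

lemma dual_vsp:
 assumes V: "vsp V"
 shows "vsp (dual_space K V)"
proof -
 note d = dual_spaceD(2) and e = dual_space_mem[THEN iffD1, THEN conjunct1] and B = base_space_vsp
 note l = dual_spaceD(1)
 show ?thesis
 proof (rule vspI)
  show "\<zero>\<^bsub>dual_space K V\<^esub> \<in> carrier (dual_space K V)"
   using dual_restrict[OF lin_zero_map[OF B] V] by (simp add: dual_space_sel)
  show "\<phi> \<oplus>\<^bsub>dual_space K V\<^esub> \<psi> \<in> carrier (dual_space K V)" if "\<phi> \<in> carrier (dual_space K V)" "\<psi> \<in> carrier (dual_space K V)" for \<phi> \<psi>
   using dual_restrict[OF lin_add[OF l[OF that(1)] l[OF that(2)] B] V] by (simp add: dual_space_sel)
  show "r \<odot>\<^bsub>dual_space K V\<^esub> \<phi> \<in> carrier (dual_space K V)" if "r \<in> carrier K" "\<phi> \<in> carrier (dual_space K V)" for r \<phi>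
   using dual_restrict[OF lin_smult[OF l[OF that(2)] B that(1)] V] by (simp add: dual_space_sel)
  show "\<phi> \<oplus>\<^bsub>dual_space K V\<^esub> \<zero>\<^bsub>dual_space K V\<^esub> = \<phi>" if "\<phi> \<in> carrier (dual_space K V)" for \<phi>
   using d[OF that] e[OF that] by (auto simp: dual_space_sel fun_eq_iff restrict_def extensional_def)
  show "\<one> \<odot>\<^bsub>dual_space K V\<^esub> \<phi> = \<phi>" if "\<phi> \<in> carrier (dual_space K V)" for \<phi>
   using d[OF that] e[OF that] by (auto simp: dual_space_sel fun_eq_iff restrict_def extensional_def)
 qed (auto simp: dual_space_sel fun_eq_iff restrict_def d a_ac m_ac l_distr r_distr)
qed

lemma lin_dual_precomp:
 assumes f: "lin V W f" and V: "vsp V" and W: "vsp W"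
 shows "lin (dual_space K W) (dual_space K V) (\<lambda>\<phi>. \<lambda>v\<in>carrier V. \<phi> (f v))"
 by (rule linI, rule dual_restrict[OF lin_comp[OF f dual_spaceD(1)] V])
  (auto simp: dual_space_sel linD(1)[OF f] fun_eq_iff restrict_def)

lemma dual_cmd:
 assumes X: "cmd C X"
 shows "cmd (op_cat C) (dual_mod X)"
proof (rule cmdI)
 show "vsp (Val (dual_mod X) c)" if "c \<in> Obj (op_cat C)" for c
  using that by (simp add: dual_sel dual_vsp[OF cmdD(1)[OF X]])
 show "Act (dual_mod X) c c (Idt (op_cat C) c) \<phi> = \<phi>" if "c \<in> Obj (op_cat C)" "\<phi> \<in> El (dual_mod X) c" for c \<phi>
  using that by (auto simp: dual_sel cmdD(2)[OF X] dual_space_mem fun_eq_iff extensional_def)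
 fix x y assume "x \<in> Obj (op_cat C)" "y \<in> Obj (op_cat C)"
 then have o: "x \<in> Obj C" "y \<in> Obj C" by simp_all
 show "lin (Val (dual_mod X) y) (Val (dual_mod X) x) (Act (dual_mod X) x y f)" if "f \<in> Arr (op_cat C) x y" for f
  using that lin_dual_precomp[OF act_lin(1)[OF X o(2,1)] cmdD(1)[OF X o(1)] cmdD(1)[OF X o(2)]] by (simp add: dual_sel)
 { fix \<phi> assume \<phi>: "\<phi> \<in> El (dual_mod X) y"
  then have p: "lin (Val X y) base_space \<phi>" by (simp add: dual_sel dual_spaceD(1))
  show "lin (Hom (op_cat C) x y) (Val (dual_mod X) x) (\<lambda>f. Act (dual_mod X) x y f \<phi>)"
   unfolding dual_sel op_cat_sel
  proof (rule linI)
   fix f assume "f \<in> Arr C y x"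
   then show "(\<lambda>v\<in>El X x. \<phi> (Act X y x f v)) \<in> carrier (dual_space K (Val X x))"
    by (rule dual_restrict[OF lin_comp[OF act_lin(1)[OF X o(2,1)] p] cmdD(1)[OF X o(1)]])
  qed (auto simp: dual_space_sel fun_eq_iff o linD(2,3)[OF act_lin(2)[OF X]] linD(2,3)[OF p] cmdD(4)[OF X]) }
 fix z f g \<phi> assume "z \<in> Obj (op_cat C)" "f \<in> Arr (op_cat C) x y" "g \<in> Arr (op_cat C) y z"
 then show "Act (dual_mod X) x z (Cmp (op_cat C) x y z g f) \<phi> = Act (dual_mod X) x y f (Act (dual_mod X) y z g \<phi>)"
  using o by (simp add: dual_sel fun_eq_iff restrict_def cmdD(3,4)[OF X])
qed

lemma dual_nt:
 assumes \<eta>: "nt C X Y \<eta>" and X: "cmd C X" and Y: "cmd C Y"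
 shows "nt (op_cat C) (dual_mod Y) (dual_mod X) (dual_map X \<eta>)"
proof (rule ntI)
 fix c assume "c \<in> Obj (op_cat C)"
 then have c: "c \<in> Obj C" by simp
 show "lin (Val (dual_mod Y) c) (Val (dual_mod X) c) (dual_map X \<eta> c)"
  using lin_dual_precomp[OF ntD(1)[OF \<eta> c] cmdD(1)[OF X c] cmdD(1)[OF Y c]] by (simp add: dual_sel dual_map_def[abs_def])
qed (auto simp: dual_sel dual_map_def fun_eq_iff restrict_def ntD[OF \<eta>] cmdD(4)[OF X])

lemma dual_niso:
 assumes \<eta>: "niso C X Y \<eta>" and X: "cmd C X" and Y: "cmd C Y"
 shows "niso (op_cat C) (dual_mod Y) (dual_mod X) (dual_map X \<eta>)"
proof -
 have n: "nt C X Y \<eta>" and b: "\<And>c. c \<in> Obj C ==> bij_betw (\<eta> c) (El X c) (El Y c)"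
  using \<eta> by (auto simp: niso_def)
 let ?\<theta> = "\<lambda>c. inv_into (El X c) (\<eta> c)"
 have m: "nt C Y X ?\<theta>" using niso_inv[OF \<eta> X Y] by (simp add: niso_def)
 show ?thesis
  unfolding niso_def
 proof (intro conjI ballI dual_nt[OF n X Y])
  fix c assume "c \<in> Obj (op_cat C)"
  then have c: "c \<in> Obj C" by simp
  note d = ntD(3)[OF dual_nt[OF n X Y], of c] and d' = ntD(3)[OF dual_nt[OF m Y X], of c]
  show "bij_betw (dual_map X \<eta> c) (El (dual_mod Y) c) (El (dual_mod X) c)"
  proof (rule bij_betwI[of _ _ _ "dual_map Y ?\<theta> c"])
   fix \<phi> assume \<phi>: "\<phi> \<in> El (dual_mod Y) c"
   show "dual_map Y ?\<theta> c (dual_map X \<eta> c \<phi>) = \<phi>"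
    using d[OF _ \<phi>] d'[of "dual_map X \<eta> c \<phi>"] \<phi> c ntD(3)[OF m c] bij_betw_inv_into_right[OF b[OF c]]
    by (intro dual_eqI[of _ "Val Y c"]) (auto simp: dual_sel dual_map_def)
  next
   fix \<phi> assume \<phi>: "\<phi> \<in> El (dual_mod X) c"
   show "dual_map X \<eta> c (dual_map Y ?\<theta> c \<phi>) = \<phi>"
    using d'[OF _ \<phi>] d[of "dual_map Y ?\<theta> c \<phi>"] \<phi> c ntD(3)[OF n c] bij_betw_inv_into_left[OF b[OF c]]
    by (intro dual_eqI[of _ "Val X c"]) (auto simp: dual_sel dual_map_def)
  qed (use d d' c in auto)
 qed
qed

text \<open>Coordinates with respect to a finite basis; only the expansion formula is retained, as
  it yields bijectivity of evaluation.\<close>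

lemma fin_dim_coords:
 assumes V: "vsp V" and fd: "vectorspace.fin_dim K V"
 obtains S \<chi> where "finite S" "S \<subseteq> carrier V" "\<And>s. s \<in> S ==> \<chi> s \<in> carrier (dual_space K V)"
  "\<And>v. v \<in> carrier V ==> v = (\<Oplus>\<^bsub>V\<^esub>s\<in>S. \<chi> s v \<odot>\<^bsub>V\<^esub> s)"
proof -
 interpret V: vectorspace K V by (rule V)
 obtain S where S: "finite S" "V.basis S" using V.finite_basis_exists[OF fd] by blast
 have SV: "S \<subseteq> carrier V" using S(2) by (simp add: V.basis_def)
 have u: "\<exists>!a. a \<in> S \<rightarrow>\<^sub>E carrier K \<and> V.lincomb a S = v" if "v \<in> carrier V" for v
  using V.basis_criterion[OF S(1) SV] S(2) that by blast
 define a where "a v = (THE a. a \<in> S \<rightarrow>\<^sub>E carrier K \<and> V.lincomb a S = v)" for v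
 have a: "a v \<in> S \<rightarrow>\<^sub>E carrier K" "V.lincomb (a v) S = v" if "v \<in> carrier V" for v
  using theI'[OF u[OF that]] by (simp_all add: a_def)
 have ae: "a v = b" if "v \<in> carrier V" "b \<in> S \<rightarrow>\<^sub>E carrier K" "V.lincomb b S = v" for v b
  using u[OF that(1)] a[OF that(1)] that(2,3) by blast
 have ak: "a v s \<in> carrier K" if "v \<in> carrier V" "s \<in> S" for v s using a(1)[OF that(1)] that(2) by auto
 have sv: "s \<in> carrier V" if "s \<in> S" for s using SV that by blast
 have add: "a (v \<oplus>\<^bsub>V\<^esub> w) = (\<lambda>s\<in>S. a v s \<oplus> a w s)" if v: "v \<in> carrier V" and w: "w \<in> carrier V" for v w
 proof (rule ae)
  have "V.lincomb (\<lambda>s\<in>S. a v s \<oplus> a w s) S = (\<Oplus>\<^bsub>V\<^esub>s\<in>S. a v s \<odot>\<^bsub>V\<^esub> s \<oplus>\<^bsub>V\<^esub> a w s \<odot>\<^bsub>V\<^esub> s)"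
   unfolding V.lincomb_def by (rule V.M.finsum_cong') (auto simp: ak v w sv V.smult_l_distr)
  also have "\<dots> = V.lincomb (a v) S \<oplus>\<^bsub>V\<^esub> V.lincomb (a w) S"
   unfolding V.lincomb_def by (rule V.M.finsum_addf) (auto simp: ak v w sv)
  finally show "V.lincomb (\<lambda>s\<in>S. a v s \<oplus> a w s) S = v \<oplus>\<^bsub>V\<^esub> w" by (simp add: a v w)
 qed (auto simp: ak v w)
 have smult: "a (r \<odot>\<^bsub>V\<^esub> v) = (\<lambda>s\<in>S. r \<otimes> a v s)" if r: "r \<in> carrier K" and v: "v \<in> carrier V" for r v
 proof (rule ae)
  have "V.lincomb (\<lambda>s\<in>S. r \<otimes> a v s) S = (\<Oplus>\<^bsub>V\<^esub>s\<in>S. r \<odot>\<^bsub>V\<^esub> (a v s \<odot>\<^bsub>V\<^esub> s))"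
   unfolding V.lincomb_def by (rule V.M.finsum_cong') (auto simp: ak r v sv V.smult_assoc1)
  also have "\<dots> = r \<odot>\<^bsub>V\<^esub> V.lincomb (a v) S"
   unfolding V.lincomb_def
   by (rule lin_finsum[OF lin_smult[OF lin_id V r] V V S(1), symmetric]) (auto simp: ak v sv)
  finally show "V.lincomb (\<lambda>s\<in>S. r \<otimes> a v s) S = r \<odot>\<^bsub>V\<^esub> v" by (simp add: a v)
 qed (auto simp: ak v r)
 define \<chi> where "\<chi> s = (\<lambda>v\<in>carrier V. a v s)" for s
 show thesis
 proof (rule that[OF S(1) SV])
  fix s assume "s \<in> S"
  then show "\<chi> s \<in> carrier (dual_space K V)"
   unfolding \<chi>_def by (intro dual_restrict[OF _ V] linI) (simp_all add: ak add smult)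
 next
  fix v assume v: "v \<in> carrier V"
  show "v = (\<Oplus>\<^bsub>V\<^esub>s\<in>S. \<chi> s v \<odot>\<^bsub>V\<^esub> s)"
   unfolding \<chi>_def using a(2)[OF v] v by (simp add: V.lincomb_def)
 qed
qed

text \<open>Coordinates are linear forms, so a vector killed by all forms is zero; surjectivity
  comes from the expansion of a form in the coordinates.\<close>

lemma evaluation_niso:
 assumes X: "cmd C X" and fd: "\<And>c. c \<in> Obj C ==> vectorspace.fin_dim K (Val X c)"
 shows "niso C X (dual_mod (dual_mod X)) (evaluation X)"
proof (rule nisoI[OF _ X])
 show "cmd C (dual_mod (dual_mod X))" using dual_cmd[OF dual_cmd[OF X]] by simp
 have el: "lin (dual_space K (Val X c)) base_space (\<lambda>\<phi>. \<phi> v)" if "v \<in> El X c" for c v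
  by (rule linI) (auto simp: dual_spaceD(2) that dual_space_sel)
 show "nt C X (dual_mod (dual_mod X)) (evaluation X)"
 proof (rule ntI)
  fix c assume c: "c \<in> Obj C"
  show "lin (Val X c) (Val (dual_mod (dual_mod X)) c) (evaluation X c)"
   unfolding dual_sel
  proof (rule linI)
   fix v assume "v \<in> El X c"
   then show "evaluation X c v \<in> carrier (dual_space K (dual_space K (Val X c)))"
    unfolding evaluation_def by (rule dual_restrict[OF el dual_vsp[OF cmdD(1)[OF X c]]])
  next
   fix v w assume "v \<in> El X c" "w \<in> El X c"
   then show "evaluation X c (v \<oplus>\<^bsub>Val X c\<^esub> w) = evaluation X c v \<oplus>\<^bsub>dual_space K (dual_space K (Val X c))\<^esub> evaluation X c w"
    by (auto simp: evaluation_def dual_space_sel(2)[where V = "dual_space K (Val X c)"] fun_eq_iff restrict_def linD(2)[OF dual_spaceD(1)])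
  next
   fix r v assume "r \<in> carrier K" "v \<in> El X c"
   then show "evaluation X c (r \<odot>\<^bsub>Val X c\<^esub> v) = r \<odot>\<^bsub>dual_space K (dual_space K (Val X c))\<^esub> evaluation X c v"
    by (auto simp: evaluation_def dual_space_sel(3)[where V = "dual_space K (Val X c)"] fun_eq_iff restrict_def linD(3)[OF dual_spaceD(1)])
  qed
 next
  fix x y f v assume h: "x \<in> Obj C" "y \<in> Obj C" "f \<in> Arr C x y" "v \<in> El X y"
  have "(\<lambda>v\<in>El X y. \<phi> (Act X x y f v)) \<in> carrier (dual_space K (Val X y))" if "\<phi> \<in> carrier (dual_space K (Val X x))" for \<phi>
   by (rule dual_restrict[OF lin_comp[OF act_lin(1)[OF X h(1-3)] dual_spaceD(1)[OF that]] cmdD(1)[OF X h(2)]])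
  then show "evaluation X x (Act X x y f v) = Act (dual_mod (dual_mod X)) x y f (evaluation X y v)"
   using h(4) by (auto simp: evaluation_def dual_sel fun_eq_iff restrict_def)
 qed
 fix c assume c: "c \<in> Obj C"
 note V = cmdD(1)[OF X c]
 obtain S \<chi> where S: "finite S" "S \<subseteq> El X c" "\<And>s. s \<in> S ==> \<chi> s \<in> carrier (dual_space K (Val X c))"
  "\<And>v. v \<in> El X c ==> v = (\<Oplus>\<^bsub>Val X c\<^esub>s\<in>S. \<chi> s v \<odot>\<^bsub>Val X c\<^esub> s)"
  by (rule fin_dim_coords[OF V fd[OF c]]) blast
 interpret V: vectorspace K "Val X c" by (rule V)
 have sv: "s \<in> El X c" if "s \<in> S" for s using S(2) that by blast
 { fix v assume v: "v \<in> El X c" "evaluation X c v = zr (dual_mod (dual_mod X)) c"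
  have "\<chi> s v = \<zero>" if "s \<in> S" for s
   using fun_cong[OF v(2), of "\<chi> s"] S(3)[OF that] by (simp add: evaluation_def dual_sel dual_space_sel(1)[where V = "dual_space K (Val X c)"])
  then have "(\<Oplus>\<^bsub>Val X c\<^esub>s\<in>S. \<chi> s v \<odot>\<^bsub>Val X c\<^esub> s) = (\<Oplus>\<^bsub>Val X c\<^esub>s\<in>S. (zr X c))"
   by (intro V.M.finsum_cong') (auto simp: sv)
  then show "v = zr X c" using S(4)[OF v(1)] by simp }
 fix \<Psi> assume "\<Psi> \<in> El (dual_mod (dual_mod X)) c"
 then have \<Psi>: "\<Psi> \<in> carrier (dual_space K (dual_space K (Val X c)))" by (simp add: dual_sel)
 note D = dual_vsp[OF V] and B = base_space_vsp
 interpret D: vectorspace K "dual_space K (Val X c)" by (rule D)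
 have k: "\<Psi> (\<chi> s) \<in> carrier K" if "s \<in> S" for s by (rule dual_spaceD(2)[OF \<Psi> S(3)[OF that]])
 \<comment> \<open>A form \<phi> is the sum of the \<phi>(s) \<chi> s. Applying \<Psi> therefore
   gives \<phi> at the sum of the \<Psi>(\<chi> s) s, which dictates this preimage.\<close>
 define v where "v = (\<Oplus>\<^bsub>Val X c\<^esub>s\<in>S. \<Psi> (\<chi> s) \<odot>\<^bsub>Val X c\<^esub> s)"
 have v: "v \<in> El X c" unfolding v_def by (rule V.M.finsum_closed) (auto simp: k sv)
 show "\<exists>v\<in>El X c. evaluation X c v = \<Psi>"
 proof (rule bexI[OF _ v], rule dual_eqI[OF _ \<Psi>])
  show "evaluation X c v \<in> carrier (dual_space K (dual_space K (Val X c)))"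
   unfolding evaluation_def by (rule dual_restrict[OF el[OF v] D])
  fix \<phi> assume \<phi>: "\<phi> \<in> carrier (dual_space K (Val X c))"
  note p = dual_spaceD[OF \<phi>]
  have cs: "\<phi> s \<odot>\<^bsub>dual_space K (Val X c)\<^esub> \<chi> s \<in> carrier (dual_space K (Val X c))" if "s \<in> S" for s
   by (rule vs_closed(5)[OF D p(2)[OF sv[OF that]] S(3)[OF that]])
  have "\<phi> = (\<Oplus>\<^bsub>dual_space K (Val X c)\<^esub>s\<in>S. \<phi> s \<odot>\<^bsub>dual_space K (Val X c)\<^esub> \<chi> s)"
  proof (rule dual_eqI[OF \<phi>])
   show "(\<Oplus>\<^bsub>dual_space K (Val X c)\<^esub>s\<in>S. \<phi> s \<odot>\<^bsub>dual_space K (Val X c)\<^esub> \<chi> s) \<in> carrier (dual_space K (Val X c))"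
    by (rule D.M.finsum_closed) (use cs in blast)
   fix w assume w: "w \<in> El X c"
   have "\<phi> w = \<phi> (\<Oplus>\<^bsub>Val X c\<^esub>s\<in>S. \<chi> s w \<odot>\<^bsub>Val X c\<^esub> s)" by (subst S(4)[OF w]) (rule refl)
   also have "\<dots> = (\<Oplus>\<^bsub>base_space\<^esub>s\<in>S. \<phi> (\<chi> s w \<odot>\<^bsub>Val X c\<^esub> s))"
    by (rule lin_finsum[OF p(1) V B S(1)]) (simp add: dual_spaceD(2)[OF S(3)] w sv)
   also have "\<dots> = (\<Oplus>\<^bsub>base_space\<^esub>s\<in>S. (\<phi> s \<odot>\<^bsub>dual_space K (Val X c)\<^esub> \<chi> s) w)"
   proof (rule abelian_monoid.finsum_cong')
    show "abelian_monoid base_space" using B by (simp add: vectorspace_def module_def abelian_group_def)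
   qed (auto simp: dual_space_sel linD(3)[OF p(1)] dual_spaceD(2)[OF S(3)] w sv p(2) m_comm)
   also have "\<dots> = (\<Oplus>\<^bsub>dual_space K (Val X c)\<^esub>s\<in>S. \<phi> s \<odot>\<^bsub>dual_space K (Val X c)\<^esub> \<chi> s) w"
    by (rule lin_finsum[OF el[OF w] D B S(1) cs, symmetric])
   finally show "\<phi> w = (\<Oplus>\<^bsub>dual_space K (Val X c)\<^esub>s\<in>S. \<phi> s \<odot>\<^bsub>dual_space K (Val X c)\<^esub> \<chi> s) w" .
  qed
  then have "\<Psi> \<phi> = \<Psi> (\<Oplus>\<^bsub>dual_space K (Val X c)\<^esub>s\<in>S. \<phi> s \<odot>\<^bsub>dual_space K (Val X c)\<^esub> \<chi> s)" by simp
  also have "\<dots> = (\<Oplus>\<^bsub>base_space\<^esub>s\<in>S. \<Psi> (\<phi> s \<odot>\<^bsub>dual_space K (Val X c)\<^esub> \<chi> s))"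
   by (rule lin_finsum[OF dual_spaceD(1)[OF \<Psi>] D B S(1) cs])
  also have "\<dots> = (\<Oplus>\<^bsub>base_space\<^esub>s\<in>S. \<phi> (\<Psi> (\<chi> s) \<odot>\<^bsub>Val X c\<^esub> s))"
  proof (rule abelian_monoid.finsum_cong')
   show "abelian_monoid base_space" using B by (simp add: vectorspace_def module_def abelian_group_def)
  qed (auto simp: linD(3)[OF p(1)] linD(3)[OF dual_spaceD(1)[OF \<Psi>]] S(3) sv p(2) k m_comm)
  also have "\<dots> = \<phi> v" unfolding v_def by (rule lin_finsum[OF p(1) V B S(1), symmetric]) (simp add: k sv)
  finally show "evaluation X c v \<phi> = \<Psi> \<phi>" using \<phi> by (simp add: evaluation_def)
 qed
qed

text \<open>The generator makes each value a quotient of a finite-dimensional Hom space. This is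
  what identifies a finitely presented module with its double dual.\<close>

lemma fp_fin_dim:
 assumes C: "lcat C" and h: "hom_finite K C" and X: "fp C X" and c: "c \<in> Obj C"
 shows "vectorspace.fin_dim K (Val X c)"
proof -
 obtain c1 c0 g x where p: "pres C X c1 c0 g x" using X by (auto simp: fp_iff[OF C])
 note p = presD[OF p]
 have "linear_map K (Hom C c c0) (Val X c) (\<lambda>f. Act X c c0 f x)"
  using catD(1)[OF C c p(4)] cmdD(1)[OF fp_cmd[OF X] c] act_lin(2)[OF fp_cmd[OF X] c p(4,5)]
  by (simp add: linear_map_def mod_hom_def mod_hom_axioms_def vectorspace_def)
 moreover have "(\<lambda>f. Act X c c0 f x) ` Arr C c c0 = El X c"
  using p(6)[OF c] cmdD(4)[OF fp_cmd[OF X] c p(4) _ p(5)] by auto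
 ultimately show ?thesis using linear_map.surj_fin_dim h c p(4) unfolding hom_finite_def by blast
qed

text \<open>Inclusions and projections exchange their roles.\<close>

lemma is_direct_sum_op:
 assumes "is_direct_sum C n xs s"
 shows "is_direct_sum (op_cat C) n xs s"
proof -
 obtain \<iota> \<pi> where *: "\<forall>i<n. \<iota> i \<in> Arr C (xs i) s \<and> \<pi> i \<in> Arr C s (xs i)"
   "\<forall>i<n. \<forall>j<n. Cmp C (xs i) s (xs j) (\<pi> j) (\<iota> i) = (if i = j then Idt C (xs i) else \<zero>\<^bsub>Hom C (xs i) (xs j)\<^esub>)"
   "(\<Oplus>\<^bsub>Hom C s s\<^esub>i\<in>{..<n}. Cmp C s (xs i) s (\<iota> i) (\<pi> i)) = Idt C s"
  using assms unfolding is_direct_sum_def by blast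
 show ?thesis
  unfolding is_direct_sum_def op_cat_sel
 proof (intro conjI)
  show "\<exists>\<iota> \<pi>. (\<forall>i<n. \<iota> i \<in> Arr C s (xs i) \<and> \<pi> i \<in> Arr C (xs i) s) \<and>
    (\<forall>i<n. \<forall>j<n. Cmp C (xs j) s (xs i) (\<iota> i) (\<pi> j) = (if i = j then Idt C (xs i) else \<zero>\<^bsub>Hom C (xs j) (xs i)\<^esub>)) \<and>
    (\<Oplus>\<^bsub>Hom C s s\<^esub>i\<in>{..<n}. Cmp C s (xs i) s (\<pi> i) (\<iota> i)) = Idt C s"
   by (rule exI[of _ \<pi>], rule exI[of _ \<iota>]) (use * in auto)
 qed (use assms in \<open>auto simp: is_direct_sum_def\<close>)
qed

lemma additive_op: "additive_category K C ==> additive_category K (op_cat C)"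
 by (auto simp: additive_category_def op_lcat) (metis is_direct_sum_op)

subsection \<open>Categories whose finitely presented modules have finitely presented duals\<close>

text \<open>The values are placed in the arrow type \<open>'m\<close>, into which every finitely
  presented module can be copied. The property is thus tied to no universe, extends to all value
  types by \<open>dual_fp\<close>, and has the same form for the opposite category.\<close>

definition dualizing :: "('k, 'o, 'm) lincat => bool" where
 "dualizing C \<longleftrightarrow> additive_category K C \<and> hom_finite K C \<and>
  (\<forall>X :: ('k, 'o, 'm, 'm) cmod. fp C X --> fp (op_cat C) (dual_mod X))"

lemma dualizing_lcat: "dualizing C ==> lcat C"
 by (simp add: dualizing_def additive_category_def)

text \<open>By means of a generator, each value is the image of a set of arrows.\<close>

lemma fp_copy:
 fixes X :: "('k, 'o, 'm, 'w) cmod" and t :: "'v itself"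
 assumes C: "lcat C" and X: "fp C X" and i: "\<exists>i :: 'm => 'v. inj i"
 shows "fp C (copy_mod X :: ('k, 'o, 'm, 'v) cmod)" "niso C X (copy_mod X :: ('k, 'o, 'm, 'v) cmod) (\<lambda>c. code (Val X c))"
proof -
 have e: "\<exists>e :: 'w => 'v. inj_on e (El X c)" if c: "c \<in> Obj C" for c
 proof -
  obtain c1 c0 g x where p: "pres C X c1 c0 g x" using X by (auto simp: fp_iff[OF C])
  obtain i :: "'m => 'v" where i: "inj i" using i ..
  have "El X c \<subseteq> (\<lambda>f. Act X c c0 f x) ` Arr C c c0" using presD(6)[OF p c] by auto
  then have "inj_on (inv_into (Arr C c c0) (\<lambda>f. Act X c c0 f x)) (El X c)"
   by (rule inj_on_subset[OF inj_on_inv_into[OF order_refl]])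
  then have "inj_on (i \<circ> inv_into (Arr C c c0) (\<lambda>f. Act X c c0 f x)) (El X c)"
   by (rule comp_inj_on) (rule inj_on_subset[OF i subset_UNIV])
  then show ?thesis by blast
 qed
 note c = copy_mod[OF fp_cmd[OF X] e]
 show "niso C X (copy_mod X :: ('k, 'o, 'm, 'v) cmod) (\<lambda>c. code (Val X c))" by (rule c(2))
 show "fp C (copy_mod X :: ('k, 'o, 'm, 'v) cmod)" by (rule niso_fp[OF C c(2) X c(1)])
qed

lemma dual_fp:
 fixes X :: "('k, 'o, 'm, 'w) cmod"
 assumes d: "dualizing C" and X: "fp C X"
 shows "fp (op_cat C) (dual_mod X)"
proof -
 note C = dualizing_lcat[OF d]
 have i: "\<exists>i :: 'm => 'm. inj i" by (rule exI[of _ id]) simp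
 note c = fp_copy[OF C X i]
 have "fp (op_cat C) (dual_mod (copy_mod X :: ('k, 'o, 'm, 'm) cmod))"
  using d c(1) by (simp add: dualizing_def)
 then show ?thesis
  by (rule niso_fp[OF op_lcat[OF C] dual_niso[OF c(2) fp_cmd[OF X] fp_cmd[OF c(1)]] _ dual_cmd[OF fp_cmd[OF X]]])
qed

text \<open>Over A this is the object part of the duality. Over the opposite category, essential
  surjectivity writes a given Y as a dual DX up to isomorphism, so DY is isomorphic to DDX and hence
  to X, by finite dimensionality.\<close>

lemma dualizing_variety_dualizing:
 fixes A :: "('k, 'o, 'm) lincat"
 assumes d: "dualizing_variety TYPE('v) K A" and i: "\<exists>i :: 'm => 'v. inj i"
 shows "dualizing A" "dualizing (op_cat A)"
proof -
 have A: "additive_category K A" "hom_finite K A" and e: "category_equivalence K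
    (op_cat (mod_cat K A :: ('k, 'o, 'm, 'v) modcat)) (mod_cat K (op_cat A)) (dual_funct K A)"
  using d by (simp_all add: dualizing_variety_def)
 have C: "lcat A" using A(1) by (simp add: additive_category_def)
 note Cop = op_lcat[OF C]
 have dv: "fp (op_cat A) (dual_mod X)" if "fp A X" for X :: "('k, 'o, 'm, 'v) cmod"
  using that lfD(1)[of "op_cat (mod_cat K A :: ('k, 'o, 'm, 'v) modcat)" "mod_cat K (op_cat A)" "dual_funct K A" X] e
  by (simp add: category_equivalence_def dual_sel)
 show "dualizing A"
  unfolding dualizing_def
 proof (intro conjI allI impI A)
  fix X :: "('k, 'o, 'm, 'm) cmod" assume X: "fp A X"
  note c = fp_copy[OF C X i]
  show "fp (op_cat A) (dual_mod X)"
   by (rule niso_fp[OF Cop dual_niso[OF c(2) fp_cmd[OF X] fp_cmd[OF c(1)]] dv[OF c(1)] dual_cmd[OF fp_cmd[OF X]]])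
 qed
 show "dualizing (op_cat A)"
  unfolding dualizing_def
 proof (intro conjI allI impI additive_op A)
  show "hom_finite K (op_cat A)" using A(2) by (simp add: hom_finite_def)
  fix Y :: "('k, 'o, 'm, 'm) cmod" assume Y: "fp (op_cat A) Y"
  \<comment> \<open>The duality ends in modules with values in \<open>'v => 'k\<close>, so Y has to
    be copied there first; an arrow is coded by the indicator of its image in
    \<open>'v\<close>.\<close>
  have "\<exists>i :: 'm => 'v => 'k. inj i"
  proof -
   obtain i :: "'m => 'v" where i: "inj i" using i ..
   have "inj (\<lambda>m v. if v = i m then \<one> else \<zero>)"
    using inj_eq[OF i] one_not_zero by (auto intro!: injI simp: fun_eq_iff split: if_splits)
   then show ?thesis by blast
  qed
  note c = fp_copy[OF Cop Y this]
  let ?Y = "copy_mod Y :: ('k, 'o, 'm, 'v => 'k) cmod"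
  obtain G where G: "linear_functor K (mod_cat K (op_cat A)) (op_cat (mod_cat K A :: ('k, 'o, 'm, 'v) modcat)) G"
    and ni: "naturally_isomorphic (mod_cat K (op_cat A)) (mod_cat K (op_cat A)) (comp_funct (dual_funct K A) G) id_funct"
   using e unfolding category_equivalence_def by blast
  obtain \<theta> where \<theta>: "\<And>y. y \<in> Obj (mod_cat K (op_cat A)) ==>
    is_iso (mod_cat K (op_cat A)) (dual_mod (Fob G y)) y (\<theta> y)"
   using ni unfolding naturally_isomorphic_def comp_funct_def id_funct_def funct.select_convs dual_sel by blast
  let ?X = "Fob G ?Y"
  have X: "fp A ?X" using lfD(1)[OF G] c(1) by simp
  have iso: "is_iso (mod_cat K (op_cat A)) (dual_mod ?X) ?Y (\<theta> ?Y)"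
   using \<theta> c(1) by simp
  note n = iso[unfolded iso_mod_iff[OF dv[OF X] c(1)], THEN conjunct2]
  note n = niso_comp[OF n niso_inv[OF c(2) fp_cmd[OF Y] fp_cmd[OF c(1)]]]
  note n = dual_niso[OF n fp_cmd[OF dv[OF X]] fp_cmd[OF Y], unfolded op_op_cat]
  note DX = dual_cmd[OF fp_cmd[OF dv[OF X]], unfolded op_op_cat] and DY = dual_cmd[OF fp_cmd[OF Y], unfolded op_op_cat]
  note ev = evaluation_niso[OF fp_cmd[OF X] fp_fin_dim[OF C A(2) X]]
  have "niso A ?X (dual_mod Y) (\<lambda>c v. inv_into (El (dual_mod Y) c) (dual_map (dual_mod ?X)
    (\<lambda>c v. inv_into (El Y c) (code (Val Y c)) (\<theta> ?Y c v)) c) (evaluation ?X c v))"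
   by (rule niso_comp[OF ev niso_inv[OF n DY DX]])
  then show "fp (op_cat (op_cat A)) (dual_mod Y)"
   unfolding op_op_cat by (rule niso_fp[OF C _ X DY])
 qed
qed

text \<open>The kernel of \<open>f\<close> is the dual of the cokernel of the dual of \<open>f\<close>.\<close>

lemma dualizing_ker_fp:
 fixes X :: "('k, 'o, 'm, 'v) cmod" and Y :: "('k, 'o, 'm, 'w) cmod"
 assumes d: "dualizing C" "dualizing (op_cat C)" and X: "fp C X" and Y: "fp C Y" and f: "nt C X Y f"
 shows "fp C (ker_mod X Y f)"
proof -
 note C = dualizing_lcat[OF d(1)] and Cop = dualizing_lcat[OF d(2)]
 have hf: "hom_finite K C" and add: "additive_category K (op_cat C)" using d by (auto simp: dualizing_def)
 note Xc = fp_cmd[OF X] and Yc = fp_cmd[OF Y]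
 note DX = dual_fp[OF d(1) X] and DY = dual_fp[OF d(1) Y]
 note Df = dual_nt[OF f Xc Yc]
 define Z where "Z = quot_mod (dual_mod X) (\<lambda>c. dual_map X f c ` El (dual_mod Y) c)"
 define p where "p = (\<lambda>c v. (dual_map X f c ` El (dual_mod Y) c) +>\<^bsub>Val (dual_mod X) c\<^esub> v)"
 note Zf = coker_fp(1)[OF add DY DX Df, folded Z_def] and Zp = coker_fp(2)[OF add DY DX Df, folded Z_def p_def]
 note pn = quot_mod_proj[OF Cop fp_cmd[OF DX] submod_image[OF Df fp_cmd[OF DY] fp_cmd[OF DX]], folded Z_def p_def]
 note DZ = dual_fp[OF d(2) Zf, unfolded op_op_cat]
 note Zc = fp_cmd[OF Zf] and DZc = fp_cmd[OF DZ]
 note Dp = dual_nt[OF pn fp_cmd[OF DX] Zc, unfolded op_op_cat]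
 note ev = evaluation_niso[OF Xc fp_fin_dim[OF C hf X]] and evY = evaluation_niso[OF Yc fp_fin_dim[OF C hf Y]]
 have evn: "nt C X (dual_mod (dual_mod X)) (evaluation X)"
  and evb: "\<And>c. c \<in> Obj C ==> bij_betw (evaluation X c) (El X c) (El (dual_mod (dual_mod X)) c)"
  using ev by (auto simp: niso_def)
 note DDX = dual_cmd[OF fp_cmd[OF DX], unfolded op_op_cat]
 \<comment> \<open>The dual of the projection onto the cokernel, read as a map to X by inverting
   evaluation.\<close>
 have "\<exists>u. nt C (dual_mod Z) X u \<and> (\<forall>c\<in>Obj C. \<forall>\<zeta>\<in>El (dual_mod Z) c. evaluation X c (u c \<zeta>) = dual_map (dual_mod X) p c \<zeta>)"
 proof (rule nt_factor_inj[OF Xc DDX DZc evn _ Dp])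
  show "inj_on (evaluation X c) (El X c)" if "c \<in> Obj C" for c using evb[OF that] by (simp add: bij_betw_def)
  fix c \<zeta> assume h: "c \<in> Obj C" "\<zeta> \<in> El (dual_mod Z) c"
  show "\<exists>x\<in>El X c. dual_map (dual_mod X) p c \<zeta> = evaluation X c x"
   using evb[OF h(1)] ntD(3)[OF Dp h] unfolding bij_betw_def by (metis imageE)
 qed
 then obtain u where u: "nt C (dual_mod Z) X u"
  "\<And>c \<zeta>. c\<in>Obj C ==> \<zeta>\<in>El (dual_mod Z) c ==> evaluation X c (u c \<zeta>) = dual_map (dual_mod X) p c \<zeta>" by blast
 have ue: "\<phi> (u c \<zeta>) = \<zeta> (p c \<phi>)" if "c \<in> Obj C" "\<zeta> \<in> El (dual_mod Z) c" "\<phi> \<in> El (dual_mod X) c" for c \<zeta> \<phi>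
  using fun_cong[OF u(2)[OF that(1,2)], of \<phi>] that(3) by (simp add: evaluation_def dual_map_def dual_sel)
 \<comment> \<open>Linear forms separate the points of the values of W.\<close>
 have inj0: "v = zr W c" if W: "cmd C W" and n: "niso C W (dual_mod (dual_mod W)) (evaluation W)" and c: "c \<in> Obj C"
  and v: "v \<in> El W c" and z: "\<And>\<phi>. \<phi> \<in> El (dual_mod W) c ==> \<phi> v = \<zero>" for W :: "('k, 'o, 'm, 'x) cmod" and c v
 proof -
  note V = cmdD(1)[OF W c]
  have i: "inj_on (evaluation W c) (El W c)" using n c by (simp add: niso_def bij_betw_def)
  have "\<phi> v = \<phi> (zr W c)" if "\<phi> \<in> carrier (dual_space K (Val W c))" for \<phi>
   using z[of \<phi>] that lin_zero[OF dual_spaceD(1)[OF that] V base_space_vsp] by (simp add: dual_sel)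
  then have "evaluation W c v = evaluation W c (zr W c)"
   by (simp add: evaluation_def restrict_def fun_eq_iff)
  then show ?thesis using inj_onD[OF i _ v vs_closed(1)[OF V]] by blast
 qed
 have zc: "lin (Val Z c) base_space \<zeta>" if "\<zeta> \<in> El (dual_mod Z) c" for c \<zeta>
  using that by (simp add: dual_sel dual_spaceD(1))
 note kp = ker_mod_pt[OF Xc Yc f]
 have ks: "El (ker_mod X Y f) c = {v \<in> El X c. f c v = zr Y c}" "zero (Val (ker_mod X Y f) c) = zr X c" for c
  by (simp_all add: ker_mod_def sub_mod_def)
 have uk: "f c (u c \<zeta>) = zr Y c" if c: "c \<in> Obj C" and z: "\<zeta> \<in> El (dual_mod Z) c" for c \<zeta>
 proof (rule inj0[OF Yc evY c ntD(3)[OF f c ntD(3)[OF u(1) c z]]])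
  fix \<theta> assume t: "\<theta> \<in> El (dual_mod Y) c"
  have D: "dual_map X f c \<theta> \<in> El (dual_mod X) c" by (rule ntD(3)[OF Df]) (use c t in auto)
  have "p c (dual_map X f c \<theta>) = zr Z c" using coker_ptD(2)[OF Zp, of c "dual_map X f c \<theta>"] c t D by auto
  then have "dual_map X f c \<theta> (u c \<zeta>) = \<zero>"
   using ue[OF c z D] lin_zero[OF zc[OF z] _ base_space_vsp] cmdD(1)[OF Zc, of c] c by simp
  then show "\<theta> (f c (u c \<zeta>)) = \<zero>" using ntD(3)[OF u(1) c z] by (simp add: dual_map_def)
 qed
 have "\<exists>w. nt C (dual_mod Z) (ker_mod X Y f) w \<and> (\<forall>c\<in>Obj C. \<forall>\<zeta>\<in>El (dual_mod Z) c. w c \<zeta> = u c \<zeta>)"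
  by (rule nt_factor_inj[OF kp(1) Xc DZc kp(2) _ u(1)]) (auto simp: ks uk ntD(3)[OF u(1)])
 then obtain w where w: "nt C (dual_mod Z) (ker_mod X Y f) w" "\<And>c \<zeta>. c\<in>Obj C ==> \<zeta>\<in>El (dual_mod Z) c ==> w c \<zeta> = u c \<zeta>" by blast
 have "niso C (dual_mod Z) (ker_mod X Y f) w"
 proof (rule nisoI[OF w(1) DZc kp(1)])
  fix c \<zeta> assume c: "c \<in> Obj C" and z: "\<zeta> \<in> El (dual_mod Z) c" and "w c \<zeta> = zr (ker_mod X Y f) c"
  then have u0: "u c \<zeta> = zr X c" using w(2) by (simp add: ks)
  show "\<zeta> = zr (dual_mod Z) c"
  proof (rule dual_eqI[of _ "Val Z c"])
   show "\<zeta> \<in> carrier (dual_space K (Val Z c))" "zr (dual_mod Z) c \<in> carrier (dual_space K (Val Z c))"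
    using z vs_closed(1)[OF cmdD(1)[OF DZc c]] by (simp_all add: dual_sel)
   fix t assume t: "t \<in> El Z c"
   obtain \<phi> where \<phi>: "\<phi> \<in> El (dual_mod X) c" "t = p c \<phi>" using coker_ptD(1)[OF Zp, of c t] c t by auto
   have "lin (Val X c) base_space \<phi>" using \<phi>(1) by (simp add: dual_sel dual_spaceD(1))
   then show "\<zeta> t = \<zero>\<^bsub>Val (dual_mod Z) c\<^esub> t"
    using ue[OF c z \<phi>(1)] u0 lin_zero[OF _ cmdD(1)[OF Xc c] base_space_vsp, of \<phi>] t \<phi>(2) by (simp add: dual_sel dual_space_sel)
  qed
 next
  fix c x assume c: "c \<in> Obj C" and "x \<in> El (ker_mod X Y f) c"
  then have x: "x \<in> El X c" "f c x = zr Y c" by (auto simp: ks)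
  note D = cmdD(1)[OF fp_cmd[OF DX], of c] 
  have el: "lin (Val (dual_mod X) c) base_space (\<lambda>\<phi>. \<phi> x)"
   by (rule linI) (auto simp: dual_sel dual_spaceD(2) x(1) dual_space_sel)
  \<comment> \<open>For x in the kernel of f, the form \<phi> \<mapsto> \<phi>(x) vanishes on all
    forms pulled back along f, so it descends to the cokernel Z. The resulting element of DZ is the
    preimage of x.\<close>
  have "\<exists>g. lin (Val Z c) base_space g \<and> (\<forall>\<phi>\<in>El (dual_mod X) c. g (p c \<phi>) = \<phi> x)"
   unfolding Z_def quot_mod_sel p_def
  proof (rule quot_lift[OF _ _ base_space_vsp el])
   show "vsp (Val (dual_mod X) c)" using D c by simp
   show "subsp (Val (dual_mod X) c) (dual_map X f c ` El (dual_mod Y) c)"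
    by (rule subsp_image[OF ntD(1)[OF Df] cmdD(1)[OF fp_cmd[OF DY]]]) (use c D in auto)
   fix n assume "n \<in> dual_map X f c ` El (dual_mod Y) c"
   then obtain \<theta> where t: "\<theta> \<in> El (dual_mod Y) c" "n = dual_map X f c \<theta>" by blast
   have "lin (Val Y c) base_space \<theta>" using t(1) by (simp add: dual_sel dual_spaceD(1))
   then show "n x = \<zero>\<^bsub>base_space\<^esub>"
    using t(2) x lin_zero[OF _ cmdD(1)[OF Yc c] base_space_vsp, of \<theta>] by (simp add: dual_map_def)
  qed
  then obtain g where g: "lin (Val Z c) base_space g" "\<And>\<phi>. \<phi>\<in>El (dual_mod X) c ==> g (p c \<phi>) = \<phi> x" by blast
  let ?\<zeta> = "\<lambda>t\<in>El Z c. g t"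
  have z: "?\<zeta> \<in> El (dual_mod Z) c"
   unfolding dual_sel using dual_restrict[OF g(1)] cmdD(1)[OF Zc, of c] c by simp
  have "evaluation X c (u c ?\<zeta>) = evaluation X c x"
   using ue[OF c z] g(2) ntD(3)[OF pn, of c] c by (auto simp: evaluation_def dual_sel fun_eq_iff restrict_def)
  then have "u c ?\<zeta> = x" using evb[OF c] x(1) ntD(3)[OF u(1) c z] by (auto simp: bij_betw_def dest: inj_onD)
  then show "\<exists>\<zeta>\<in>El (dual_mod Z) c. w c \<zeta> = x" using z w(2)[OF c z] by (intro bexI[of _ ?\<zeta>]) auto
 qed
 then show ?thesis by (rule niso_fp[OF C _ DZ kp(1)])
qed

section \<open>Restriction to a subcategory\<close>


lemma incl_sel [simp]: "Fob incl x = x" "Far incl x y f = f"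
 by (simp_all add: incl_def)

lemma precomp_incl [simp]: "precomp incl X = X"
 by (cases X) (simp add: precomp_def)

lemma incl_lf: "lcat C ==> B \<subseteq> Obj C ==> linear_functor K (full_sub C B) C incl"
 by (rule lfI) (auto simp: incl_def catD intro: lin_id)

lemma rep_full_sub [simp]: "rep (full_sub C B) = rep C"
 by (simp add: rep_def fun_eq_iff)

lemma sub_cmd: "lcat C ==> B \<subseteq> Obj C ==> cmd C X ==> cmd (full_sub C B) X"
 using precomp_cmd[OF incl_lf, of C B X] by simp

lemma sub_nt: "lcat C ==> B \<subseteq> Obj C ==> nt C X Y \<eta> ==> nt (full_sub C B) X Y \<eta>"
 using precomp_nt[OF incl_lf, of C B X Y \<eta>] by simp

lemma ker_mod_sel: "El (ker_mod X Y f) c = {v \<in> El X c. f c v = zr Y c}"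
 "zr (ker_mod X Y f) c = zr X c" "Act (ker_mod X Y f) = Act X"
 by (simp_all add: ker_mod_def sub_mod_def)

lemma ker_mod_nt:
 assumes g: "nt C W X g" and "\<And>c w. c \<in> Obj C ==> w \<in> El W c ==> f c (g c w) = zr Y c"
 shows "nt C W (ker_mod X Y f) g"
 by (rule ntI[OF linI]) (auto simp: ker_mod_def sub_mod_def assms ntD[OF g])

text \<open>One half of functorial finiteness: every x has an arrow h : b \<rightarrow> x from an
  object of B through which all arrows from B to x factor, a right B-approximation. The other half
  is the same condition over the opposite category.\<close>

definition contra_finite :: "('k, 'o, 'm) lincat => 'o set => bool" where
 "contra_finite C B \<longleftrightarrow> B \<subseteq> Obj C \<and> (\<forall>x\<in>Obj C. \<exists>b h. gen (full_sub C B) (rep C x) b h)"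

lemma contra_finiteD:
 assumes "contra_finite C B"
 shows "B \<subseteq> Obj C" "x \<in> Obj C ==> \<exists>b h. gen (full_sub C B) (rep C x) b h"
 using assms by (auto simp: contra_finite_def)

text \<open>Approximating \<open>c0\<close> by B yields a generator over B. Its relations over all
  of A form the kernel of a map between finitely presented modules, hence are generated by one
  element; approximating the object of that element by B yields the relations over B.\<close>

lemma restrict_fp:
 assumes d: "dualizing C" "dualizing (op_cat C)" and cf: "contra_finite C B" and X: "fp C X"
 shows "fp (full_sub C B) X"
proof -
 note C = dualizing_lcat[OF d(1)] and BC = contra_finiteD(1)[OF cf] and Xc = fp_cmd[OF X]
 note SC = full_sub_lcat[OF C BC]
 obtain c1 c0 g x0 where "pres C X c1 c0 g x0" using X by (auto simp: fp_iff[OF C])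
 note p = presD[OF this]
 obtain b0 h0 where "gen (full_sub C B) (rep C c0) b0 h0" using contra_finiteD(2)[OF cf p(4)] by blast
 note g0 = genD[OF this, simplified]
 have b0: "b0 \<in> Obj C" using g0(1) BC by blast
 define x1 where "x1 = Act X b0 c0 h0 x0"
 have x1: "x1 \<in> El X b0" unfolding x1_def by (rule cmdD(4)[OF Xc b0 p(4) g0(2) p(5)])
 note y = yoneda_nt[OF C Xc b0 x1]
 \<comment> \<open>The relations are collected over all of C, where the duality makes the kernel
   finitely presented, and only afterwards restricted to B.\<close>
 let ?N = "ker_mod (rep C b0) X (\<lambda>a f. Act X a b0 f x1)"
 obtain e1 e g' z where "pres C ?N e1 e g' z"
  using dualizing_ker_fp[OF d rep_fp[OF C b0] X y] by (auto simp: fp_iff[OF C])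
 note q = presD(4-6)[OF this, unfolded ker_mod_sel rep_sel]
 \<comment> \<open>A second approximation, now of the object \<open>e\<close> that carries the
   generator of the relations.\<close>
 obtain b' h' where "gen (full_sub C B) (rep C e) b' h'" using contra_finiteD(2)[OF cf q(1)] by blast
 note g1 = genD[OF this, simplified]
 have b': "b' \<in> Obj C" using g1(1) BC by blast
 have z: "z \<in> Arr C e b0" "Act X e b0 z x1 = zr X e" using q(2) by auto
 have "pres (full_sub C B) X b' b0 (Cmp C b' e b0 z h') x1"
  unfolding pres_def gen_def full_sub_sel
 proof (intro conjI ballI g1(1) g0(1) x1 catD(3)[OF C b' q(1) b0 g1(2) z(1)])
  fix a assume aB: "a \<in> B"
  then have a: "a \<in> Obj C" using BC by blast
  { fix v assume "v \<in> El X a"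
   then obtain f where f: "f \<in> Arr C a c0" "v = Act X a c0 f x0" using p(6)[OF a] by blast
   obtain l where l: "l \<in> Arr C a b0" "f = Cmp C a b0 c0 h0 l" using g0(3)[OF aB f(1)] by blast
   then show "\<exists>l\<in>Arr C a b0. v = Act X a b0 l x1"
    using f(2) cmdD(3)[OF Xc a b0 p(4) l(1) g0(2) p(5)] by (auto simp: x1_def) }
  fix f assume f: "f \<in> Arr C a b0"
  show "Act X a b0 f x1 = zr X a \<longleftrightarrow> (\<exists>h\<in>Arr C a b'. f = Cmp C a b' b0 (Cmp C b' e b0 z h') h)"
  proof
   assume "Act X a b0 f x1 = zr X a"
   then obtain k where k: "k \<in> Arr C a e" "f = Cmp C a e b0 z k" using q(3)[OF a, of f] f by auto
   obtain m where m: "m \<in> Arr C a b'" "k = Cmp C a b' e h' m" using g1(3)[OF aB k(1)] by blast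
   then show "\<exists>h\<in>Arr C a b'. f = Cmp C a b' b0 (Cmp C b' e b0 z h') h"
    by (intro bexI[OF _ m(1)]) (simp add: k(2) m(2) cmp_assoc'[OF C a b' q(1) b0 m(1) g1(2) z(1)])
  next
   assume "\<exists>h\<in>Arr C a b'. f = Cmp C a b' b0 (Cmp C b' e b0 z h') h"
   then obtain m where m: "m \<in> Arr C a b'" "f = Cmp C a b' b0 (Cmp C b' e b0 z h') m" by blast
   note hm = catD(3)[OF C a b' q(1) m(1) g1(2)]
   have "Act X a b0 f x1 = Act X a e (Cmp C a b' e h' m) (Act X e b0 z x1)"
    using m(2) cmp_assoc'[OF C a b' q(1) b0 m(1) g1(2) z(1)] cmdD(3)[OF Xc a q(1) b0 hm z(1) x1] by simp
   then show "Act X a b0 f x1 = zr X a"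
    using z(2) lin_zero[OF act_lin(1)[OF Xc a q(1) hm] cmdD(1)[OF Xc q(1)] cmdD(1)[OF Xc a]] by simp
  qed
 qed
 then show ?thesis using sub_cmd[OF C BC Xc] by (auto simp: fp_iff[OF SC])
qed

text \<open>For b in B every arrow h : b \<rightarrow> c to an object of B already lies in B by
  fullness, so it acts on M, and y \<otimes> h \<mapsto> M(h) y inverts the unit.\<close>

lemma left_unit_niso:
 fixes M :: "('k, 'o, 'm, 'v) cmod"
 assumes C: "lcat C" and B: "B \<subseteq> Obj C" and M: "cmd (full_sub C B) M"
 shows "niso (full_sub C B) M (left_ext_mod K (full_sub C B) C incl M) (left_unit (full_sub C B) C incl M)"
proof -
 let ?S = "full_sub C B" let ?L = "left_ext_mod K ?S C incl M" let ?u = "left_unit ?S C incl M"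
 note SC = full_sub_lcat[OF C B] note F = incl_lf[OF C B] note T = SC C F note TM = SC C F M
 note un = lunit_nt[OF TM, unfolded precomp_incl] and Lc = lext_cmd[OF TM]
 have r: "\<exists>r. lin (Val ?L b) (Val M b) r \<and> (\<forall>c\<in>B. \<forall>y\<in>El M c. \<forall>h\<in>Arr C b c.
   r (tens ?S M (corep_along C incl b) c y h) = Act M b c h y)" if b: "b \<in> B" for b
 proof -
  have bS: "b \<in> Obj ?S" and bC: "b \<in> Obj C" using b B by auto
  have "balanced ?S M (corep_along C incl b) (Val M b) (\<lambda>c y h. Act M b c h y)"
   unfolding balanced_def
  proof (intro conjI ballI)
   fix c h assume "c \<in> Obj ?S" "h \<in> El (corep_along C incl b) c"
   then show "lin (Val M c) (Val M b) (\<lambda>y. Act M b c h y)" using act_lin(1)[OF M bS, of c h] by (simp add: corep_sel[OF T])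
  next
   fix c y assume "c \<in> Obj ?S" "y \<in> El M c"
   then show "lin (Val (corep_along C incl b) c) (Val M b) (\<lambda>h. Act M b c h y)"
    using act_lin(2)[OF M bS, of c y] by (simp add: corep_sel[OF T])
  next
   fix c d f y z assume "c \<in> Obj ?S" "d \<in> Obj ?S" "f \<in> Arr ?S c d" "y \<in> El M d" "z \<in> El (corep_along C incl b) c"
   then show "Act M b c z (Act M c d f y) = Act M b d (Act (corep_along C incl b) d c f z) y"
    using cmdD(3)[OF M bS, of c d z f y] by (simp add: corep_sel[OF T])
  qed
  from tensor_ext[OF M corep_cmd[OF T bC] cmdD(1)[OF M bS] this] show ?thesis
   by (simp add: lext_sel[OF T] corep_sel[OF T])
 qed
 show ?thesis
 proof (rule nisoI[OF un M sub_cmd[OF C B Lc]])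
  fix b v assume "b \<in> Obj ?S" and v: "v \<in> El M b" "?u b v = zr ?L b"
  then have b: "b \<in> B" and bS: "b \<in> Obj ?S" and bC: "b \<in> Obj C" using B by auto
  obtain r where rl: "lin (Val ?L b) (Val M b) r" and rt: "\<forall>c\<in>B. \<forall>y\<in>El M c. \<forall>h\<in>Arr C b c.
   r (tens ?S M (corep_along C incl b) c y h) = Act M b c h y" using r[OF b] by blast
  have "r (?u b v) = v" using rt b v(1) catD(2)[OF C bC] cmdD(2)[OF M bS v(1)] by (simp add: left_unit_def)
  then show "v = zr M b" using v(2) lin_zero[OF rl cmdD(1)[OF Lc bC] cmdD(1)[OF M bS]] by simp
 next
  fix b t assume "b \<in> Obj ?S" and t: "t \<in> El ?L b"
  then have b: "b \<in> B" and bS: "b \<in> Obj ?S" and bC: "b \<in> Obj C" using B by auto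
  obtain r where rl: "lin (Val ?L b) (Val M b) r" and rt: "\<forall>c\<in>B. \<forall>y\<in>El M c. \<forall>h\<in>Arr C b c.
   r (tens ?S M (corep_along C incl b) c y h) = Act M b c h y" using r[OF b] by blast
  have "?u b (r t) = t"
  proof (rule lext_eq[OF TM bC cmdD(1)[OF Lc bC] lin_comp[OF rl ntD(1)[OF un bS]] lin_id _ t])
   fix c y h assume h: "c \<in> Obj ?S" "y \<in> El M c" "h \<in> Arr C b (Fob incl c)"
   then have c: "c \<in> B" "h \<in> Arr C b c" "c \<in> Obj C" using B by auto
   show "?u b (r (tens ?S M (corep_along C incl b) c y h)) = tens ?S M (corep_along C incl b) c y h"
    using rt c h(2) tn_bal[OF TM bC bS h(1), of h y "Idt C b"] catD(2)[OF C bC] catD(5)[OF C bC c(3,2)]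
    by (simp add: left_unit_def)
  qed
  then show "\<exists>v\<in>El M b. ?u b v = t" using linD(1)[OF rl t] by blast
 qed
qed

text \<open>For b in B the restriction of A(-,b) is representable over B, so evaluation at the
  identity is the Yoneda isomorphism.\<close>

lemma right_counit_niso:
 fixes M :: "('k, 'o, 'm, 'v) cmod"
 assumes C: "lcat C" and B: "B \<subseteq> Obj C" and M: "cmd (full_sub C B) M"
 shows "niso (full_sub C B) (right_ext_mod K (full_sub C B) C incl M) M (right_counit C incl)"
proof -
 let ?S = "full_sub C B" let ?R = "right_ext_mod K ?S C incl M"
 note SC = full_sub_lcat[OF C B] note F = incl_lf[OF C B] note T = SC C F note TM = SC C F M
 note Rs = rext_sel[OF T, unfolded precomp_incl]
 show ?thesis
 proof (rule nisoI[OF rcounit_nt[OF TM, unfolded precomp_incl] sub_cmd[OF C B rext_cmd[OF TM]] M])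
  fix b \<phi> assume bS: "b \<in> Obj ?S" and "\<phi> \<in> El ?R b" and z: "right_counit C incl b \<phi> = zr M b"
  then have \<phi>: "\<phi> \<in> Nats ?S (rep C b) M" by (simp add: Rs)
  have bC: "b \<in> Obj C" using bS B by auto
  have "\<phi> c h = zr M c" if c: "c \<in> Obj ?S" and h: "h \<in> Arr C c b" for c h
  proof -
   have cC: "c \<in> Obj C" using c B by auto
   have "\<phi> c h = Act M c b h (\<phi> b (Idt C b))"
    using ntD(2)[OF nat_homD(1)[OF \<phi>] c bS, of h "Idt C b"] h catD(2)[OF C bC] catD(4)[OF C cC bC h] by simp
   then show ?thesis
    using z lin_zero[OF act_lin(1)[OF M c bS] cmdD(1)[OF M bS] cmdD(1)[OF M c], of h] h by (simp add: right_counit_def)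
  qed
  then have "ex ?S (rep C b) \<phi> = zr ?R b" by (simp add: Rs nat_hom_sel ex_eq_iff)
  then show "\<phi> = zr ?R b" using nat_homD(2)[OF \<phi>] by simp
 next
  fix b m assume bS: "b \<in> Obj ?S" and m: "m \<in> El M b"
  have bC: "b \<in> Obj C" using bS B by auto
  note y = nat_homI[OF yoneda_nt[OF SC M bS m] rep_cmd[OF SC bS], unfolded rep_full_sub]
  show "\<exists>\<phi>\<in>El ?R b. right_counit C incl b \<phi> = m"
   by (rule bexI[of _ "ex ?S (rep C b) (\<lambda>a f. Act M a b f m)"])
    (use y bS catD(2)[OF C bC] cmdD(2)[OF M bS m] in \<open>simp_all add: Rs right_counit_def\<close>)
 qed
qed

text \<open>The right adjoint of restriction is computed by duality from the left adjoint over the opposite category: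
 linear forms on \<open>DM \<otimes> A(-,a)\<close> are natural transformations from \<open>A(-,a)\<close> to \<open>DDM \<cong> M\<close>.\<close>

lemma right_ext_mod_fp:
 fixes M :: "('k, 'o, 'm, 'v) cmod"
 assumes d: "dualizing C" "dualizing (op_cat C)" and cfo: "contra_finite (op_cat C) B"
  and M: "fp (full_sub C B) M"
 shows "fp C (right_ext_mod K (full_sub C B) C incl M)"
proof -
 let ?S = "full_sub C B" and ?O = "op_cat (full_sub C B)" and ?P = "op_cat C"
 note C = dualizing_lcat[OF d(1)] and P = dualizing_lcat[OF d(2)]
 have B: "B \<subseteq> Obj C" using contra_finiteD(1)[OF cfo] by simp
 note SC = full_sub_lcat[OF C B] note F = incl_lf[OF C B] and Mc = fp_cmd[OF M]
 have O: "lcat ?O" using op_lcat[OF SC] .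
 have Fo: "linear_functor K ?O ?P incl" using incl_lf[OF P, of B] B by (simp add: op_full_sub)
 note T = SC C F Mc
 have hf: "hom_finite K C" using d(1) by (simp add: dualizing_def)
 then have hfS: "hom_finite K ?S" using B by (auto simp: hom_finite_def)
 let ?L = "left_ext_mod K ?S C incl M"
 note Lfp = left_ext_mod_fp[OF T M]
 \<comment> \<open>The dual of M is finitely presented over the opposite of B, although the duality
   is given over C: M is the restriction of its left extension, whose dual is finitely presented
   over the opposite of C and restricts by \<open>cfo\<close>.\<close>
 have "fp ?O (dual_mod ?L)"
  using restrict_fp[OF d(2) _ cfo dual_fp[OF d(1) Lfp]] d(1) by (simp add: op_full_sub)
 note DM = niso_fp[OF O dual_niso[OF left_unit_niso[OF C B Mc] Mc sub_cmd[OF C B lext_cmd[OF T]]] this dual_cmd[OF Mc]]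
 note DMc = fp_cmd[OF DM] note To = O P Fo DMc
 define N where "N = left_ext_mod K ?O ?P incl (dual_mod M)"
 define u where "u = left_unit ?O ?P incl (dual_mod M)"
 note Nfp = left_ext_mod_fp[OF To DM, folded N_def] and Nc = lext_cmd[OF To, folded N_def]
 note un = lunit_nt[OF To, unfolded precomp_incl, folded N_def u_def]
 note DN = dual_fp[OF d(2) Nfp, unfolded op_op_cat]
 note DNc = fp_cmd[OF DN]
 have NcO: "cmd ?O N" using sub_cmd[OF P _ Nc, of B] B by (simp add: op_full_sub)
 note Du = dual_nt[OF un DMc NcO, unfolded op_op_cat]
 note DDM = dual_cmd[OF DMc, unfolded op_op_cat]
 note ev = evaluation_niso[OF Mc fp_fin_dim[OF SC hfS M]]
 have evb: "bij_betw (evaluation M b) (El M b) (El (dual_mod (dual_mod M)) b)" if "b \<in> Obj ?S" for b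
  using ev that by (simp add: niso_def)
 \<comment> \<open>The dual of the unit from DM to N, followed by the inverse of evaluation, is a
   map on B from DN to M; its adjoint \<theta> will be the isomorphism.\<close>
 define e where "e = (\<lambda>c \<zeta>. inv_into (El M c) (evaluation M c) (dual_map (dual_mod M) u c \<zeta>))"
 have en: "nt ?S (dual_mod N) M e"
  unfolding e_def by (rule nt_comp[OF Du]) (use niso_inv[OF ev Mc DDM] in \<open>simp add: niso_def\<close>)
 let ?R = "right_ext_mod K ?S C incl M"
 note Rs = rext_sel[OF T(1-3), unfolded precomp_incl]
 define \<theta> where "\<theta> = (\<lambda>d x. ex ?S (rep C d) (\<lambda>c g. e c (Act (dual_mod N) c d g x)))"
 have \<theta>n: "nt C (dual_mod N) ?R \<theta>"
  using right_universal(1)[OF T DNc, of e] en unfolding \<theta>_def by simp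
 have sepM: "v = w" if "b \<in> Obj ?S" "v \<in> El M b" "w \<in> El M b"
  "\<And>m. m \<in> carrier (dual_space K (Val M b)) ==> m v = m w" for b v w
 proof -
  have "evaluation M b v = evaluation M b w" by (simp add: evaluation_def restrict_def fun_eq_iff that(4))
  then show ?thesis using evb[OF that(1)] that(2,3) by (auto simp: bij_betw_def dest: inj_onD)
 qed
 let ?t = "\<lambda>a b m h. tens ?O (dual_mod M) (corep_along ?P incl a) b m h"
 \<comment> \<open>In terms of pure tensors, a linear form m on M b applied to \<theta>(\<zeta>)(h)
   gives \<zeta>(m \<otimes> h). Both halves of bijectivity are read off from this formula.\<close>
 have key: "m (e b (Act (dual_mod N) b a h \<zeta>)) = \<zeta> (?t a b m h)"
  if a: "a \<in> Obj C" and z: "\<zeta> \<in> El (dual_mod N) a" and b: "b \<in> Obj ?S" and h: "h \<in> Arr C b a"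
   and m: "m \<in> carrier (dual_space K (Val M b))" for a b m h \<zeta>
 proof -
  have bC: "b \<in> Obj C" using b B by auto
  let ?\<xi> = "Act (dual_mod N) b a h \<zeta>"
  have xi: "?\<xi> \<in> El (dual_mod N) b" by (rule cmdD(4)[OF DNc bC a h z])
  have "evaluation M b (e b ?\<xi>) = dual_map (dual_mod M) u b ?\<xi>"
   unfolding e_def by (rule bij_betw_inv_into_right[OF evb[OF b] ntD(3)[OF Du b xi]])
  from fun_cong[OF this, of m] have "m (e b ?\<xi>) = ?\<xi> (u b m)" using m by (simp add: evaluation_def dual_map_def dual_sel)
  also have "\<dots> = \<zeta> (Act N a b h (u b m))" using ntD(3)[OF un, of b m] b m by (simp add: dual_sel)
  also have "Act N a b h (u b m) = ?t a b m h"
   using lunit_act[OF To, of a b m h] a b h m by (simp add: N_def u_def dual_sel)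
  finally show ?thesis .
 qed
 have th: "\<theta> a \<zeta> b h = e b (Act (dual_mod N) b a h \<zeta>)" if "b \<in> Obj ?S" "h \<in> Arr C b a" for a \<zeta> b h
  using that by (simp add: \<theta>_def)
 have ec: "e b (Act (dual_mod N) b a h \<zeta>) \<in> El M b"
  if "a \<in> Obj C" "\<zeta> \<in> El (dual_mod N) a" "b \<in> Obj ?S" "h \<in> Arr C b a" for a b h \<zeta>
  by (rule ntD(3)[OF en that(3) cmdD(4)[OF DNc _ that(1,4,2)]]) (use that(3) B in auto)
 have tv: "Val N a = tensor K ?O (dual_mod M) (corep_along ?P incl a)" for a
  unfolding N_def by (rule lext_sel(1)[OF To(1-3)])
 have ck: "cmd (op_cat ?O) (corep_along ?P incl a)" if "a \<in> Obj C" for a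
  using corep_cmd[OF To(1-3), of a] that by simp
 have cv: "Val (corep_along ?P incl a) b = Hom C b a" for a b by (simp add: corep_sel[OF To(1-3)])
 have "niso C (dual_mod N) ?R \<theta>"
 proof (rule nisoI[OF \<theta>n DNc rext_cmd[OF T]])
  fix a \<zeta> assume a: "a \<in> Obj C" and z: "\<zeta> \<in> El (dual_mod N) a" and t0: "\<theta> a \<zeta> = zr ?R a"
  have zd: "\<zeta> \<in> carrier (dual_space K (Val N a))" using z by (simp add: dual_sel)
  have Va: "vsp (Val N a)" using cmdD(1)[OF Nc, of a] a by simp
  \<comment> \<open>If \<theta> sends \<zeta> to zero, then by \<open>key\<close> the form \<zeta>
    vanishes on all pure tensors, hence everywhere.\<close>
  have "\<zeta> t = \<zero>" if t: "t \<in> El N a" for t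
  proof (rule tensor_eq[OF DMc ck[OF a] base_space_vsp dual_spaceD(1)[OF zd, unfolded tv] lin_zero_map[OF base_space_vsp] _ t[unfolded tv], unfolded base_space_sel])
   fix b m h assume "b \<in> Obj ?O" "m \<in> El (dual_mod M) b" "h \<in> El (corep_along ?P incl a) b"
   then have b: "b \<in> Obj ?S" and m: "m \<in> carrier (dual_space K (Val M b))" and h: "h \<in> Arr C b a" by (simp_all add: dual_sel cv)
   have "e b (Act (dual_mod N) b a h \<zeta>) = zr M b"
    using th[OF b h, of \<zeta>] t0 b h by (simp add: Rs nat_hom_sel)
   then show "\<zeta> (?t a b m h) = \<zero>"
    using key[OF a z b h m] lin_zero[OF dual_spaceD(1)[OF m] cmdD(1)[OF Mc b] base_space_vsp] by simp
  qed
  then show "\<zeta> = zr (dual_mod N) a"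
   using vs_closed(1)[OF dual_vsp[OF Va]] by (intro dual_eqI[OF zd]) (simp_all add: dual_sel dual_space_sel)
 next
  fix a \<phi> assume a: "a \<in> Obj C" and p: "\<phi> \<in> El ?R a"
  then have p': "\<phi> \<in> Nats ?S (rep C a) M" by (simp add: Rs)
  note pn = nat_homD(1)[OF p']
  have pc: "\<phi> b h \<in> El M b" if "b \<in> Obj ?S" "h \<in> Arr C b a" for b h
   using ntD(3)[OF pn that(1)] that(2) by simp
  \<comment> \<open>The preimage of \<phi> is the form with m \<otimes> h \<mapsto> m(\<phi>(h)), as
    forced by \<open>key\<close>.\<close>
  have "balanced ?O (dual_mod M) (corep_along ?P incl a) base_space (\<lambda>b m h. m (\<phi> b h))"
   unfolding balanced_def
  proof (intro conjI ballI)
   fix b h assume "b \<in> Obj ?O" "h \<in> El (corep_along ?P incl a) b"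
   then have "\<phi> b h \<in> El M b" by (intro pc) (simp_all add: cv)
   then show "lin (Val (dual_mod M) b) base_space (\<lambda>m. m (\<phi> b h))"
    by (intro linI) (auto simp: dual_sel dual_spaceD(2) dual_space_sel)
  next
   fix b m assume "b \<in> Obj ?O" "m \<in> El (dual_mod M) b"
   then show "lin (Val (corep_along ?P incl a) b) base_space (\<lambda>h. m (\<phi> b h))"
    using lin_comp[OF ntD(1)[OF pn, of b] dual_spaceD(1), of m] by (simp add: dual_sel cv)
  next
   fix b c f m h assume "b \<in> Obj ?O" "c \<in> Obj ?O" "f \<in> Arr ?O b c" "m \<in> El (dual_mod M) c" "h \<in> El (corep_along ?P incl a) b"
   then show "Act (dual_mod M) b c f m (\<phi> b h) = m (\<phi> c (Act (corep_along ?P incl a) c b f h))"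
    using ntD(2)[OF pn, of c b f h] pc[of b h] by (simp add: dual_sel cv corep_sel[OF To(1-3)])
  qed
  then obtain g where g: "lin (Val N a) base_space g"
   "\<And>b m h. b \<in> Obj ?S ==> m \<in> carrier (dual_space K (Val M b)) ==> h \<in> Arr C b a ==> g (?t a b m h) = m (\<phi> b h)"
   using tensor_ext[OF DMc ck[OF a] base_space_vsp] unfolding tv[symmetric] by (fastforce simp: dual_sel cv)
  let ?\<zeta> = "\<lambda>t\<in>El N a. g t"
  have z: "?\<zeta> \<in> El (dual_mod N) a"
   unfolding dual_sel using dual_restrict[OF g(1)] cmdD(1)[OF Nc, of a] a by simp
  have "\<theta> a ?\<zeta> b h = \<phi> b h" if b: "b \<in> Obj ?S" and h: "h \<in> Arr C b a" for b h
   unfolding th[OF b h]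
  proof (rule sepM[OF b ec[OF a z b h] pc[OF b h]])
   fix m assume m: "m \<in> carrier (dual_space K (Val M b))"
   have "?t a b m h \<in> El N a"
    unfolding tv by (rule tens_mem[OF DMc ck[OF a]]) (use b m h in \<open>simp_all add: dual_sel cv\<close>)
   then show "m (e b (Act (dual_mod N) b a h ?\<zeta>)) = m (\<phi> b h)" using key[OF a z b h m] g(2)[OF b m h] by simp
  qed
  then have "ex ?S (rep C a) (\<theta> a ?\<zeta>) = ex ?S (rep C a) \<phi>" by (simp add: ex_eq_iff)
  then have "\<theta> a ?\<zeta> = \<phi>" using nat_homD(2)[OF p'] by (simp add: \<theta>_def)
  then show "\<exists>\<zeta>\<in>El (dual_mod N) a. \<theta> a \<zeta> = \<phi>" using z by blast
 qed
 then show ?thesis by (rule niso_fp[OF C _ DN rext_cmd[OF T]])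
qed

text \<open>The unit is an isomorphism on B, so \<phi> is the restriction of the induced map between
  left extensions. Its kernel is therefore the restriction of a kernel over C, which is finitely
  presented by duality.\<close>

lemma ker_closed_full_sub:
 fixes C :: "('k, 'o, 'm) lincat"
 assumes d: "dualizing C" "dualizing (op_cat C)" and cf: "contra_finite C B"
 shows "ker_closed TYPE('v) (full_sub C B)"
 unfolding ker_closed_def
proof (intro allI impI)
 let ?S = "full_sub C B"
 note C = dualizing_lcat[OF d(1)] and B = contra_finiteD(1)[OF cf]
 note SC = full_sub_lcat[OF C B] note F = incl_lf[OF C B]
 fix X Y :: "('k, 'o, 'm, 'v) cmod" and \<phi>
 assume X: "fp ?S X" and Y: "fp ?S Y" and \<phi>: "nt ?S X Y \<phi>"
 note Xc = fp_cmd[OF X] and Yc = fp_cmd[OF Y]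
 let ?L = "left_ext_mod K ?S C incl" let ?u = "left_unit ?S C incl"
 note TX = SC C F Xc and TY = SC C F Yc
 note uX = left_unit_niso[OF C B Xc] and uY = left_unit_niso[OF C B Yc]
 have un: "nt ?S X (?L X) (?u X)" "nt ?S Y (?L Y) (?u Y)" using uX uY by (simp_all add: niso_def)
 note LX = lext_cmd[OF TX] and LY = lext_cmd[OF TY]
 obtain k where k: "nt C (?L X) (?L Y) k" "\<And>c y. c \<in> B ==> y \<in> El X c ==> k c (?u X c y) = ?u Y c (\<phi> c y)"
  using left_universal[OF TX LY, unfolded precomp_incl, OF nt_comp[OF \<phi> un(2)]] by auto
 note N = dualizing_ker_fp[OF d left_ext_mod_fp[OF TX X] left_ext_mod_fp[OF TY Y] k(1)]
 note kX = ker_mod_pt[OF Xc Yc \<phi>]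
 have iff: "k c (?u X c v) = zr (?L Y) c \<longleftrightarrow> \<phi> c v = zr Y c" if c: "c \<in> Obj ?S" "v \<in> El X c" for c v
 proof -
  have Vc: "vsp (Val (?L Y) c)" using cmdD(1)[OF LY, of c] c(1) B by auto
  have "inj_on (?u Y c) (El Y c)" using uY c(1) by (simp add: niso_def bij_betw_def)
  then show ?thesis
   using k(2)[of c v] c ntD(3)[OF \<phi> c] lin_inj_iff[OF ntD(1)[OF un(2) c(1)] cmdD(1)[OF Yc c(1)] Vc]
    lin_zero[OF ntD(1)[OF un(2) c(1)] cmdD(1)[OF Yc c(1)] Vc] by auto
 qed
 have "niso ?S (ker_mod X Y \<phi>) (ker_mod (?L X) (?L Y) k) (?u X)"
  unfolding niso_def
 proof (intro conjI ballI)
  show "nt ?S (ker_mod X Y \<phi>) (ker_mod (?L X) (?L Y) k) (?u X)"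
   by (rule ker_mod_nt[OF nt_comp[OF kX(2) un(1)]]) (auto simp: ker_mod_sel iff)
  fix c assume c: "c \<in> Obj ?S"
  then have b: "bij_betw (?u X c) (El X c) (El (?L X) c)" using uX by (simp add: niso_def)
  show "bij_betw (?u X c) (El (ker_mod X Y \<phi>) c) (El (ker_mod (?L X) (?L Y) k) c)"
   unfolding ker_mod_sel by (rule bij_betw_Collect[OF b]) (rule iff[OF c])
 qed
 from niso_inv[OF this kX(1) sub_cmd[OF C B fp_cmd[OF N]]]
 show "fp ?S (ker_mod X Y \<phi>)" by (rule niso_fp[OF SC _ restrict_fp[OF d cf N] kX(1)])
qed

text \<open>Applied to the projection, which is the identity on objects, this makes the ideal
  quotient additive.\<close>

lemma is_direct_sum_functor:
 assumes F: "linear_functor K C D F" and C: "lcat C" and D: "lcat D" and s: "is_direct_sum C n xs s"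
 shows "is_direct_sum D n (\<lambda>i. Fob F (xs i)) (Fob F s)"
proof -
 note FD = lfD[OF F]
 obtain \<iota> \<pi> where o: "s \<in> Obj C" "\<And>i. i < n ==> xs i \<in> Obj C"
   and a: "\<And>i. i < n ==> \<iota> i \<in> Arr C (xs i) s" "\<And>i. i < n ==> \<pi> i \<in> Arr C s (xs i)"
   and e: "\<And>i j. i < n ==> j < n ==> Cmp C (xs i) s (xs j) (\<pi> j) (\<iota> i) = (if i = j then Idt C (xs i) else \<zero>\<^bsub>Hom C (xs i) (xs j)\<^esub>)"
   and f: "(\<Oplus>\<^bsub>Hom C s s\<^esub>i\<in>{..<n}. Cmp C s (xs i) s (\<iota> i) (\<pi> i)) = Idt C s"
  using s unfolding is_direct_sum_def by blast
 interpret H: vectorspace K "Hom D (Fob F s) (Fob F s)" by (rule catD(1)[OF D FD(1)[OF o(1)] FD(1)[OF o(1)]])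
 let ?i = "\<lambda>i. Far F (xs i) s (\<iota> i)" and ?p = "\<lambda>i. Far F s (xs i) (\<pi> i)"
 have c: "Cmp C s (xs i) s (\<iota> i) (\<pi> i) \<in> Arr C s s" if "i < n" for i using that by (intro catD(3)[OF C] o a)
 have "Idt D (Fob F s) = Far F s s (\<Oplus>\<^bsub>Hom C s s\<^esub>i\<in>{..<n}. Cmp C s (xs i) s (\<iota> i) (\<pi> i))" using f FD(2)[OF o(1)] by simp
 also have "\<dots> = (\<Oplus>\<^bsub>Hom D (Fob F s) (Fob F s)\<^esub>i\<in>{..<n}. Far F s s (Cmp C s (xs i) s (\<iota> i) (\<pi> i)))"
  by (rule lin_finsum[OF FD(5)[OF o(1) o(1)] catD(1)[OF C o(1) o(1)] H.vectorspace_axioms]) (use c in auto)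
 also have "\<dots> = (\<Oplus>\<^bsub>Hom D (Fob F s) (Fob F s)\<^esub>i\<in>{..<n}. Cmp D (Fob F s) (Fob F (xs i)) (Fob F s) (?i i) (?p i))"
  by (rule H.M.finsum_cong') (auto simp: FD(4) o a intro!: catD(3)[OF D] FD(1,3))
 finally have sum: "(\<Oplus>\<^bsub>Hom D (Fob F s) (Fob F s)\<^esub>i\<in>{..<n}. Cmp D (Fob F s) (Fob F (xs i)) (Fob F s) (?i i) (?p i)) = Idt D (Fob F s)" by simp
 have rel: "Cmp D (Fob F (xs i)) (Fob F s) (Fob F (xs j)) (?p j) (?i i) =
   (if i = j then Idt D (Fob F (xs i)) else \<zero>\<^bsub>Hom D (Fob F (xs i)) (Fob F (xs j))\<^esub>)" if h: "i < n" "j < n" for i j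
  using FD(4)[OF o(2)[OF h(1)] o(1) o(2)[OF h(2)] a(1)[OF h(1)] a(2)[OF h(2)]] e[OF h] FD(2)[OF o(2)[OF h(1)]]
   lin_zero[OF FD(5)[OF o(2)[OF h(1)] o(2)[OF h(2)]] catD(1)[OF C o(2)[OF h(1)] o(2)[OF h(2)]] catD(1)[OF D FD(1)[OF o(2)[OF h(1)]] FD(1)[OF o(2)[OF h(2)]]]]
  by (auto split: if_splits)
 show ?thesis
  unfolding is_direct_sum_def
 proof (intro conjI)
  show "\<exists>\<iota> \<pi>. (\<forall>i<n. \<iota> i \<in> Arr D (Fob F (xs i)) (Fob F s) \<and> \<pi> i \<in> Arr D (Fob F s) (Fob F (xs i))) \<and>
    (\<forall>i<n. \<forall>j<n. Cmp D (Fob F (xs i)) (Fob F s) (Fob F (xs j)) (\<pi> j) (\<iota> i) =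
     (if i = j then Idt D (Fob F (xs i)) else \<zero>\<^bsub>Hom D (Fob F (xs i)) (Fob F (xs j))\<^esub>)) \<and>
    (\<Oplus>\<^bsub>Hom D (Fob F s) (Fob F s)\<^esub>i\<in>{..<n}. Cmp D (Fob F s) (Fob F (xs i)) (Fob F s) (\<iota> i) (\<pi> i)) = Idt D (Fob F s)"
   by (rule exI[of _ ?i], rule exI[of _ ?p]) (use sum rel FD(3) o a in blast)
 qed (use FD(1) o in auto)
qed

section \<open>The ideal quotient\<close>


lemma ideal_sel:
 "Obj (ideal_quotient A B) = Obj A"
 "Hom (ideal_quotient A B) x y = quot_space (Hom A x y) (factor_ideal A B x y)"
 "Idt (ideal_quotient A B) x = factor_ideal A B x x +>\<^bsub>Hom A x x\<^esub> Idt A x"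
 "Cmp (ideal_quotient A B) x y z G F = (\<Union>g\<in>G. \<Union>f\<in>F. factor_ideal A B x z +>\<^bsub>Hom A x z\<^esub> Cmp A x y z g f)"
 "Fob (proj A B) x = x" "Far (proj A B) x y = (\<lambda>f. factor_ideal A B x y +>\<^bsub>Hom A x y\<^esub> f)"
 by (simp_all add: ideal_quotient_def proj_def)

context
 fixes A :: "('k, 'o, 'm) lincat" and B :: "'o set"
 assumes A: "lcat A" and cf: "contra_finite A B"
begin

abbreviation (input) J where "J \<equiv> factor_ideal A B"
abbreviation (input) Q where "Q \<equiv> ideal_quotient A B"
abbreviation (input) pr where "pr x y f \<equiv> factor_ideal A B x y +>\<^bsub>Hom A x y\<^esub> f"

text \<open>An arrow to y that passes through B passes through the approximation h : b \<rightarrow>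
  y. Thus the ideal is the image of composition with h, which shows that it is a subspace and gives
  a presentation of the quotient of A(-,y).\<close>

lemma ideal_image:
 assumes o: "x \<in> Obj A" "y \<in> Obj A" and g: "gen (full_sub A B) (rep A y) b h"
 shows "J x y = (\<lambda>f. Cmp A x b y h f) ` Arr A x b" "b \<in> B" "h \<in> Arr A b y" "b \<in> Obj A"
proof -
 note BA = contra_finiteD(1)[OF cf] and g = genD[OF g, simplified]
 show b: "b \<in> B" "h \<in> Arr A b y" "b \<in> Obj A" using g BA by auto
 show "J x y = (\<lambda>f. Cmp A x b y h f) ` Arr A x b"
 proof (rule equalityI; rule subsetI)
  fix k assume "k \<in> J x y"
  then obtain c f l where k: "k = Cmp A x c y l f" "c \<in> B" "f \<in> Arr A x c" "l \<in> Arr A c y"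
   unfolding factor_ideal_def by blast
  have c: "c \<in> Obj A" using k(2) BA by blast
  obtain m where m: "m \<in> Arr A c b" "l = Cmp A c b y h m" using g(3)[OF k(2,4)] by blast
  have "k = Cmp A x b y h (Cmp A x c b m f)" using k(1) m(2) cmp_assoc'[OF A o(1) c b(3) o(2) k(3) m(1) b(2)] by simp
  then show "k \<in> (\<lambda>f. Cmp A x b y h f) ` Arr A x b" using catD(3)[OF A o(1) c b(3) k(3) m(1)] by blast
 qed (use b in \<open>auto simp: factor_ideal_def\<close>)
qed

lemma ideal_subsp:
 assumes o: "x \<in> Obj A" "y \<in> Obj A"
 shows "subsp (Hom A x y) (J x y)"
proof -
 obtain b h where g: "gen (full_sub A B) (rep A y) b h" using contra_finiteD(2)[OF cf o(2)] by blast
 note i = ideal_image[OF o g]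
 show ?thesis unfolding i(1)
  by (rule subsp_image[OF cmp_lin(2)[OF A o(1) i(4) o(2) i(3)] catD(1)[OF A o(1) i(4)] catD(1)[OF A o]])
qed

lemma ideal_comp:
 assumes o: "x \<in> Obj A" "y \<in> Obj A" "z \<in> Obj A"
 shows "f \<in> Arr A x y ==> g \<in> J y z ==> Cmp A x y z g f \<in> J x z"
  "f \<in> J x y ==> g \<in> Arr A y z ==> Cmp A x y z g f \<in> J x z"
proof -
 note BA = contra_finiteD(1)[OF cf]
 assume f: "f \<in> Arr A x y" and "g \<in> J y z"
 then obtain b k l where k: "g = Cmp A y b z l k" "b \<in> B" "k \<in> Arr A y b" "l \<in> Arr A b z" unfolding factor_ideal_def by blast
 have b: "b \<in> Obj A" using k(2) BA by blast
 have "Cmp A x y z g f = Cmp A x b z l (Cmp A x y b k f)" using k(1) cmp_assoc'[OF A o(1,2) b o(3) f k(3,4)] by simp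
 then show "Cmp A x y z g f \<in> J x z" unfolding factor_ideal_def using k catD(3)[OF A o(1,2) b f k(3)] by blast
next
 note BA = contra_finiteD(1)[OF cf]
 assume "f \<in> J x y" and g: "g \<in> Arr A y z"
 then obtain b k l where k: "f = Cmp A x b y l k" "b \<in> B" "k \<in> Arr A x b" "l \<in> Arr A b y" unfolding factor_ideal_def by blast
 have b: "b \<in> Obj A" using k(2) BA by blast
 have "Cmp A x y z g f = Cmp A x b z (Cmp A b y z g l) k" using k(1) cmp_assoc'[OF A o(1) b o(2,3) k(3,4) g] by simp
 then show "Cmp A x y z g f \<in> J x z" unfolding factor_ideal_def using k catD(3)[OF A b o(2,3) k(4) g] by blast
qed

lemma pr_lin: "x \<in> Obj A ==> y \<in> Obj A ==> lin (Hom A x y) (Hom Q x y) (\<lambda>f. pr x y f)"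
 and quot_hom_vsp: "x \<in> Obj A ==> y \<in> Obj A ==> vsp (Hom Q x y)"
 unfolding ideal_sel using quot_lin[OF catD(1)[OF A] ideal_subsp] quot_vsp[OF catD(1)[OF A] ideal_subsp] by blast+

lemma pr_surj: "F \<in> Arr Q x y ==> \<exists>f\<in>Arr A x y. F = pr x y f"
 by (auto simp: ideal_sel quot_space_def A_RCOSETS_def')

lemma pr_eq:
 assumes "x \<in> Obj A" "y \<in> Obj A" "f \<in> Arr A x y" "g \<in> Arr A x y"
 shows "pr x y f = pr x y g \<longleftrightarrow> f \<ominus>\<^bsub>Hom A x y\<^esub> g \<in> J x y"
 by (rule coset_eq[OF catD(1)[OF A assms(1,2)] ideal_subsp[OF assms(1,2)] assms(3,4)])

lemma pr_zero:
 assumes "x \<in> Obj A" "y \<in> Obj A" "f \<in> Arr A x y"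
 shows "pr x y f = \<zero>\<^bsub>Hom Q x y\<^esub> \<longleftrightarrow> f \<in> J x y"
 using coset_eq_zero[OF catD(1)[OF A assms(1,2)] ideal_subsp[OF assms(1,2)] assms(3)] by (simp add: ideal_sel quot_space_def)

lemma pr_mem:
 assumes "x \<in> Obj A" "y \<in> Obj A" "f \<in> Arr A x y" "g \<in> pr x y f"
 shows "g \<in> Arr A x y" "pr x y g = pr x y f"
 using coset_mem[OF catD(1)[OF A assms(1,2)] ideal_subsp[OF assms(1,2)] assms(3), of g] pr_eq[OF assms(1,2) _ assms(3), of g] assms(4) by auto

lemma pr_self: "x \<in> Obj A ==> y \<in> Obj A ==> f \<in> Arr A x y ==> f \<in> pr x y f"
 by (rule coset_self[OF catD(1)[OF A] ideal_subsp])

lemma pr_cmp: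
 assumes o: "x \<in> Obj A" "y \<in> Obj A" "z \<in> Obj A" and f: "f \<in> Arr A x y" and g: "g \<in> Arr A y z"
 shows "Cmp Q x y z (pr y z g) (pr x y f) = pr x z (Cmp A x y z g f)"
proof -
 have "pr x z (Cmp A x y z g' f') = pr x z (Cmp A x y z g f)" if g': "g' \<in> pr y z g" and f': "f' \<in> pr x y f" for g' f'
 proof -
  note g1 = pr_mem[OF o(2,3) g g'] and f1 = pr_mem[OF o(1,2) f f']
  note H = catD(1)[OF A o(1,3)]
  note m = catD(3)[OF A o]
  have "Cmp A x y z g' f' \<ominus>\<^bsub>Hom A x z\<^esub> Cmp A x y z g f' \<in> J x z"
   using ideal_comp(1)[OF o f1(1), of "g' \<ominus>\<^bsub>Hom A y z\<^esub> g"] g1(2) pr_eq[OF o(2,3) g1(1) g]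
    lin_diff[OF cmp_lin(1)[OF A o f1(1)] catD(1)[OF A o(2,3)] H g1(1) g] by simp
  moreover have "Cmp A x y z g f' \<ominus>\<^bsub>Hom A x z\<^esub> Cmp A x y z g f \<in> J x z"
   using ideal_comp(2)[OF o _ g, of "f' \<ominus>\<^bsub>Hom A x y\<^esub> f"] f1(2) pr_eq[OF o(1,2) f1(1) f]
    lin_diff[OF cmp_lin(2)[OF A o g] catD(1)[OF A o(1,2)] H f1(1) f] by simp
  ultimately show ?thesis
   using pr_eq[OF o(1,3) m[OF f1(1) g1(1)] m[OF f1(1) g]] pr_eq[OF o(1,3) m[OF f1(1) g] m[OF f g]] by simp
 qed
 then have "(\<Union>g'\<in>pr y z g. \<Union>f'\<in>pr x y f. pr x z (Cmp A x y z g' f')) = (\<Union>g'\<in>pr y z g. \<Union>f'\<in>pr x y f. pr x z (Cmp A x y z g f))"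
  by (intro SUP_cong refl) simp
 also have "\<dots> = pr x z (Cmp A x y z g f)" using pr_self[OF o(2,3) g] pr_self[OF o(1,2) f] by auto
 finally show ?thesis by (simp add: ideal_sel)
qed

lemma quot_lcat: "lcat Q"
proof -
 note c = pr_lin[THEN linD(1)] and s = pr_surj and cm = catD(3)[OF A]
 note ad = linD(2)[OF pr_lin, symmetric] and sm = linD(3)[OF pr_lin, symmetric]
 have "linear_category_axioms K Q"
  unfolding linear_category_axioms_def
 proof (intro conjI allI impI, unfold ideal_sel(1))
  show "vectorspace K (Hom Q x y)" if "x \<in> Obj A" "y \<in> Obj A" for x y by (rule quot_hom_vsp[OF that])
  show "Idt Q x \<in> Arr Q x x" if "x \<in> Obj A" for x
   using c[OF that that catD(2)[OF A that]] by (simp add: ideal_sel(3))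
  fix x y assume xy: "x \<in> Obj A" "y \<in> Obj A"
  show "Cmp Q x y y (Idt Q y) F = F" if F: "F \<in> Arr Q x y" for F
  proof -
   obtain f where f: "f \<in> Arr A x y" "F = pr x y f" using s[OF F] by blast
   show ?thesis unfolding f(2) ideal_sel(3) by (simp add: pr_cmp xy f(1) catD(2,4)[OF A])
  qed
  show "Cmp Q x x y F (Idt Q x) = F" if F: "F \<in> Arr Q x y" for F
  proof -
   obtain f where f: "f \<in> Arr A x y" "F = pr x y f" using s[OF F] by blast
   show ?thesis unfolding f(2) ideal_sel(3) by (simp add: pr_cmp xy f(1) catD(2,5)[OF A])
  qed
  fix z assume z: "z \<in> Obj A"
  show "lin (Hom Q y z) (Hom Q x z) (\<lambda>G. Cmp Q x y z G F)" if F: "F \<in> Arr Q x y" for F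
  proof -
   obtain f where f: "f \<in> Arr A x y" "F = pr x y f" using s[OF F] by blast
   show ?thesis
    unfolding f(2)
   proof (rule linI)
    fix G assume "G \<in> Arr Q y z"
    then obtain g where g: "g \<in> Arr A y z" "G = pr y z g" using s by blast
    show "Cmp Q x y z G (pr x y f) \<in> Arr Q x z" unfolding g(2) by (simp add: pr_cmp xy z f(1) g(1) c cm)
    { fix G' assume "G' \<in> Arr Q y z"
     then obtain g' where g': "g' \<in> Arr A y z" "G' = pr y z g'" using s by blast
     show "Cmp Q x y z (G \<oplus>\<^bsub>Hom Q y z\<^esub> G') (pr x y f) = Cmp Q x y z G (pr x y f) \<oplus>\<^bsub>Hom Q x z\<^esub> Cmp Q x y z G' (pr x y f)"
      unfolding g(2) g'(2) by (simp add: ad pr_cmp xy z f(1) g(1) g'(1) cm vs_closed(2)[OF catD(1)[OF A]] cmp_add[OF A]) }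
    { fix r assume r: "r \<in> carrier K"
     show "Cmp Q x y z (r \<odot>\<^bsub>Hom Q y z\<^esub> G) (pr x y f) = r \<odot>\<^bsub>Hom Q x z\<^esub> Cmp Q x y z G (pr x y f)"
      unfolding g(2) by (simp add: sm r pr_cmp xy z f(1) g(1) cm vs_closed(5)[OF catD(1)[OF A]] cmp_add[OF A]) }
   qed
  qed
  show "lin (Hom Q x y) (Hom Q x z) (\<lambda>F. Cmp Q x y z G F)" if G: "G \<in> Arr Q y z" for G
  proof -
   obtain g where g: "g \<in> Arr A y z" "G = pr y z g" using s[OF G] by blast
   show ?thesis
    unfolding g(2)
   proof (rule linI)
    fix F assume "F \<in> Arr Q x y"
    then obtain f where f: "f \<in> Arr A x y" "F = pr x y f" using s by blast
    show "Cmp Q x y z (pr y z g) F \<in> Arr Q x z" unfolding f(2) by (simp add: pr_cmp xy z f(1) g(1) c cm)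
    { fix F' assume "F' \<in> Arr Q x y"
     then obtain f' where f': "f' \<in> Arr A x y" "F' = pr x y f'" using s by blast
     show "Cmp Q x y z (pr y z g) (F \<oplus>\<^bsub>Hom Q x y\<^esub> F') = Cmp Q x y z (pr y z g) F \<oplus>\<^bsub>Hom Q x z\<^esub> Cmp Q x y z (pr y z g) F'"
      unfolding f(2) f'(2) by (simp add: ad pr_cmp xy z f(1) g(1) f'(1) cm vs_closed(2)[OF catD(1)[OF A]] cmp_add[OF A]) }
    { fix r assume r: "r \<in> carrier K"
     show "Cmp Q x y z (pr y z g) (r \<odot>\<^bsub>Hom Q x y\<^esub> F) = r \<odot>\<^bsub>Hom Q x z\<^esub> Cmp Q x y z (pr y z g) F"
      unfolding f(2) by (simp add: sm r pr_cmp xy z f(1) g(1) cm vs_closed(5)[OF catD(1)[OF A]] cmp_add[OF A]) }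
   qed
  qed
 next
  fix w x y z F G H assume o: "w \<in> Obj A" "x \<in> Obj A" "y \<in> Obj A" "z \<in> Obj A" and "F \<in> Arr Q w x" "G \<in> Arr Q x y" "H \<in> Arr Q y z"
  then obtain f g h where f: "f \<in> Arr A w x" "F = pr w x f" and g: "g \<in> Arr A x y" "G = pr x y g" and h: "h \<in> Arr A y z" "H = pr y z h"
   using s by meson
  show "Cmp Q w y z H (Cmp Q w x y G F) = Cmp Q w x z (Cmp Q x y z H G) F"
   unfolding f(2) g(2) h(2) by (simp add: pr_cmp o f(1) g(1) h(1) cm cmp_assoc'[OF A])
 qed
 then show ?thesis by (simp add: linear_category_def field_axioms)
qed

lemma proj_lf: "linear_functor K A Q (proj A B)"
 by (rule lfI) (simp_all add: ideal_sel(1,3,5,6) pr_lin pr_cmp linD(1)[OF pr_lin])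

lemma quot_additive: "additive_category K A ==> additive_category K Q"
 unfolding additive_category_def ideal_sel(1) using quot_lcat is_direct_sum_functor[OF proj_lf A quot_lcat, unfolded ideal_sel(5)] by meson

lemma precomp_proj_sel: "Val (precomp (proj A B) X) = Val X" "Act (precomp (proj A B) X) x y f = Act X x y (pr x y f)"
 by (simp_all add: ideal_sel)

text \<open>From A/[B] to A, a cokernel of representables over A/[B] becomes a cokernel of finitely
  presented A-modules, and \<open>fp_exact\<close> applies. Conversely a presentation over A
  projects to one over A/[B], since the projection is onto on arrows.\<close>

lemma quot_fp_iff:
 fixes X :: "('k, 'o, 'm set, 'v) cmod"
 assumes add: "additive_category K A" and X: "cmd Q X"
 shows "fp Q X \<longleftrightarrow> fp A (precomp (proj A B) X)"
proof
 note Qc = quot_lcat and pX = precomp_cmd[OF proj_lf X]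
 note c = pr_lin[THEN linD(1)]
 let ?p = "precomp (proj A B)"
 assume "fp Q X"
 then obtain c1 c0 G x where "pres Q X c1 c0 G x" by (auto simp: fp_iff[OF Qc])
 note p = presD[OF this, unfolded ideal_sel(1)]
 \<comment> \<open>The approximation h : b \<rightarrow> d is the arrow of relations, and the class
   of the identity is the generator.\<close>
 have pres_rep: "pres A (?p (rep Q d)) b d h (pr d d (Idt A d))" if d: "d \<in> Obj A" and g: "gen (full_sub A B) (rep A d) b h" for b d h
  unfolding pres_def gen_def precomp_proj_sel rep_sel
 proof (intro conjI ballI d)
  note i = ideal_image[OF d d g] and Id = catD(2)[OF A d]
  show "b \<in> Obj A" "h \<in> Arr A b d" by (fact i)+
  show "pr d d (Idt A d) \<in> Arr Q d d" by (rule c[OF d d Id])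
  fix a assume a: "a \<in> Obj A"
  have e: "Cmp Q a d d (pr d d (Idt A d)) (pr a d f) = pr a d f" if "f \<in> Arr A a d" for f
   using pr_cmp[OF a d d that Id] catD(4)[OF A a d that] by simp
  show "\<exists>f\<in>Arr A a d. F = Cmp Q a d d (pr d d (Idt A d)) (pr a d f)" if "F \<in> Arr Q a d" for F
   using pr_surj[OF that] e by auto
  show "Cmp Q a d d (pr d d (Idt A d)) (pr a d f) = \<zero>\<^bsub>Hom Q a d\<^esub> \<longleftrightarrow> (\<exists>l\<in>Arr A a b. f = Cmp A a b d h l)" if "f \<in> Arr A a d" for f
   by (simp only: e[OF that] pr_zero[OF a d that]) (auto simp: ideal_image(1)[OF a d g])
 qed
 obtain b0 h0 b1 h1 where b: "gen (full_sub A B) (rep A c0) b0 h0" "gen (full_sub A B) (rep A c1) b1 h1"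
  using contra_finiteD(2)[OF cf] p(1,4) by meson
 have rc: "cmd A (?p (rep Q d))" if "d \<in> Obj A" for d
  using precomp_cmd[OF proj_lf rep_cmd[OF Qc, of d]] that by (simp add: ideal_sel(1))
 have N: "fp A (?p (rep Q c0))" using rc[OF p(4)] pres_rep[OF p(4) b(1)] by (auto simp: fp_iff[OF A])
 have yo: "nt A (?p (rep Q d)) (?p Z) (\<lambda>a F. Act Z a d F z)" if "cmd Q Z" "d \<in> Obj A" "z \<in> El Z d"
  for Z :: "('k, 'o, 'm set, 'w) cmod" and d z
  using precomp_nt[OF proj_lf yoneda_nt[OF Qc that(1)]] that(2,3) by (simp add: ideal_sel(1,5))
 show "fp A (?p X)"
 proof (rule fp_exact[OF add N presD(3)[OF pres_rep[OF p(1) b(2)]] rc[OF p(1)] pX])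
  show "nt A (?p (rep Q c1)) (?p (rep Q c0)) (\<lambda>a F. Cmp Q a c1 c0 G F)"
   using yo[OF rep_cmd[OF Qc] p(1), of c0 G] p(2,4) by (simp add: ideal_sel(1))
  show "nt A (?p (rep Q c0)) (?p X) (\<lambda>a F. Act X a c0 F x)" by (rule yo[OF X p(4,5)])
 qed (use p(6,7) in \<open>auto simp: ideal_sel(5,6)\<close>)
next
 note Qc = quot_lcat and c = pr_lin[THEN linD(1)]
 assume "fp A (precomp (proj A B) X)"
 then obtain c1 c0 g x where "pres A (precomp (proj A B) X) c1 c0 g x" by (auto simp: fp_iff[OF A])
 note p = presD[OF this, unfolded precomp_proj_sel]
 have "pres Q X c1 c0 (pr c1 c0 g) x"
  unfolding pres_def gen_def ideal_sel(1)
 proof (intro conjI ballI p(1,4,5) c[OF p(1,4,2)])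
  fix a assume a: "a \<in> Obj A"
  show "\<exists>F\<in>Arr Q a c0. v = Act X a c0 F x" if "v \<in> El X a" for v
   using p(6)[OF a that] c[OF a p(4)] by blast
  fix F assume "F \<in> Arr Q a c0"
  then obtain f where f: "f \<in> Arr A a c0" "F = pr a c0 f" using pr_surj by blast
  show "Act X a c0 F x = zr X a \<longleftrightarrow> (\<exists>H\<in>Arr Q a c1. F = Cmp Q a c1 c0 (pr c1 c0 g) H)"
  proof
   assume "Act X a c0 F x = zr X a"
   then obtain l where "l \<in> Arr A a c1" "f = Cmp A a c1 c0 g l" using p(7)[OF a f(1)] f(2) by auto
   then show "\<exists>H\<in>Arr Q a c1. F = Cmp Q a c1 c0 (pr c1 c0 g) H"
    using f(2) c[OF a p(1)] pr_cmp[OF a p(1,4) _ p(2)] by metis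
  next
   assume "\<exists>H\<in>Arr Q a c1. F = Cmp Q a c1 c0 (pr c1 c0 g) H"
   then obtain l where l: "l \<in> Arr A a c1" "F = Cmp Q a c1 c0 (pr c1 c0 g) (pr a c1 l)" using pr_surj by blast
   then have "F = pr a c0 (Cmp A a c1 c0 g l)" by (simp add: pr_cmp[OF a p(1,4) _ p(2)])
   then show "Act X a c0 F x = zr X a" using p(7)[OF a catD(3)[OF A a p(1,4) l(1) p(2)]] l(1) by auto
  qed
 qed
 then show "fp Q X" using X by (auto simp: fp_iff[OF Qc])
qed

text \<open>The identity of an object of B lies in the ideal, so it acts both as the identity and as
  zero.\<close>

lemma quot_mod_zero:
 assumes X: "cmd Q X" and b: "b \<in> B"
 shows "El X b = {(zr X b)}"
proof -
 have bA: "b \<in> Obj A" and bQ: "b \<in> Obj Q" using b contra_finiteD(1)[OF cf] by (auto simp: ideal_sel(1))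
 note I = catD(2)[OF A bA] and V = cmdD(1)[OF X bQ]
 have "Idt A b \<in> J b b" unfolding factor_ideal_def using b I catD(4)[OF A bA bA I, symmetric] by blast
 then have "Idt Q b = \<zero>\<^bsub>Hom Q b b\<^esub>" using pr_zero[OF bA bA I] by (simp add: ideal_sel(3))
 then have "v = zr X b" if "v \<in> El X b" for v
  using cmdD(2)[OF X bQ that] lin_zero[OF act_lin(2)[OF X bQ bQ that] quot_hom_vsp[OF bA bA] V] by simp
 then show ?thesis using vs_closed(1)[OF V] by blast
qed

text \<open>An arrow through B acts through a zero value, so all representatives of a coset act
  alike and one may be chosen arbitrarily. With \<open>quot_mod_zero\<close> this identifies the
  image of the pullback along the projection with the modules vanishing on B.\<close>

lemma quot_mod_descend:
 fixes Y :: "('k, 'o, 'm, 'v) cmod"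
 assumes Y: "cmd A Y" and z: "\<And>b. b \<in> B ==> El Y b = {(zr Y b)}"
 shows "\<exists>X :: ('k, 'o, 'm set, 'v) cmod. cmd Q X \<and> niso A (precomp (proj A B) X) Y (\<lambda>c v. v)"
proof -
 define X :: "('k, 'o, 'm set, 'v) cmod" where "X = \<lparr>Val = Val Y, Act = (\<lambda>x y F. Act Y x y (SOME f. f \<in> F))\<rparr>"
 have sel: "Val X = Val Y" "Act X = (\<lambda>x y F. Act Y x y (SOME f. f \<in> F))" by (simp_all add: X_def)
 have J0: "Act Y x y k v = zr Y x" if o: "x \<in> Obj A" "y \<in> Obj A" and k: "k \<in> J x y" and v: "v \<in> El Y y" for x y k v
 proof -
  obtain b f g where b: "k = Cmp A x b y g f" "b \<in> B" "f \<in> Arr A x b" "g \<in> Arr A b y" using k unfolding factor_ideal_def by blast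
  have bA: "b \<in> Obj A" using b(2) contra_finiteD(1)[OF cf] by blast
  have "Act Y b y g v = zr Y b" using cmdD(4)[OF Y bA o(2) b(4) v] z[OF b(2)] by blast
  then show ?thesis
   using b(1) cmdD(3)[OF Y o(1) bA o(2) b(3,4) v] lin_zero[OF act_lin(1)[OF Y o(1) bA b(3)] cmdD(1)[OF Y bA] cmdD(1)[OF Y o(1)]] by simp
 qed
 have act: "Act X x y (pr x y f) v = Act Y x y f v" if o: "x \<in> Obj A" "y \<in> Obj A" and f: "f \<in> Arr A x y" and v: "v \<in> El Y y" for x y f v
 proof -
  note m = pr_mem[OF o f someI[where P = "\<lambda>g. g \<in> pr x y f", OF pr_self[OF o f]]]
  let ?g = "SOME g. g \<in> pr x y f"
  note l = act_lin(2)[OF Y o v] and V = cmdD(1)[OF Y o(1)]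
  have "?g \<ominus>\<^bsub>Hom A x y\<^esub> f \<in> J x y" using m pr_eq[OF o m(1) f] by simp
  then have "Act Y x y ?g v \<ominus>\<^bsub>Val Y x\<^esub> Act Y x y f v = zr Y x"
   using J0[OF o _ v] lin_diff[OF l catD(1)[OF A o] V m(1) f] by simp
  then show ?thesis using vs_diff(1)[OF V linD(1)[OF l m(1)] linD(1)[OF l f]] by (simp add: sel)
 qed
 have X: "cmd Q X"
 proof (rule cmdI, unfold ideal_sel(1))
  show "vsp (Val X c)" if "c \<in> Obj A" for c using cmdD(1)[OF Y that] by (simp add: sel)
  show "Act X c c (Idt Q c) v = v" if "c \<in> Obj A" "v \<in> El X c" for c v
   using that act[OF that(1,1) catD(2)[OF A that(1)]] cmdD(2)[OF Y] by (simp add: sel(1) ideal_sel(3))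
  fix x y assume o: "x \<in> Obj A" "y \<in> Obj A"
  show "lin (Val X y) (Val X x) (Act X x y F)" if F: "F \<in> Arr Q x y" for F
  proof -
   obtain f where f: "f \<in> Arr A x y" "F = pr x y f" using pr_surj[OF F] by blast
   show ?thesis unfolding f(2) sel(1)
    by (rule lin_cong[OF act_lin(1)[OF Y o f(1)] act[OF o f(1), symmetric] cmdD(1)[OF Y o(2)]])
  qed
  { fix v assume v: "v \<in> El X y"
   then have v': "v \<in> El Y y" by (simp add: sel)
   note l = act_lin(2)[OF Y o v'] and H = catD(1)[OF A o]
   show "lin (Hom Q x y) (Val X x) (\<lambda>F. Act X x y F v)"
   proof (rule linI)
    fix F assume "F \<in> Arr Q x y"
    then obtain f where f: "f \<in> Arr A x y" "F = pr x y f" using pr_surj by blast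
    show "Act X x y F v \<in> El X x" unfolding f(2) act[OF o f(1) v'] sel(1) by (rule linD(1)[OF l f(1)])
    { fix G assume "G \<in> Arr Q x y"
     then obtain g where g: "g \<in> Arr A x y" "G = pr x y g" using pr_surj by blast
     show "Act X x y (F \<oplus>\<^bsub>Hom Q x y\<^esub> G) v = Act X x y F v \<oplus>\<^bsub>Val X x\<^esub> Act X x y G v"
      unfolding f(2) g(2) linD(2)[OF pr_lin[OF o] f(1) g(1), symmetric] sel(1)
      using act[OF o _ v'] f(1) g(1) vs_closed(2)[OF H f(1) g(1)] linD(2)[OF l f(1) g(1)] by simp }
    { fix r assume r: "r \<in> carrier K"
     show "Act X x y (r \<odot>\<^bsub>Hom Q x y\<^esub> F) v = r \<odot>\<^bsub>Val X x\<^esub> Act X x y F v"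
      unfolding f(2) linD(3)[OF pr_lin[OF o] r f(1), symmetric] sel(1)
      using act[OF o _ v'] f(1) vs_closed(5)[OF H r f(1)] linD(3)[OF l r f(1)] by simp }
   qed }
  fix z F G v assume zo: "z \<in> Obj A" and "F \<in> Arr Q x y" "G \<in> Arr Q y z" and "v \<in> El X z"
  then obtain f g where f: "f \<in> Arr A x y" "F = pr x y f" and g: "g \<in> Arr A y z" "G = pr y z g" and v: "v \<in> El Y z"
   using pr_surj unfolding sel by meson
  show "Act X x z (Cmp Q x y z G F) v = Act X x y F (Act X y z G v)"
   unfolding f(2) g(2) pr_cmp[OF o zo f(1) g(1)] act[OF o(2) zo g(1) v] act[OF o f(1) cmdD(4)[OF Y o(2) zo g(1) v]]
    act[OF o(1) zo catD(3)[OF A o zo f(1) g(1)] v] by (rule cmdD(3)[OF Y o zo f(1) g(1) v])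
 qed
 moreover have "niso A (precomp (proj A B) X) Y (\<lambda>c v. v)"
 proof (rule nisoI[OF ntI precomp_cmd[OF proj_lf X] Y])
 qed (auto simp: ideal_sel(5,6) sel(1) act lin_id)
 ultimately show ?thesis by blast
qed

text \<open>Pullback along the projection leaves values unchanged, so it commutes with
  \<open>ker_mod\<close> on the nose, and finite presentation is tested over A on both
  sides.\<close>

lemma quot_ker_closed:
 assumes add: "additive_category K A" and d: "dualizing A" "dualizing (op_cat A)"
 shows "ker_closed TYPE('v) Q"
 unfolding ker_closed_def
proof (intro allI impI)
 fix X Y :: "('k, 'o, 'm set, 'v) cmod" and \<phi>
 assume X: "fp Q X" and Y: "fp Q Y" and \<phi>: "nt Q X Y \<phi>"
 let ?p = "precomp (proj A B)"
 note kX = ker_mod_pt[OF fp_cmd[OF X] fp_cmd[OF Y] \<phi>]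
 have e: "?p (ker_mod X Y \<phi>) = ker_mod (?p X) (?p Y) \<phi>"
  by (simp add: ker_mod_def sub_mod_def precomp_def ideal_sel)
 have "nt A (?p X) (?p Y) \<phi>" using precomp_nt[OF proj_lf \<phi>] by (simp add: ideal_sel)
 from dualizing_ker_fp[OF d _ _ this]
 show "fp Q (ker_mod X Y \<phi>)"
  using quot_fp_iff[OF add kX(1)] quot_fp_iff[OF add fp_cmd[OF X]] quot_fp_iff[OF add fp_cmd[OF Y]] X Y by (simp add: e)
qed

text \<open>On the image of \<open>p\<^sup>*\<close>, the right adjoint \<open>p\<^sup>*\<^sub>\<rho>\<close> takes the part of \<open>X\<close> annihilated by \<open>\<B>\<close>,
 which is the kernel of the unit \<open>X \<rightarrow> i\<^sup>*\<^sub>\<rho> i\<^sup>* X\<close>.\<close>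

lemma right_ext_quot_fp:
 fixes X :: "('k, 'o, 'm, 'v) cmod"
 assumes add: "additive_category K A" and d: "dualizing A" "dualizing (op_cat A)" and cfo: "contra_finite (op_cat A) B"
  and X: "fp A X"
 shows "fp Q (right_ext_mod K A Q (proj A B) X)"
proof -
 let ?S = "full_sub A B" and ?p = "precomp (proj A B)"
 note BA = contra_finiteD(1)[OF cf] and Xc = fp_cmd[OF X]
 note SC = full_sub_lcat[OF A BA] note F = incl_lf[OF A BA] and XS = sub_cmd[OF A BA Xc]
 let ?R = "right_ext_mod K ?S A incl X" and ?E = "right_ext_mod K A Q (proj A B) X"
 note R = right_ext_mod_fp[OF d cfo restrict_fp[OF d cf X]]
 note Rs = rext_sel[OF SC A F, unfolded precomp_incl] and Es = rext_sel[OF A quot_lcat proj_lf]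
 \<comment> \<open>The unit of the adjunction between restriction to B and its right adjoint, at X.
   Its kernel consists of the elements killed by every arrow from B.\<close>
 define u where "u = (\<lambda>a x. ex ?S (rep A a) (\<lambda>b h. Act X b a h x))"
 have un: "nt A X ?R u"
  unfolding u_def using right_universal(1)[OF SC A F XS Xc, of "\<lambda>c v. v", unfolded precomp_incl, OF nt_id] by simp
 have u0: "u a x = zr ?R a \<longleftrightarrow> (\<forall>b\<in>B. \<forall>h\<in>Arr A b a. Act X b a h x = zr X b)" for a x
  by (simp add: u_def Rs nat_hom_sel ex_eq_iff)
 note Ec = rext_cmd[OF A quot_lcat proj_lf Xc] note pE = precomp_cmd[OF proj_lf Ec]
 let ?e = "right_counit Q (proj A B)"
 note en = rcounit_nt[OF A quot_lcat proj_lf Xc]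
 note kp = ker_mod_pt[OF Xc fp_cmd[OF R] un]
 have ev: "?e a \<phi> = \<phi> a (pr a a (Idt A a))" for a \<phi> by (simp add: right_counit_def ideal_sel(3,5))
 have tm: "\<phi> \<in> Nats A (?p (rep Q a)) X" if "\<phi> \<in> El (?p ?E) a" for \<phi> a
  using that by (simp add: ideal_sel(5,6) Es ideal_sel(5))
 \<comment> \<open>A map out of the quotient of A(-,a) is determined by its value at the class of
   the identity; hence evaluation there is injective.\<close>
 have val: "\<phi> c (pr c a f) = Act X c a f (?e a \<phi>)" if o: "c \<in> Obj A" "a \<in> Obj A" and f: "f \<in> Arr A c a"
  and p: "\<phi> \<in> El (?p ?E) a" for c a f \<phi>
 proof -
  have "pr a a (Idt A a) \<in> Arr Q a a" using linD(1)[OF pr_lin[OF o(2) o(2)] catD(2)[OF A o(2)]] .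
  then have "\<phi> c (Cmp Q c a a (pr a a (Idt A a)) (pr c a f)) = Act X c a f (\<phi> a (pr a a (Idt A a)))"
   using ntD(2)[OF nat_homD(1)[OF tm[OF p]] o f, of "pr a a (Idt A a)"] by (simp add: ideal_sel(5,6))
  then show ?thesis using pr_cmp[OF o(1,2,2) f catD(2)[OF A o(2)]] catD(4)[OF A o f] by (simp add: ev)
 qed
 have "niso A (?p ?E) (ker_mod X ?R u) ?e"
 proof (rule nisoI[OF ker_mod_nt[OF en] pE kp(1)])
  fix a \<phi> assume a: "a \<in> Obj A" and p: "\<phi> \<in> El (?p ?E) a"
  { show "u a (?e a \<phi>) = zr ?R a"
    unfolding u0
   proof (intro ballI)
    fix b h assume b: "b \<in> B" "h \<in> Arr A b a"
    have bA: "b \<in> Obj A" using b(1) BA by blast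
    have "h \<in> J b a" unfolding factor_ideal_def using b catD(2)[OF A bA] catD(5)[OF A bA a b(2), symmetric] by blast
    then have "pr b a h = zr (?p (rep Q a)) b" using pr_zero[OF bA a b(2)] by (simp add: ideal_sel(5,6))
    moreover have "cmd A (?p (rep Q a))" using prep_cmd[OF A quot_lcat proj_lf, of a] a by (simp add: ideal_sel(1))
    ultimately show "Act X b a h (?e a \<phi>) = zr X b"
     using val[OF bA a b(2) p] nt_zero_app[OF nat_homD(1)[OF tm[OF p]] _ Xc bA] by simp
   qed }
  assume "?e a \<phi> = zr (ker_mod X ?R u) a"
  then have e0: "?e a \<phi> = zr X a" by (simp add: ker_mod_sel)
  have "\<phi> c H = zr X c" if c: "c \<in> Obj A" and H: "H \<in> Arr Q c a" for c H
  proof -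
   obtain f where f: "f \<in> Arr A c a" "H = pr c a f" using pr_surj[OF H] by blast
   show ?thesis unfolding f(2) val[OF c a f(1) p] e0
    by (rule lin_zero[OF act_lin(1)[OF Xc c a f(1)] cmdD(1)[OF Xc a] cmdD(1)[OF Xc c]])
  qed
  then have "ex A (?p (rep Q a)) \<phi> = zr (?p ?E) a" by (simp add: ideal_sel(5,6) Es nat_hom_sel ex_eq_iff)
  then show "\<phi> = zr (?p ?E) a" using nat_homD(2)[OF tm[OF p]] by simp
 next
  fix a x assume a: "a \<in> Obj A" and "x \<in> El (ker_mod X ?R u) a"
  then have x: "x \<in> El X a" and x0: "\<And>b h. b \<in> B ==> h \<in> Arr A b a ==> Act X b a h x = zr X b"
   by (auto simp: ker_mod_sel u0)
  have rc: "cmd A (?p (rep Q a))" using prep_cmd[OF A quot_lcat proj_lf, of a] a by (simp add: ideal_sel(1))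
  have pn: "nt A (rep A a) (?p (rep Q a)) (\<lambda>c f. pr c a f)"
   by (rule ntI) (simp_all add: ideal_sel(5,6) pr_lin a pr_cmp)
  \<comment> \<open>An element killed by arrows from B is killed by the whole ideal, so its Yoneda
    map factors through the quotient of A(-,a).\<close>
  have "\<exists>\<phi>. nt A (?p (rep Q a)) X \<phi> \<and> (\<forall>c\<in>Obj A. \<forall>f\<in>El (rep A a) c. \<phi> c (pr c a f) = Act X c a f x)"
  proof (rule nt_factor_surj[OF rep_cmd[OF A a] rc Xc pn _ yoneda_nt[OF A Xc a x]])
   show "\<exists>f\<in>El (rep A a) c. H = pr c a f" if "c \<in> Obj A" "H \<in> El (?p (rep Q a)) c" for c H
    using pr_surj[of H c a] that(2) by (simp add: ideal_sel(5,6))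
   fix c f assume c: "c \<in> Obj A" and f: "f \<in> El (rep A a) c" and "pr c a f = zr (?p (rep Q a)) c"
   then have "f \<in> J c a" using pr_zero[OF c a] by (simp add: ideal_sel(5,6))
   then obtain b k l where k: "f = Cmp A c b a l k" "b \<in> B" "k \<in> Arr A c b" "l \<in> Arr A b a" unfolding factor_ideal_def by blast
   have bA: "b \<in> Obj A" using k(2) BA by blast
   show "Act X c a f x = zr X c"
    using k(1) cmdD(3)[OF Xc c bA a k(3,4) x] x0[OF k(2,4)] lin_zero[OF act_lin(1)[OF Xc c bA k(3)] cmdD(1)[OF Xc bA] cmdD(1)[OF Xc c]] by simp
  qed
  then obtain \<phi> where \<phi>: "nt A (?p (rep Q a)) X \<phi>" "\<And>c f. c\<in>Obj A ==> f\<in>Arr A c a ==> \<phi> c (pr c a f) = Act X c a f x" by auto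
  have "ex A (?p (rep Q a)) \<phi> \<in> El (?p ?E) a" using nat_homI[OF \<phi>(1) rc] by (simp add: ideal_sel(5,6) Es)
  moreover have "?e a (ex A (?p (rep Q a)) \<phi>) = x"
   using a \<phi>(2)[OF a catD(2)[OF A a]] cmdD(2)[OF Xc a x] linD(1)[OF pr_lin[OF a a] catD(2)[OF A a]] by (simp add: ev ideal_sel(5,6))
  ultimately show "\<exists>\<phi>\<in>El (?p ?E) a. ?e a \<phi> = x" by blast
 qed
 from niso_inv[OF this pE kp(1)]
 have "fp A (?p ?E)" by (rule niso_fp[OF A _ dualizing_ker_fp[OF d X R un] pE])
 then show ?thesis by (simp add: quot_fp_iff[OF add Ec])
qed

end

section \<open>The recollement\<close>


lemma niso_ex: "niso C X Y \<eta> ==> cmd C X ==> niso C X Y (ex C X \<eta>)"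
 using nt_ex by (auto simp: niso_def cong: bij_betw_cong)

lemma sub_niso: "lcat C ==> B \<subseteq> Obj C ==> niso C X Y \<eta> ==> niso (full_sub C B) X Y \<eta>"
 using sub_nt unfolding niso_def by (auto simp: subset_iff)

definition vanishes_on :: "'o set => ('k, 'o, 'm, 'v) cmod => bool" where
 "vanishes_on B X \<longleftrightarrow> (\<forall>b\<in>B. El X b = {(zr X b)})"

lemma vanishes_onI:
 assumes "cmd C X" "B \<subseteq> Obj C" and "\<And>b v. b \<in> B ==> v \<in> El X b ==> v = zr X b"
 shows "vanishes_on B X"
 unfolding vanishes_on_def using assms(3) vs_closed(1)[OF cmdD(1)[OF assms(1)]] assms(2) by blast

lemma vanishes_onD: "vanishes_on B X ==> b \<in> B ==> v \<in> El X b ==> v = zr X b"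
 unfolding vanishes_on_def by blast

text \<open>A zero object has only one endomorphism, so its identity is the zero map and every value
  is zero.\<close>

lemma zero_object_iff:
 assumes X: "fp C X"
 shows "is_zero_object (mod_cat K C) X \<longleftrightarrow> vanishes_on (Obj C) X"
proof
 note Xc = fp_cmd[OF X]
 assume "is_zero_object (mod_cat K C) X"
 then have "Nats C X X = {\<zero>\<^bsub>nat_hom K C X X\<^esub>}" using X by (simp add: is_zero_object_def)
 then have "ex C X (\<lambda>c v. v) = \<zero>\<^bsub>nat_hom K C X X\<^esub>" using nat_homI[OF nt_id Xc] by blast
 then have "ex C X (\<lambda>c v. v) = ex C X (\<lambda>c v. (zr X c))" by (simp add: nat_hom_sel)
 from this[unfolded ex_eq_iff] show "vanishes_on (Obj C) X" by (intro vanishes_onI[OF Xc order_refl]) blast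
next
 note Xc = fp_cmd[OF X]
 assume v: "vanishes_on (Obj C) X"
 show "is_zero_object (mod_cat K C) X"
  unfolding is_zero_object_def mod_cat_sel
 proof (intro conjI ballI equalityI subsetI)
  show "X \<in> {X. fp C X}" using X by simp
  fix Y assume "Y \<in> {X. fp C X}"
  then have Yc: "cmd C Y" using fp_cmd by blast
  note z = vs_closed(1)[OF nat_hom_vsp[OF Yc Xc]] vs_closed(1)[OF nat_hom_vsp[OF Xc Yc]]
  { fix \<eta> assume "\<eta> \<in> Nats C Y X"
   note e = this
   have "\<eta> = \<zero>\<^bsub>nat_hom K C Y X\<^esub>"
    by (rule nat_hom_eqI[OF e z(1)]) (use vanishes_onD[OF v _ ntD(3)[OF nat_homD(1)[OF e]]] in \<open>simp add: nat_hom_sel\<close>)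
   then show "\<eta> \<in> {\<zero>\<^bsub>nat_hom K C Y X\<^esub>}" by simp }
  { fix \<eta> assume "\<eta> \<in> Nats C X Y"
   note e = this
   have "\<eta> = \<zero>\<^bsub>nat_hom K C X Y\<^esub>"
   proof (rule nat_hom_eqI[OF e z(2)])
    fix c x assume c: "c \<in> Obj C" and x: "x \<in> El X c"
    have "\<eta> c x = zr Y c" using vanishes_onD[OF v c x] nt_zero_app[OF nat_homD(1)[OF e] Xc Yc c] by simp
    then show "\<eta> c x = \<zero>\<^bsub>nat_hom K C X Y\<^esub> c x" using c x by (simp add: nat_hom_sel)
   qed
   then show "\<eta> \<in> {\<zero>\<^bsub>nat_hom K C X Y\<^esub>}" by simp }
  { fix \<eta> assume "\<eta> \<in> {\<zero>\<^bsub>nat_hom K C Y X\<^esub>}"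
   then show "\<eta> \<in> Nats C Y X" using z(1) by simp }
  { fix \<eta> assume "\<eta> \<in> {\<zero>\<^bsub>nat_hom K C X Y\<^esub>}"
   then show "\<eta> \<in> Nats C X Y" using z(2) by simp }
 qed
qed

theorem recollement_mod:
 fixes A :: "('k, 'o, 'm) lincat" and B :: "'o set"
 assumes U: "module_universe TYPE('v) K A" and dv: "dualizing_variety TYPE('v) K A" and fin: "functorially_finite K A B"
 defines "AB \<equiv> full_sub A B" and "AQ \<equiv> ideal_quotient A B" and "p \<equiv> proj A B"
  and "ModA \<equiv> (Mod_cat K A :: ('k, 'o, 'm, 'v) modcat)"
  and "ModB \<equiv> (Mod_cat K (full_sub A B) :: ('k, 'o, 'm, 'v) modcat)"
  and "ModQ \<equiv> (Mod_cat K (ideal_quotient A B) :: ('k, 'o, 'm set, 'v) modcat)"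
  and "modA \<equiv> (mod_cat K A :: ('k, 'o, 'm, 'v) modcat)"
  and "modB \<equiv> (mod_cat K (full_sub A B) :: ('k, 'o, 'm, 'v) modcat)"
  and "modQ \<equiv> (mod_cat K (ideal_quotient A B) :: ('k, 'o, 'm set, 'v) modcat)"
 defines "S \<equiv> essential_image modQ modA (pullback A p)"
 shows "adjoint_pair K ModA ModQ (left_ext K A AQ p) (pullback A p)"
  "adjoint_pair K ModQ ModA (pullback A p) (right_ext K A AQ p)"
  "adjoint_pair K ModB ModA (left_ext K AB A incl) (pullback AB incl)"
  "adjoint_pair K ModA ModB (pullback AB incl) (right_ext K AB A incl)"
  "recollement K modQ modA modB (pullback A p) (left_ext K A AQ p) (right_ext K A AQ p)
   (pullback AB incl) (left_ext K AB A incl) (right_ext K AB A incl)"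
  "serre_subcategory modA S"
  "\<exists>F. category_equivalence K (serre_quotient K modA S) modB F"
proof -
 have add: "additive_category K A" and addB: "additive_category K AB" and B: "B \<subseteq> Obj A"
  using dv fin by (simp_all add: dualizing_variety_def functorially_finite_def AB_def)
 have A: "lcat A" and SC: "lcat AB" using add addB by (simp_all add: additive_category_def)
 \<comment> \<open>The two halves of functorial finiteness: this one is used for restriction,
   kernels over B and the ideal quotient, the one over the opposite category for the right
   extensions.\<close>
 have cf: "contra_finite A B"
  unfolding contra_finite_def
 proof (intro conjI ballI B)
  fix x assume "x \<in> Obj A"
  then have "finitely_generated K AB (rep A x)" using fin by (simp add: functorially_finite_def AB_def)
  then show "\<exists>b h. gen (full_sub A B) (rep A x) b h" using fg_iff[OF SC] unfolding AB_def by blast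
 qed
 have cfo: "contra_finite (op_cat A) B"
  unfolding contra_finite_def
 proof (intro conjI ballI)
  fix x assume "x \<in> Obj (op_cat A)"
  then have "finitely_generated K (op_cat AB) (rep (op_cat A) x)" using fin by (simp add: functorially_finite_def AB_def)
  then show "\<exists>b h. gen (full_sub (op_cat A) B) (rep (op_cat A) x) b h" using fg_iff[OF op_lcat[OF SC]] unfolding AB_def op_full_sub by blast
 qed (simp add: B)
 obtain j :: "('o \<times> 'm \<times> nat => 'v) => 'v" and a b :: 'v where j: "inj j" "a \<noteq> b" by (rule universe_fits[OF U])
 have i: "\<exists>i :: 'm => 'v. inj i" using fits_delta(2)[OF j] by (simp add: fits_def)
 note sq = fits_seq[OF j] and d = dualizing_variety_dualizing[OF dv i]
 note Qc = quot_lcat[OF A cf, folded AQ_def] and pl = proj_lf[OF A cf, folded AQ_def p_def] and F = incl_lf[OF A B, folded AB_def]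
 note addQ = quot_additive[OF A cf add, folded AQ_def]
 \<comment> \<open>Arrows of A name themselves, and arrows of A/[B] are named by representatives, so
   the one universe given for A serves both pairs of adjunctions.\<close>
 have rB: "\<exists>r :: 'm => 'm. X \<subseteq> range r" for X by (rule exI[of _ id]) simp
 have rQ: "\<exists>r :: 'm => 'm set. Arr AQ x y \<subseteq> range r" for x y
  by (rule exI[of _ "\<lambda>f. factor_ideal A B x y +>\<^bsub>Hom A x y\<^esub> f"]) (auto simp: AQ_def dest!: pr_surj[OF A cf])
 note lB = left_ext_univ[OF SC A F U rB] and lQ = left_ext_univ[OF A Qc pl U rQ]
 note rB = right_ext_univ[OF SC A F U rB] and rQ = right_ext_univ[OF A Qc pl U rQ]
 obtain \<eta> where "univ_unit ModB ModA (left_ext K AB A incl) (pullback AB incl) \<eta> \<and>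
   (\<forall>Y. cmd AB Y --> \<eta> Y = ex AB Y (\<lambda>c y. code (Val (left_ext_mod K AB A incl Y) c) (left_unit AB A incl Y c y)))"
  using lB(1)[unfolded incl_sel, folded ModA_def ModB_def[folded AB_def]] by (elim exE) (rule that)
 note \<eta> = this[THEN conjunct1] this[THEN conjunct2, rule_format]
 obtain \<eta>Q where "univ_unit ModA ModQ (left_ext K A AQ p) (pullback A p) \<eta>Q \<and>
   (\<forall>Y. cmd A Y --> \<eta>Q Y = ex A Y (\<lambda>c y. code (Val (left_ext_mod K A AQ p Y) (Fob p c)) (left_unit A AQ p Y c y)))"
  using lQ(1)[folded ModA_def ModQ_def[folded AQ_def]] by (elim exE) (rule that)
 note \<eta>Q = this[THEN conjunct1]
 obtain \<epsilon> where "univ_counit ModA ModB (pullback AB incl) (right_ext K AB A incl) \<epsilon> \<and>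
   (\<forall>M. cmd AB M --> \<epsilon> M = ex AB (copy_mod (right_ext_mod K AB A incl M) :: ('k, 'o, 'm, 'v) cmod)
    (\<lambda>c v. right_counit A incl c (decode (Val (right_ext_mod K AB A incl M) c) v)))"
  using rB(1)[unfolded incl_sel precomp_incl, folded ModA_def ModB_def[folded AB_def]] by (elim exE) (rule that)
 note \<epsilon> = this[THEN conjunct1] this[THEN conjunct2, rule_format]
 obtain \<epsilon>Q where "univ_counit ModQ ModA (pullback A p) (right_ext K A AQ p) \<epsilon>Q \<and>
   (\<forall>M. cmd A M --> \<epsilon>Q M = ex A (precomp p (copy_mod (right_ext_mod K A AQ p M) :: ('k, 'o, 'm set, 'v) cmod))
    (\<lambda>c v. right_counit AQ p c (decode (Val (right_ext_mod K A AQ p M) (Fob p c)) v)))"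
  using rQ(1)[folded ModA_def ModQ_def[folded AQ_def]] by (elim exE) (rule that)
 note \<epsilon>Q = this[THEN conjunct1]
 have MA: "lcat ModA" and MB: "lcat ModB" and MQ: "lcat ModQ"
  unfolding ModA_def ModB_def ModQ_def AB_def[symmetric] AQ_def[symmetric] using Mod_cat_lcat A SC Qc by blast+
 show "adjoint_pair K ModA ModQ (left_ext K A AQ p) (pullback A p)" by (rule univ_unit_adjoint[OF MA MQ \<eta>Q])
 show "adjoint_pair K ModQ ModA (pullback A p) (right_ext K A AQ p)" by (rule univ_counit_adjoint[OF MQ MA \<epsilon>Q])
 show "adjoint_pair K ModB ModA (left_ext K AB A incl) (pullback AB incl)" by (rule univ_unit_adjoint[OF MB MA \<eta>(1)])
 show "adjoint_pair K ModA ModB (pullback AB incl) (right_ext K AB A incl)" by (rule univ_counit_adjoint[OF MA MB \<epsilon>(1)])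
 let ?SA = "{X :: ('k, 'o, 'm, 'v) cmod. fp A X}"
  and ?SB = "{X :: ('k, 'o, 'm, 'v) cmod. fp AB X}"
  and ?SQ = "{X :: ('k, 'o, 'm set, 'v) cmod. fp AQ X}"
 \<comment> \<open>With the closure facts \<open>f1\<close> to \<open>f6\<close> below, the four
   universal arrows restrict to these full subcategories.\<close>
 have m: "modA = full_sub ModA ?SA" "modB = full_sub ModB ?SB" "modQ = full_sub ModQ ?SQ"
  by (simp_all add: modA_def modB_def modQ_def ModA_def ModB_def ModQ_def mod_cat_def AB_def AQ_def)
 have o: "?SA \<subseteq> Obj ModA" "?SB \<subseteq> Obj ModB" "?SQ \<subseteq> Obj ModQ"
  using fp_cmd by (auto simp: ModA_def ModB_def ModQ_def AB_def AQ_def)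
 have f1: "Fob (pullback AB incl) X \<in> ?SB" if "X \<in> ?SA" for X
  using that restrict_fp[OF d cf, of X] by (simp add: pullback_sel(1) AB_def)
 have f2: "Fob (left_ext K AB A incl) X \<in> ?SA" if X: "X \<in> ?SB" for X
 proof -
  have X: "fp AB X" using X by simp
  show ?thesis using niso_fp[OF A lB(2)[OF fp_cmd[OF X]] left_ext_mod_fp[OF SC A F fp_cmd[OF X] X] lB(3)[OF fp_cmd[OF X]]]
   by (simp add: left_ext_def)
 qed
 have f3: "Fob (right_ext K AB A incl) X \<in> ?SA" if X: "X \<in> ?SB" for X
 proof -
  have X: "fp AB X" using X by simp
  show ?thesis using niso_fp[OF A rB(3)[OF fp_cmd[OF X]] right_ext_mod_fp[OF d cfo X[unfolded AB_def], folded AB_def] rB(4)[OF fp_cmd[OF X]]]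
   by (simp add: right_ext_def)
 qed
 note qfp = quot_fp_iff[OF A cf add, folded AQ_def p_def]
 have f4: "Fob (pullback A p) X \<in> ?SA" if "X \<in> ?SQ" for X
  using that qfp[OF fp_cmd, of X] by (simp add: pullback_sel(1))
 have f5: "Fob (left_ext K A AQ p) X \<in> ?SQ" if X: "X \<in> ?SA" for X
 proof -
  have X: "fp A X" using X by simp
  show ?thesis using niso_fp[OF Qc lQ(2)[OF fp_cmd[OF X]] left_ext_mod_fp[OF A Qc pl fp_cmd[OF X] X] lQ(3)[OF fp_cmd[OF X]]]
   by (simp add: left_ext_def)
 qed
 have f6: "Fob (right_ext K A AQ p) X \<in> ?SQ" if X: "X \<in> ?SA" for X
 proof -
  have X: "fp A X" using X by simp
  show ?thesis using niso_fp[OF Qc rQ(3)[OF fp_cmd[OF X]] right_ext_quot_fp[OF A cf add d cfo X, folded AQ_def p_def] rQ(4)[OF fp_cmd[OF X]]]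
   by (simp add: right_ext_def)
 qed
 note u = univ_unit_full_sub[OF \<eta>(1) o(2,1) f2 f1, folded m] and uQ = univ_unit_full_sub[OF \<eta>Q o(1,3) f5 f4, folded m]
 note c = univ_counit_full_sub[OF \<epsilon>(1) o(1,2) f1 f3, folded m] and cQ = univ_counit_full_sub[OF \<epsilon>Q o(3,1) f4 f6, folded m]
 have mA: "lcat modA" and mB: "lcat modB" and mQ: "lcat modQ"
  unfolding modA_def modB_def modQ_def AB_def[symmetric] AQ_def[symmetric] using mod_cat_lcat A SC Qc by blast+
 have oA: "X \<in> Obj modA \<longleftrightarrow> fp A X" for X by (simp add: modA_def)
 have oB: "X \<in> Obj modB \<longleftrightarrow> fp AB X" for X by (simp add: modB_def AB_def)
 have oQ: "X \<in> Obj modQ \<longleftrightarrow> fp AQ X" for X by (simp add: modQ_def AQ_def)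
 \<comment> \<open>The unit in the universe is y \<mapsto> y \<otimes> 1 followed by the code of the
   copy, and both are bijective on B. This gives full faithfulness of the left extension here and
   the localization property at the end.\<close>
 have \<eta>i: "is_iso modB M (Fob (pullback AB incl) (Fob (left_ext K AB A incl) M)) (\<eta> M)" if M: "M \<in> Obj modB" for M
 proof -
  have Mf: "fp AB M" using M oB by simp
  let ?L = "copy_mod (left_ext_mod K AB A incl M) :: ('k, 'o, 'm, 'v) cmod"
  have L: "Fob (pullback AB incl) (Fob (left_ext K AB A incl) M) = ?L" by (simp add: pullback_sel left_ext_def)
  have Lf: "fp AB ?L" using f1[OF f2, of M] Mf L by simp
  have "niso AB M ?L (\<eta> M)"
   unfolding \<eta>(2)[OF fp_cmd[OF Mf]]
   by (rule niso_ex[OF niso_comp[OF left_unit_niso[OF A B fp_cmd[OF Mf[unfolded AB_def]], folded AB_def]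
     sub_niso[OF A B lB(2)[OF fp_cmd[OF Mf]], folded AB_def]] fp_cmd[OF Mf]])
  moreover have "\<eta> M \<in> Nats AB M ?L"
   using univ_unitD(3)[OF mB mA u M] L by (simp add: modB_def AB_def)
  ultimately show ?thesis using iso_mod_iff[OF Mf Lf] L by (simp add: modB_def AB_def)
 qed
 have \<epsilon>i: "is_iso modB (Fob (pullback AB incl) (Fob (right_ext K AB A incl) M)) M (\<epsilon> M)" if M: "M \<in> Obj modB" for M
 proof -
  have Mf: "fp AB M" using M oB by simp
  let ?R = "copy_mod (right_ext_mod K AB A incl M) :: ('k, 'o, 'm, 'v) cmod"
  have R: "Fob (pullback AB incl) (Fob (right_ext K AB A incl) M) = ?R" by (simp add: pullback_sel right_ext_def)
  have Rf: "fp AB ?R" using f1[OF f3, of M] Mf R by simp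
  have "niso AB ?R M (\<epsilon> M)"
   unfolding \<epsilon>(2)[OF fp_cmd[OF Mf]]
   by (rule niso_ex[OF niso_comp[OF sub_niso[OF A B rB(2)[OF fp_cmd[OF Mf]], folded AB_def]
     right_counit_niso[OF A B fp_cmd[OF Mf[unfolded AB_def]], folded AB_def]] fp_cmd[OF Rf]])
  moreover have "\<epsilon> M \<in> Nats AB ?R M"
   using univ_counitD(3)[OF mA mB c M] R by (simp add: modB_def AB_def)
  ultimately show ?thesis using iso_mod_iff[OF Rf Mf] R by (simp add: modB_def AB_def)
 qed
 have pv: "Val (precomp p X) = Val X" "Act (precomp p X) x y f = Act X x y (Far p x y f)" for X x y f
  by (simp_all add: p_def ideal_sel(5))
 have eff: "fully_faithful modQ modA (pullback A p)"
  unfolding fully_faithful_def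
 proof (intro ballI)
  fix X Y assume "X \<in> Obj modQ" "Y \<in> Obj modQ"
  then have X: "cmd AQ X" and Y: "cmd AQ Y" using oQ fp_cmd by blast+
  note pX = precomp_cmd[OF pl X]
  have exq: "ex A (precomp p X) \<theta> = ex AQ X \<theta>" for \<theta> :: "'o => 'v => 'v" unfolding ex_def pv by (simp add: AQ_def ideal_sel(1))
  have far: "Far (pullback A p) X Y \<theta> = \<theta>" if t: "\<theta> \<in> Nats AQ X Y" for \<theta>
   using pullback_far[OF pl t] nat_homD(2)[OF t] exq by (simp add: p_def ideal_sel(5))
  \<comment> \<open>The projection is the identity on objects and onto on arrows, so naturality over
    A/[B] and over A is the same condition; full faithfulness becomes an equality of sets.\<close>
  have "Nats AQ X Y = Nats A (precomp p X) (precomp p Y)"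
  proof (intro equalityI subsetI)
   fix \<theta> assume t: "\<theta> \<in> Nats AQ X Y"
   show "\<theta> \<in> Nats A (precomp p X) (precomp p Y)"
    using precomp_nt[OF pl nat_homD(1)[OF t]] nat_homD(2)[OF t] unfolding nat_hom_iff exq by (simp add: p_def ideal_sel(5))
  next
   fix \<theta> assume t: "\<theta> \<in> Nats A (precomp p X) (precomp p Y)"
   note n = ntD[OF nat_homD(1)[OF t], unfolded pv]
   have "nt AQ X Y \<theta>"
   proof (rule ntI)
    fix c assume "c \<in> Obj AQ" then show "lin (Val X c) (Val Y c) (\<theta> c)" using n(1) by (simp add: AQ_def ideal_sel(1))
   next
    fix x y f v assume h: "x \<in> Obj AQ" "y \<in> Obj AQ" "f \<in> Arr AQ x y" "v \<in> El X y"
    obtain g where "g \<in> Arr A x y" "f = Far p x y g" using pr_surj[OF A cf h(3)[unfolded AQ_def]] by (auto simp: p_def ideal_sel(6))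
    then show "\<theta> x (Act X x y f v) = Act Y x y f (\<theta> y v)" using n(2)[of x y g v] h by (simp add: AQ_def ideal_sel(1))
   qed
   then show "\<theta> \<in> Nats AQ X Y" using nat_homD(2)[OF t] unfolding nat_hom_iff exq by blast
  qed
  then have "bij_betw (Far (pullback A p) X Y) (Nats AQ X Y) (Nats A (precomp p X) (precomp p Y))"
   by (intro bij_betwI[of _ _ _ "\<lambda>\<theta>. \<theta>"]) (use far in auto)
  then show "bij_betw (Far (pullback A p) X Y) (Arr modQ X Y) (Arr modA (Fob (pullback A p) X) (Fob (pullback A p) Y))"
   by (simp add: modQ_def modA_def AQ_def pullback_sel(1))
 qed
 have KA: "ker_closed TYPE('v) A" unfolding ker_closed_def using dualizing_ker_fp[OF d] by blast
 note abA = abelian_mod_cat[OF add KA sq, folded modA_def]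
 note abB = abelian_mod_cat[OF addB ker_closed_full_sub[OF d cf, where 'v = 'v, folded AB_def] sq, unfolded AB_def, folded modB_def]
 note abQ = abelian_mod_cat[OF addQ quot_ker_closed[OF A cf add d, where 'v = 'v, folded AQ_def] sq, unfolded AQ_def, folded modQ_def]
 \<comment> \<open>Vanishing on B is the form in which the kernel of the restriction, the Serre
   property and the inverted arrows are all tested.\<close>
 have S: "y \<in> S \<longleftrightarrow> fp A y \<and> vanishes_on B y" for y
 proof
  assume "y \<in> S"
  then obtain x f where y: "fp A y" and x: "fp AQ x" and i: "is_iso modA (precomp p x) y f"
   unfolding S_def essential_image_def isomorphic_def oA oQ pullback_sel(1) by (auto simp: oA oQ)
  note xc = fp_cmd[OF x]
  have px: "fp A (precomp p x)" using qfp[OF xc] x by simp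
  have n: "niso A (precomp p x) y f" using i iso_mod_iff[OF px y] by (simp add: modA_def)
  have "vanishes_on B y"
  proof (rule vanishes_onI[OF fp_cmd[OF y] B])
   fix b v assume b: "b \<in> B" and v: "v \<in> El y b"
   have bA: "b \<in> Obj A" using b B by blast
   obtain w where w: "w \<in> El (precomp p x) b" "v = f b w"
    using n bA v unfolding niso_def bij_betw_def by blast
   have "w = zr (precomp p x) b" using quot_mod_zero[OF A cf xc[unfolded AQ_def] b] w(1) unfolding pv by blast
   then show "v = zr y b"
    using w(2) nt_zero_app[OF _ fp_cmd[OF px] fp_cmd[OF y] bA] n by (simp add: niso_def)
  qed
  then show "fp A y \<and> vanishes_on B y" using y by blast
 next
  assume y: "fp A y \<and> vanishes_on B y"
  then have yf: "fp A y" by blast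
  note yc = fp_cmd[OF yf]
  have "\<exists>X :: ('k, 'o, 'm set, 'v) cmod. cmd AQ X \<and> niso A (precomp p X) y (\<lambda>c v. v)"
   unfolding AQ_def p_def by (rule quot_mod_descend[OF A cf yc]) (use y in \<open>simp add: vanishes_on_def\<close>)
  then obtain X :: "('k, 'o, 'm set, 'v) cmod" where X: "cmd AQ X" and n: "niso A (precomp p X) y (\<lambda>c v. v)" by blast
  note pX = precomp_cmd[OF pl X]
  have pf: "fp A (precomp p X)" by (rule niso_fp[OF A niso_inv[OF n pX yc] yf pX])
  then have "is_iso modA (precomp p X) y (ex A (precomp p X) (\<lambda>c v. v))"
   unfolding modA_def iso_mod_iff[OF pf yf] using niso_ex[OF n pX] nat_homI[OF n[unfolded niso_def, THEN conjunct1] pX] by blast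
  then show "y \<in> S"
   unfolding S_def essential_image_def isomorphic_def using oA oQ yf qfp[OF X] pf by (auto simp: pullback_sel(1))
 qed
 have zB: "is_zero_object modB (Fob (pullback AB incl) y) \<longleftrightarrow> vanishes_on B y" if "fp A y" for y
  using zero_object_iff[of AB y] f1[of y] that by (simp add: modB_def AB_def pullback_sel(1))
 have "essential_image modQ modA (pullback A p) = {y \<in> Obj modA. is_zero_object modB (Fob (pullback AB incl) y)}"
  using S zB oA unfolding S_def by blast
 then show "recollement K modQ modA modB (pullback A p) (left_ext K A AQ p) (right_ext K A AQ p)
   (pullback AB incl) (left_ext K AB A incl) (right_ext K AB A incl)"
  unfolding recollement_def using abA abB abQ univ_unit_adjoint[OF mA mQ uQ] univ_counit_adjoint[OF mQ mA cQ]
   univ_unit_adjoint[OF mB mA u] univ_counit_adjoint[OF mA mB c] univ_unit_ff[OF mB mA u \<eta>i] univ_counit_ff[OF mA mB c \<epsilon>i] eff by simp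
 note ik = is_kernel_iff[OF add KA sq, folded modA_def] and ic = is_cokernel_iff[OF add KA sq, folded modA_def]
 note zero = nt_zero_app[OF nat_homD(1)]
 show "serre_subcategory modA S"
  unfolding serre_subcategory_def
 proof (intro conjI ballI allI impI)
  \<comment> \<open>The empty direct sum supplies an object, whose pullback shows that S is
    nonempty.\<close>
  obtain s where "s \<in> Obj modQ" using abQ unfolding abelian_category_def additive_category_def is_direct_sum_def by (metis less_nat_zero_code)
  then have s: "fp AQ s" by (simp add: oQ)
  have "precomp p s \<in> S" unfolding S using qfp[OF fp_cmd[OF s]] s quot_mod_zero[OF A cf fp_cmd[OF s[unfolded AQ_def]]] by (simp add: vanishes_on_def p_def ideal_sel(5))
  then show "S \<noteq> {}" by blast
  show "S \<subseteq> Obj modA" using S oA by blast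
  fix x y z f g assume "x \<in> Obj modA" "y \<in> Obj modA" "z \<in> Obj modA" and k: "is_kernel modA y z g x f \<and> is_cokernel modA x y f z g"
  then have x: "fp A x" and y: "fp A y" and z: "fp A z" by (simp_all add: oA)
  have g: "g \<in> Nats A y z" and f: "f \<in> Nats A x y"
   using k by (simp_all add: is_kernel_def is_cokernel_def modA_def)
  note kp = ker_ptD[OF k[THEN conjunct1, unfolded ik[OF y z x g f]]] and cp = coker_ptD[OF k[THEN conjunct2, unfolded ic[OF x y z f g]]]
  note xc = fp_cmd[OF x] and yc = fp_cmd[OF y] and zc = fp_cmd[OF z]
  note f0 = zero[OF f xc yc] and g0 = zero[OF g yc zc] and fc = ntD(3)[OF nat_homD(1)[OF f]] and gc = ntD(3)[OF nat_homD(1)[OF g]]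
  have "vanishes_on B y \<longleftrightarrow> vanishes_on B x \<and> vanishes_on B z"
  proof (intro iffI conjI)
   assume v: "vanishes_on B y"
   show "vanishes_on B x"
   proof (rule vanishes_onI[OF xc B])
    fix b w assume b: "b \<in> B" and w: "w \<in> El x b"
    have bA: "b \<in> Obj A" using b B by blast
    have "f b w = f b (zr x b)" using vanishes_onD[OF v b fc[OF bA w]] f0[OF bA] by simp
    then show "w = zr x b" by (rule inj_onD[OF kp(1)[OF bA] _ w vs_closed(1)[OF cmdD(1)[OF xc bA]]])
   qed
   show "vanishes_on B z"
   proof (rule vanishes_onI[OF zc B])
    fix b w assume b: "b \<in> B" and w: "w \<in> El z b"
    have bA: "b \<in> Obj A" using b B by blast
    obtain q where q: "q \<in> El y b" "w = g b q" using cp(1)[OF bA w] by blast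
    then show "w = zr z b" using vanishes_onD[OF v b q(1)] g0[OF bA] by simp
   qed
  next
   assume v: "vanishes_on B x \<and> vanishes_on B z"
   show "vanishes_on B y"
   proof (rule vanishes_onI[OF yc B])
    fix b w assume b: "b \<in> B" and w: "w \<in> El y b"
    have bA: "b \<in> Obj A" using b B by blast
    have "g b w = zr z b" using vanishes_onD[OF conjunct2[OF v] b gc[OF bA w]] .
    then obtain q where q: "q \<in> El x b" "w = f b q" using kp(2)[OF bA w] by blast
    then show "w = zr y b" using vanishes_onD[OF conjunct1[OF v] b q(1)] f0[OF bA] by simp
   qed
  qed
  then show "y \<in> S \<longleftrightarrow> x \<in> S \<and> z \<in> S" unfolding S using x y z by blast
 qed
 show "\<exists>F. category_equivalence K (serre_quotient K modA S) modB F"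
 proof (rule serre_quotient_equivalence[OF mA mB u \<eta>i])
  fix x y s assume "x \<in> Obj modA" "y \<in> Obj modA" "s \<in> Arr modA x y"
  then have x: "fp A x" and y: "fp A y" and s: "s \<in> Nats A x y"
   by (simp_all add: oA) (simp add: modA_def)
  note xc = fp_cmd[OF x] and yc = fp_cmd[OF y] and sn = nat_homD(1)[OF s] note s0 = nt_zero_app[OF sn xc yc]
  have xB: "fp AB x" and yB: "fp AB y" using f1[of x] f1[of y] x y by (simp_all add: pullback_sel(1))
  have far: "Far (pullback AB incl) x y s = ex AB x s" using pullback_far[OF F s] by simp
  have sB: "nt AB x y s" unfolding AB_def by (rule sub_nt[OF A B sn])
  have "is_iso modB x y (ex AB x s) \<longleftrightarrow> ex AB x s \<in> Nats AB x y \<and> niso AB x y (ex AB x s)"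
   using iso_mod_iff[OF xB yB] by (simp add: modB_def AB_def)
  also have "\<dots> \<longleftrightarrow> niso AB x y s"
   using nat_homI[OF sB fp_cmd[OF xB]] sB nt_ex[OF sB fp_cmd[OF xB]] by (auto simp: niso_def cong: bij_betw_cong)
  also have "\<dots> \<longleftrightarrow> inverted modA S x y s"
  proof
   assume n: "niso AB x y s"
   have bj: "bij_betw (s b) (El x b) (El y b)" if "b \<in> B" for b using n that by (simp add: niso_def AB_def)
   obtain N :: "('k, 'o, 'm, 'v) cmod" and i where N: "fp A N" "i \<in> Nats A N x" "ker_pt A x y s N i"
    using ker_ex[OF add KA sq x y sn] by blast
   obtain Z :: "('k, 'o, 'm, 'v) cmod" and q where Z: "fp A Z" "q \<in> Nats A y Z" "coker_pt A x y s Z q"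
    using coker_ex[OF add KA sq x y sn] by blast
   note Nc = fp_cmd[OF N(1)] and Zc = fp_cmd[OF Z(1)]
   have "vanishes_on B N"
   proof (rule vanishes_onI[OF Nc B])
    fix b k assume b: "b \<in> B" and k: "k \<in> El N b"
    have bA: "b \<in> Obj A" using b B by blast
    note ik = ntD(3)[OF nat_homD(1)[OF N(2)] bA k] and z = vs_closed(1)[OF cmdD(1)[OF xc bA]] vs_closed(1)[OF cmdD(1)[OF Nc bA]]
    have "s b (i b k) = s b (zr x b)" using ker_ptD(2)[OF N(3) bA ik] k s0[OF bA] by auto
    then have "i b k = zr x b" using bj[OF b] ik z(1) by (auto simp: bij_betw_def dest: inj_onD)
    then have "i b k = i b (zr N b)" using zero[OF N(2) Nc xc bA] by simp
    then show "k = zr N b" by (rule inj_onD[OF ker_ptD(1)[OF N(3) bA] _ k z(2)])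
   qed
   moreover have "vanishes_on B Z"
   proof (rule vanishes_onI[OF Zc B])
    fix b w assume b: "b \<in> B" and w: "w \<in> El Z b"
    have bA: "b \<in> Obj A" using b B by blast
    obtain v where v: "v \<in> El y b" "w = q b v" using coker_ptD(1)[OF Z(3) bA w] by blast
    obtain v' where "v' \<in> El x b" "v = s b v'" using bj[OF b] v(1) unfolding bij_betw_def by blast
    then show "w = zr Z b" using coker_ptD(2)[OF Z(3) bA v(1)] v(2) by blast
   qed
   ultimately show "inverted modA S x y s"
    unfolding inverted_def using ik[OF x y N(1) s N(2)] ic[OF x y Z(1) s Z(2)] N(1,3) Z(1,3) S s by (auto simp: modA_def)
  next
   assume "inverted modA S x y s"
   then obtain N i Z q where Ns: "N \<in> S" and Zs: "Z \<in> S" and N: "is_kernel modA x y s N i" and Z: "is_cokernel modA x y s Z q"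
    unfolding inverted_def by blast
   have Nf: "fp A N" and Zf: "fp A Z" using Ns Zs S by blast+
   have i: "i \<in> Nats A N x" and q: "q \<in> Nats A y Z"
    using N Z by (simp_all add: is_kernel_def is_cokernel_def modA_def)
   note kp = ker_ptD(2)[OF N[unfolded ik[OF x y Nf s i]]] and cp = coker_ptD(2)[OF Z[unfolded ic[OF x y Zf s q]]]
   show "niso AB x y s"
   proof (rule nisoI[OF sB fp_cmd[OF xB] fp_cmd[OF yB]])
    fix b v assume "b \<in> Obj AB" and v: "v \<in> El x b" "s b v = zr y b"
    then have b: "b \<in> B" and bA: "b \<in> Obj A" using B by (auto simp: AB_def)
    obtain k where k: "k \<in> El N b" "v = i b k" using kp[OF bA v(1)] v(2) by blast
    have "k = zr N b" using vanishes_onD[OF _ b k(1)] Ns S by blast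
    then show "v = zr x b" using k(2) zero[OF i fp_cmd[OF Nf] xc bA] by simp
   next
    fix b w assume "b \<in> Obj AB" and w: "w \<in> El y b"
    then have b: "b \<in> B" and bA: "b \<in> Obj A" using B by (auto simp: AB_def)
    have "q b w = zr Z b" using vanishes_onD[OF _ b ntD(3)[OF nat_homD(1)[OF q] bA w]] Zs S by blast
    then show "\<exists>v\<in>El x b. s b v = w" using cp[OF bA w] by blast
   qed
  qed
  finally show "inverted modA S x y s \<longleftrightarrow> is_iso modB (Fob (pullback AB incl) x) (Fob (pullback AB incl) y) (Far (pullback AB incl) x y s)"
   unfolding far pullback_sel(1) precomp_incl by simp
 qed
qed

end

theorem theorem2p3:
  fixes K :: "'k ring" and A :: "('k, 'o, 'm) lincat" and B :: "'o set"
  assumes "field K"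
    and "module_universe TYPE('v) K A"
    and "dualizing_variety TYPE('v) K A"
    and "functorially_finite K A B"
  shows
    "let AB = full_sub A B; i = incl; Q = ideal_quotient A B; p = proj A B;
         ModA = (Mod_cat K A :: ('k, ('k, 'o, 'm, 'v) cmod, 'o \<Rightarrow> 'v \<Rightarrow> 'v) lincat);
         ModB = (Mod_cat K AB :: ('k, ('k, 'o, 'm, 'v) cmod, 'o \<Rightarrow> 'v \<Rightarrow> 'v) lincat);
         ModQ = (Mod_cat K Q :: ('k, ('k, 'o, 'm set, 'v) cmod, 'o \<Rightarrow> 'v \<Rightarrow> 'v) lincat);
         modA = (mod_cat K A :: ('k, ('k, 'o, 'm, 'v) cmod, 'o \<Rightarrow> 'v \<Rightarrow> 'v) lincat);
         modB = (mod_cat K AB :: ('k, ('k, 'o, 'm, 'v) cmod, 'o \<Rightarrow> 'v \<Rightarrow> 'v) lincat);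
         modQ = (mod_cat K Q :: ('k, ('k, 'o, 'm set, 'v) cmod, 'o \<Rightarrow> 'v \<Rightarrow> 'v) lincat);
         S = essential_image modQ modA (pullback A p)
     in adjoint_pair K ModA ModQ (left_ext K A Q p) (pullback A p) \<and>
        adjoint_pair K ModQ ModA (pullback A p) (right_ext K A Q p) \<and>
        adjoint_pair K ModB ModA (left_ext K AB A i) (pullback AB i) \<and>
        adjoint_pair K ModA ModB (pullback AB i) (right_ext K AB A i) \<and>
        recollement K modQ modA modB
          (pullback A p) (left_ext K A Q p) (right_ext K A Q p)
          (pullback AB i) (left_ext K AB A i) (right_ext K AB A i) \<and>
        serre_subcategory modA S \<and>
        (\<exists>F. category_equivalence K (serre_quotient K modA S) modB F)"
proof -
  interpret base_field K using assms(1) by (simp add: base_field_def)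
  show ?thesis
    unfolding Let_def by (intro conjI) (rule recollement_mod[OF assms(2-4)])+
qed
end
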